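(* Suppose that assumptions (FS1), (SS1), (VA1) and (VA2) (written out in the context) hold, and that $d_2(p_I,p_{rI})\to0$. Then $$\frac{\hat\tau_\rho-\tau_\rho}{\sqrt{V(\hat\tau_\rho)}}\longrightarrow\mathcal N(0,1)\ \text{ in distribution,}$$ and also $$E\left[A^{-2}n_I\left|\hat V_{HAJ}(\hat\tau_\rho)-V(\hat\tau_\rho)\right|\right]=o(1),\qquad\frac{\hat V_{HAJ}(\hat\tau_\rho)}{V(\hat\tau_\rho)}\longrightarrow1\ \text{ in probability.}$$
   Context: Setting. $\mathcal F\subset\mathbb R^d$ is a fixed bounded measurable set of Lebesgue measure $A>0$, and $\rho:\mathcal F\to\mathbb R$ is Lebesgue integrable, with $\tau_\rho=\int_{\mathcal F}\rho(x)\,dx$. We consider a sequence (index suppressed) of partitions of $\mathcal F$ into $N_I$ disjoint measurable sub-regions (primary sampling units, PSUs) forming $U_I=\{u_1,\dots,u_{N_I}\}$; $A_i$ is the measure of $u_i$. Asymptotics: $A$ is fixed, $N_I\to\infty$, the partition becomes increasingly fine (PSU diameters shrink to $0$), and $n_I\to\infty$. Constants in the assumptions do not depend on the position in the sequence; $o(\cdot)$ and limits are along this sequence. Sampling. First stage: a random sample $S_I\subset U_I$ of fixed size $n_I$ is selected according to a design $p_I(\cdot)$ (a probability distribution on subsets of $U_I$) with inclusion probabilities $\pi_{Ii}=P(u_i\in S_I)$, $\pi_{Iij}=P(u_i,u_j\in S_I)$ (so $\pi_{Iii}=\pi_{Ii}$), $\Delta_{Iij}=\pi_{Iij}-\pi_{Ii}\pi_{Ij}$.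 Let $p_{rI}(\cdot)$ be the rejective (conditional Poisson) sampling design of size $n_I$ on $U_I$ with the same inclusion probabilities $\pi_{Ii}$, i.e. a Poisson sampling design (independent selection of the units) conditioned on the sample size being $n_I$, with parameters such that the resulting first-order inclusion probabilities equal $\pi_{Ii}$. Define $$d_2(p_I,p_{rI})=\sum_{s_I\subset U_I;\ p_{rI}(s_I)>0}\frac{\{p_I(s_I)-p_{rI}(s_I)\}^2}{p_{rI}(s_I)}.$$ Second stage: conditionally on $S_I$, for each $u_i\in S_I$ a sample $S_{IIi}$ of $n_{IIi}$ points is drawn independently from a probability density $f_{IIi}$ supported on $u_i$; the second-stage mechanism does not depend on the realization of $S_I$, and the samples $S_{IIi}$ are conditionally independent across PSUs given $S_I$. Put $\pi_{IIi}(x)=n_{IIi}f_{IIi}(x)$ and $n_{II0}=N_I^{-1}\sum_{i=1}^{N_I}n_{IIi}$. Estimator and variance (under $p_I$). $\tau_{\rho i}=\int_{u_i}\rho(x)\,dx$, $\hat\tau_{\rho i}=\sum_{x\in S_{IIi}}\rho(x)/\pi_{IIi}(x)$, $\hat\tau_\rho=\sum_{u_i\in S_I}\hat\tau_{\rho i}/\pi_{Ii}$; $V(\hat\tau_\rho)$ is its variance, and its first-stage component is $$V_1(\hat\tau_\rho)=\sum_{u_i\in U_I}\sum_{u_j\in U_I}\Delta_{Iij}\frac{\tau_{\rho i}}{\pi_{Ii}}\frac{\tau_{\rho j}}{\pi_{Ij}}.$$ Hájek variance estimator: $$\hat V_{HAJ}(\hat\tau_\rho)=\sum_{u_i\in S_I}(1-\pi_{Ii})\left(\frac{\hat\tau_{\rho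 i}}{\pi_{Ii}}-\hat{\hat R}_{\pi}\right)^2+\sum_{u_i\in S_I}\frac{\hat V_i}{\pi_{Ii}},\quad \hat{\hat R}_{\pi}=\frac{\sum_{u_i\in S_I}(1-\pi_{Ii})\hat\tau_{\rho i}/\pi_{Ii}}{\sum_{u_i\in S_I}(1-\pi_{Ii})},$$ $$\hat V_i=\frac{n_{IIi}}{n_{IIi}-1}\sum_{x\in S_{IIi}}\left\{\frac{\rho(x)}{\pi_{IIi}(x)}-\frac{\hat\tau_{\rho i}}{n_{IIi}}\right\}^2.$$ Assumptions. (FS1) There exist constants $f_{I0}<1$ and $0<c_{I1}\le C_{I1}<\infty$ with $n_I/N_I\le f_{I0}$ and $c_{I1}\le (N_I/n_I)\pi_{Ii}\le C_{I1}$ for all $i$. (SS1) There exist constants $0<\lambda_1\le\Lambda_1<\infty$, $0<\phi_1\le\Phi_1<\infty$, $0<c_1\le C_1<\infty$ such that for every PSU $u_i$: $\lambda_1n_{II0}\le n_{IIi}\le\Lambda_1n_{II0}$; $\phi_1A/N_I\le A_i\le\Phi_1A/N_I$; $c_1/A_i\le f_{IIi}(x)\le C_1/A_i$ for all $x\in u_i$; and $n_{IIi}\ge2$. (VA1) There exist constants $m_1,M_1$ such that $A^{-1}\int_{\mathcal F}\rho(x)^4dx\le M_1$ and $|A^{-1}\int_{\mathcal F}\rho(x)\,dx|\ge m_1>0$. (VA2) There exists a constant $m_2$ such that $n_IA^{-2}V_1(\hat\tau_\rho)\ge m_2>0$. *)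

theory Defs
  imports "HOL-Probability.Probability"
begin

text \<open>
  A partition of the region \<open>F\<close> into \<open>N\<close> primary sampling units (PSUs) is an indexed family
  \<open>u i\<close>, \<open>i < N\<close>, and a first-stage sample is a set \<open>s \<subseteq> {..<N}\<close> of indices.
\<close>

definition psu_partition :: "'a::euclidean_space set \<Rightarrow> nat \<Rightarrow> (nat \<Rightarrow> 'a set) \<Rightarrow> bool" where
  "psu_partition F N u \<longleftrightarrow>
     (\<forall>i<N. u i \<in> sets lebesgue) \<and> disjoint_family_on u {..<N} \<and> (\<Union>i<N. u i) = F"

section \<open>First-stage design\<close>

definition fixed_size_design :: "nat \<Rightarrow> nat \<Rightarrow> nat set pmf \<Rightarrow> bool" where
  "fixed_size_design N n p \<longleftrightarrow> (\<forall>s\<in>set_pmf p. s \<subseteq> {..<N} \<and> card s = n)"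

definition incl :: "nat set pmf \<Rightarrow> nat \<Rightarrow> real" where
  "incl p i = measure_pmf.prob p {s. i \<in> s}"

definition incl2 :: "nat set pmf \<Rightarrow> nat \<Rightarrow> nat \<Rightarrow> real" where
  "incl2 p i j = measure_pmf.prob p {s. i \<in> s \<and> j \<in> s}"

definition Delta :: "nat set pmf \<Rightarrow> nat \<Rightarrow> nat \<Rightarrow> real" where
  "Delta p i j = incl2 p i j - incl p i * incl p j"

definition poisson_design :: "nat \<Rightarrow> (nat \<Rightarrow> real) \<Rightarrow> nat set pmf" where
  "poisson_design N q =
     map_pmf (\<lambda>b. {i. i < N \<and> b i}) (Pi_pmf {..<N} False (\<lambda>i. bernoulli_pmf (q i)))"

text \<open>
  The side conditions keep \<^const>\<open>bernoulli_pmf\<close> and \<^const>\<open>cond_pmf\<close> within the range of arguments on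
  which they are meaningful.  The parameters 0 and 1 are allowed, since units may be selected with
  certainty.
\<close>

definition rejective_design :: "nat \<Rightarrow> nat \<Rightarrow> nat set pmf \<Rightarrow> bool" where
  "rejective_design N n p \<longleftrightarrow>
     (\<exists>q. (\<forall>i<N. 0 \<le> q i \<and> q i \<le> 1) \<and>
          set_pmf (poisson_design N q) \<inter> {s. card s = n} \<noteq> {} \<and>
          p = cond_pmf (poisson_design N q) {s. card s = n})"

definition d2 :: "nat \<Rightarrow> nat set pmf \<Rightarrow> nat set pmf \<Rightarrow> real" where
  "d2 N p pr = (\<Sum>s | s \<subseteq> {..<N} \<and> pmf pr s > 0. (pmf p s - pmf pr s)\<^sup>2 / pmf pr s)"

section \<open>Second-stage design\<close>

definition density_on :: "'a::euclidean_space set \<Rightarrow> ('a \<Rightarrow> real) \<Rightarrow> bool" where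
  "density_on B f \<longleftrightarrow>
     f \<in> borel_measurable lebesgue \<and> (\<forall>x. 0 \<le> f x) \<and> (\<forall>x. x \<notin> B \<longrightarrow> f x = 0) \<and>
     (\<integral>\<^sup>+x. ennreal (f x) \<partial>lebesgue) = 1"

text \<open>
  \<open>S\<close> is the first-stage sample and \<open>X i j\<close>, \<open>j < nII i\<close>, are the points drawn in PSU \<open>i\<close>.
  Conditionally on \<open>S = s\<close>, i.e. under \<^const>\<open>uniform_measure\<close> on that event, the points in the
  selected PSUs are independent and those in PSU \<open>i\<close> have density \<open>f i\<close>, whatever \<open>s\<close> is.
  Nothing is required of \<open>X i j\<close> on the event \<open>i \<notin> S\<close> beyond measurability.
\<close>

definition two_stage_sample ::
  "'w measure \<Rightarrow> nat \<Rightarrow> nat set pmf \<Rightarrow> (nat \<Rightarrow> nat) \<Rightarrow> (nat \<Rightarrow> 'a::euclidean_space \<Rightarrow> real) \<Rightarrow>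
   ('w \<Rightarrow> nat set) \<Rightarrow> (nat \<Rightarrow> nat \<Rightarrow> 'w \<Rightarrow> 'a) \<Rightarrow> bool" where
  "two_stage_sample M N p nII f S X \<longleftrightarrow>
     prob_space M \<and>
     S \<in> measurable M (count_space (Pow {..<N})) \<and>
     (\<forall>s. s \<subseteq> {..<N} \<longrightarrow> measure M {\<omega>\<in>space M. S \<omega> = s} = pmf p s) \<and>
     (\<forall>s\<in>set_pmf p.
        prob_space.indep_vars (uniform_measure M {\<omega>\<in>space M. S \<omega> = s}) (\<lambda>_. lebesgue)
          (\<lambda>(i, j). X i j) (SIGMA i:s. {..<nII i}) \<and>
        (\<forall>i\<in>s. \<forall>j<nII i.
           distributed (uniform_measure M {\<omega>\<in>space M. S \<omega> = s}) lebesgue (X i j)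
             (\<lambda>x. ennreal (f i x))))"

definition piII :: "(nat \<Rightarrow> nat) \<Rightarrow> (nat \<Rightarrow> 'a \<Rightarrow> real) \<Rightarrow> nat \<Rightarrow> 'a \<Rightarrow> real" where
  "piII nII f i x = real (nII i) * f i x"

definition nII0 :: "nat \<Rightarrow> (nat \<Rightarrow> nat) \<Rightarrow> real" where
  "nII0 N nII = (\<Sum>i<N. real (nII i)) / real N"

section \<open>Estimator and variance estimator\<close>

definition tau :: "('a::euclidean_space \<Rightarrow> real) \<Rightarrow> 'a set \<Rightarrow> real" where
  "tau \<rho> B = (LINT x:B|lebesgue. \<rho> x)"

definition tau_hat_psu ::
  "('a \<Rightarrow> real) \<Rightarrow> (nat \<Rightarrow> nat) \<Rightarrow> (nat \<Rightarrow> 'a \<Rightarrow> real) \<Rightarrow> (nat \<Rightarrow> nat \<Rightarrow> 'w \<Rightarrow> 'a) \<Rightarrow>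
   nat \<Rightarrow> 'w \<Rightarrow> real" where
  "tau_hat_psu \<rho> nII f X i \<omega> = (\<Sum>j<nII i. \<rho> (X i j \<omega>) / piII nII f i (X i j \<omega>))"

definition tau_hat ::
  "('a \<Rightarrow> real) \<Rightarrow> nat set pmf \<Rightarrow> (nat \<Rightarrow> nat) \<Rightarrow> (nat \<Rightarrow> 'a \<Rightarrow> real) \<Rightarrow>
   ('w \<Rightarrow> nat set) \<Rightarrow> (nat \<Rightarrow> nat \<Rightarrow> 'w \<Rightarrow> 'a) \<Rightarrow> 'w \<Rightarrow> real" where
  "tau_hat \<rho> p nII f S X \<omega> = (\<Sum>i\<in>S \<omega>. tau_hat_psu \<rho> nII f X i \<omega> / incl p i)"

definition V1 ::
  "('a::euclidean_space \<Rightarrow> real) \<Rightarrow> nat \<Rightarrow> (nat \<Rightarrow> 'a set) \<Rightarrow> nat set pmf \<Rightarrow> real" where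
  "V1 \<rho> N u p =
     (\<Sum>i<N. \<Sum>j<N. Delta p i j * (tau \<rho> (u i) / incl p i) * (tau \<rho> (u j) / incl p j))"

definition R_hat ::
  "('a \<Rightarrow> real) \<Rightarrow> nat set pmf \<Rightarrow> (nat \<Rightarrow> nat) \<Rightarrow> (nat \<Rightarrow> 'a \<Rightarrow> real) \<Rightarrow>
   ('w \<Rightarrow> nat set) \<Rightarrow> (nat \<Rightarrow> nat \<Rightarrow> 'w \<Rightarrow> 'a) \<Rightarrow> 'w \<Rightarrow> real" where
  "R_hat \<rho> p nII f S X \<omega> =
     (\<Sum>i\<in>S \<omega>. (1 - incl p i) * (tau_hat_psu \<rho> nII f X i \<omega> / incl p i)) /
     (\<Sum>i\<in>S \<omega>. 1 - incl p i)"

definition V_hat_psu ::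
  "('a \<Rightarrow> real) \<Rightarrow> (nat \<Rightarrow> nat) \<Rightarrow> (nat \<Rightarrow> 'a \<Rightarrow> real) \<Rightarrow> (nat \<Rightarrow> nat \<Rightarrow> 'w \<Rightarrow> 'a) \<Rightarrow>
   nat \<Rightarrow> 'w \<Rightarrow> real" where
  "V_hat_psu \<rho> nII f X i \<omega> =
     real (nII i) / (real (nII i) - 1) *
     (\<Sum>j<nII i. (\<rho> (X i j \<omega>) / piII nII f i (X i j \<omega>)
                   - tau_hat_psu \<rho> nII f X i \<omega> / real (nII i))\<^sup>2)"

definition V_HAJ ::
  "('a \<Rightarrow> real) \<Rightarrow> nat set pmf \<Rightarrow> (nat \<Rightarrow> nat) \<Rightarrow> (nat \<Rightarrow> 'a \<Rightarrow> real) \<Rightarrow>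
   ('w \<Rightarrow> nat set) \<Rightarrow> (nat \<Rightarrow> nat \<Rightarrow> 'w \<Rightarrow> 'a) \<Rightarrow> 'w \<Rightarrow> real" where
  "V_HAJ \<rho> p nII f S X \<omega> =
     (\<Sum>i\<in>S \<omega>. (1 - incl p i) *
        (tau_hat_psu \<rho> nII f X i \<omega> / incl p i - R_hat \<rho> p nII f S X \<omega>)\<^sup>2) +
     (\<Sum>i\<in>S \<omega>. V_hat_psu \<rho> nII f X i \<omega> / incl p i)"

section \<open>Assumptions along the sequence\<close>

definition FS1 :: "(nat \<Rightarrow> nat) \<Rightarrow> (nat \<Rightarrow> nat) \<Rightarrow> (nat \<Rightarrow> nat set pmf) \<Rightarrow> bool" where
  "FS1 N nI p \<longleftrightarrow>
     (\<exists>f0 c C. f0 < 1 \<and> 0 < c \<and> c \<le> C \<and>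
        (\<forall>k. real (nI k) / real (N k) \<le> f0 \<and>
             (\<forall>i<N k. c \<le> real (N k) / real (nI k) * incl (p k) i \<and>
                      real (N k) / real (nI k) * incl (p k) i \<le> C)))"

definition SS1 ::
  "'a::euclidean_space set \<Rightarrow> (nat \<Rightarrow> nat) \<Rightarrow> (nat \<Rightarrow> nat \<Rightarrow> 'a set) \<Rightarrow>
   (nat \<Rightarrow> nat \<Rightarrow> nat) \<Rightarrow> (nat \<Rightarrow> nat \<Rightarrow> 'a \<Rightarrow> real) \<Rightarrow> bool" where
  "SS1 F N u nII f \<longleftrightarrow>
     (\<exists>l1 L1 phi1 Phi1 c1 C1.
        0 < l1 \<and> l1 \<le> L1 \<and> 0 < phi1 \<and> phi1 \<le> Phi1 \<and> 0 < c1 \<and> c1 \<le> C1 \<and>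
        (\<forall>k. \<forall>i<N k.
           l1 * nII0 (N k) (nII k) \<le> real (nII k i) \<and>
           real (nII k i) \<le> L1 * nII0 (N k) (nII k) \<and>
           phi1 * measure lebesgue F / real (N k) \<le> measure lebesgue (u k i) \<and>
           measure lebesgue (u k i) \<le> Phi1 * measure lebesgue F / real (N k) \<and>
           (\<forall>x\<in>u k i. c1 / measure lebesgue (u k i) \<le> f k i x \<and>
                      f k i x \<le> C1 / measure lebesgue (u k i)) \<and>
           2 \<le> nII k i))"

text \<open>
  Integrability of \<open>\<rho>\<^sup>4\<close> is part of the first condition: without it the Bochner integral is 0
  and the bound is void.
\<close>

definition VA1 :: "'a::euclidean_space set \<Rightarrow> ('a \<Rightarrow> real) \<Rightarrow> bool" where
  "VA1 F \<rho> \<longleftrightarrow>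
     (\<exists>m1 M1. set_integrable lebesgue F (\<lambda>x. \<rho> x ^ 4) \<and>
        (LINT x:F|lebesgue. \<rho> x ^ 4) / measure lebesgue F \<le> M1 \<and>
        0 < m1 \<and> m1 \<le> \<bar>(LINT x:F|lebesgue. \<rho> x) / measure lebesgue F\<bar>)"

definition VA2 ::
  "'a::euclidean_space set \<Rightarrow> ('a \<Rightarrow> real) \<Rightarrow> (nat \<Rightarrow> nat) \<Rightarrow> (nat \<Rightarrow> nat \<Rightarrow> 'a set) \<Rightarrow>
   (nat \<Rightarrow> nat) \<Rightarrow> (nat \<Rightarrow> nat set pmf) \<Rightarrow> bool" where
  "VA2 F \<rho> N u nI p \<longleftrightarrow>
     (\<exists>m2>0. \<forall>k. m2 \<le> real (nI k) / (measure lebesgue F)\<^sup>2 * V1 \<rho> (N k) (u k) (p k))"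

section \<open>Convergence in probability\<close>

text \<open>The random variables may live on different probability spaces.\<close>

definition conv_in_prob :: "(nat \<Rightarrow> 'w measure) \<Rightarrow> (nat \<Rightarrow> 'w \<Rightarrow> real) \<Rightarrow> real \<Rightarrow> bool" where
  "conv_in_prob M Y c \<longleftrightarrow>
     (\<forall>\<epsilon>>0. (\<lambda>k. measure (M k) {\<omega>\<in>space (M k). \<epsilon> < \<bar>Y k \<omega> - c\<bar>}) \<longlonglongrightarrow> 0)"

end

theory Submission
  imports Defs
begin

text \<open>
  Multiplying all odds \<open>q\<^sub>i / (1 - q\<^sub>i)\<close> by a constant does not change a rejective design, so one may take
  \<open>\<Sum> q\<^sub>i = n\<close>; then the size \<open>|S|\<close> of the Poisson sample has its mode near \<open>n\<close> and
  \<open>P(|S| = n)\<close> is of order \<open>1 / sqrt d\<close> with \<open>d = \<Sum> q\<^sub>i (1 - q\<^sub>i)\<close>.  Fourier inversion expresses the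
  characteristic function of a linear statistic under the rejective design through Poisson sampling,
  where it is a product over the units; dominated convergence yields a central limit theorem for
  sums of independent marks over the sample, jointly for both stages.  By the
  Cauchy-Schwarz inequality, passing from \<open>p\<^sub>r\<^sub>I\<close> to \<open>p\<^sub>I\<close> changes the expectation of \<open>g(S)\<close> by at
  most \<open>sqrt d\<^sub>2\<close> times the root mean square of \<open>g(S)\<close> under \<open>p\<^sub>r\<^sub>I\<close>.  This carries over to \<open>p\<^sub>I\<close> the limit
  law, the consistency of Hajek's estimator in \<open>L\<^sup>1\<close>, and a bound for truncated second moments
  that comes from fourth moments under \<open>p\<^sub>r\<^sub>I\<close>; the limit law and that bound give the
  convergence of the variance.
\<close>

text \<open>Moment bounds under rejective sampling come with lossy constants, so no direct
  computation yields the asymptotic variance. The estimator is therefore standardised by quantities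
  \<open>bc\<close> and \<open>nu\<close> computed under Poisson sampling, and its true variance is
  read off afterwards from the limit law. Three facts support this. A linear statistic is correlated
  with the Poisson sample size, and conditioning on the size would lower its variance; subtracting
  the constant \<open>Rc\<close> from every expanded total removes the correlation, while for
  samples of fixed size it only shifts the estimator and leaves Hajek's estimator unchanged.
  \<open>VA2\<close> speaks about the actual design, so the comparison of designs is also used
  backwards, to keep \<open>nu\<close> away from 0; there lossy constants do no harm. The estimators
  contain inclusion probabilities whereas Fourier inversion sees Poisson parameters; their relative
  difference is of order \<open>1 / sqrt d\<close>, because the law of the sample size is smooth at
  the scale \<open>sqrt d\<close>. Several estimates need \<open>d\<close> above a numerical
  threshold, reached only from some index on, hence the passage to a shifted sequence.\<close>

definition poisson_weight :: "nat set \<Rightarrow> (nat \<Rightarrow> real) \<Rightarrow> nat set \<Rightarrow> real" where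
  "poisson_weight A q s = (\<Prod>i\<in>s. q i) * (\<Prod>i\<in>A - s. 1 - q i)"

text \<open>An explicit finite sum rather than an integral over \<open>poisson_design\<close>, with
  values in any real vector space: moments are real, characteristic functions complex.\<close>

definition E_poisson :: "nat set \<Rightarrow> (nat \<Rightarrow> real) \<Rightarrow> (nat set \<Rightarrow> 'b::real_vector) \<Rightarrow> 'b" where
  "E_poisson A q g = (\<Sum>s\<in>Pow A. poisson_weight A q s *\<^sub>R g s)"

text \<open>The size is an integer, so that \<open>m - 1\<close> at \<open>m = 0\<close> has
  probability 0 instead of being truncated.\<close>

definition size_prob :: "nat set \<Rightarrow> (nat \<Rightarrow> real) \<Rightarrow> int \<Rightarrow> real" where
  "size_prob A q m = E_poisson A q (\<lambda>s. if int (card s) = m then 1 else 0)"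

definition size_var :: "nat set \<Rightarrow> (nat \<Rightarrow> real) \<Rightarrow> real" where
  "size_var A q = (\<Sum>i\<in>A. q i * (1 - q i))"

section \<open>Calculus of expectations under Poisson sampling\<close>

lemma E_poisson_empty [simp]: "E_poisson {} q g = g {}"
  by (simp add: E_poisson_def poisson_weight_def)

text \<open>Conditioning on whether unit \<open>i\<close> is selected. Products, moments and size
  probabilities are computed by induction along this recursion.\<close>

lemma E_poisson_insert:
  assumes "finite A" "i \<notin> A"
  shows "E_poisson (insert i A) q g = (1 - q i) *\<^sub>R E_poisson A q g + q i *\<^sub>R E_poisson A q (\<lambda>s. g (insert i s))"
proof -
  have 1: "poisson_weight (insert i A) q s = (1 - q i) * poisson_weight A q s" if "s \<in> Pow A" for s
  proof -
    have "insert i A - s = insert i (A - s)" "i \<notin> A - s" using that assms by auto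
    then show ?thesis using assms by (simp add: poisson_weight_def)
  qed
  have 2: "poisson_weight (insert i A) q (insert i s) = q i * poisson_weight A q s" if "s \<in> Pow A" for s
  proof -
    have "insert i A - insert i s = A - s" "i \<notin> s" "finite s"
      using that assms by (auto intro: finite_subset)
    then show ?thesis by (simp add: poisson_weight_def)
  qed
  have inj: "inj_on (insert i) (Pow A)" using assms by (auto simp: inj_on_def)
  have "E_poisson (insert i A) q g = (\<Sum>s\<in>Pow A. poisson_weight (insert i A) q s *\<^sub>R g s)
      + (\<Sum>s\<in>insert i ` Pow A. poisson_weight (insert i A) q s *\<^sub>R g s)"
    unfolding E_poisson_def Pow_insert by (rule sum.union_disjoint) (use assms in auto)
  also have "(\<Sum>s\<in>insert i ` Pow A. poisson_weight (insert i A) q s *\<^sub>R g s)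
      = (\<Sum>s\<in>Pow A. poisson_weight (insert i A) q (insert i s) *\<^sub>R g (insert i s))"
    by (simp add: sum.reindex[OF inj])
  finally show ?thesis
    unfolding E_poisson_def scaleR_sum_right by (simp only: 1 2 scaleR_scaleR cong: sum.cong)
qed

lemma E_poisson_cong: "(\<And>s. s \<subseteq> A \<Longrightarrow> f s = g s) \<Longrightarrow> E_poisson A q f = E_poisson A q g"
  unfolding E_poisson_def by (rule sum.cong) auto

lemma E_poisson_add: "E_poisson A q (\<lambda>s. f s + g s) = E_poisson A q f + E_poisson A q g"
  by (simp add: E_poisson_def scaleR_add_right sum.distrib)

lemma E_poisson_cmult: "E_poisson A q (\<lambda>s. c * g s) = c * E_poisson A q g" for c :: "'b::real_algebra"
  by (simp add: E_poisson_def sum_distrib_left mult_scaleR_right)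

lemma E_poisson_multc: "E_poisson A q (\<lambda>s. g s * c) = E_poisson A q g * c" for c :: "'b::real_algebra"
  by (simp add: E_poisson_def sum_distrib_right)

lemma E_poisson_sum: "E_poisson A q (\<lambda>s. \<Sum>i\<in>I. g i s) = (\<Sum>i\<in>I. E_poisson A q (g i))"
  unfolding E_poisson_def scaleR_sum_right by (rule sum.swap)

lemma E_poisson_zero [simp]: "E_poisson A q (\<lambda>s. 0) = 0"
  by (simp add: E_poisson_def)

lemma E_poisson_const: "finite A \<Longrightarrow> E_poisson A q (\<lambda>s. c) = c"
  by (induction A rule: finite_induct) (simp_all add: E_poisson_insert flip: scaleR_add_left)

text \<open>Independence of the selections in disjoint sets of units, in the form of Fubini's
  theorem.\<close>

lemma E_poisson_union:
  assumes "finite A" "finite B" "A \<inter> B = {}"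
  shows "E_poisson (A \<union> B) q g = E_poisson A q (\<lambda>s. E_poisson B q (\<lambda>t. g (s \<union> t)))"
  using assms
proof (induction A arbitrary: g rule: finite_induct)
  case (insert i A)
  then show ?case
    by (simp add: E_poisson_insert)
qed simp

lemma poisson_weight_nonneg: "(\<And>i. i \<in> A \<Longrightarrow> 0 \<le> q i \<and> q i \<le> 1) \<Longrightarrow> s \<subseteq> A \<Longrightarrow> 0 \<le> poisson_weight A q s"
  unfolding poisson_weight_def by (intro mult_nonneg_nonneg prod_nonneg) auto

lemma E_poisson_mono:
  fixes f g :: "nat set \<Rightarrow> real"
  assumes "\<And>i. i \<in> A \<Longrightarrow> 0 \<le> q i \<and> q i \<le> 1" "\<And>s. s \<subseteq> A \<Longrightarrow> f s \<le> g s"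
  shows "E_poisson A q f \<le> E_poisson A q g"
  unfolding E_poisson_def by (intro sum_mono) (auto intro!: mult_left_mono poisson_weight_nonneg assms)

lemma E_poisson_nonneg:
  fixes g :: "nat set \<Rightarrow> real"
  assumes "\<And>i. i \<in> A \<Longrightarrow> 0 \<le> q i \<and> q i \<le> 1" "\<And>s. s \<subseteq> A \<Longrightarrow> 0 \<le> g s"
  shows "0 \<le> E_poisson A q g"
  using E_poisson_mono[of A q "\<lambda>_. 0" g] assms by simp

text \<open>Splits off a member of a given population; this leads to size biasing and to the
  inclusion probabilities of the rejective design.\<close>

lemma E_poisson_split_member:
  assumes "finite A" "i \<in> A"
  shows "E_poisson A q (\<lambda>s. if i \<in> s then g s else 0) = q i *\<^sub>R E_poisson (A - {i}) q (\<lambda>s. g (insert i s))"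
    and "E_poisson A q (\<lambda>s. if i \<in> s then 0 else g s) = (1 - q i) *\<^sub>R E_poisson (A - {i}) q g"
proof -
  have A: "A = insert i (A - {i})" using assms by auto
  have *: "E_poisson (A - {i}) q (\<lambda>s. if i \<in> s then g s else 0) = E_poisson (A - {i}) q (\<lambda>s. 0)"
    "E_poisson (A - {i}) q (\<lambda>s. if i \<in> s then 0 else g s) = E_poisson (A - {i}) q g"
    by (rule E_poisson_cong; auto)+
  show "E_poisson A q (\<lambda>s. if i \<in> s then g s else 0) = q i *\<^sub>R E_poisson (A - {i}) q (\<lambda>s. g (insert i s))"
    by (subst A, subst E_poisson_insert) (use assms * in auto)
  show "E_poisson A q (\<lambda>s. if i \<in> s then 0 else g s) = (1 - q i) *\<^sub>R E_poisson (A - {i}) q g"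
    by (subst A, subst E_poisson_insert) (use assms * in auto)
qed

text \<open>Independence of the units turns a multiplicative functional into a product of Bernoulli
  transforms; this product form is what makes Fourier inversion useful.\<close>

lemma E_poisson_prod:
  fixes z :: "nat \<Rightarrow> 'b::{comm_monoid_mult,real_algebra_1}"
  assumes "finite A"
  shows "E_poisson A q (\<lambda>s. \<Prod>i\<in>s. z i) = (\<Prod>i\<in>A. of_real (1 - q i) + of_real (q i) * z i)"
  using assms
proof (induction A rule: finite_induct)
  case (insert i A)
  have "E_poisson A q (\<lambda>s. \<Prod>j\<in>insert i s. z j) = E_poisson A q (\<lambda>s. z i * (\<Prod>j\<in>s. z j))"
  proof (rule E_poisson_cong)
    fix s assume "s \<subseteq> A"
    then have "i \<notin> s" "finite s" using insert by (auto intro: finite_subset)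
    then show "(\<Prod>j\<in>insert i s. z j) = z i * (\<Prod>j\<in>s. z j)" by simp
  qed
  then show ?case using insert
    by (simp add: E_poisson_insert E_poisson_cmult scaleR_conv_of_real algebra_simps)
qed simp

subsection \<open>Moments of linear statistics under Poisson sampling\<close>

text \<open>Adding a unit adds an independent variable equal to \<open>(1 - q i) * a i\<close> with
  probability \<open>q i\<close> and to \<open>- q i * a i\<close> otherwise. Its mean is 0, so
  terms linear in it vanish, as do those linear in the old sum. In the fourth moment
  \<open>q i ^ 3 + (1 - q i) ^ 3 \<le> 1\<close> gives the stated form.\<close>

lemma E_poisson_linear:
  fixes a :: "nat \<Rightarrow> real"
  assumes "finite A"
  shows "E_poisson A q (\<lambda>s. (\<Sum>i\<in>s. a i) - (\<Sum>i\<in>A. q i * a i)) = 0" (is "?P1 A")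
    and "E_poisson A q (\<lambda>s. ((\<Sum>i\<in>s. a i) - (\<Sum>i\<in>A. q i * a i))\<^sup>2) = (\<Sum>i\<in>A. q i * (1 - q i) * (a i)\<^sup>2)" (is "?P2 A")
    and "(\<And>i. i \<in> A \<Longrightarrow> 0 \<le> q i \<and> q i \<le> 1) \<Longrightarrow>
       E_poisson A q (\<lambda>s. ((\<Sum>i\<in>s. a i) - (\<Sum>i\<in>A. q i * a i)) ^ 4)
        \<le> (\<Sum>i\<in>A. q i * (1 - q i) * a i ^ 4) + 3 * (\<Sum>i\<in>A. q i * (1 - q i) * (a i)\<^sup>2)\<^sup>2"
proof -
  have step: "E_poisson (insert i A) q (\<lambda>s. ((\<Sum>i\<in>s. a i) - (\<Sum>i\<in>insert i A. q i * a i)) ^ k)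
    = (1 - q i) * E_poisson A q (\<lambda>s. ((\<Sum>i\<in>s. a i) - (\<Sum>i\<in>A. q i * a i) - q i * a i) ^ k)
    + q i * E_poisson A q (\<lambda>s. ((\<Sum>i\<in>s. a i) - (\<Sum>i\<in>A. q i * a i) + (1 - q i) * a i) ^ k)"
    if "finite A" "i \<notin> A" for A i k
  proof -
    have 1: "E_poisson A q (\<lambda>s. ((\<Sum>j\<in>insert i s. a j) - (\<Sum>j\<in>insert i A. q j * a j)) ^ k)
      = E_poisson A q (\<lambda>s. ((\<Sum>i\<in>s. a i) - (\<Sum>i\<in>A. q i * a i) + (1 - q i) * a i) ^ k)"
    proof (rule E_poisson_cong)
      fix s assume "s \<subseteq> A"
      then have "i \<notin> s" "finite s" using that by (auto intro: finite_subset)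
      then have "(\<Sum>j\<in>insert i s. a j) - (\<Sum>j\<in>insert i A. q j * a j) =
       (\<Sum>i\<in>s. a i) - (\<Sum>i\<in>A. q i * a i) + (1 - q i) * a i"
        using that by (simp add: algebra_simps)
      then show "((\<Sum>j\<in>insert i s. a j) - (\<Sum>j\<in>insert i A. q j * a j)) ^ k =
       ((\<Sum>i\<in>s. a i) - (\<Sum>i\<in>A. q i * a i) + (1 - q i) * a i) ^ k" by simp
    qed
    have 2: "(\<Sum>j\<in>s. a j) - (\<Sum>j\<in>insert i A. q j * a j)
      = (\<Sum>i\<in>s. a i) - (\<Sum>i\<in>A. q i * a i) - q i * a i" for s
      using that by simp
    show ?thesis unfolding E_poisson_insert[OF that] 1 by (simp only: 2 real_scaleR_def)
  qed
  define Y where "Y A s = (\<Sum>i\<in>s. a i) - (\<Sum>i\<in>A. q i * a i)" for A s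
  have m12: "E_poisson A q (Y A) = 0" "E_poisson A q (\<lambda>s. (Y A s)\<^sup>2) = (\<Sum>i\<in>A. q i * (1 - q i) * (a i)\<^sup>2)"
    if "finite A" for A
    using that
  proof (induction A rule: finite_induct)
    case (insert i A)
    have e1: "E_poisson A q (\<lambda>s. (Y A s + c)^1) = c" for c
      using insert by (simp add: E_poisson_add E_poisson_const)
    have e2: "E_poisson A q (\<lambda>s. (Y A s + c)^2) = E_poisson A q (\<lambda>s. (Y A s)\<^sup>2) + c\<^sup>2" for c
      using insert by (simp add: power2_sum E_poisson_add E_poisson_const E_poisson_cmult E_poisson_multc)
    { case 1 show ?case
      using step[OF insert(1,2), of 1] e1[of "- q i * a i"] e1[of "(1 - q i) * a i"]
      by (simp add: Y_def) }
    { case 2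
      define V where "V = (\<Sum>i\<in>A. q i * (1 - q i) * (a i)\<^sup>2)"
      have "E_poisson (insert i A) q (\<lambda>s. (Y (insert i A) s)\<^sup>2) =
        (1 - q i) * E_poisson A q (\<lambda>s. (Y A s + - q i * a i)\<^sup>2) + q i * E_poisson A q (\<lambda>s. (Y A s + (1 - q i) * a i)\<^sup>2)"
        using step[OF insert(1,2), of 2] by (simp add: Y_def)
      also have "\<dots> = (1 - q i) * (V + (- q i * a i)\<^sup>2) + q i * (V + ((1 - q i) * a i)\<^sup>2)"
        unfolding e2 insert(4) V_def ..
      also have "\<dots> = q i * (1 - q i) * (a i)\<^sup>2 + V" by algebra
      finally show ?case using insert(1,2) by (simp add: V_def) }
  qed (simp_all add: Y_def)
  show "?P1 A" "?P2 A" using m12[OF assms] by (auto simp: Y_def[abs_def])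
  assume q: "\<And>i. i \<in> A \<Longrightarrow> 0 \<le> q i \<and> q i \<le> 1"
  show "E_poisson A q (\<lambda>s. ((\<Sum>i\<in>s. a i) - (\<Sum>i\<in>A. q i * a i)) ^ 4)
        \<le> (\<Sum>i\<in>A. q i * (1 - q i) * a i ^ 4) + 3 * (\<Sum>i\<in>A. q i * (1 - q i) * (a i)\<^sup>2)\<^sup>2"
    using assms q
  proof (induction A rule: finite_induct)
    case (insert i A)
    define V where "V = (\<Sum>i\<in>A. q i * (1 - q i) * (a i)\<^sup>2)"
    define v where "v = q i * (1 - q i)"
    have v: "0 \<le> v" using insert(4)[of i] by (simp add: v_def)
    have e4: "E_poisson A q (\<lambda>s. (Y A s + c)^4) = E_poisson A q (\<lambda>s. (Y A s)^4) + 4 * c * E_poisson A q (\<lambda>s. (Y A s)^3) 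
        + 6 * c\<^sup>2 * V + c ^ 4" for c
    proof -
      have "(Y A s + c)^4 = (Y A s)^4 + (4 * c) * (Y A s)^3 + (6 * c\<^sup>2) * (Y A s)\<^sup>2 + (4 * c^3) * Y A s + c^4" for s
        by algebra
      then show ?thesis using m12[OF insert(1)] insert(1)
        by (simp only: E_poisson_add E_poisson_cmult E_poisson_const V_def)
    qed
    have "E_poisson (insert i A) q (\<lambda>s. (Y (insert i A) s) ^ 4) =
      (1 - q i) * E_poisson A q (\<lambda>s. (Y A s + - q i * a i)^4) + q i * E_poisson A q (\<lambda>s. (Y A s + (1 - q i) * a i)^4)"
      using step[OF insert(1,2), of 4] by (simp add: Y_def)
    also have "\<dots> = E_poisson A q (\<lambda>s. (Y A s)^4) + 6 * v * (a i)\<^sup>2 * V + v * (a i ^4 * (q i ^ 3 + (1 - q i)^3))"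
      unfolding e4 v_def by algebra
    also have "\<dots> \<le> E_poisson A q (\<lambda>s. (Y A s)^4) + 6 * v * (a i)\<^sup>2 * V + v * (a i ^4 * 1)"
    proof -
      have "q i ^ 3 + (1 - q i)^3 = 1 - 3 * v" unfolding v_def by algebra
      then show ?thesis using v by (intro add_left_mono mult_left_mono) auto
    qed
    also have "\<dots> \<le> (\<Sum>i\<in>A. q i * (1 - q i) * a i ^ 4) + 3 * V\<^sup>2 + 6 * v * (a i)\<^sup>2 * V + v * (a i ^4 * 1)"
      using insert(3,4) by (simp add: V_def Y_def)
    also have "\<dots> \<le> (\<Sum>i\<in>A. q i * (1 - q i) * a i ^ 4) + v * a i ^ 4 + 3 * (V + v * (a i)\<^sup>2)\<^sup>2"
    proof -
      have "3 * (V + v * (a i)\<^sup>2)\<^sup>2 = 3 * V\<^sup>2 + 6 * v * (a i)\<^sup>2 * V + 3 * (v * (a i)\<^sup>2)\<^sup>2" by algebra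
      then show ?thesis by simp
    qed
    finally show ?case using insert by (simp add: Y_def V_def v_def add_ac)
  qed simp
qed

subsection \<open>The size of a Poisson sample\<close>

lemma size_prob_empty: "size_prob {} q m = (if m = 0 then 1 else 0)"
  by (auto simp: size_prob_def)

lemma size_prob_nonneg: "(\<And>i. i \<in> A \<Longrightarrow> 0 \<le> q i \<and> q i \<le> 1) \<Longrightarrow> 0 \<le> size_prob A q m"
  unfolding size_prob_def by (rule E_poisson_nonneg) auto

lemma size_prob_insert:
  assumes "finite A" "i \<notin> A"
  shows "size_prob (insert i A) q m = (1 - q i) * size_prob A q m + q i * size_prob A q (m - 1)"
proof -
  have "E_poisson A q (\<lambda>s. if int (card (insert i s)) = m then 1 else 0 :: real) =
    E_poisson A q (\<lambda>s. if int (card s) = m - 1 then 1 else 0)"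
  proof (rule E_poisson_cong)
    fix s assume "s \<subseteq> A"
    then have "i \<notin> s" "finite s" using assms by (auto intro: finite_subset)
    then show "(if int (card (insert i s)) = m then 1 else 0 :: real) = (if int (card s) = m - 1 then 1 else 0)"
      by auto
  qed
  then show ?thesis using assms unfolding size_prob_def by (simp add: E_poisson_insert)
qed

lemma size_prob_remove:
  assumes "finite A" "i \<in> A"
  shows "size_prob A q m = (1 - q i) * size_prob (A - {i}) q m + q i * size_prob (A - {i}) q (m - 1)"
  using size_prob_insert[of "A - {i}" i q m] assms by (simp add: insert_absorb)

text \<open>Interchanging selected and unselected units replaces \<open>q\<close> by
  \<open>1 - q\<close>; this converts monotonicity below the mean into monotonicity above
  it.\<close>

lemma size_prob_complement:
  "finite A \<Longrightarrow> size_prob A (\<lambda>i. 1 - q i) m = size_prob A q (int (card A) - m)"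
proof (induction A arbitrary: m rule: finite_induct)
  case (insert i A)
  have "int (card A) - (m - 1) = 1 + int (card A) - m" "1 + int (card A) - m - 1 = int (card A) - m"
    by auto
  then show ?case using insert by (simp add: size_prob_insert) (simp add: algebra_simps)
qed (auto simp: size_prob_empty)

text \<open>Double counting of pairs of a sample of size \<open>m\<close> and a member
  \<open>i\<close>; removing \<open>i\<close> leaves a Poisson sample of size \<open>m - 1\<close>
  from the other units.\<close>

lemma size_prob_size_bias:
  assumes "finite A"
  shows "of_int m * size_prob A q m = (\<Sum>i\<in>A. q i * size_prob (A - {i}) q (m - 1))"
proof -
  have "(\<Sum>i\<in>A. q i * size_prob (A - {i}) q (m - 1)) =
    (\<Sum>i\<in>A. E_poisson A q (\<lambda>s. if i \<in> s then if int (card s) = m then 1 else 0 else 0))"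
  proof (rule sum.cong[OF refl])
    fix i assume i: "i \<in> A"
    have "size_prob (A - {i}) q (m - 1) = E_poisson (A - {i}) q (\<lambda>s. if int (card (insert i s)) = m then 1 else 0)"
      unfolding size_prob_def
    proof (rule E_poisson_cong)
      fix s assume "s \<subseteq> A - {i}"
      then have "i \<notin> s" "finite s" using assms by (auto intro: finite_subset)
      then show "(if int (card s) = m - 1 then 1 else 0 :: real) = (if int (card (insert i s)) = m then 1 else 0)"
        by auto
    qed
    then show "q i * size_prob (A - {i}) q (m - 1) =
        E_poisson A q (\<lambda>s. if i \<in> s then if int (card s) = m then 1 else 0 else 0)"
      using E_poisson_split_member(1)[OF assms i, of q "\<lambda>s. if int (card s) = m then 1 else 0 :: real"] by simp
  qed
  also have "\<dots> = E_poisson A q (\<lambda>s. of_int m * (if int (card s) = m then 1 else 0))"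
    unfolding E_poisson_sum[symmetric]
  proof (rule E_poisson_cong)
    fix s assume s: "s \<subseteq> A"
    have "(\<Sum>i\<in>A. if i \<in> s then if int (card s) = m then 1 else 0 else 0 :: real)
       = (\<Sum>i\<in>s. if int (card s) = m then 1 else 0)"
      using s assms by (simp add: sum.If_cases Int_absorb1)
    then show "(\<Sum>i\<in>A. if i \<in> s then if int (card s) = m then 1 else 0 else 0 :: real)
       = of_int m * (if int (card s) = m then 1 else 0)"
      by (auto simp: )
  qed
  finally show ?thesis by (simp add: E_poisson_cmult size_prob_def)
qed

text \<open>
  Subtracting \<open>\<mu> P(S = m - 1)\<close> from the size-biasing identity \<open>m P(S = m) = \<Sum> q\<^sub>i P(S\<^sub>-\<^sub>i = m - 1)\<close>
  reduces the claim to the samples \<open>S\<^sub>-\<^sub>i\<close> without unit \<open>i\<close>, whose mean is at least \<open>m - 1\<close>.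
\<close>

lemma size_prob_increasing_below_mean:
  assumes "finite A" "\<And>i. i \<in> A \<Longrightarrow> 0 \<le> q i \<and> q i \<le> 1" "of_int m \<le> (\<Sum>i\<in>A. q i)"
  shows "size_prob A q (m - 1) \<le> size_prob A q m"
  using assms
proof (induction "card A" arbitrary: A m)
  case 0
  then show ?case by (auto simp: size_prob_empty)
next
  case (Suc k)
  show ?case
  proof (cases "m \<le> 0")
    case True
    then have "size_prob A q (m - 1) = E_poisson A q (\<lambda>s. 0)" unfolding size_prob_def by (intro E_poisson_cong) auto
    then show ?thesis using size_prob_nonneg[of A q m] Suc by simp
  next
    case False
    let ?\<mu> = "\<Sum>i\<in>A. q i"
    have IH: "size_prob (A - {i}) q (m - 2) \<le> size_prob (A - {i}) q (m - 1)" if "i \<in> A" for i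
    proof -
      have "(\<Sum>j\<in>A - {i}. q j) = ?\<mu> - q i" using Suc.prems that by (simp add: sum_diff1)
      then have "of_int (m - 1) \<le> (\<Sum>j\<in>A - {i}. q j)" using Suc.prems(2)[OF that] Suc.prems(3) by simp
      then have "size_prob (A - {i}) q (m - 1 - 1) \<le> size_prob (A - {i}) q (m - 1)"
        using Suc that by (intro Suc.hyps(1)) auto
      then show ?thesis by simp
    qed
    have "?\<mu> * size_prob A q (m - 1) = (\<Sum>i\<in>A. q i * ((1 - q i) * size_prob (A - {i}) q (m - 1) + q i * size_prob (A - {i}) q (m - 2)))"
      unfolding sum_distrib_right
      by (rule sum.cong[OF refl], subst size_prob_remove) (use Suc in auto)
    also have "\<dots> \<le> (\<Sum>i\<in>A. q i * size_prob (A - {i}) q (m - 1))"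
    proof (rule sum_mono)
      fix i assume i: "i \<in> A"
      have "(1 - q i) * size_prob (A - {i}) q (m - 1) + q i * size_prob (A - {i}) q (m - 2)
        \<le> (1 - q i) * size_prob (A - {i}) q (m - 1) + q i * size_prob (A - {i}) q (m - 1)"
        using IH[OF i] Suc.prems(2)[OF i] by (intro add_left_mono mult_left_mono) auto
      also have "\<dots> = size_prob (A - {i}) q (m - 1)" by (simp add: algebra_simps)
      finally show "q i * ((1 - q i) * size_prob (A - {i}) q (m - 1) + q i * size_prob (A - {i}) q (m - 2))
         \<le> q i * size_prob (A - {i}) q (m - 1)" using Suc.prems(2)[OF i] by (intro mult_left_mono) auto
    qed
    also have "\<dots> = of_int m * size_prob A q m" using size_prob_size_bias[of A m q] Suc by simp
    finally have *: "?\<mu> * size_prob A q (m - 1) \<le> of_int m * size_prob A q m" .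
    have "of_int m * size_prob A q (m - 1) \<le> ?\<mu> * size_prob A q (m - 1)"
      using Suc size_prob_nonneg[of A q "m-1"] by (intro mult_right_mono) auto
    then have "of_int m * size_prob A q (m - 1) \<le> of_int m * size_prob A q m" using * by linarith
    then show ?thesis using False by simp
  qed
qed

text \<open>An integer mean is a mode. Sizes above the mean are treated by passing to complements,
  whose mean \<open>card A - n\<close> is an integer too.\<close>

lemma size_prob_le_size_prob_mean:
  assumes A: "finite A" "\<And>i. i \<in> A \<Longrightarrow> 0 \<le> q i \<and> q i \<le> 1" and n: "of_int n = (\<Sum>i\<in>A. q i)"
  shows "size_prob A q m \<le> size_prob A q n"
proof (cases "m \<le> n")
  case True
  have "size_prob A q (n - int k) \<le> size_prob A q n" for k
  proof (induction k)
    case (Suc k)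
    have "size_prob A q (n - int k - 1) \<le> size_prob A q (n - int k)"
      using A n by (intro size_prob_increasing_below_mean) auto
    moreover have "n - int (Suc k) = n - int k - 1" by simp
    ultimately show ?case using Suc by (metis order.trans)
  qed simp
  from this[of "nat (n - m)"] True show ?thesis by simp
next
  case False
  have "size_prob A q (n + int k) \<le> size_prob A q n" for k
  proof (induction k)
    case (Suc k)
    let ?m = "int (card A) - (n + int k)"
    have "size_prob A (\<lambda>i. 1 - q i) (?m - 1) \<le> size_prob A (\<lambda>i. 1 - q i) ?m"
      using A n by (intro size_prob_increasing_below_mean) (auto simp: sum_subtractf)
    then have "size_prob A q (int (card A) - (?m - 1)) \<le> size_prob A q (int (card A) - ?m)"
      using A by (simp add: size_prob_complement)
    moreover have "int (card A) - (?m - 1) = n + int (Suc k)" "int (card A) - ?m = n + int k" by simp_all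
    ultimately show ?case using Suc by (metis order.trans)
  qed simp
  from this[of "nat (m - n)"] False show ?thesis by simp
qed

lemma size_var_nonneg: "(\<And>i. i \<in> A \<Longrightarrow> 0 \<le> q i \<and> q i \<le> 1) \<Longrightarrow> 0 \<le> size_var A q"
  unfolding size_var_def by (intro sum_nonneg) auto

text \<open>Chebyshev's inequality leaves mass at least 1/2 on the \<open>2 * r - 1\<close> sizes at
  distance less than \<open>r\<close> from the mean, and none of them is more probable than the mean
  itself.\<close>

lemma size_prob_mean_lower:
  assumes A: "finite A" "\<And>i. i \<in> A \<Longrightarrow> 0 \<le> q i \<and> q i \<le> 1" and n: "of_int n = (\<Sum>i\<in>A. q i)"
  shows "1 / (8 * sqrt (1 + size_var A q)) \<le> size_prob A q n"
proof -
  let ?d = "size_var A q"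
  have d: "0 \<le> ?d" using A(2) by (rule size_var_nonneg)
  \<comment> \<open>\<open>1 + d\<close> instead of \<open>d\<close> keeps \<open>r\<close> positive
    when the size is nearly deterministic; the factor 2 makes the Chebyshev term at most
    1/2.\<close>
  define r where "r = nat \<lceil>sqrt (2 * (1 + ?d))\<rceil>"
  have s0: "0 \<le> sqrt (2 * (1 + ?d))" using d by simp
  have r1: "sqrt (2 * (1 + ?d)) \<le> real r" and r2: "real r \<le> sqrt (2 * (1 + ?d)) + 1"
    unfolding r_def using s0 by linarith+
  have r3: "2 * ?d \<le> (real r)\<^sup>2"
  proof -
    have "2 * ?d \<le> (sqrt (2 * (1 + ?d)))\<^sup>2" using d by simp
    also have "\<dots> \<le> (real r)\<^sup>2" using r1 s0 by (rule power_mono)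
    finally show ?thesis .
  qed
  have r0: "0 < real r" using r1 d by (smt (verit) real_sqrt_gt_zero)
  have "1 = E_poisson A q (\<lambda>s. 1 :: real)" using A by (simp add: E_poisson_const)
  also have "\<dots> \<le> E_poisson A q (\<lambda>s. (\<Sum>m\<in>{n - int r<..<n + int r}. if int (card s) = m then 1 else 0) +
       (1 / (real r)\<^sup>2) * ((\<Sum>i\<in>s. 1) - (\<Sum>i\<in>A. q i * 1))\<^sup>2)"
  proof (rule E_poisson_mono[OF A(2)])
    fix s assume "s \<subseteq> A"
    show "1 \<le> (\<Sum>m\<in>{n - int r<..<n + int r}. if int (card s) = m then 1 else 0) +
       (1 / (real r)\<^sup>2) * ((\<Sum>i\<in>s. 1) - (\<Sum>i\<in>A. q i * 1))\<^sup>2"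
    proof (cases "int (card s) \<in> {n - int r<..<n + int r}")
      case True
      then show ?thesis by simp
    next
      case False
      then have "int r \<le> \<bar>int (card s) - n\<bar>" by auto
      then have "real r \<le> \<bar>real (card s) - of_int n\<bar>" by linarith
      then have "(real r)\<^sup>2 \<le> (real (card s) - of_int n)\<^sup>2" using r0 
        by (metis abs_le_square_iff abs_of_pos)
      then have "1 \<le> (1 / (real r)\<^sup>2) * (real (card s) - of_int n)\<^sup>2" using r0 by (simp add: field_simps)
      then show ?thesis using n by (simp add: sum_nonneg add_increasing)
    qed
  qed auto
  also have "\<dots> = (\<Sum>m\<in>{n - int r<..<n + int r}. size_prob A q m) + (1 / (real r)\<^sup>2) * ?d"
    unfolding E_poisson_add E_poisson_sum E_poisson_cmult E_poisson_linear(2)[OF A(1)] size_prob_def by (simp add: size_var_def)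
  also have "\<dots> \<le> (\<Sum>m\<in>{n - int r<..<n + int r}. size_prob A q n) + 1 / 2"
    using r3 r0 by (intro add_mono sum_mono size_prob_le_size_prob_mean A n) (auto simp: field_simps)
  also have "\<dots> \<le> (2 * real r - 1) * size_prob A q n + 1/2"
  proof -
    have "real (card {n - int r<..<n + int r}) = 2 * real r - 1" using r0 by (simp add: of_nat_diff)
    then show ?thesis by simp
  qed
  finally have 1: "1 \<le> 2 * (2 * real r - 1) * size_prob A q n" by (simp add: algebra_simps)
  \<comment> \<open>With \<open>t = sqrt (1 + d)\<close> and \<open>sqrt 2 \<le> 3/2\<close> one has
    \<open>r \<le> 3/2 * t + 1\<close>, so the left side is at most \<open>6 * t + 2\<close>, and
    \<open>1 \<le> t\<close>.\<close>
  have "2 * (2 * real r - 1) \<le> 8 * sqrt (1 + ?d)"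
  proof -
    define t where "t = sqrt (1 + ?d)"
    define t' where "t' = sqrt (2 * (1 + ?d))"
    have "t' \<le> 3/2 * t"
      unfolding t_def t'_def real_sqrt_mult
      by (intro mult_right_mono real_le_lsqrt) (use d in \<open>auto simp: power2_eq_square\<close>)
    moreover have "1 \<le> t" using d by (simp add: t_def)
    moreover have "real r \<le> t' + 1" using r2 by (simp add: t'_def)
    ultimately have "2 * (2 * real r - 1) \<le> 8 * t" by argo
    then show ?thesis by (simp add: t_def)
  qed
  then have "1 \<le> 8 * sqrt (1 + ?d) * size_prob A q n"
    using 1 size_prob_nonneg[of A q n] A by (meson mult_right_mono order.trans)
  moreover have "0 < sqrt (1 + ?d)" using d by simp
  ultimately show ?thesis by (simp add: field_simps)
qed

subsection \<open>Fourier inversion for the sample size\<close>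

text \<open>Taylor expansion gives the lower bound \<open>x\<^sup>2 / 2 - x ^ 4 / 24\<close>, and
  \<open>x\<^sup>2 \<le> 10\<close> on the interval; \<open>1/2 - 10/24 = 1/12\<close>.\<close>

lemma one_minus_cos_ge:
  assumes "\<bar>x\<bar> \<le> pi"
  shows "x\<^sup>2 / 12 \<le> 1 - cos x"
proof -
  have "\<bar>Re (iexp x - (\<Sum>k\<le>3. (\<i> * x)^k / fact k))\<bar> \<le> \<bar>x\<bar>^4 / 24"
    using iexp_approx1[of x 3] abs_Re_le_cmod[of "iexp x - (\<Sum>k\<le>3. (\<i> * x)^k / fact k)"]
    by (simp add: fact_numeral numeral_eq_Suc)
  moreover have "Re (iexp x - (\<Sum>k\<le>3. (\<i> * x)^k / fact k)) = cos x - 1 + x\<^sup>2 / 2"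
    by (simp add: numeral_3_eq_3 Re_exp power2_eq_square)
  ultimately have "\<bar>cos x - 1 + x\<^sup>2 / 2\<bar> \<le> \<bar>x\<bar>^4 / 24" by metis
  then have 1: "cos x \<le> 1 - x\<^sup>2 / 2 + x^4 / 24" by simp argo
  have "pi \<le> 3.15" using pi_approx by simp
  then have "\<bar>x\<bar> \<le> 3.15" using assms by linarith
  then have "\<bar>x\<bar>\<^sup>2 \<le> 3.15\<^sup>2" by (rule power_mono) simp
  then have "x\<^sup>2 \<le> 10" by (simp add: power2_eq_square)
  then have "x\<^sup>2 * x\<^sup>2 \<le> 10 * x\<^sup>2" by (rule mult_right_mono) simp
  then have "x ^ 4 \<le> 10 * x\<^sup>2" by (simp add: power_numeral_reduce)
  then show ?thesis using 1 by simp
qed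

lemma integral_iexp_int:
  "(CLINT x:{-pi..pi}|lborel. exp (\<i> * of_int k * of_real x)) = (if k = 0 then 2 * pi else 0)"
proof (cases "k = 0")
  case True
  then show ?thesis by (simp add: set_lebesgue_integral_def scaleR_conv_of_real)
next
  case False
  define F where "F = (\<lambda>x::real. exp (\<i> * of_int k * of_real x) / (\<i> * of_int k))"
  have "(CLINT x:{-pi..pi}|lborel. exp (\<i> * of_int k * of_real x)) = F pi - F (-pi)"
    unfolding set_lebesgue_integral_def
  proof (rule integral_FTC_Icc)
    fix x :: real
    show "(F has_vector_derivative exp (\<i> * of_int k * of_real x)) (at x within {-pi..pi})"
      unfolding F_def using False
      by (intro has_vector_derivative_real_field[where f="\<lambda>z. exp (\<i> * of_int k * z) / (\<i> * of_int k)"])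
        (auto intro!: derivative_eq_intros)
  qed (auto intro!: continuous_intros)
  also have "exp (\<i> * of_int k * of_real pi) = exp (\<i> * of_int k * of_real (- pi))"
  proof -
    have "exp (\<i> * of_int k * of_real pi) = exp (\<i> * of_int k * of_real (- pi) + 2 * of_int k * of_real pi * \<i>)"
      by (rule arg_cong[where f = exp]) (simp add: algebra_simps)
    also have "\<dots> = exp (\<i> * of_int k * of_real (- pi))"
      unfolding exp_add using exp_integer_2pi[of "of_int k"] by (simp add: mult_ac)
    finally show ?thesis .
  qed
  then have "F pi - F (-pi) = 0" by (simp add: F_def)
  finally show ?thesis using False by simp
qed

text \<open>The indicator of \<open>card s = m\<close> is an integral of exponentials over a period.
  Interchanging it with the finite sum leaves an unconditional Poisson expectation, which factorises
  for multiplicative \<open>F\<close>.\<close>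

lemma E_poisson_fourier:
  fixes F :: "nat set \<Rightarrow> complex"
  assumes "finite A"
  shows "E_poisson A q (\<lambda>s. if int (card s) = m then F s else 0) =
    (CLINT x:{-pi..pi}|lborel. exp (- (\<i> * of_int m * of_real x)) *
        E_poisson A q (\<lambda>s. F s * exp (\<i> * of_real x) ^ card s)) / (2 * pi)"
proof -
  have int: "set_integrable lborel {-pi..pi} (\<lambda>x. exp (\<i> * of_int k * of_real x))" for k
    by (intro borel_integrable_atLeastAtMost') (auto intro!: continuous_intros)
  have 1: "exp (- (\<i> * of_int m * of_real x)) * E_poisson A q (\<lambda>s. F s * exp (\<i> * of_real x) ^ card s)
     = (\<Sum>s\<in>Pow A. (poisson_weight A q s *\<^sub>R F s) * exp (\<i> * of_int (int (card s) - m) * of_real x))" for x :: real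
    unfolding E_poisson_def sum_distrib_left
  proof (intro sum.cong refl)
    fix s :: "nat set"
    have "exp (- (\<i> * of_int m * of_real x)) * exp (\<i> * of_real x) ^ card s = exp (\<i> * of_int (int (card s) - m) * of_real x)"
      unfolding exp_of_nat_mult[symmetric] exp_add[symmetric] by (simp add: algebra_simps)
    then show "exp (- (\<i> * of_int m * of_real x)) * poisson_weight A q s *\<^sub>R (F s * exp (\<i> * of_real x) ^ card s)
      = (poisson_weight A q s *\<^sub>R F s) * exp (\<i> * of_int (int (card s) - m) * of_real x)"
      by (simp only: mult_scaleR_right mult_scaleR_left mult.left_commute[of _ "F s"])
  qed
  have "(CLINT x:{-pi..pi}|lborel. exp (- (\<i> * of_int m * of_real x)) *
        E_poisson A q (\<lambda>s. F s * exp (\<i> * of_real x) ^ card s))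
     = (\<Sum>s\<in>Pow A. CLINT x:{-pi..pi}|lborel. (poisson_weight A q s *\<^sub>R F s) * exp (\<i> * of_int (int (card s) - m) * of_real x))"
    unfolding 1 set_lebesgue_integral_def scaleR_sum_right
    using set_integrable_mult_right[OF int] unfolding set_integrable_def
    by (intro Bochner_Integration.integral_sum)
  also have "\<dots> = (\<Sum>s\<in>Pow A. (poisson_weight A q s *\<^sub>R F s) * (if int (card s) = m then 2 * pi else 0))"
    by (intro sum.cong refl) (simp only: set_integral_mult_right integral_iexp_int right_minus_eq)
  also have "\<dots> = 2 * pi * E_poisson A q (\<lambda>s. if int (card s) = m then F s else 0)"
    unfolding E_poisson_def sum_distrib_left by (intro sum.cong refl) auto
  finally show ?thesis by simp
qed

text \<open>For \<open>norm z = 1\<close> the squared modulus is exactly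
  \<open>1 - 2 * q * (1 - q) * (1 - Re z)\<close>. Values inside the disc are allowed because
  \<open>z\<close> will also be the characteristic function of a random mark.\<close>

lemma norm_bernoulli_char_le:
  fixes z :: complex
  assumes "0 \<le> q" "q \<le> 1" "norm z \<le> 1"
  shows "norm (of_real (1 - q) + of_real q * z) \<le> exp (- (q * (1 - q) * (1 - Re z)))"
proof -
  have "(norm (of_real (1 - q) + of_real q * z))\<^sup>2 = (1 - q)\<^sup>2 + q\<^sup>2 * (norm z)\<^sup>2 + 2 * q * (1 - q) * Re z"
    unfolding cmod_power2 by simp algebra
  also have "\<dots> \<le> (1 - q)\<^sup>2 + q\<^sup>2 * 1 + 2 * q * (1 - q) * Re z"
    using assms by (intro add_mono mult_left_mono) (auto simp: power_le_one)
  also have "\<dots> = 1 + - (2 * (q * (1 - q) * (1 - Re z)))" by algebra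
  also have "\<dots> \<le> exp (- (2 * (q * (1 - q) * (1 - Re z))))" by (rule exp_ge_add_one_self)
  also have "\<dots> = (exp (- (q * (1 - q) * (1 - Re z))))\<^sup>2" by (simp add: power2_eq_square flip: exp_add)
  finally show ?thesis by (rule power2_le_imp_le) simp
qed

text \<open>This majorant comes from \<open>one_minus_cos_ge\<close>; up to a factor it is the
  centred normal density of variance \<open>6 / d\<close>.\<close>

lemma gauss_integrals:
  assumes "0 < d"
  shows "integrable lborel (\<lambda>x. exp (- (d * x\<^sup>2 / 12)))" 
    and "(LINT x|lborel. exp (- (d * x\<^sup>2 / 12))) = sqrt (12 * pi / d)"
    and "integrable lborel (\<lambda>x. \<bar>x\<bar> * exp (- (d * x\<^sup>2 / 12)))" 
    and "(LINT x|lborel. \<bar>x\<bar> * exp (- (d * x\<^sup>2 / 12))) = 12 / d"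
proof -
  define \<sigma> where "\<sigma> = sqrt (6 / d)"
  have \<sigma>: "0 < \<sigma>" "\<sigma>\<^sup>2 = 6 / d" using assms by (auto simp: \<sigma>_def)
  have e: "exp (- (d * x\<^sup>2 / 12)) = sqrt (2 * pi * \<sigma>\<^sup>2) * normal_density 0 \<sigma> x" for x
    using assms by (simp add: normal_density_def \<sigma>(2) field_simps)
  show "integrable lborel (\<lambda>x. exp (- (d * x\<^sup>2 / 12)))"
    unfolding e using \<sigma> by (intro integrable_mult_right integrable_normal_density)
  show "(LINT x|lborel. exp (- (d * x\<^sup>2 / 12))) = sqrt (12 * pi / d)"
    unfolding e using \<sigma> assms by (simp add: integral_normal_density)
  have i: "integrable lborel (\<lambda>x. normal_density 0 \<sigma> x * \<bar>x\<bar>)"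
    using integrable_normal_moment_abs[OF \<sigma>(1), of 0 1] by simp
  have e': "\<bar>x\<bar> * exp (- (d * x\<^sup>2 / 12)) = sqrt (2 * pi * \<sigma>\<^sup>2) * (normal_density 0 \<sigma> x * \<bar>x\<bar>)" for x
    unfolding e by simp
  show "integrable lborel (\<lambda>x. \<bar>x\<bar> * exp (- (d * x\<^sup>2 / 12)))"
    unfolding e' using i by (intro integrable_mult_right)
  have "(LINT x|lborel. \<bar>x\<bar> * exp (- (d * x\<^sup>2 / 12))) = sqrt (2 * pi * \<sigma>\<^sup>2) * (\<sigma> * sqrt (2 / pi))"
    unfolding e' using integral_normal_moment_abs_odd[OF \<sigma>(1), of 0 0] by simp
  also have "\<dots> = 2 * \<sigma>\<^sup>2" using \<sigma>(1) by (simp add: real_sqrt_mult real_sqrt_divide power2_eq_square)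
  finally show "(LINT x|lborel. \<bar>x\<bar> * exp (- (d * x\<^sup>2 / 12))) = 12 / d" by (simp add: \<sigma>)
qed

lemma norm_prod_bernoulli_iexp_le:
  assumes A: "finite A" "\<And>i. i \<in> A \<Longrightarrow> 0 \<le> q i \<and> q i \<le> 1" and x: "\<bar>x\<bar> \<le> pi"
  shows "norm (\<Prod>i\<in>A. of_real (1 - q i) + of_real (q i) * iexp x) \<le> exp (- (size_var A q * x\<^sup>2 / 12))"
proof -
  have "norm (\<Prod>i\<in>A. of_real (1 - q i) + of_real (q i) * iexp x)
     \<le> (\<Prod>i\<in>A. exp (- (q i * (1 - q i) * (x\<^sup>2 / 12))))"
    unfolding prod_norm[symmetric]
  proof (intro prod_mono conjI)
    fix i assume i: "i \<in> A"
    have "norm (of_real (1 - q i) + of_real (q i) * iexp x) \<le> exp (- (q i * (1 - q i) * (1 - Re (iexp x))))"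
      using A(2)[OF i] by (intro norm_bernoulli_char_le) auto
    also have "\<dots> \<le> exp (- (q i * (1 - q i) * (x\<^sup>2 / 12)))"
    proof -
      have "q i * (1 - q i) * (x\<^sup>2 / 12) \<le> q i * (1 - q i) * (1 - cos x)"
        using A(2)[OF i] one_minus_cos_ge[OF x] by (intro mult_left_mono) auto
      then show ?thesis by (simp add: Re_exp)
    qed
    finally show "norm (of_real (1 - q i) + of_real (q i) * iexp x) \<le> exp (- (q i * (1 - q i) * (x\<^sup>2 / 12)))" .
  qed auto
  also have "\<dots> = exp (- (size_var A q * x\<^sup>2 / 12))"
    using A(1) by (simp add: exp_sum[symmetric] size_var_def sum_distrib_right sum_negf sum_divide_distrib)
  finally show ?thesis .
qed

lemma size_prob_fourier:
  assumes "finite A"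
  shows "complex_of_real (size_prob A q m) = (CLINT x:{-pi..pi}|lborel. exp (- (\<i> * of_int m * of_real x)) *
        (\<Prod>i\<in>A. of_real (1 - q i) + of_real (q i) * iexp x)) / (2 * pi)"
proof -
  have "complex_of_real (size_prob A q m) = E_poisson A q (\<lambda>s. if int (card s) = m then 1 else 0)"
    unfolding size_prob_def E_poisson_def of_real_sum by (intro sum.cong refl) (simp add: scaleR_conv_of_real)
  also have "\<dots> = (CLINT x:{-pi..pi}|lborel. exp (- (\<i> * of_int m * of_real x)) *
        E_poisson A q (\<lambda>s. 1 * exp (\<i> * of_real x) ^ card s)) / (2 * pi)"
    by (rule E_poisson_fourier[OF assms])
  also have "(\<lambda>x::real. E_poisson A q (\<lambda>s. 1 * exp (\<i> * of_real x) ^ card s)) =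
     (\<lambda>x. \<Prod>i\<in>A. of_real (1 - q i) + of_real (q i) * iexp x)"
    using E_poisson_prod[OF assms, of q "\<lambda>_. iexp x" for x] by (simp add: fun_eq_iff)
  finally show ?thesis .
qed

lemma norm_set_integral_Icc_le:
  fixes f :: "real \<Rightarrow> complex"
  assumes "continuous_on {a..b} f" "integrable lborel g"
    and "\<And>x. a \<le> x \<Longrightarrow> x \<le> b \<Longrightarrow> norm (f x) \<le> g x" "\<And>x. 0 \<le> g x"
  shows "norm (CLINT x:{a..b}|lborel. f x) \<le> (LINT x|lborel. g x)"
proof -
  have "integrable lborel (\<lambda>x. indicat_real {a..b} x *\<^sub>R f x)"
    using borel_integrable_atLeastAtMost'[OF assms(1)] by (simp add: set_integrable_def)
  then show ?thesis
    unfolding set_lebesgue_integral_def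
    by (rule Bochner_Integration.integral_norm_bound_integral[OF _ assms(2)])
      (use assms(3,4) in \<open>auto simp: indicator_def\<close>)
qed

text \<open>The Gaussian majorant of the Fourier integrand has mass of order
  \<open>1 / sqrt d\<close>. In the difference, the factor \<open>1 - iexp x\<close>, of modulus at
  most \<open>\<bar>x\<bar>\<close>, gains another \<open>1 / sqrt d\<close>.\<close>

lemma size_prob_upper:
  assumes A: "finite A" "\<And>i. i \<in> A \<Longrightarrow> 0 \<le> q i \<and> q i \<le> 1" and d: "0 < size_var A q"
  shows "size_prob A q m \<le> 1 / sqrt (size_var A q)"
    and "\<bar>size_prob A q m - size_prob A q (m - 1)\<bar> \<le> 2 / size_var A q"
proof -
  let ?d = "size_var A q"
  let ?P = "\<lambda>x. \<Prod>i\<in>A. of_real (1 - q i) + of_real (q i) * iexp x"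
  have n1: "norm (exp (- (\<i> * of_int m * of_real x))) = 1" for m :: int and x :: real
    by (simp add: norm_exp_eq_Re)
  have nP: "(\<Prod>i\<in>A. norm (of_real (1 - q i) + of_real (q i) * iexp x)) \<le> exp (- (?d * x\<^sup>2 / 12))"
    if "- pi \<le> x" "x \<le> pi" for x
    using norm_prod_bernoulli_iexp_le[of A q x] A that by (auto simp: prod_norm abs_le_iff)
  have int: "set_integrable lborel {-pi..pi} (\<lambda>x. exp (- (\<i> * of_int m * of_real x)) * ?P x)" for m
    by (intro borel_integrable_atLeastAtMost') (auto intro!: continuous_intros)
  have "\<bar>size_prob A q m\<bar> = norm (complex_of_real (size_prob A q m))" by simp
  also have "\<dots> = norm (CLINT x:{-pi..pi}|lborel. exp (- (\<i> * of_int m * of_real x)) * ?P x) / (2 * pi)"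
    unfolding size_prob_fourier[OF A(1)] by (simp add: norm_divide)
  also have "\<dots> \<le> (LINT x|lborel. exp (- (?d * x\<^sup>2 / 12))) / (2 * pi)"
    by (intro divide_right_mono norm_set_integral_Icc_le gauss_integrals[OF d])
      (auto simp: norm_mult n1 prod_norm[symmetric] simp del: of_real_diff intro!: continuous_intros nP)
  also have "\<dots> = sqrt (3 / (pi * ?d))"
  proof -
    have "sqrt (12 * pi / ?d) = 2 * pi * sqrt (3 / (pi * ?d))"
    proof (rule real_sqrt_unique)
      have "(2 * pi * sqrt (3 / (pi * ?d)))\<^sup>2 = 4 * pi\<^sup>2 * (3 / (pi * ?d))"
        using d by (simp add: power_mult_distrib)
      then show "(2 * pi * sqrt (3 / (pi * ?d)))\<^sup>2 = 12 * pi / ?d"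
        using d by (simp add: power2_eq_square)
    qed (use d in auto)
    then show ?thesis using d by (simp add: gauss_integrals)
  qed
  also have "\<dots> \<le> sqrt (1 / ?d)"
    using d pi_gt3 by (intro real_sqrt_le_mono) (auto simp: field_simps)
  finally show "size_prob A q m \<le> 1 / sqrt ?d" by (simp add: real_sqrt_divide)
  have "\<bar>size_prob A q m - size_prob A q (m - 1)\<bar> = norm (complex_of_real (size_prob A q m) - complex_of_real (size_prob A q (m - 1)))"
    by (simp flip: of_real_diff)
  also have "\<dots> = norm ((CLINT x:{-pi..pi}|lborel. exp (- (\<i> * of_int m * of_real x)) * ?P x) -
    (CLINT x:{-pi..pi}|lborel. exp (- (\<i> * of_int (m - 1) * of_real x)) * ?P x)) / (2 * pi)"
    unfolding size_prob_fourier[OF A(1)] by (simp add: norm_divide flip: diff_divide_distrib)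
  also have "\<dots> = norm (CLINT x:{-pi..pi}|lborel. exp (- (\<i> * of_int m * of_real x)) * (1 - iexp x) * ?P x) / (2 * pi)"
  proof -
    have "exp (- (\<i> * of_int (m - 1) * of_real x)) = exp (- (\<i> * of_int m * of_real x)) * iexp x" for x :: real
      by (simp add: exp_add[symmetric] algebra_simps)
    then show ?thesis
      by (subst set_integral_diff(2)[OF int int, symmetric]) (simp add: algebra_simps)
  qed
  also have "\<dots> \<le> (LINT x|lborel. \<bar>x\<bar> * exp (- (?d * x\<^sup>2 / 12))) / (2 * pi)"
  proof -
    have "norm (1 - iexp x) \<le> \<bar>x\<bar>" for x using iexp_approx1[of x 0] by (simp add: norm_minus_commute)
    then show ?thesis
      by (intro divide_right_mono norm_set_integral_Icc_le gauss_integrals[OF d])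
        (auto simp: norm_mult n1 prod_norm[symmetric] simp del: of_real_diff intro!: continuous_intros mult_mono nP prod_nonneg)
  qed
  also have "\<dots> = 6 / (pi * ?d)" using d by (simp add: gauss_integrals)
  also have "\<dots> \<le> 2 / ?d" using d pi_gt3 by (simp add: field_simps)
  finally show "\<bar>size_prob A q m - size_prob A q (m - 1)\<bar> \<le> 2 / ?d" .
qed

subsection \<open>Rejective sampling\<close>

text \<open>The weight is arbitrary, so that the same calculus serves the rejective design and the
  actual first-stage design.\<close>

definition Ew :: "nat set \<Rightarrow> (nat set \<Rightarrow> real) \<Rightarrow> (nat set \<Rightarrow> 'b::real_vector) \<Rightarrow> 'b" where
  "Ew A w g = (\<Sum>s\<in>Pow A. w s *\<^sub>R g s)"

definition prob_weight :: "nat set \<Rightarrow> (nat set \<Rightarrow> real) \<Rightarrow> bool" where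
  "prob_weight A w \<longleftrightarrow> finite A \<and> (\<forall>s. s \<subseteq> A \<longrightarrow> 0 \<le> w s) \<and> (\<Sum>s\<in>Pow A. w s) = 1"

lemma Ew_cong: "(\<And>s. s \<subseteq> A \<Longrightarrow> w s \<noteq> 0 \<Longrightarrow> f s = g s) \<Longrightarrow> Ew A w f = Ew A w g"
  unfolding Ew_def by (rule sum.cong) auto

lemma Ew_add: "Ew A w (\<lambda>s. f s + g s) = Ew A w f + Ew A w g"
  by (simp add: Ew_def scaleR_add_right sum.distrib)

lemma Ew_diff: "Ew A w (\<lambda>s. f s - g s) = Ew A w f - Ew A w g"
  by (simp add: Ew_def scaleR_diff_right sum_subtractf)

lemma Ew_cmult: "Ew A w (\<lambda>s. c * g s) = c * Ew A w g" for c :: "'b::real_algebra"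
  by (simp add: Ew_def sum_distrib_left mult_scaleR_right)

lemma Ew_multc: "Ew A w (\<lambda>s. g s * c) = Ew A w g * c" for c :: "'b::real_algebra"
  by (simp add: Ew_def sum_distrib_right)

lemma Ew_sum: "Ew A w (\<lambda>s. \<Sum>i\<in>I. g i s) = (\<Sum>i\<in>I. Ew A w (g i))"
  unfolding Ew_def scaleR_sum_right by (rule sum.swap)

lemma Ew_const: "prob_weight A w \<Longrightarrow> Ew A w (\<lambda>s. c) = c"
  by (simp add: Ew_def prob_weight_def flip: scaleR_sum_left)

lemma Ew_mono:
  fixes f g :: "nat set \<Rightarrow> real"
  assumes "prob_weight A w" "\<And>s. s \<subseteq> A \<Longrightarrow> w s \<noteq> 0 \<Longrightarrow> f s \<le> g s"
  shows "Ew A w f \<le> Ew A w g"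
  unfolding Ew_def
proof (rule sum_mono)
  fix s assume "s \<in> Pow A"
  then show "w s *\<^sub>R f s \<le> w s *\<^sub>R g s"
    using assms by (cases "w s = 0") (auto simp: prob_weight_def intro!: mult_left_mono)
qed

lemma Ew_nonneg:
  fixes g :: "nat set \<Rightarrow> real"
  assumes "prob_weight A w" "\<And>s. s \<subseteq> A \<Longrightarrow> w s \<noteq> 0 \<Longrightarrow> 0 \<le> g s"
  shows "0 \<le> Ew A w g"
  using Ew_mono[of A w "\<lambda>_. 0" g] assms by (simp add: Ew_const)

lemma Ew_member_sum:
  fixes f :: "nat \<Rightarrow> real"
  assumes "finite A"
  shows "Ew A w (\<lambda>s. \<Sum>i\<in>s. f i) = (\<Sum>i\<in>A. Ew A w (\<lambda>s. of_bool (i \<in> s)) * f i)"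
proof -
  have "Ew A w (\<lambda>s. \<Sum>i\<in>s. f i) = Ew A w (\<lambda>s. \<Sum>i\<in>A. of_bool (i \<in> s) * f i)"
  proof (rule Ew_cong)
    fix s assume "s \<subseteq> A"
    then show "(\<Sum>i\<in>s. f i) = (\<Sum>i\<in>A. of_bool (i \<in> s) * f i)"
      using assms by (intro sum.mono_neutral_cong_left) auto
  qed
  then show ?thesis by (simp add: Ew_sum Ew_multc)
qed

lemma Ew_power2_le:
  fixes g :: "nat set \<Rightarrow> real"
  assumes "prob_weight A w"
  shows "(Ew A w g)\<^sup>2 \<le> Ew A w (\<lambda>s. (g s)\<^sup>2)"
proof -
  let ?m = "Ew A w g"
  have "0 \<le> Ew A w (\<lambda>s. (g s - ?m)\<^sup>2)" by (rule Ew_nonneg[OF assms]) simp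
  also have "(\<lambda>s. (g s - ?m)\<^sup>2) = (\<lambda>s. (g s)\<^sup>2 - (2 * ?m) * g s + ?m\<^sup>2)"
    by (simp add: fun_eq_iff power2_diff)
  also have "Ew A w \<dots> = Ew A w (\<lambda>s. (g s)\<^sup>2) - ?m\<^sup>2"
    unfolding Ew_add Ew_diff Ew_cmult Ew_const[OF assms] by (simp add: power2_eq_square)
  finally show ?thesis by simp
qed

definition rej_weight :: "nat set \<Rightarrow> (nat \<Rightarrow> real) \<Rightarrow> nat \<Rightarrow> nat set \<Rightarrow> real" where
  "rej_weight A q n s = (if card s = n then poisson_weight A q s / size_prob A q (int n) else 0)"

lemma Ew_rej_weight: "Ew A (rej_weight A q n) g = (1 / size_prob A q (int n)) *\<^sub>R E_poisson A q (\<lambda>s. if int (card s) = int n then g s else 0)"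
  unfolding Ew_def rej_weight_def E_poisson_def scaleR_sum_right by (rule sum.cong) auto

definition rej_incl :: "nat set \<Rightarrow> (nat \<Rightarrow> real) \<Rightarrow> nat \<Rightarrow> nat \<Rightarrow> real" where
  "rej_incl A q n i = Ew A (rej_weight A q n) (\<lambda>s. of_bool (i \<in> s))"

lemma size_prob_le_1:
  assumes "finite A" "\<And>i. i \<in> A \<Longrightarrow> 0 \<le> q i \<and> q i \<le> 1"
  shows "size_prob A q m \<le> 1"
proof -
  have "size_prob A q m \<le> E_poisson A q (\<lambda>_. 1)" unfolding size_prob_def by (rule E_poisson_mono[OF assms(2)]) auto
  then show ?thesis by (simp add: E_poisson_const assms)
qed

text \<open>
  Poisson parameters \<open>q\<close> normalised so that the expected size of the Poisson sample is the size \<open>n\<close>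
  of the rejective sample.
\<close>

locale rejective_normalised =
  fixes A :: "nat set" and q :: "nat \<Rightarrow> real" and n :: nat
  assumes fin: "finite A"
    and q01: "\<And>i. i \<in> A \<Longrightarrow> 0 \<le> q i \<and> q i \<le> 1"
    and sumq: "(\<Sum>i\<in>A. q i) = real n"
begin

abbreviation "d \<equiv> size_var A q"
abbreviation "b \<equiv> size_prob A q (int n)"
abbreviation "E \<equiv> Ew A (rej_weight A q n)"
abbreviation "\<pi> \<equiv> rej_incl A q n"

lemma d_nonneg: "0 \<le> d" using q01 by (rule size_var_nonneg)

lemma b_lower: "1 / (8 * sqrt (1 + d)) \<le> b"
  by (rule size_prob_mean_lower[OF fin q01]) (use sumq in auto)

lemma b_pos: "0 < b"
proof -
  have "0 < 1 / (8 * sqrt (1 + d))" using d_nonneg by simp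
  then show ?thesis using b_lower by linarith
qed

lemma inv_b_le: "1 / b \<le> 8 * sqrt (1 + d)"
proof -
  have "0 < sqrt (1 + d)" using d_nonneg by simp
  then show ?thesis using b_lower b_pos by (simp add: field_simps)
qed

lemma prob_weight_rej_weight: "prob_weight A (rej_weight A q n)"
proof -
  have "(\<Sum>s\<in>Pow A. rej_weight A q n s) = Ew A (rej_weight A q n) (\<lambda>_. 1)" by (simp add: Ew_def)
  also have "\<dots> = 1" unfolding Ew_rej_weight size_prob_def[symmetric] using b_pos by simp
  finally show ?thesis
    using fin b_pos poisson_weight_nonneg[of A q] q01 by (auto simp: prob_weight_def rej_weight_def)
qed

text \<open>Samples of size \<open>n\<close> with and without \<open>i\<close> correspond to samples
  of size \<open>n - 1\<close> and \<open>n\<close> from the other units. The two forms give bounds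
  by \<open>q i\<close> and by \<open>1 - q i\<close>.\<close>

lemma pi_eq:
  assumes "i \<in> A"
  shows "\<pi> i = q i * size_prob (A - {i}) q (int n - 1) / b"
    and "1 - \<pi> i = (1 - q i) * size_prob (A - {i}) q (int n) / b"
proof -
  have "E_poisson A q (\<lambda>s. if int (card s) = int n then of_bool (i \<in> s) else 0 :: real)
    = E_poisson A q (\<lambda>s. if i \<in> s then if int (card s) = int n then 1 else 0 else 0)"
    by (rule E_poisson_cong) auto
  also have "\<dots> = q i * E_poisson (A - {i}) q (\<lambda>s. if int (card (insert i s)) = int n then 1 else 0)"
    using E_poisson_split_member(1)[OF fin assms, of q "\<lambda>s. if int (card s) = int n then 1 else 0 :: real"] by simp
  also have "E_poisson (A - {i}) q (\<lambda>s. if int (card (insert i s)) = int n then 1 else 0) = size_prob (A - {i}) q (int n - 1)"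
    unfolding size_prob_def
  proof (rule E_poisson_cong)
    fix s assume "s \<subseteq> A - {i}"
    then have "i \<notin> s" "finite s" using fin by (auto intro: finite_subset)
    then show "(if int (card (insert i s)) = int n then 1 else 0 :: real) = (if int (card s) = int n - 1 then 1 else 0)"
      by auto
  qed
  finally show 1: "\<pi> i = q i * size_prob (A - {i}) q (int n - 1) / b" by (simp add: rej_incl_def Ew_rej_weight)
  show "1 - \<pi> i = (1 - q i) * size_prob (A - {i}) q (int n) / b"
    using b_pos size_prob_remove[OF fin assms, of q "int n"] unfolding 1 by (simp add: field_simps)
qed

lemma pi_le:
  assumes "i \<in> A"
  shows "0 \<le> \<pi> i" "\<pi> i \<le> 1" "\<pi> i \<le> q i / b" "1 - \<pi> i \<le> (1 - q i) / b"
proof -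
  have q: "0 \<le> q i" "q i \<le> 1" using q01[OF assms] by auto
  have p: "0 \<le> size_prob (A - {i}) q m" "size_prob (A - {i}) q m \<le> 1" for m
    using q01 fin by (auto intro!: size_prob_nonneg size_prob_le_1)
  show "0 \<le> \<pi> i" unfolding pi_eq[OF assms] using q p b_pos by simp
  have "0 \<le> 1 - \<pi> i" unfolding pi_eq(2)[OF assms] using q p b_pos by simp
  then show "\<pi> i \<le> 1" by simp
  show "\<pi> i \<le> q i / b"
    unfolding pi_eq(1)[OF assms] using q p b_pos by (intro divide_right_mono mult_left_le; simp)
  show "1 - \<pi> i \<le> (1 - q i) / b"
    unfolding pi_eq(2)[OF assms] using q p b_pos by (intro divide_right_mono mult_left_le; simp)
qed

text \<open>The assumptions control inclusion probabilities, not \<open>q\<close>, so a lower bound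
  for \<open>d\<close> has to be recovered from them. If \<open>d < 1\<close> then
  \<open>1 / b \<le> 12\<close>, and \<open>144 = 12\<^sup>2\<close> bounds the ratio of the two
  sums of variances.\<close>

lemma d_ge_1_if_pi_variance:
  assumes "144 \<le> (\<Sum>i\<in>A. \<pi> i * (1 - \<pi> i))"
  shows "1 \<le> d"
proof (rule ccontr)
  assume "\<not> 1 \<le> d"
  then have "sqrt (1 + d) \<le> 3/2" by (intro real_le_lsqrt) (auto simp: power2_eq_square d_nonneg)
  then have ib: "1 / b \<le> 12" using inv_b_le by linarith
  have ib0: "0 \<le> 1 / b" using b_pos by simp
  have "(\<Sum>i\<in>A. \<pi> i * (1 - \<pi> i)) \<le> (\<Sum>i\<in>A. (q i * 12) * ((1 - q i) * 12))"
  proof (rule sum_mono)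
    fix i assume i: "i \<in> A"
    have q: "0 \<le> q i" "q i \<le> 1" using q01[OF i] by auto
    have "q i * (1 / b) \<le> q i * 12" "(1 - q i) * (1 / b) \<le> (1 - q i) * 12"
      using ib q by (intro mult_left_mono; simp)+
    then have "\<pi> i \<le> q i * 12" "1 - \<pi> i \<le> (1 - q i) * 12"
      using pi_le[OF i] by auto
    then show "\<pi> i * (1 - \<pi> i) \<le> (q i * 12) * ((1 - q i) * 12)"
      using pi_le[OF i] q by (intro mult_mono) auto
  qed
  also have "\<dots> = 144 * d" by (simp add: size_var_def sum_distrib_left mult_ac)
  finally show False using assms \<open>\<not> 1 \<le> d\<close> by simp
qed

end

locale rejective = rejective_normalised +
  assumes d1: "1 \<le> size_var A q"
begin

lemma inv_b_le': "1 / b \<le> 12 * sqrt d"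
proof -
  have "sqrt (1 + d) \<le> 3/2 * sqrt d"
    by (rule real_le_lsqrt) (use d1 in \<open>auto simp: power_mult_distrib power2_eq_square\<close>)
  then show ?thesis using inv_b_le by linarith
qed

text \<open>\<open>\<pi> i - q i\<close> is \<open>q i * (1 - q i)\<close> times a difference of
  neighbouring size probabilities of the other units, of order \<open>1 / d\<close>, divided by
  \<open>b\<close>, which is at least of order \<open>1 / sqrt d\<close>.\<close>

lemma pi_minus_q:
  assumes "i \<in> A"
  shows "\<bar>\<pi> i - q i\<bar> \<le> 32 / sqrt d * (q i * (1 - q i))"
proof -
  have q: "0 \<le> q i" "q i \<le> 1" using q01[OF assms] by auto
  have dr: "size_var (A - {i}) q = d - q i * (1 - q i)"
    unfolding size_var_def using fin assms by (simp add: sum_diff1)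
  have "q i * (1 - q i) = 1/4 - (q i - 1/2)\<^sup>2" by algebra
  \<comment> \<open>A unit contributes at most 1/4 to \<open>d\<close>, hence at most
    \<open>d / 4\<close> since \<open>1 \<le> d\<close>. The constant 32 is then
    \<open>8 / 3 * 12\<close>.\<close>
  then have d': "3/4 * d \<le> size_var (A - {i}) q" using dr d1 zero_le_power2[of "q i - 1/2"] by linarith
  have d0: "0 < size_var (A - {i}) q" using d' d1 by linarith
  have "\<bar>size_prob (A - {i}) q (int n) - size_prob (A - {i}) q (int n - 1)\<bar> \<le> 2 / size_var (A - {i}) q"
    by (rule size_prob_upper(2)) (use fin q01 d0 in auto)
  also have "\<dots> \<le> 2 / (3/4 * d)" using d' d1 by (intro divide_left_mono mult_pos_pos) auto
  finally have *: "\<bar>size_prob (A - {i}) q (int n) - size_prob (A - {i}) q (int n - 1)\<bar> \<le> 8 / (3 * d)" by simp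
  have "\<pi> i - q i = q i * (1 - q i) * (size_prob (A - {i}) q (int n - 1) - size_prob (A - {i}) q (int n)) * (1 / b)"
  proof -
    have "q i * size_prob (A - {i}) q (int n - 1) - q i * b = 
      q i * (1 - q i) * (size_prob (A - {i}) q (int n - 1) - size_prob (A - {i}) q (int n))"
      unfolding size_prob_remove[OF fin assms, of q "int n"] by (simp add: algebra_simps)
    moreover have "\<pi> i - q i = (q i * size_prob (A - {i}) q (int n - 1) - q i * b) / b"
      unfolding pi_eq(1)[OF assms] using b_pos by (simp add: field_simps)
    ultimately show ?thesis by simp
  qed
  then have "\<bar>\<pi> i - q i\<bar> = q i * (1 - q i) * \<bar>size_prob (A - {i}) q (int n) - size_prob (A - {i}) q (int n - 1)\<bar> * (1 / b)"
    using q b_pos by (simp add: abs_mult abs_minus_commute)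
  also have "\<dots> \<le> q i * (1 - q i) * (8 / (3 * d)) * (12 * sqrt d)"
    using q * inv_b_le' b_pos d1 by (intro mult_mono) auto
  also have "\<dots> = 32 / sqrt d * (q i * (1 - q i))"
  proof -
    define r where "r = sqrt d"
    have r: "d = r\<^sup>2" "0 < r" using d1 by (auto simp: r_def)
    have "8 / (3 * d) * (12 * r) = 32 / r" unfolding r(1) using r(2) by (simp add: power2_eq_square)
    then show ?thesis unfolding r_def by (metis mult.assoc mult.commute)
  qed
  finally show ?thesis .
qed

lemma pi_le_q:
  assumes "i \<in> A"
  shows "\<pi> i \<le> 33 * q i" "1 - \<pi> i \<le> 33 * (1 - q i)"
proof -
  have q: "0 \<le> q i" "q i \<le> 1" using q01[OF assms] by auto
  have "32 / sqrt d * (q i * (1 - q i)) \<le> 32 * (q i * (1 - q i))"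
    using d1 q by (intro mult_right_mono; simp add: divide_le_eq)
  then have "\<bar>\<pi> i - q i\<bar> \<le> 32 * (q i * (1 - q i))" using pi_minus_q[OF assms] by linarith
  moreover have "q i * (1 - q i) \<le> q i" "q i * (1 - q i) \<le> 1 - q i"
    using mult_left_le[of "1 - q i" "q i"] mult_left_le_one_le[of "1 - q i" "q i"] q by auto
  ultimately show "\<pi> i \<le> 33 * q i" "1 - \<pi> i \<le> 33 * (1 - q i)" by (auto simp: abs_le_iff)
qed

text \<open>Turns a lower bound on the variances of the inclusion indicators into one on
  \<open>d\<close>; \<open>1089 = 33\<^sup>2\<close>.\<close>

lemma pi_variance_le: "(\<Sum>i\<in>A. \<pi> i * (1 - \<pi> i)) \<le> 1089 * d"
proof -
  have "(\<Sum>i\<in>A. \<pi> i * (1 - \<pi> i)) \<le> (\<Sum>i\<in>A. (33 * q i) * (33 * (1 - q i)))"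
    using pi_le pi_le_q q01 by (intro sum_mono mult_mono) auto
  also have "\<dots> = 1089 * d" unfolding size_var_def sum_distrib_left by (intro sum.cong) auto
  finally show ?thesis .
qed

text \<open>
  The loss of a factor \<open>sqrt d\<close> in conditioning on the sample size is avoided for statistics that
  depend on one half of the population only, since the size constraint can then be
  met by the other half.
\<close>

lemma E_le_E_poisson:
  fixes g :: "nat set \<Rightarrow> real"
  assumes AB: "A = A1 \<union> A2" "A1 \<inter> A2 = {}" "d / 4 \<le> size_var A2 q"
    and g: "\<And>s. s \<subseteq> A1 \<Longrightarrow> 0 \<le> g s"
  shows "E (\<lambda>s. g (s \<inter> A1)) \<le> 24 * E_poisson A1 q g"
proof -
  have f12: "finite A1" "finite A2" using AB fin by auto
  have q12: "\<And>i. i \<in> A1 \<Longrightarrow> 0 \<le> q i \<and> q i \<le> 1" "\<And>i. i \<in> A2 \<Longrightarrow> 0 \<le> q i \<and> q i \<le> 1" using AB q01 by auto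
  have d2: "0 < size_var A2 q" using AB d1 by linarith
  have up: "size_prob A2 q m \<le> 2 / sqrt d" for m
  proof -
    have "size_prob A2 q m \<le> 1 / sqrt (size_var A2 q)" by (rule size_prob_upper(1)) (use f12 q12 d2 in auto)
    also have "\<dots> \<le> 1 / sqrt (d / 4)" using AB d1 d2 by (intro divide_left_mono real_sqrt_le_mono) auto
    also have "\<dots> = 2 / sqrt d" by (simp add: real_sqrt_divide)
    finally show ?thesis .
  qed
  have "E_poisson A q (\<lambda>s. if int (card s) = int n then g (s \<inter> A1) else 0) =
    E_poisson A1 q (\<lambda>s. E_poisson A2 q (\<lambda>t. if int (card (s \<union> t)) = int n then g ((s \<union> t) \<inter> A1) else 0))"
    unfolding AB(1) by (rule E_poisson_union) (use f12 AB in auto)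
  also have "\<dots> = E_poisson A1 q (\<lambda>s. g s * size_prob A2 q (int n - int (card s)))"
  proof (rule E_poisson_cong)
    fix s assume s: "s \<subseteq> A1"
    have "E_poisson A2 q (\<lambda>t. if int (card (s \<union> t)) = int n then g ((s \<union> t) \<inter> A1) else 0)
      = E_poisson A2 q (\<lambda>t. g s * (if int (card t) = int n - int (card s) then 1 else 0))"
    proof (rule E_poisson_cong)
      fix t assume t: "t \<subseteq> A2"
      have "card (s \<union> t) = card s + card t"
        using s t AB f12 by (intro card_Un_disjoint) (auto intro: finite_subset)
      moreover have "(s \<union> t) \<inter> A1 = s" using s t AB by auto
      ultimately show "(if int (card (s \<union> t)) = int n then g ((s \<union> t) \<inter> A1) else 0)
        = g s * (if int (card t) = int n - int (card s) then 1 else 0)" by auto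
    qed
    then show "E_poisson A2 q (\<lambda>t. if int (card (s \<union> t)) = int n then g ((s \<union> t) \<inter> A1) else 0)
      = g s * size_prob A2 q (int n - int (card s))" by (simp add: E_poisson_cmult size_prob_def)
  qed
  also have "\<dots> \<le> E_poisson A1 q (\<lambda>s. g s * (2 / sqrt d))"
    using g up by (intro E_poisson_mono q12 mult_left_mono) auto
  finally have 1: "E_poisson A q (\<lambda>s. if int (card s) = int n then g (s \<inter> A1) else 0) \<le> E_poisson A1 q g * (2 / sqrt d)"
    by (simp only: E_poisson_multc)
  have g0: "0 \<le> E_poisson A1 q g * (2 / sqrt d)" using E_poisson_nonneg[of A1 q g] q12 g d1 by simp
  have "E (\<lambda>s. g (s \<inter> A1)) = 1 / b * E_poisson A q (\<lambda>s. if int (card s) = int n then g (s \<inter> A1) else 0)"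
    by (simp add: Ew_rej_weight)
  also have "\<dots> \<le> 12 * sqrt d * (E_poisson A1 q g * (2 / sqrt d))"
    by (rule mult_mono'[OF inv_b_le' 1]) 
      (use b_pos g q12 AB q01 in \<open>auto intro!: E_poisson_nonneg\<close>)
  also have "\<dots> = 24 * E_poisson A1 q g" using d1 by simp
  finally show ?thesis .
qed

text \<open>Units are added one by one; each contributes at most 1/4, so some subset has variance
  between \<open>d / 2 - 1/4\<close> and \<open>d / 2\<close>, and \<open>1 \<le> d\<close> leaves
  \<open>d / 4\<close> on both sides.\<close>

lemma halves:
  obtains A1 A2 where "A = A1 \<union> A2" "A1 \<inter> A2 = {}" "d / 4 \<le> size_var A1 q" "d / 4 \<le> size_var A2 q"
proof -
  have split: "\<exists>B\<subseteq>A'. x - 1/4 \<le> size_var B q \<and> size_var B q \<le> x"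
    if "finite A'" "A' \<subseteq> A" "0 \<le> x" "x \<le> size_var A' q" for A' x
    using that
  proof (induction A' rule: finite_induct)
    case empty
    then show ?case by (auto simp: size_var_def)
  next
    case (insert i A')
    have "q i * (1 - q i) = 1/4 - (q i - 1/2)\<^sup>2" by algebra
    then have q4: "q i * (1 - q i) \<le> 1/4" by simp
    have di: "size_var (insert i A') q = q i * (1 - q i) + size_var A' q" using insert by (simp add: size_var_def)
    show ?case
    proof (cases "x \<le> size_var A' q")
      case True
      then show ?thesis using insert by auto
    next
      case False
      then show ?thesis using insert q4 di by (intro exI[of _ A']) auto
    qed
  qed
  obtain B where B: "B \<subseteq> A" "d / 2 - 1/4 \<le> size_var B q" "size_var B q \<le> d / 2"
    using split[of A "d / 2"] fin d_nonneg by auto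
  have "size_var (A - B) q = d - size_var B q" unfolding size_var_def using B fin by (simp add: sum_diff)
  then show ?thesis using B d1 by (intro that[of B "A - B"]) auto
qed

text \<open>The statistic is the sum of its parts on two halves, and \<open>E_le_E_poisson\<close>
  applies to each part with the other half absorbing the size constraint. The constants are
  \<open>2 * 24\<close> and \<open>8 * 24\<close>.\<close>

lemma E_linear_moments:
  fixes a :: "nat \<Rightarrow> real"
  shows "E (\<lambda>s. ((\<Sum>i\<in>s. a i) - (\<Sum>i\<in>A. q i * a i))\<^sup>2) \<le> 48 * (\<Sum>i\<in>A. q i * (1 - q i) * (a i)\<^sup>2)"
    and "E (\<lambda>s. ((\<Sum>i\<in>s. a i) - (\<Sum>i\<in>A. q i * a i)) ^ 4) \<le>
       192 * ((\<Sum>i\<in>A. q i * (1 - q i) * a i ^ 4) + 3 * (\<Sum>i\<in>A. q i * (1 - q i) * (a i)\<^sup>2)\<^sup>2)"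
proof -
  obtain A1 A2 where AB: "A = A1 \<union> A2" "A1 \<inter> A2 = {}" "d / 4 \<le> size_var A1 q" "d / 4 \<le> size_var A2 q"
    by (rule halves)
  have AB': "A = A2 \<union> A1" "A2 \<inter> A1 = {}" using AB by auto
  have f12: "finite A1" "finite A2" using AB fin by auto
  have q12: "\<And>i. i \<in> A1 \<Longrightarrow> 0 \<le> q i \<and> q i \<le> 1" "\<And>i. i \<in> A2 \<Longrightarrow> 0 \<le> q i \<and> q i \<le> 1" using AB q01 by auto
  define Y where "Y B s = (\<Sum>i\<in>s. a i) - (\<Sum>i\<in>B. q i * a i)" for B s
  have Y: "Y A s = Y A1 (s \<inter> A1) + Y A2 (s \<inter> A2)" if "s \<subseteq> A" for s
  proof -
    have "s = (s \<inter> A1) \<union> (s \<inter> A2)" using that AB by auto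
    then have "(\<Sum>i\<in>s. a i) = (\<Sum>i\<in>(s \<inter> A1) \<union> (s \<inter> A2). a i)" by simp
    also have "\<dots> = (\<Sum>i\<in>s \<inter> A1. a i) + (\<Sum>i\<in>s \<inter> A2. a i)"
      using AB f12 by (intro sum.union_disjoint) auto
    finally show ?thesis using AB f12 by (simp add: Y_def sum.union_disjoint)
  qed
  have sp: "(\<Sum>i\<in>A. f i) = (\<Sum>i\<in>A1. f i) + (\<Sum>i\<in>A2. f i)" for f :: "nat \<Rightarrow> real"
    unfolding AB(1) using f12 AB by (intro sum.union_disjoint)
  have "E (\<lambda>s. (Y A s)\<^sup>2) \<le> E (\<lambda>s. 2 * (Y A1 (s \<inter> A1))\<^sup>2 + 2 * (Y A2 (s \<inter> A2))\<^sup>2)"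
  proof (rule Ew_mono[OF prob_weight_rej_weight])
    fix s assume s: "s \<subseteq> A"
    have "(x + y)\<^sup>2 \<le> 2 * x\<^sup>2 + 2 * y\<^sup>2" for x y :: real
      using zero_le_power2[of "x - y"] by (simp add: power2_sum power2_diff)
    then show "(Y A s)\<^sup>2 \<le> 2 * (Y A1 (s \<inter> A1))\<^sup>2 + 2 * (Y A2 (s \<inter> A2))\<^sup>2" unfolding Y[OF s] .
  qed
  also have "\<dots> \<le> 2 * (24 * E_poisson A1 q (\<lambda>s. (Y A1 s)\<^sup>2)) + 2 * (24 * E_poisson A2 q (\<lambda>s. (Y A2 s)\<^sup>2))"
    unfolding Ew_add Ew_cmult
    by (intro add_mono mult_left_mono E_le_E_poisson[OF AB(1,2,4)] E_le_E_poisson[OF AB' AB(3)]) auto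
  also have "\<dots> = 48 * (\<Sum>i\<in>A. q i * (1 - q i) * (a i)\<^sup>2)"
    unfolding Y_def E_poisson_linear(2)[OF f12(1)] E_poisson_linear(2)[OF f12(2)] sp by simp
  finally show "E (\<lambda>s. ((\<Sum>i\<in>s. a i) - (\<Sum>i\<in>A. q i * a i))\<^sup>2) \<le> 48 * (\<Sum>i\<in>A. q i * (1 - q i) * (a i)\<^sup>2)"
    by (simp add: Y_def)
  have "E (\<lambda>s. (Y A s)^4) \<le> E (\<lambda>s. 8 * (Y A1 (s \<inter> A1))^4 + 8 * (Y A2 (s \<inter> A2))^4)"
  proof (rule Ew_mono[OF prob_weight_rej_weight])
    fix s assume s: "s \<subseteq> A"
    have "(x + y)^4 \<le> 8 * x^4 + 8 * y^4" for x y :: real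
    proof -
      have sq: "(x + y)\<^sup>2 \<le> 2 * x\<^sup>2 + 2 * y\<^sup>2" for x y :: real
        using zero_le_power2[of "x - y"] by (simp add: power2_sum power2_diff)
      have "(x + y)^4 = ((x + y)\<^sup>2)\<^sup>2" by simp
      also have "\<dots> \<le> (2 * x\<^sup>2 + 2 * y\<^sup>2)\<^sup>2" by (rule power_mono[OF sq]) simp
      also have "\<dots> \<le> 2 * (2 * x\<^sup>2)\<^sup>2 + 2 * (2 * y\<^sup>2)\<^sup>2" by (rule sq)
      also have "\<dots> = 8 * x^4 + 8 * y^4" by (simp add: power_mult_distrib)
      finally show ?thesis .
    qed
    then show "(Y A s)^4 \<le> 8 * (Y A1 (s \<inter> A1))^4 + 8 * (Y A2 (s \<inter> A2))^4" unfolding Y[OF s] .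
  qed
  also have "\<dots> \<le> 8 * (24 * E_poisson A1 q (\<lambda>s. (Y A1 s)^4)) + 8 * (24 * E_poisson A2 q (\<lambda>s. (Y A2 s)^4))"
    unfolding Ew_add Ew_cmult
    by (intro add_mono mult_left_mono E_le_E_poisson[OF AB(1,2,4)] E_le_E_poisson[OF AB' AB(3)]) auto
  also have "\<dots> \<le> 8 * (24 * ((\<Sum>i\<in>A1. q i * (1 - q i) * a i ^ 4) + 3 * (\<Sum>i\<in>A1. q i * (1 - q i) * (a i)\<^sup>2)\<^sup>2))
      + 8 * (24 * ((\<Sum>i\<in>A2. q i * (1 - q i) * a i ^ 4) + 3 * (\<Sum>i\<in>A2. q i * (1 - q i) * (a i)\<^sup>2)\<^sup>2))"
    unfolding Y_def by (intro add_mono mult_left_mono E_poisson_linear(3) f12 q12) auto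
  also have "\<dots> \<le> 192 * ((\<Sum>i\<in>A. q i * (1 - q i) * a i ^ 4) + 3 * (\<Sum>i\<in>A. q i * (1 - q i) * (a i)\<^sup>2)\<^sup>2)"
  proof -
    have "0 \<le> (\<Sum>i\<in>A1. q i * (1 - q i) * (a i)\<^sup>2)" "0 \<le> (\<Sum>i\<in>A2. q i * (1 - q i) * (a i)\<^sup>2)"
      using q12 by (auto intro!: sum_nonneg)
    then have "0 \<le> (\<Sum>i\<in>A1. q i * (1 - q i) * (a i)\<^sup>2) * (\<Sum>i\<in>A2. q i * (1 - q i) * (a i)\<^sup>2)" by simp
    then show ?thesis unfolding sp by (simp add: power2_sum)
  qed
  finally show "E (\<lambda>s. ((\<Sum>i\<in>s. a i) - (\<Sum>i\<in>A. q i * a i)) ^ 4) \<le>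
       192 * ((\<Sum>i\<in>A. q i * (1 - q i) * a i ^ 4) + 3 * (\<Sum>i\<in>A. q i * (1 - q i) * (a i)\<^sup>2)\<^sup>2)"
    by (simp add: Y_def)
qed

end

subsection \<open>Central limit theorem for rejective sampling with random marks\<close>

lemma power2_add_le: "(x + y)\<^sup>2 \<le> 2 * x\<^sup>2 + 2 * y\<^sup>2" for x y :: real
  using zero_le_power2[of "x - y"] by (simp add: power2_sum power2_diff)

lemma power4_add_le: "(x + y)^4 \<le> 8 * x^4 + 8 * y^4" for x y :: real
proof -
  have "(x + y)^4 = ((x + y)\<^sup>2)\<^sup>2" by simp
  also have "\<dots> \<le> (2 * x\<^sup>2 + 2 * y\<^sup>2)\<^sup>2" by (rule power_mono[OF power2_add_le]) simp
  also have "\<dots> \<le> 2 * (2 * x\<^sup>2)\<^sup>2 + 2 * (2 * y\<^sup>2)\<^sup>2" by (rule power2_add_le)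
  also have "\<dots> = 8 * x^4 + 8 * y^4" by (simp add: power_mult_distrib)
  finally show ?thesis .
qed

section \<open>Taylor estimates for characteristic functions under fourth moments\<close>

lemma (in prob_space) integrable_power_le4:
  fixes Y :: "'a \<Rightarrow> real"
  assumes [measurable]: "Y \<in> borel_measurable M" and Y: "integrable M (\<lambda>x. Y x ^ 4)" and k: "k \<le> 4"
  shows "integrable M (\<lambda>x. Y x ^ k)"
proof (rule Bochner_Integration.integrable_bound[where f = "\<lambda>x. 1 + Y x ^ 4"])
  show "AE x in M. norm (Y x ^ k) \<le> norm (1 + Y x ^ 4)"
  proof (rule AE_I2)
    fix x
    have "\<bar>Y x\<bar> ^ k \<le> 1 + \<bar>Y x\<bar> ^ 4"
    proof (cases "\<bar>Y x\<bar> \<le> 1")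
      case True
      then have "\<bar>Y x\<bar> ^ k \<le> 1" by (simp add: power_le_one)
      then show ?thesis by (simp add: add_increasing2)
    next
      case False
      then have "\<bar>Y x\<bar> ^ k \<le> \<bar>Y x\<bar> ^ 4" using k by (intro power_increasing) auto
      then show ?thesis by simp
    qed
    then show "norm (Y x ^ k) \<le> norm (1 + Y x ^ 4)" by (simp add: power_abs)
  qed
qed (use Y in auto)

lemma norm_integral_le_integral:
  fixes f :: "'a \<Rightarrow> 'b::{banach,second_countable_topology}"
  assumes "integrable M f" "integrable M g" "\<And>x. x \<in> space M \<Longrightarrow> norm (f x) \<le> g x"
  shows "norm (\<integral>x. f x \<partial>M) \<le> (\<integral>x. g x \<partial>M)"
  using assms by (intro order.trans[OF integral_norm_bound] integral_mono) auto

text \<open>Taylor remainders produce third absolute moments, whereas only second and fourth moments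
  are tracked; the free parameter decides which of the two carries the error.\<close>

lemma abs_cube_le:
  fixes y \<delta> :: real
  assumes "0 < \<delta>"
  shows "\<bar>y\<bar> ^ 3 \<le> (\<delta> * y\<^sup>2 + y ^ 4 / \<delta>) / 2"
proof -
  have "0 \<le> y\<^sup>2 * (\<delta> - \<bar>y\<bar>)\<^sup>2" by simp
  also have "\<dots> = \<delta> * (\<delta> * y\<^sup>2 + y ^ 4 / \<delta> - 2 * \<bar>y\<bar> ^ 3)"
  proof -
    have "\<bar>y\<bar>\<^sup>2 = y\<^sup>2" by simp
    then have "y ^ 4 = \<bar>y\<bar>^4" "y\<^sup>2 = \<bar>y\<bar>\<^sup>2" by auto
    then show ?thesis using assms by (simp add: field_simps power2_eq_square power3_eq_cube power4_eq_xxxx)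
  qed
  finally show ?thesis using assms by (simp add: zero_le_mult_iff)
qed

text \<open>The variable equals \<open>\<alpha>\<close> with probability \<open>1 - q\<close> and
  the mark \<open>Y\<close> otherwise, and \<open>m2\<close>, \<open>m4\<close> are its moments. Its
  mean is 0, which leaves \<open>1 - m2 / 2\<close> in the second-order expansion; replacing this by
  \<open>exp (- m2 / 2)\<close> costs \<open>m2\<^sup>2 / 8 \<le> m4 / 8\<close>.\<close>

lemma (in prob_space) mixture_char_approx:
  fixes Y :: "'a \<Rightarrow> real" and q \<alpha> \<delta> :: real
  assumes [measurable]: "Y \<in> borel_measurable M" and Y: "integrable M (\<lambda>x. Y x ^ 4)"
    and q: "0 \<le> q" "q \<le> 1" and mean: "(1 - q) * \<alpha> + q * expectation Y = 0" and \<delta>: "0 < \<delta>"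
  defines "m2 \<equiv> (1 - q) * \<alpha>\<^sup>2 + q * expectation (\<lambda>x. (Y x)\<^sup>2)"
    and "m4 \<equiv> (1 - q) * \<alpha> ^ 4 + q * expectation (\<lambda>x. Y x ^ 4)"
  shows "norm (of_real (1 - q) * iexp \<alpha> + of_real q * (CLINT x|M. iexp (Y x)) - exp (- m2 / 2))
    \<le> \<delta> * m2 + (1 / \<delta> + 1) * m4"
proof -
  have iY: "integrable M Y" "integrable M (\<lambda>x. (Y x)\<^sup>2)"
    using integrable_power_le4[OF _ Y, of 1] integrable_power_le4[OF _ Y, of 2] by simp_all
  have iexpY: "complex_integrable M (\<lambda>x. iexp (Y x))"
    by (rule integrable_iexp) auto
  define P where "P y = 1 + \<i> * complex_of_real y - (complex_of_real y)\<^sup>2 / 2" for y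
  define B where "B y = (\<delta> * y\<^sup>2 + y ^ 4 / \<delta>) / 12" for y
  have PB: "norm (iexp y - P y) \<le> B y" for y
  proof -
    have "(\<Sum>k\<le>2. (\<i> * y)^k / fact k) = 1 + \<i> * y + (\<i> * y)\<^sup>2 / 2"
      by (simp add: numeral_2_eq_2)
    then have "P y = (\<Sum>k\<le>2. (\<i> * y)^k / fact k)"
      by (simp add: P_def power_mult_distrib)
    then have "norm (iexp y - P y) \<le> \<bar>y\<bar>^3 / 6"
      using iexp_approx1[of y 2] by (simp add: eval_nat_numeral)
    also have "\<dots> \<le> B y" using abs_cube_le[OF \<delta>, of y] by (simp add: B_def)
    finally show ?thesis .
  qed
  have iP: "complex_integrable M (\<lambda>x. P (Y x))"
    unfolding P_def of_real_power[symmetric] using iY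
    by (intro Bochner_Integration.integrable_add Bochner_Integration.integrable_diff
        integrable_mult_right integrable_divide integrable_of_real) auto
  have EP: "(CLINT x|M. P (Y x)) = 1 + \<i> * expectation Y - expectation (\<lambda>x. (Y x)\<^sup>2) / 2"
    unfolding P_def of_real_power[symmetric] using iY
    by (simp add: prob_space del: of_real_power)
  have iB: "integrable M (\<lambda>x. B (Y x))" unfolding B_def using iY Y by auto
  have EB: "expectation (\<lambda>x. B (Y x)) = (\<delta> * expectation (\<lambda>x. (Y x)\<^sup>2) + expectation (\<lambda>x. Y x ^ 4) / \<delta>) / 12"
    unfolding B_def using iY Y by simp
  have "of_real (1 - q) * P \<alpha> + of_real q * (CLINT x|M. P (Y x)) 
     = complex_of_real (1 - m2 / 2) + \<i> * complex_of_real ((1 - q) * \<alpha> + q * expectation Y)"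
    unfolding EP unfolding P_def m2_def by (simp add: algebra_simps add_divide_distrib diff_divide_distrib)
  then have Pm2: "of_real (1 - q) * P \<alpha> + of_real q * (CLINT x|M. P (Y x)) = complex_of_real (1 - m2 / 2)"
    unfolding mean by simp
  have "norm (of_real (1 - q) * iexp \<alpha> + of_real q * (CLINT x|M. iexp (Y x)) - of_real (1 - m2 / 2))
    = norm (of_real (1 - q) * (iexp \<alpha> - P \<alpha>) + of_real q * (CLINT x|M. iexp (Y x) - P (Y x)))"
    unfolding Pm2[symmetric] Bochner_Integration.integral_diff[OF iexpY iP] by (simp add: algebra_simps)
  also have "\<dots> \<le> (1 - q) * norm (iexp \<alpha> - P \<alpha>) + q * norm (CLINT x|M. iexp (Y x) - P (Y x))"
    using q by (intro order.trans[OF norm_triangle_ineq]) (simp add: norm_mult del: of_real_diff)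
  also have "\<dots> \<le> (1 - q) * B \<alpha> + q * expectation (\<lambda>x. B (Y x))"
    using q PB iB iexpY iP
    by (intro add_mono mult_left_mono norm_integral_le_integral) auto
  also have "\<dots> = (\<delta> * m2 + m4 / \<delta>) / 12"
    unfolding EB unfolding B_def m2_def m4_def
    by (simp add: algebra_simps add_divide_distrib diff_divide_distrib)
  finally have 1: "norm (of_real (1 - q) * iexp \<alpha> + of_real q * (CLINT x|M. iexp (Y x)) - of_real (1 - m2 / 2))
     \<le> (\<delta> * m2 + m4 / \<delta>) / 12" .
  have m2: "0 \<le> m2" unfolding m2_def using q by (intro add_nonneg_nonneg mult_nonneg_nonneg) auto
  have m4: "0 \<le> m4" unfolding m4_def using q by (intro add_nonneg_nonneg mult_nonneg_nonneg) auto
  have m24: "m2\<^sup>2 \<le> m4"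
  proof -
    have v: "(expectation (\<lambda>x. (Y x)\<^sup>2))\<^sup>2 \<le> expectation (\<lambda>x. Y x ^ 4)"
    proof -
      have "0 \<le> variance (\<lambda>x. (Y x)\<^sup>2)" by (rule variance_positive)
      also have "variance (\<lambda>x. (Y x)\<^sup>2) = expectation (\<lambda>x. Y x ^ 4) - (expectation (\<lambda>x. (Y x)\<^sup>2))\<^sup>2"
        using iY Y by (subst variance_eq) auto
      finally show ?thesis by simp
    qed
    define y where "y = expectation (\<lambda>x. (Y x)\<^sup>2)"
    have "((1 - q) * \<alpha>\<^sup>2 + q * y)\<^sup>2 = (1 - q) * \<alpha>^4 + q * y\<^sup>2 - q * (1 - q) * (\<alpha>\<^sup>2 - y)\<^sup>2" by algebra
    also have "\<dots> \<le> (1 - q) * \<alpha>^4 + q * y\<^sup>2" using q by simp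
    also have "\<dots> \<le> m4" unfolding m4_def using v q by (intro add_left_mono mult_left_mono) (auto simp: y_def)
    finally show ?thesis by (simp add: m2_def y_def)
  qed
  have "norm (complex_of_real (1 - m2 / 2) - exp (- m2 / 2)) = \<bar>exp (- m2 / 2) - (1 - m2 / 2)\<bar>"
    by (metis abs_minus_commute norm_of_real of_real_diff of_real_exp of_real_minus of_real_divide of_real_numeral)
  also have "\<dots> \<le> m2\<^sup>2 / 8"
  proof -
    have "0 \<le> exp (- m2 / 2) - (1 - m2 / 2)" using exp_ge_add_one_self[of "- m2 / 2"] by simp
    moreover have "exp (- m2 / 2) \<le> 1 - m2 / 2 + m2\<^sup>2 / 8"
    proof -
      obtain c where "exp (- m2 / 2) = (\<Sum>k<2. (- m2 / 2) ^ k / fact k) + exp c / fact 2 * (- m2 / 2) ^ 2" "\<bar>c\<bar> \<le> \<bar>- m2 / 2\<bar>" 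
        using Maclaurin_exp_le[of "- m2 / 2" 2] by auto
      have "1 + m2/2 + (m2/2)\<^sup>2/2 \<le> exp (m2 / 2)" using m2 exp_lower_Taylor_quadratic[of "m2/2"] by simp
      then have "exp (- (m2 / 2)) * (1 + m2/2 + (m2/2)\<^sup>2/2) \<le> 1"
        by (metis exp_ge_zero exp_minus_inverse mult.commute mult_left_mono)
      \<comment> \<open>With \<open>y = m2 / 2\<close> the product is
        \<open>(1 + y\<^sup>2 / 2)\<^sup>2 - y\<^sup>2 = 1 + y ^ 4 / 4\<close>.\<close>
      moreover have "1 \<le> (1 - m2 / 2 + m2\<^sup>2 / 8) * (1 + m2/2 + (m2/2)\<^sup>2/2)"
        using m2 by (simp add: algebra_simps power2_eq_square)
      ultimately have "exp (- (m2 / 2)) * (1 + m2/2 + (m2/2)\<^sup>2/2) \<le> (1 - m2 / 2 + m2\<^sup>2 / 8) * (1 + m2/2 + (m2/2)\<^sup>2/2)"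
        by linarith
      moreover have "0 < 1 + m2/2 + (m2/2)\<^sup>2/2" using m2 by (intro add_pos_nonneg) auto
      ultimately show ?thesis by (simp add: mult_le_cancel_right)
    qed
    ultimately show ?thesis by simp
  qed
  also have "\<dots> \<le> m4 / 8" using m24 by simp
  finally have 2: "norm (complex_of_real (1 - m2 / 2) - exp (- m2 / 2)) \<le> m4 / 8" .
  have "norm (of_real (1 - q) * iexp \<alpha> + of_real q * (CLINT x|M. iexp (Y x)) - exp (- m2 / 2))
    \<le> (\<delta> * m2 + m4 / \<delta>) / 12 + m4 / 8"
    using norm_triangle_mono[OF 1 2] by (simp add: algebra_simps)
  also have "\<dots> \<le> \<delta> * m2 + m4 / \<delta> + m4"
  proof -
    have "0 \<le> \<delta> * m2" "0 \<le> m4 / \<delta>" using m2 m4 \<delta> by auto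
    then show ?thesis using m4 by argo
  qed
  also have "\<dots> = \<delta> * m2 + (1 / \<delta> + 1) * m4" by (simp add: algebra_simps)
  finally show ?thesis .
qed

text \<open>Decay in \<open>\<theta>\<close> survives a perturbation \<open>y\<close>: half of the
  term \<open>\<theta>\<^sup>2 / 12\<close> from \<open>one_minus_cos_ge\<close> absorbs the cross
  term \<open>\<bar>\<theta>\<bar> * \<bar>y\<bar>\<close>, at the price of
  \<open>6 * y\<^sup>2\<close>; the rest of \<open>13 / 2\<close> comes from
  \<open>1 - cos y\<close>.\<close>

lemma cos_add_le:
  assumes "\<bar>\<theta>\<bar> \<le> pi"
  shows "cos (\<theta> + y) \<le> 1 - \<theta>\<^sup>2 / 24 + 13 / 2 * y\<^sup>2"
proof -
  have c: "1 - cos y \<le> y\<^sup>2 / 2" 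
  proof -
    have "\<bar>sin (y / 2)\<bar>\<^sup>2 \<le> \<bar>y / 2\<bar>\<^sup>2" by (intro power_mono abs_sin_x_le_abs_x) auto
    then show ?thesis using cos_double_sin[of "y / 2"] by (simp add: power_divide)
  qed
  have "0 \<le> 1 + cos \<theta>" using cos_ge_minus_one[of \<theta>] by linarith
  then have "0 \<le> (1 + cos \<theta>) * (1 - cos y)" by (intro mult_nonneg_nonneg) auto
  then have c1: "cos \<theta> * cos y \<le> cos \<theta> + (1 - cos y)" by (simp add: algebra_simps)
  have "- (sin \<theta> * sin y) \<le> \<bar>sin \<theta>\<bar> * \<bar>sin y\<bar>" by (simp flip: abs_mult)
  also have "\<dots> \<le> \<bar>\<theta>\<bar> * \<bar>y\<bar>" by (intro mult_mono abs_sin_x_le_abs_x) auto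
  also have "\<dots> \<le> \<theta>\<^sup>2 / 24 + 6 * y\<^sup>2"
    using zero_le_power2[of "\<bar>\<theta>\<bar> - 12 * \<bar>y\<bar>"] by (simp add: power2_diff)
  finally have "cos (\<theta> + y) \<le> cos \<theta> + (1 - cos y) + (\<theta>\<^sup>2 / 24 + 6 * y\<^sup>2)"
    using c1 by (simp add: cos_add)
  then show ?thesis using c one_minus_cos_ge[OF assms] by simp
qed

text \<open>The characteristic function of \<open>t (I Z - q e) + \<theta> (I - q)\<close>, where \<open>I\<close> is a Bernoulli variable with
  parameter \<open>q\<close> and the mark \<open>Z\<close> has mean \<open>e\<close>.\<close>

definition hfun :: "'a measure \<Rightarrow> ('a \<Rightarrow> real) \<Rightarrow> real \<Rightarrow> real \<Rightarrow> real \<Rightarrow> complex" where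
  "hfun M Z q t \<theta> = iexp (- (t * q * (LINT x|M. Z x) + \<theta> * q)) *
     (of_real (1 - q) + of_real q * (iexp \<theta> * (CLINT x|M. iexp (t * Z x))))"

context prob_space begin

context
  fixes Z :: "'a \<Rightarrow> real" and q :: real
  assumes Z [measurable]: "Z \<in> borel_measurable M" and Z4: "integrable M (\<lambda>x. Z x ^ 4)"
    and q: "0 \<le> q" "q \<le> 1"
begin

lemma iZ: "integrable M Z" "integrable M (\<lambda>x. (Z x)\<^sup>2)" "integrable M (\<lambda>x. Z x ^ 3)"
  using integrable_power_le4[OF Z Z4, of 1] integrable_power_le4[OF Z Z4, of 2]
    integrable_power_le4[OF Z Z4, of 3] by simp_all

text \<open>Supplies the integrable majorant in \<open>\<theta>\<close> for dominated convergence;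
  the mark spoils it only by a factor whose exponent stays bounded after summation over the
  normalised units.\<close>

lemma norm_hfun_le:
  assumes "\<bar>\<theta>\<bar> \<le> pi"
  shows "norm (hfun M Z q t \<theta>) \<le> exp (q * (1 - q) * (13 / 2 * t\<^sup>2 * expectation (\<lambda>x. (Z x)\<^sup>2) - \<theta>\<^sup>2 / 24))"
proof -
  let ?z = "CLINT x|M. iexp (\<theta> + t * Z x)"
  have ii: "complex_integrable M (\<lambda>x. iexp (\<theta> + t * Z x))" by (rule integrable_iexp) auto
  have z: "iexp \<theta> * (CLINT x|M. iexp (t * Z x)) = ?z"
    by (simp add: exp_add distrib_left flip: integral_mult_right_zero)
  have "norm ?z \<le> expectation (\<lambda>x. 1)"
    by (intro norm_integral_le_integral ii) auto
  then have nz: "norm ?z \<le> 1" by (simp add: prob_space)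
  have "Re ?z = expectation (\<lambda>x. cos (\<theta> + t * Z x))"
    using ii by (simp add: Re_exp flip: integral_Re)
  also have "\<dots> \<le> expectation (\<lambda>x. 1 - \<theta>\<^sup>2 / 24 + 13 / 2 * (t * Z x)\<^sup>2)"
  proof (rule integral_mono)
    show "integrable M (\<lambda>x. cos (\<theta> + t * Z x))" by (rule integrable_const_bound[where B = 1]) auto
    show "integrable M (\<lambda>x. 1 - \<theta>\<^sup>2 / 24 + 13 / 2 * (t * Z x)\<^sup>2)" using iZ by (simp add: power_mult_distrib)
  qed (rule cos_add_le[OF assms])
  also have "\<dots> = 1 - \<theta>\<^sup>2 / 24 + 13 / 2 * t\<^sup>2 * expectation (\<lambda>x. (Z x)\<^sup>2)"
    using iZ by (simp add: power_mult_distrib prob_space)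
  finally have Rez: "Re ?z \<le> 1 - \<theta>\<^sup>2 / 24 + 13 / 2 * t\<^sup>2 * expectation (\<lambda>x. (Z x)\<^sup>2)" .
  have "norm (hfun M Z q t \<theta>) = norm (of_real (1 - q) + of_real q * ?z)"
    by (simp only: hfun_def z norm_mult norm_exp_i_times mult_1_left)
  also have "\<dots> \<le> exp (- (q * (1 - q) * (1 - Re ?z)))" by (rule norm_bernoulli_char_le[OF q nz])
  also have "\<dots> = exp (q * (1 - q) * (Re ?z - 1))" by (simp add: algebra_simps)
  also have "\<dots> \<le> exp (q * (1 - q) * (13 / 2 * t\<^sup>2 * expectation (\<lambda>x. (Z x)\<^sup>2) - \<theta>\<^sup>2 / 24))"
    using Rez q by (subst exp_le_cancel_iff, intro mult_left_mono) auto
  finally show ?thesis .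
qed

lemma norm_hfun_le_1: "norm (hfun M Z q t \<theta>) \<le> 1"
proof -
  let ?z = "iexp \<theta> * (CLINT x|M. iexp (t * Z x))"
  have ii: "complex_integrable M (\<lambda>x. iexp (t * Z x))" by (rule integrable_iexp) auto
  have "norm (CLINT x|M. iexp (t * Z x)) \<le> expectation (\<lambda>x. 1)"
    by (intro norm_integral_le_integral ii) auto
  then have nz: "norm ?z \<le> 1" by (simp add: prob_space norm_mult)
  have "norm (hfun M Z q t \<theta>) = norm (of_real (1 - q) + of_real q * ?z)" by (simp add: hfun_def norm_mult)
  also have "\<dots> \<le> (1 - q) + q * norm ?z"
    using q by (intro order.trans[OF norm_triangle_ineq]) (simp add: norm_mult del: of_real_diff)
  also have "\<dots> \<le> (1 - q) + q * 1" using nz q by (intro add_left_mono mult_left_mono) auto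
  finally show ?thesis by simp
qed

text \<open>Here \<open>m2\<close> is the variance of
  \<open>t * (I * Z - q * e) + \<theta> * (I - q)\<close>, with \<open>I\<close> the selection
  indicator; its middle term is the covariance that centring cancels in the sum over units.\<close>

lemma hfun_approx:
  fixes t \<theta> \<delta> :: real
  assumes \<delta>: "0 < \<delta>"
  defines "e \<equiv> expectation Z"
  defines "m2 \<equiv> t\<^sup>2 * (q * expectation (\<lambda>x. (Z x)\<^sup>2) - q\<^sup>2 * e\<^sup>2) + 2 * t * \<theta> * (q * (1 - q) * e) + \<theta>\<^sup>2 * (q * (1 - q))"
  shows "norm (hfun M Z q t \<theta> - exp (- m2 / 2)) \<le> \<delta> * m2 +
      (1 / \<delta> + 1) * (128 * t ^ 4 * (q * expectation (\<lambda>x. Z x ^ 4)) + 8 * \<theta> ^ 4 * (q * (1 - q)))"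
proof -
  \<comment> \<open>On an unselected unit the variable has the value \<open>\<alpha>\<close>, on a
    selected one the value \<open>Y\<close>.\<close>
  define \<alpha> where "\<alpha> = - (t * q * e + \<theta> * q)"
  define Y where "Y x = t * Z x + (\<theta> + \<alpha>)" for x
  have [measurable]: "Y \<in> borel_measurable M" unfolding Y_def by measurable
  define E2 E4 where "E2 = expectation (\<lambda>x. (Z x)\<^sup>2)" and "E4 = expectation (\<lambda>x. Z x ^ 4)"
  have Y2: "(\<lambda>x. (Y x)\<^sup>2) = (\<lambda>x. t\<^sup>2 * (Z x)\<^sup>2 + (2 * t * (\<theta> + \<alpha>)) * Z x + (\<theta> + \<alpha>)\<^sup>2)"
    unfolding Y_def fun_eq_iff by algebra
  have Y4: "(\<lambda>x. Y x ^ 4) = (\<lambda>x. t^4 * Z x ^ 4 + (4 * t^3 * (\<theta> + \<alpha>)) * Z x ^ 3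
     + (6 * t\<^sup>2 * (\<theta> + \<alpha>)\<^sup>2) * (Z x)\<^sup>2 + (4 * t * (\<theta> + \<alpha>)^3) * Z x + (\<theta> + \<alpha>)^4)"
    unfolding Y_def fun_eq_iff by algebra
  have iY4: "integrable M (\<lambda>x. Y x ^ 4)" unfolding Y4 using iZ Z4 by simp
  have EY: "expectation Y = t * e + (\<theta> + \<alpha>)" unfolding Y_def e_def using iZ by (simp add: prob_space)
  have EY2: "expectation (\<lambda>x. (Y x)\<^sup>2) = t\<^sup>2 * E2 + 2 * t * (\<theta> + \<alpha>) * e + (\<theta> + \<alpha>)\<^sup>2"
    unfolding Y2 e_def E2_def using iZ by (simp add: prob_space)
  have mean: "(1 - q) * \<alpha> + q * expectation Y = 0" unfolding EY \<alpha>_def by algebra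
  have m2: "(1 - q) * \<alpha>\<^sup>2 + q * expectation (\<lambda>x. (Y x)\<^sup>2) = m2"
    unfolding EY2 m2_def \<alpha>_def E2_def[symmetric] by algebra
  have e4: "e ^ 4 \<le> E4"
  proof -
    have j: "(expectation V)\<^sup>2 \<le> expectation (\<lambda>x. (V x)\<^sup>2)" if "integrable M V" "integrable M (\<lambda>x. (V x)\<^sup>2)" for V :: "'a \<Rightarrow> real"
    proof -
      have "0 \<le> variance V" by (rule variance_positive)
      then show ?thesis using that by (simp add: variance_eq)
    qed
    have "e ^ 4 = (e\<^sup>2)\<^sup>2" by simp
    also have "\<dots> \<le> E2\<^sup>2" unfolding e_def E2_def using iZ by (intro power_mono j) auto
    also have "\<dots> \<le> E4" using j[of "\<lambda>x. (Z x)\<^sup>2"] iZ Z4 unfolding E2_def E4_def by simp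
    finally show ?thesis .
  qed
  have m4: "(1 - q) * \<alpha> ^ 4 + q * expectation (\<lambda>x. Y x ^ 4) \<le> 128 * t ^ 4 * (q * E4) + 8 * \<theta> ^ 4 * (q * (1 - q))"
  proof -
    have "\<alpha> ^ 4 = (t * (- q * e) + \<theta> * (- q)) ^ 4" by (simp add: \<alpha>_def algebra_simps)
    also have "\<dots> \<le> 8 * (t * (- q * e)) ^ 4 + 8 * (\<theta> * (- q)) ^ 4" by (rule power4_add_le)
    finally have 1: "\<alpha> ^ 4 \<le> 8 * t^4 * (q * e)^4 + 8 * \<theta>^4 * q^4" by (simp add: power_mult_distrib)
    have "expectation (\<lambda>x. Y x ^ 4) \<le> expectation (\<lambda>x. 64 * t^4 * Z x ^ 4 + (64 * t^4 * (q * e)^4 + 8 * \<theta> ^ 4 * (1 - q)^4))"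
    proof (rule integral_mono[OF iY4])
      show "integrable M (\<lambda>x. 64 * t^4 * Z x ^ 4 + (64 * t^4 * (q * e)^4 + 8 * \<theta> ^ 4 * (1 - q)^4))" using Z4 by simp
      fix x
      have "Y x ^ 4 = (t * (Z x + - (q * e)) + \<theta> * (1 - q)) ^ 4" by (simp add: Y_def \<alpha>_def algebra_simps)
      also have "\<dots> \<le> 8 * (t * (Z x + - (q * e))) ^ 4 + 8 * (\<theta> * (1 - q)) ^ 4" by (rule power4_add_le)
      also have "\<dots> = 8 * t^4 * (Z x + - (q * e)) ^ 4 + 8 * \<theta> ^ 4 * (1 - q) ^ 4" unfolding power_mult_distrib by simp
      also have "\<dots> \<le> 8 * t^4 * (8 * Z x ^ 4 + 8 * (- (q * e)) ^ 4) + 8 * \<theta> ^ 4 * (1 - q) ^ 4"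
        by (intro add_right_mono mult_left_mono power4_add_le) auto
      finally show "Y x ^ 4 \<le> 64 * t^4 * Z x ^ 4 + (64 * t^4 * (q * e)^4 + 8 * \<theta> ^ 4 * (1 - q)^4)" 
        by (simp add: algebra_simps)
    qed
    also have "\<dots> = 64 * t^4 * E4 + (64 * t^4 * (q * e)^4 + 8 * \<theta> ^ 4 * (1 - q)^4)"
      using Z4 by (simp add: E4_def prob_space)
    finally have 2: "expectation (\<lambda>x. Y x ^ 4) \<le> 64 * t^4 * E4 + (64 * t^4 * (q * e)^4 + 8 * \<theta> ^ 4 * (1 - q)^4)" .
    have "(1 - q) * \<alpha> ^ 4 + q * expectation (\<lambda>x. Y x ^ 4)
      \<le> (1 - q) * (8 * t^4 * (q * e)^4 + 8 * \<theta>^4 * q^4) + q * (64 * t^4 * E4 + (64 * t^4 * (q * e)^4 + 8 * \<theta> ^ 4 * (1 - q)^4))"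
      using 1 2 q by (intro add_mono mult_left_mono) auto
    also have "\<dots> \<le> (1 - q) * (64 * t^4 * (q * e)^4 + 8 * \<theta>^4 * q^4) + q * (64 * t^4 * E4 + (64 * t^4 * (q * e)^4 + 8 * \<theta> ^ 4 * (1 - q)^4))"
      using q by (intro add_mono mult_left_mono mult_right_mono) auto
    also have "\<dots> = 64 * t^4 * (q * e)^4 + 64 * t^4 * (q * E4) + 8 * \<theta>^4 * (q * (1 - q)) * (q^3 + (1-q)^3)" by algebra
    also have "\<dots> \<le> 64 * t^4 * (q * E4) + 64 * t^4 * (q * E4) + 8 * \<theta>^4 * (q * (1 - q)) * 1"
    proof (intro add_mono mult_left_mono)
      have "q ^ 4 \<le> q ^ 1" using q by (intro power_decreasing) auto
      then show "(q * e) ^ 4 \<le> q * E4" unfolding power_mult_distrib using e4 q by (intro mult_mono) auto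
      have "q ^ 3 + (1 - q)^3 = 1 - 3 * (q * (1 - q))" by algebra
      then show "q ^ 3 + (1 - q)^3 \<le> 1" using q by simp
    qed (use q in auto)
    finally show ?thesis by (simp add: mult_ac)
  qed
  have h: "hfun M Z q t \<theta> = of_real (1 - q) * iexp \<alpha> + of_real q * (CLINT x|M. iexp (Y x))"
  proof -
    have "(CLINT x|M. iexp (Y x)) = (CLINT x|M. iexp (\<theta> + \<alpha>) * iexp (t * Z x))"
      unfolding Y_def by (intro Bochner_Integration.integral_cong refl) (simp add: exp_add distrib_left mult_ac)
    also have "\<dots> = iexp \<alpha> * (iexp \<theta> * (CLINT x|M. iexp (t * Z x)))"
      by (simp add: exp_add distrib_left)
    finally show ?thesis unfolding hfun_def e_def[symmetric] \<alpha>_def[symmetric] by (simp add: algebra_simps)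
  qed
  have "norm (hfun M Z q t \<theta> - exp (- m2 / 2)) \<le> \<delta> * m2 + (1 / \<delta> + 1) * ((1 - q) * \<alpha> ^ 4 + q * expectation (\<lambda>x. Y x ^ 4))"
    using mixture_char_approx[OF _ iY4 q mean \<delta>] unfolding h m2 by simp
  also have "\<dots> \<le> \<delta> * m2 + (1 / \<delta> + 1) * (128 * t ^ 4 * (q * E4) + 8 * \<theta> ^ 4 * (q * (1 - q)))"
    using m4 \<delta> by (intro add_left_mono mult_left_mono) auto
  finally show ?thesis by (simp add: E4_def)
qed

end
end

lemma (in prob_space) expectation_power2_le:
  fixes Z :: "'a \<Rightarrow> real"
  assumes "Z \<in> borel_measurable M" "integrable M (\<lambda>x. Z x ^ 4)"
  shows "(expectation Z)\<^sup>2 \<le> expectation (\<lambda>x. (Z x)\<^sup>2)"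
proof -
  have "variance Z = expectation (\<lambda>x. (Z x)\<^sup>2) - (expectation Z)\<^sup>2"
    using integrable_power_le4[OF assms, of 1] integrable_power_le4[OF assms, of 2] by (intro variance_eq) auto
  then show ?thesis using variance_positive[of Z] by linarith
qed

lemma prod_diff_le_sum:
  fixes z w :: "nat \<Rightarrow> complex"
  assumes "\<And>i. i \<in> A \<Longrightarrow> norm (z i) \<le> 1" "\<And>i. i \<in> A \<Longrightarrow> norm (w i) \<le> 1"
  shows "norm ((\<Prod>i\<in>A. z i) - (\<Prod>i\<in>A. w i)) \<le> (\<Sum>i\<in>A. norm (z i - w i))"
  using assms by (rule norm_prod_diff)

section \<open>Fourier representation of rejective samples and the limit law\<close>

context rejective_normalised begin

text \<open>Conditioning on the sample size by Fourier inversion, with the frequency rescaled by \<open>sqrt d\<close>.\<close>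

lemma E_prod_char:
  fixes M :: "'w measure" and Z :: "nat \<Rightarrow> 'w \<Rightarrow> real"
  assumes d: "0 < d"
  shows "E (\<lambda>s. \<Prod>i\<in>s. CLINT x|M. iexp (t * Z i x)) * iexp (- (t * (\<Sum>i\<in>A. q i * (LINT x|M. Z i x)))) =
    (CLINT x|lborel. indicator {-pi * sqrt d..pi * sqrt d} x *\<^sub>R (\<Prod>i\<in>A. hfun M (Z i) (q i) t (x / sqrt d))) / (2 * pi * b * sqrt d)"
proof -
  let ?\<phi> = "\<lambda>i. CLINT x|M. iexp (t * Z i x)"
  let ?c = "iexp (- (t * (\<Sum>i\<in>A. q i * (LINT x|M. Z i x))))"
  let ?H = "\<lambda>x. \<Prod>i\<in>A. hfun M (Z i) (q i) t x"
  have prodphi: "E_poisson A q (\<lambda>s. (\<Prod>i\<in>s. ?\<phi> i) * iexp x ^ card s)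
     = (\<Prod>i\<in>A. of_real (1 - q i) + of_real (q i) * (iexp x * ?\<phi> i))" for x
  proof -
    have "(\<lambda>s. (\<Prod>i\<in>s. ?\<phi> i) * iexp x ^ card s) = (\<lambda>s. \<Prod>i\<in>s. iexp x * ?\<phi> i)"
      by (simp add: prod.distrib mult.commute)
    then show ?thesis using E_poisson_prod[OF fin, of q "\<lambda>i. iexp x * ?\<phi> i"] by simp
  qed
  have H: "?c * (exp (- (\<i> * of_int (int n) * of_real x)) * E_poisson A q (\<lambda>s. (\<Prod>i\<in>s. ?\<phi> i) * iexp x ^ card s)) = ?H x" for x
  proof -
    have "(\<Prod>i\<in>A. iexp (- (t * q i * (LINT x|M. Z i x) + x * q i))) = 
       exp (\<Sum>i\<in>A. \<i> * complex_of_real (- (t * q i * (LINT x|M. Z i x) + x * q i)))"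
      using fin by (simp add: exp_sum)
    also have "(\<Sum>i\<in>A. \<i> * complex_of_real (- (t * q i * (LINT x|M. Z i x) + x * q i)))
      = \<i> * complex_of_real (\<Sum>i\<in>A. - (t * q i * (LINT x|M. Z i x) + x * q i))"
      by (simp add: sum_distrib_left del: of_real_add of_real_minus of_real_mult)
    also have "(\<Sum>i\<in>A. - (t * q i * (LINT x|M. Z i x) + x * q i)) = - (t * (\<Sum>i\<in>A. q i * (LINT x|M. Z i x))) - x * n"
      unfolding sumq[symmetric] by (simp add: sum_negf sum.distrib sum_subtractf sum_distrib_left mult_ac)
    also have "exp (\<i> * complex_of_real (- (t * (\<Sum>i\<in>A. q i * (LINT x|M. Z i x))) - x * n))
       = ?c * exp (- (\<i> * of_int (int n) * of_real x))"
      unfolding exp_add[symmetric] by (rule arg_cong[where f = exp]) (simp add: algebra_simps)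
    finally show ?thesis unfolding prodphi hfun_def prod.distrib by (simp add: mult.assoc)
  qed
  have "E_poisson A q (\<lambda>s. if int (card s) = int n then \<Prod>i\<in>s. ?\<phi> i else 0) * ?c
     = ?c * (CLINT x:{-pi..pi}|lborel. exp (- (\<i> * of_int (int n) * of_real x)) *
        E_poisson A q (\<lambda>s. (\<Prod>i\<in>s. ?\<phi> i) * iexp x ^ card s)) / (2 * pi)"
    unfolding E_poisson_fourier[OF fin] by simp
  also have "?c * (CLINT x:{-pi..pi}|lborel. exp (- (\<i> * of_int (int n) * of_real x)) *
        E_poisson A q (\<lambda>s. (\<Prod>i\<in>s. ?\<phi> i) * iexp x ^ card s)) = (CLINT x:{-pi..pi}|lborel. ?H x)"
    unfolding H[symmetric] by (rule set_integral_mult_right[symmetric])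
  also have "\<dots> = (CLINT x|lborel. indicator {-pi..pi} x *\<^sub>R ?H x)" by (simp add: set_lebesgue_integral_def)
  also have "\<dots> = \<bar>1 / sqrt d\<bar> *\<^sub>R (CLINT x|lborel. indicator {-pi..pi} (0 + 1 / sqrt d * x) *\<^sub>R ?H (0 + 1 / sqrt d * x))"
    using d by (intro lborel_integral_real_affine) auto
  also have "(CLINT x|lborel. indicator {-pi..pi} (0 + 1 / sqrt d * x) *\<^sub>R ?H (0 + 1 / sqrt d * x))
    = (CLINT x|lborel. indicator {-pi * sqrt d..pi * sqrt d} x *\<^sub>R ?H (x / sqrt d))"
  proof (rule Bochner_Integration.integral_cong[OF refl])
    fix x
    have "(0 + 1 / sqrt d * x \<in> {-pi..pi}) = (x \<in> {-pi * sqrt d..pi * sqrt d})"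
      using d by (simp add: field_simps)
    then show "indicator {-pi..pi} (0 + 1 / sqrt d * x) *\<^sub>R ?H (0 + 1 / sqrt d * x)
      = indicator {-pi * sqrt d..pi * sqrt d} x *\<^sub>R ?H (x / sqrt d)"
      by (simp add: indicator_def)
  qed
  finally have *: "E_poisson A q (\<lambda>s. if int (card s) = int n then \<Prod>i\<in>s. ?\<phi> i else 0) * ?c = \<bar>1 / sqrt d\<bar> *\<^sub>R
    (CLINT x|lborel. indicator {-pi * sqrt d..pi * sqrt d} x *\<^sub>R ?H (x / sqrt d)) / (2 * pi)" .
  have "E (\<lambda>s. \<Prod>i\<in>s. ?\<phi> i) * ?c = of_real (1 / b) *
    (E_poisson A q (\<lambda>s. if int (card s) = int n then \<Prod>i\<in>s. ?\<phi> i else 0) * ?c)"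
    unfolding Ew_rej_weight scaleR_conv_of_real by (rule mult.assoc)
  then show ?thesis
    unfolding * using d b_pos by (simp add: scaleR_conv_of_real)
qed

end

text \<open>At \<open>t = 0\<close> the left-hand side of the previous identity is 1, which identifies the normalising
  constant \<open>2 * pi * b * sqrt d\<close> as an integral of the same form.\<close>

lemma rejective_char_tendsto:
  fixes A :: "nat \<Rightarrow> nat set" and q :: "nat \<Rightarrow> nat \<Rightarrow> real" and n :: "nat \<Rightarrow> nat"
    and M :: "nat \<Rightarrow> 'w measure" and Z :: "nat \<Rightarrow> nat \<Rightarrow> 'w \<Rightarrow> real"
  assumes rej: "\<And>k. rejective (A k) (q k) (n k)"
    and dinf: "filterlim (\<lambda>k. size_var (A k) (q k)) at_top sequentially"
    and M: "\<And>k. prob_space (M k)"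
    and Zm: "\<And>k i. i \<in> A k \<Longrightarrow> Z k i \<in> borel_measurable (M k)"
    and Z4: "\<And>k i. i \<in> A k \<Longrightarrow> integrable (M k) (\<lambda>x. Z k i x ^ 4)"
    and centred: "\<And>k. (\<Sum>i\<in>A k. q k i * (1 - q k i) * (LINT x|M k. Z k i x)) = 0"
    and norm1: "\<And>k. (\<Sum>i\<in>A k. q k i * (LINT x|M k. (Z k i x)\<^sup>2) - (q k i)\<^sup>2 * (LINT x|M k. Z k i x)\<^sup>2) = 1"
    and lyap: "(\<lambda>k. \<Sum>i\<in>A k. q k i * (LINT x|M k. Z k i x ^ 4)) \<longlonglongrightarrow> 0"
  shows "(\<lambda>k. Ew (A k) (rej_weight (A k) (q k) (n k)) (\<lambda>s. \<Prod>i\<in>s. CLINT x|M k. iexp (t * Z k i x)) *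
      iexp (- (t * (\<Sum>i\<in>A k. q k i * (LINT x|M k. Z k i x))))) \<longlonglongrightarrow> exp (- (t\<^sup>2) / 2)"
proof -
  let ?d = "\<lambda>k. size_var (A k) (q k)"
  let ?m4 = "\<lambda>k. \<Sum>i\<in>A k. q k i * (LINT x|M k. Z k i x ^ 4)"
  interpret rejective "A k" "q k" "n k" for k by (rule rej)
  interpret prob_space "M k" for k by (rule M)
  have d0: "0 < ?d k" for k using d1[of k] by linarith
  define G where "G t k x = indicator {-pi * sqrt (?d k)..pi * sqrt (?d k)} x *\<^sub>R
    (\<Prod>i\<in>A k. hfun (M k) (Z k i) (q k i) t (x / sqrt (?d k)))" for t k x
  have [measurable]: "(\<lambda>x. G t k x) \<in> borel_measurable lborel" for t k
    unfolding G_def hfun_def by measurable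
  have G_lim: "(\<lambda>k. G t k x) \<longlonglongrightarrow> complex_of_real (exp (- (t\<^sup>2 + x\<^sup>2) / 2))" for t x
  proof -
    have bound: "norm ((\<Prod>i\<in>A k. hfun (M k) (Z k i) (q k i) t (x / sqrt (?d k))) - complex_of_real (exp (- (t\<^sup>2 + x\<^sup>2) / 2)))
       \<le> \<delta> * (t\<^sup>2 + x\<^sup>2) + (1 / \<delta> + 1) * (128 * t ^ 4 * ?m4 k + 8 * x ^ 4 / ?d k)" if \<delta>: "0 < \<delta>" for \<delta> k
    proof -
      define \<theta> where "\<theta> = x / sqrt (?d k)"
      have \<theta>2: "\<theta>\<^sup>2 = x\<^sup>2 / ?d k" using d0[of k] by (simp add: \<theta>_def power_divide)
      then have "\<theta> ^ 4 = (x\<^sup>2 / ?d k)\<^sup>2" by (metis power2_eq_square power4_eq_xxxx mult.assoc)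
      then have \<theta>4: "\<theta> ^ 4 * ?d k = x ^ 4 / ?d k" using d0[of k] by (simp add: power_divide power2_eq_square power4_eq_xxxx)
      define m2 where "m2 i = t\<^sup>2 * (q k i * (LINT x|M k. (Z k i x)\<^sup>2) - (q k i)\<^sup>2 * (LINT x|M k. Z k i x)\<^sup>2)
         + 2 * t * \<theta> * (q k i * (1 - q k i) * (LINT x|M k. Z k i x)) + \<theta>\<^sup>2 * (q k i * (1 - q k i))" for i
      have ha: "norm (hfun (M k) (Z k i) (q k i) t \<theta> - exp (- m2 i / 2)) \<le> \<delta> * m2 i +
        (1 / \<delta> + 1) * (128 * t ^ 4 * (q k i * (LINT x|M k. Z k i x ^ 4)) + 8 * \<theta> ^ 4 * (q k i * (1 - q k i)))"
        if "i \<in> A k" for i unfolding m2_def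
        using hfun_approx[OF Zm[OF that] Z4[OF that] _ _ \<delta>] q01[OF that] by simp
      \<comment> \<open>The covariance terms in \<open>t * \<theta>\<close> cancel by
        \<open>centred\<close>, so in the limit the statistic and the sample size behave like
        independent Gaussians and conditioning on the size changes nothing.\<close>
      have summ2: "(\<Sum>i\<in>A k. m2 i) = t\<^sup>2 + x\<^sup>2"
      proof -
        have "(\<Sum>i\<in>A k. m2 i) = t\<^sup>2 * 1 + 2 * t * \<theta> * 0 + \<theta>\<^sup>2 * ?d k"
          unfolding m2_def sum.distrib sum_distrib_left[symmetric] centred norm1 size_var_def ..
        then show ?thesis using d0[of k] by (simp add: \<theta>2)
      qed
      have m2: "0 \<le> m2 i" if i: "i \<in> A k" for i
      proof -
        let ?e = "LINT x|M k. Z k i x" and ?e2 = "LINT x|M k. (Z k i x)\<^sup>2"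
        have v: "?e\<^sup>2 \<le> ?e2"
          by (rule expectation_power2_le[OF Zm[OF i] Z4[OF i]])
        have "m2 i = q k i * (1 - q k i) * (t * ?e + \<theta>)\<^sup>2 + q k i * t\<^sup>2 * (?e2 - ?e\<^sup>2)" unfolding m2_def by algebra
        also have "0 \<le> \<dots>" using v q01[OF i] by (intro add_nonneg_nonneg mult_nonneg_nonneg) auto
        finally show ?thesis .
      qed
      have e: "complex_of_real (exp (- (t\<^sup>2 + x\<^sup>2) / 2)) = (\<Prod>i\<in>A k. complex_of_real (exp (- m2 i / 2)))"
        using fin[of k] unfolding summ2[symmetric]
        by (simp add: of_real_prod[symmetric] exp_sum[symmetric] sum_negf sum_divide_distrib del: of_real_prod)
      have "norm ((\<Prod>i\<in>A k. hfun (M k) (Z k i) (q k i) t \<theta>) - complex_of_real (exp (- (t\<^sup>2 + x\<^sup>2) / 2)))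
        \<le> (\<Sum>i\<in>A k. norm (hfun (M k) (Z k i) (q k i) t \<theta> - complex_of_real (exp (- m2 i / 2))))"
        unfolding e
      proof (rule prod_diff_le_sum)
        fix i assume i: "i \<in> A k"
        show "norm (hfun (M k) (Z k i) (q k i) t \<theta>) \<le> 1"
          using q01[OF i] by (intro norm_hfun_le_1[OF Zm[OF i] Z4[OF i]]) auto
        show "norm (complex_of_real (exp (- m2 i / 2))) \<le> 1" using m2[OF i] by simp
      qed
      also have "\<dots> \<le> (\<Sum>i\<in>A k. \<delta> * m2 i +
        (1 / \<delta> + 1) * (128 * t ^ 4 * (q k i * (LINT x|M k. Z k i x ^ 4)) + 8 * \<theta> ^ 4 * (q k i * (1 - q k i))))"
        by (intro sum_mono) (use ha in simp)
      also have "\<dots> = \<delta> * (t\<^sup>2 + x\<^sup>2) + (1 / \<delta> + 1) * (128 * t ^ 4 * ?m4 k + 8 * \<theta> ^ 4 * ?d k)"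
        unfolding sum.distrib sum_distrib_left[symmetric] summ2 size_var_def ..
      also have "8 * \<theta> ^ 4 * ?d k = 8 * x ^ 4 / ?d k" using \<theta>4 by simp
      finally show ?thesis unfolding \<theta>_def .
    qed
    have "(\<lambda>k. \<Prod>i\<in>A k. hfun (M k) (Z k i) (q k i) t (x / sqrt (?d k))) \<longlonglongrightarrow> complex_of_real (exp (- (t\<^sup>2 + x\<^sup>2) / 2))"
    proof (rule LIMSEQ_I)
      fix r :: real assume r: "0 < r"
      define \<delta> where "\<delta> = r / (2 * (t\<^sup>2 + x\<^sup>2 + 1))"
      have pos: "0 < t\<^sup>2 + x\<^sup>2 + 1" by (smt (verit) zero_le_power2)
      have \<delta>: "0 < \<delta>" using r pos by (simp add: \<delta>_def)
      have \<delta>2: "\<delta> * (t\<^sup>2 + x\<^sup>2) < r / 2"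
      proof -
        have "\<delta> * (t\<^sup>2 + x\<^sup>2) < \<delta> * (t\<^sup>2 + x\<^sup>2 + 1)" using \<delta> by simp
        also have "\<dots> = r / 2" using pos by (simp add: \<delta>_def field_simps)
        finally show ?thesis .
      qed
      have "(\<lambda>k. (1 / \<delta> + 1) * (128 * t ^ 4 * ?m4 k + 8 * x ^ 4 / ?d k)) \<longlonglongrightarrow> (1 / \<delta> + 1) * (128 * t ^ 4 * 0 + 0)"
        by (intro tendsto_intros lyap tendsto_divide_0[OF tendsto_const] filterlim_at_top_imp_at_infinity dinf)
      then have "\<forall>\<^sub>F k in sequentially. (1 / \<delta> + 1) * (128 * t ^ 4 * ?m4 k + 8 * x ^ 4 / ?d k) < r / 2"
        using r by (intro order_tendstoD(2)) auto
      then show "\<exists>no. \<forall>k\<ge>no. norm ((\<Prod>i\<in>A k. hfun (M k) (Z k i) (q k i) t (x / sqrt (?d k))) -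
         complex_of_real (exp (- (t\<^sup>2 + x\<^sup>2) / 2))) < r"
        unfolding eventually_sequentially using bound[OF \<delta>] \<delta>2 by (smt (verit) field_sum_of_halves)
    qed
    \<comment> \<open>For fixed \<open>x\<close> the cut-off at \<open>pi * sqrt d\<close> is
      eventually inactive.\<close>
    moreover have "\<forall>\<^sub>F k in sequentially. G t k x = (\<Prod>i\<in>A k. hfun (M k) (Z k i) (q k i) t (x / sqrt (?d k)))"
    proof -
      have "\<forall>\<^sub>F k in sequentially. (\<bar>x\<bar> / pi)\<^sup>2 \<le> ?d k" using dinf by (simp add: filterlim_at_top)
      then show ?thesis
      proof eventually_elim
        case (elim k)
        then have "\<bar>x\<bar> / pi \<le> sqrt (?d k)" by (rule real_le_rsqrt)
        then have "\<bar>x\<bar> \<le> pi * sqrt (?d k)" by (simp add: field_simps)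
        then show ?case by (simp add: G_def abs_le_iff)
      qed
    qed
    ultimately show ?thesis by (simp add: tendsto_cong)
  qed
  \<comment> \<open>The exponent is \<open>x\<^sup>2 / 24\<close> in the shape of
    \<open>gauss_integrals\<close> with parameter 1/2. The factor in \<open>t\<close> arises because
    \<open>norm1\<close> bounds the sum of the \<open>q * (1 - q)\<close>-weighted second moments by
    1.\<close>
  have G_bound: "norm (G t k x) \<le> exp (13 / 2 * t\<^sup>2) * exp (- (1 / 2 * x\<^sup>2 / 12))" for t k x
  proof (cases "x \<in> {-pi * sqrt (?d k)..pi * sqrt (?d k)}")
    case True
    let ?\<theta> = "x / sqrt (?d k)"
    have \<theta>: "\<bar>?\<theta>\<bar> \<le> pi" using True d0[of k] by (auto simp: abs_le_iff field_simps)
    have \<theta>2: "?\<theta>\<^sup>2 * ?d k = x\<^sup>2" using d0[of k] by (simp add: power_divide)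
    have "norm (G t k x) = (\<Prod>i\<in>A k. norm (hfun (M k) (Z k i) (q k i) t ?\<theta>))"
      using True by (simp add: G_def prod_norm)
    also have "\<dots> \<le> (\<Prod>i\<in>A k. exp (q k i * (1 - q k i) * (13 / 2 * t\<^sup>2 * (LINT x|M k. (Z k i x)\<^sup>2) - ?\<theta>\<^sup>2 / 24)))"
      using q01 by (intro prod_mono conjI norm_hfun_le[OF Zm Z4 _ _ \<theta>]) auto
    also have "\<dots> = exp (13 / 2 * t\<^sup>2 * (\<Sum>i\<in>A k. q k i * (1 - q k i) * (LINT x|M k. (Z k i x)\<^sup>2)) - ?\<theta>\<^sup>2 * ?d k / 24)"
    proof -
      have "(\<Sum>i\<in>A k. q k i * (1 - q k i) * (13 / 2 * t\<^sup>2 * (LINT x|M k. (Z k i x)\<^sup>2) - c)) =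
        13 / 2 * t\<^sup>2 * (\<Sum>i\<in>A k. q k i * (1 - q k i) * (LINT x|M k. (Z k i x)\<^sup>2)) - c * ?d k" for c
        unfolding size_var_def sum_distrib_left sum_subtractf[symmetric]
        by (intro sum.cong refl) (simp only: right_diff_distrib mult_ac)
      then show ?thesis using fin[of k] by (simp only: exp_sum[symmetric]) simp
    qed
    also have "\<dots> \<le> exp (13 / 2 * t\<^sup>2 * 1 - x\<^sup>2 / 24)"
    proof -
      have "(\<Sum>i\<in>A k. q k i * (1 - q k i) * (LINT x|M k. (Z k i x)\<^sup>2)) \<le>
        (\<Sum>i\<in>A k. q k i * (LINT x|M k. (Z k i x)\<^sup>2) - (q k i)\<^sup>2 * (LINT x|M k. Z k i x)\<^sup>2)"
      proof (rule sum_mono)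
        fix i assume i: "i \<in> A k"
        let ?e = "LINT x|M k. Z k i x" and ?e2 = "LINT x|M k. (Z k i x)\<^sup>2"
        have v: "?e\<^sup>2 \<le> ?e2"
          by (rule expectation_power2_le[OF Zm[OF i] Z4[OF i]])
        then have "(q k i)\<^sup>2 * ?e\<^sup>2 \<le> (q k i)\<^sup>2 * ?e2" by (intro mult_left_mono) auto
        then show "q k i * (1 - q k i) * ?e2 \<le> q k i * ?e2 - (q k i)\<^sup>2 * ?e\<^sup>2"
          by (simp add: algebra_simps power2_eq_square)
      qed
      then have "13 / 2 * t\<^sup>2 * (\<Sum>i\<in>A k. q k i * (1 - q k i) * (LINT x|M k. (Z k i x)\<^sup>2)) \<le> 13 / 2 * t\<^sup>2 * 1"
        unfolding norm1 by (intro mult_left_mono) auto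
      then show ?thesis unfolding \<theta>2 by simp
    qed
    also have "\<dots> = exp (13 / 2 * t\<^sup>2) * exp (- (1 / 2 * x\<^sup>2 / 12))" by (simp flip: exp_add)
    finally show ?thesis .
  qed (simp add: G_def)
  have gi: "integrable lborel (\<lambda>x. exp (13 / 2 * t\<^sup>2) * exp (- (1 / 2 * x\<^sup>2 / 12)))" for t :: real
    using gauss_integrals(1)[of "1/2"] by (intro integrable_mult_right) auto
  have I_lim: "(\<lambda>k. CLINT x|lborel. G t k x) \<longlonglongrightarrow> (CLINT x|lborel. complex_of_real (exp (- (t\<^sup>2 + x\<^sup>2) / 2)))" for t
    by (rule integral_dominated_convergence[OF _ _ gi[of t]]) (use G_lim G_bound in auto)
  have I: "(CLINT x|lborel. complex_of_real (exp (- (t\<^sup>2 + x\<^sup>2) / 2))) = complex_of_real (exp (- t\<^sup>2 / 2) * sqrt (2 * pi))" for t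
  proof -
    have "(LINT x|lborel. exp (- (t\<^sup>2 + x\<^sup>2) / 2)) = (LINT x|lborel. exp (- t\<^sup>2 / 2) * exp (- (6 * x\<^sup>2 / 12)))"
      by (intro Bochner_Integration.integral_cong refl) (simp add: exp_add[symmetric] add_divide_distrib)
    also have "\<dots> = exp (- t\<^sup>2 / 2) * sqrt (2 * pi)" using gauss_integrals(2)[of 6] by simp
    finally show ?thesis by (simp only: integral_complex_of_real)
  qed
  have ident: "Ew (A k) (rej_weight (A k) (q k) (n k)) (\<lambda>s. \<Prod>i\<in>s. CLINT x|M k. iexp (t * Z k i x)) *
      iexp (- (t * (\<Sum>i\<in>A k. q k i * (LINT x|M k. Z k i x)))) = (CLINT x|lborel. G t k x) / (CLINT x|lborel. G 0 k x)" for t k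
  proof -
    let ?c = "complex_of_real (2 * pi * size_prob (A k) (q k) (int (n k)) * sqrt (?d k))"
    have 1: "Ew (A k) (rej_weight (A k) (q k) (n k)) (\<lambda>s. \<Prod>i\<in>s. CLINT x|M k. iexp (t * Z k i x)) *
      iexp (- (t * (\<Sum>i\<in>A k. q k i * (LINT x|M k. Z k i x)))) = (CLINT x|lborel. G t k x) / ?c" for t
      using E_prod_char[OF d0] by (simp add: G_def)
    have "1 = (CLINT x|lborel. G 0 k x) / ?c"
      using 1[of 0] Ew_const[OF prob_weight_rej_weight, of k "1::complex"] by (simp add: prob_space)
    then have "(CLINT x|lborel. G 0 k x) = ?c" by (simp add: field_simps split: if_splits)
    then show ?thesis using 1[of t] by simp
  qed
  have "(\<lambda>k. (CLINT x|lborel. G t k x) / (CLINT x|lborel. G 0 k x)) \<longlonglongrightarrow>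
     complex_of_real (exp (- t\<^sup>2 / 2) * sqrt (2 * pi)) / complex_of_real (exp (- 0\<^sup>2 / 2) * sqrt (2 * pi))"
    using I_lim[of t, unfolded I] I_lim[of 0, unfolded I] by (intro tendsto_divide) auto
  then show ?thesis unfolding ident by (simp flip: of_real_exp of_real_divide)
qed

subsection \<open>Change of the sampling design\<close>

text \<open>Terms with \<open>w s = 0\<close> vanish by division by zero, in agreement with the
  restricted sum in \<open>d2\<close>.\<close>

definition chi2 :: "nat set \<Rightarrow> (nat set \<Rightarrow> real) \<Rightarrow> (nat set \<Rightarrow> real) \<Rightarrow> real" where
  "chi2 A w' w = (\<Sum>s\<in>Pow A. (w' s - w s)\<^sup>2 / w s)"

text \<open>Cauchy-Schwarz for \<open>((w' - w) / sqrt w) * (sqrt w * g)\<close>. Absolute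
  continuity is used at \<open>w s = 0\<close>, where this factorisation would lose the
  term.\<close>

lemma norm_Ew_diff_le:
  fixes g :: "nat set \<Rightarrow> 'b::real_normed_vector"
  assumes w: "prob_weight A w" and ac: "\<And>s. s \<subseteq> A \<Longrightarrow> w s = 0 \<Longrightarrow> w' s = 0"
  shows "norm (Ew A w' g - Ew A w g) \<le> sqrt (chi2 A w' w) * sqrt (Ew A w (\<lambda>s. (norm (g s))\<^sup>2))"
proof -
  have w0: "0 \<le> w s" if "s \<in> Pow A" for s using w that by (auto simp: prob_weight_def)
  have "Ew A w' g - Ew A w g = (\<Sum>s\<in>Pow A. (w' s - w s) *\<^sub>R g s)"
    by (simp add: Ew_def scaleR_diff_left sum_subtractf)
  also have "norm \<dots> \<le> (\<Sum>s\<in>Pow A. \<bar>w' s - w s\<bar> * norm (g s))"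
    by (intro order.trans[OF norm_sum] sum_mono) simp
  also have "\<dots> = (\<Sum>s\<in>Pow A. (\<bar>w' s - w s\<bar> / sqrt (w s)) * (sqrt (w s) * norm (g s)))"
  proof (rule sum.cong[OF refl])
    fix s assume "s \<in> Pow A"
    then show "\<bar>w' s - w s\<bar> * norm (g s) = (\<bar>w' s - w s\<bar> / sqrt (w s)) * (sqrt (w s) * norm (g s))"
      using ac[of s] w0[of s] by (cases "w s = 0") auto
  qed
  also have "\<dots> \<le> sqrt ((\<Sum>s\<in>Pow A. (\<bar>w' s - w s\<bar> / sqrt (w s))\<^sup>2) * (\<Sum>s\<in>Pow A. (sqrt (w s) * norm (g s))\<^sup>2))"
    by (intro real_le_rsqrt Cauchy_Schwarz_ineq_sum)
  also have "(\<Sum>s\<in>Pow A. (\<bar>w' s - w s\<bar> / sqrt (w s))\<^sup>2) = chi2 A w' w"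
    unfolding chi2_def using w0 by (intro sum.cong refl) (simp add: power_divide)
  also have "(\<Sum>s\<in>Pow A. (sqrt (w s) * norm (g s))\<^sup>2) = Ew A w (\<lambda>s. (norm (g s))\<^sup>2)"
    unfolding Ew_def using w0 by (intro sum.cong refl) (simp add: power_mult_distrib)
  finally show ?thesis by (simp add: real_sqrt_mult)
qed

lemma chi2_nonneg: "prob_weight A w \<Longrightarrow> 0 \<le> chi2 A w' w"
  unfolding chi2_def by (intro sum_nonneg) (auto simp: prob_weight_def)

text \<open>Second moments under \<open>w\<close> give first moments under \<open>w'\<close>; this
  is why fourth moments of the marks are enough for sums of squared marks.\<close>

lemma Ew_change_le:
  fixes g :: "nat set \<Rightarrow> real"
  assumes w: "prob_weight A w" and ac: "\<And>s. s \<subseteq> A \<Longrightarrow> w s = 0 \<Longrightarrow> w' s = 0"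
  shows "Ew A w' g \<le> (1 + sqrt (chi2 A w' w)) * sqrt (Ew A w (\<lambda>s. (g s)\<^sup>2))"
proof -
  have "Ew A w' g \<le> Ew A w g + sqrt (chi2 A w' w) * sqrt (Ew A w (\<lambda>s. (g s)\<^sup>2))"
  proof -
    have "norm (Ew A w' g - Ew A w g) \<le> sqrt (chi2 A w' w) * sqrt (Ew A w (\<lambda>s. (norm (g s))\<^sup>2))"
      by (rule norm_Ew_diff_le[OF w ac])
    then show ?thesis by (simp add: abs_le_iff)
  qed
  moreover have "Ew A w g \<le> sqrt (Ew A w (\<lambda>s. (g s)\<^sup>2))" by (intro real_le_rsqrt Ew_power2_le w)
  ultimately show ?thesis by (simp add: algebra_simps)
qed

subsection \<open>Moments of sums of independent variables\<close>

context prob_space begin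

lemma integrable_square_imp:
  fixes Y :: "'a \<Rightarrow> real"
  assumes "Y \<in> borel_measurable M" and "integrable M (\<lambda>x. (Y x)\<^sup>2)"
  shows "integrable M Y"
proof (rule Bochner_Integration.integrable_bound[where f = "\<lambda>x. 1 + (Y x)\<^sup>2"])
  show "AE x in M. norm (Y x) \<le> norm (1 + (Y x)\<^sup>2)"
  proof (rule AE_I2)
    fix x
    have "0 \<le> (\<bar>Y x\<bar> - 1)\<^sup>2 + (Y x)\<^sup>2 + 1" by simp
    then show "norm (Y x) \<le> norm (1 + (Y x)\<^sup>2)" by (simp add: power2_diff)
  qed
qed (use assms in auto)

lemma indep_sum_second_moment:
  fixes V :: "nat \<Rightarrow> 'a \<Rightarrow> real"
  assumes "finite I" "indep_vars (\<lambda>_. borel) V I" "\<And>i. i \<in> I \<Longrightarrow> integrable M (\<lambda>x. (V i x)\<^sup>2)"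
    and "\<And>i. i \<in> I \<Longrightarrow> expectation (V i) = 0"
  shows "integrable M (\<lambda>x. (\<Sum>i\<in>I. V i x)\<^sup>2) \<and> expectation (\<lambda>x. \<Sum>i\<in>I. V i x) = 0 \<and>
     expectation (\<lambda>x. (\<Sum>i\<in>I. V i x)\<^sup>2) = (\<Sum>i\<in>I. expectation (\<lambda>x. (V i x)\<^sup>2))"
  using assms
proof (induction I rule: finite_induct)
  case (insert i I)
  define S where "S x = (\<Sum>j\<in>I. V j x)" for x
  have ind: "indep_vars (\<lambda>_. borel) V I" using insert.prems(1) by (rule indep_vars_subset) auto
  have IH: "integrable M (\<lambda>x. (S x)\<^sup>2)" "expectation S = 0" 
     "expectation (\<lambda>x. (S x)\<^sup>2) = (\<Sum>i\<in>I. expectation (\<lambda>x. (V i x)\<^sup>2))"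
    using insert.IH[OF ind] insert.prems by (auto simp: S_def[abs_def])
  have Vm [measurable]: "V j \<in> borel_measurable M" if "j \<in> insert i I" for j
    using insert.prems(1) that unfolding indep_vars_def by auto
  have Sm [measurable]: "S \<in> borel_measurable M" unfolding S_def using Vm by (intro borel_measurable_sum) auto
  have iV: "integrable M (V i)" "integrable M (\<lambda>x. (V i x)\<^sup>2)" using insert.prems Vm by (auto intro: integrable_square_imp)
  have iS: "integrable M S" using IH(1) Sm by (rule integrable_square_imp[rotated])
  have ivar: "indep_var borel (V i) borel S"
    unfolding S_def using insert by (intro indep_vars_sum) auto
  note VS = indep_var_lebesgue_integral[OF ivar iV(1) iS] indep_var_integrable[OF ivar iV(1) iS]
  have e: "(\<lambda>x. (\<Sum>j\<in>insert i I. V j x)\<^sup>2) = (\<lambda>x. (V i x)\<^sup>2 + 2 * (V i x * S x) + (S x)\<^sup>2)"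
    using insert by (simp add: S_def power2_sum algebra_simps)
  have e1: "(\<lambda>x. \<Sum>j\<in>insert i I. V j x) = (\<lambda>x. V i x + S x)" using insert by (simp add: S_def)
  show ?case unfolding e e1 using iV IH iS VS insert by simp
qed (simp add: prob_space)

text \<open>In the fourth power of \<open>V i + S\<close> the odd terms vanish by independence and
  centring; six times the product of the second moments is the cross term in the square of the sum
  of variances.\<close>

lemma indep_sum_fourth_moment:
  fixes V :: "nat \<Rightarrow> 'a \<Rightarrow> real"
  assumes "finite I" "indep_vars (\<lambda>_. borel) V I" "\<And>i. i \<in> I \<Longrightarrow> integrable M (\<lambda>x. V i x ^ 4)"
    and "\<And>i. i \<in> I \<Longrightarrow> expectation (V i) = 0"
  shows "integrable M (\<lambda>x. (\<Sum>i\<in>I. V i x) ^ 4) \<and>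
     expectation (\<lambda>x. (\<Sum>i\<in>I. V i x) ^ 4) \<le> (\<Sum>i\<in>I. expectation (\<lambda>x. V i x ^ 4))
       + 3 * (\<Sum>i\<in>I. expectation (\<lambda>x. (V i x)\<^sup>2))\<^sup>2"
  using assms
proof (induction I rule: finite_induct)
  case (insert i I)
  define S where "S x = (\<Sum>j\<in>I. V j x)" for x
  have ind: "indep_vars (\<lambda>_. borel) V I" using insert.prems(1) by (rule indep_vars_subset) auto
  have Vm [measurable]: "V j \<in> borel_measurable M" if "j \<in> insert i I" for j
    using insert.prems(1) that unfolding indep_vars_def by auto
  have Sm [measurable]: "S \<in> borel_measurable M" unfolding S_def using Vm by (intro borel_measurable_sum) auto
  have iVk: "integrable M (\<lambda>x. V j x ^ k)" if "k \<le> 4" "j \<in> insert i I" for k j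
    by (rule integrable_power_le4[OF _ _ that(1)]) (use that insert.prems Vm in auto)
  have IH: "integrable M (\<lambda>x. S x ^ 4)" "expectation S = 0" 
     "expectation (\<lambda>x. (S x)\<^sup>2) = (\<Sum>i\<in>I. expectation (\<lambda>x. (V i x)\<^sup>2))"
     "expectation (\<lambda>x. S x ^ 4) \<le> (\<Sum>i\<in>I. expectation (\<lambda>x. V i x ^ 4)) + 3 * (\<Sum>i\<in>I. expectation (\<lambda>x. (V i x)\<^sup>2))\<^sup>2"
  proof -
    have "integrable M (\<lambda>x. (\<Sum>i\<in>I. V i x) ^ 4) \<and>
      expectation (\<lambda>x. (\<Sum>i\<in>I. V i x) ^ 4) \<le> (\<Sum>i\<in>I. expectation (\<lambda>x. V i x ^ 4))
       + 3 * (\<Sum>i\<in>I. expectation (\<lambda>x. (V i x)\<^sup>2))\<^sup>2"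
      using insert.prems by (intro insert.IH[OF ind]) auto
    moreover have "integrable M (\<lambda>x. (\<Sum>i\<in>I. V i x)\<^sup>2) \<and> expectation (\<lambda>x. \<Sum>i\<in>I. V i x) = 0 \<and>
      expectation (\<lambda>x. (\<Sum>i\<in>I. V i x)\<^sup>2) = (\<Sum>i\<in>I. expectation (\<lambda>x. (V i x)\<^sup>2))"
      by (rule indep_sum_second_moment[OF insert.hyps(1) ind]) (use iVk insert.prems in auto)
    ultimately show "integrable M (\<lambda>x. S x ^ 4)" "expectation S = 0" 
     "expectation (\<lambda>x. (S x)\<^sup>2) = (\<Sum>i\<in>I. expectation (\<lambda>x. (V i x)\<^sup>2))"
     "expectation (\<lambda>x. S x ^ 4) \<le> (\<Sum>i\<in>I. expectation (\<lambda>x. V i x ^ 4)) + 3 * (\<Sum>i\<in>I. expectation (\<lambda>x. (V i x)\<^sup>2))\<^sup>2"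
      unfolding S_def[abs_def] by blast+
  qed
  have iSk: "integrable M (\<lambda>x. S x ^ k)" if "k \<le> 4" for k
    by (rule integrable_power_le4[OF Sm IH(1) that])
  have ivar: "indep_var borel (V i) borel S"
    unfolding S_def using insert by (intro indep_vars_sum) auto
  have ivp: "indep_var borel (\<lambda>x. V i x ^ k) borel (\<lambda>x. S x ^ l)" for k l
    using indep_var_compose[OF ivar, of "\<lambda>x. x ^ k" borel "\<lambda>x. x ^ l" borel] by (simp add: comp_def)
  have VS: "expectation (\<lambda>x. V i x ^ k * S x ^ l) = expectation (\<lambda>x. V i x ^ k) * expectation (\<lambda>x. S x ^ l)"
    "integrable M (\<lambda>x. V i x ^ k * S x ^ l)" if "k \<le> 4" "l \<le> 4" for k l
    using indep_var_lebesgue_integral[OF ivp iVk iSk] indep_var_integrable[OF ivp iVk iSk] that by auto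
  have e: "(\<lambda>x. (\<Sum>j\<in>insert i I. V j x) ^ 4) = (\<lambda>x. V i x ^ 4 + 4 * (V i x ^ 3 * S x ^ 1) + 6 * (V i x ^ 2 * S x ^ 2)
     + 4 * (V i x ^ 1 * S x ^ 3) + S x ^ 4)"
  proof
    fix x
    have h: "(\<Sum>j\<in>insert i I. V j x) = V i x + S x" using insert by (simp add: S_def)
    show "(\<Sum>j\<in>insert i I. V j x) ^ 4 = V i x ^ 4 + 4 * (V i x ^ 3 * S x ^ 1) + 6 * (V i x ^ 2 * S x ^ 2)
     + 4 * (V i x ^ 1 * S x ^ 3) + S x ^ 4" unfolding h by algebra
  qed
  have int: "integrable M (\<lambda>x. (\<Sum>j\<in>insert i I. V j x) ^ 4)"
    unfolding e using VS(2)[of 3 1] VS(2)[of 2 2] VS(2)[of 1 3] iVk[of 4 i] IH(1) by simp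
  have "expectation (\<lambda>x. (\<Sum>j\<in>insert i I. V j x) ^ 4) = expectation (\<lambda>x. V i x ^ 4) +
     6 * (expectation (\<lambda>x. (V i x)\<^sup>2) * expectation (\<lambda>x. (S x)\<^sup>2)) + expectation (\<lambda>x. S x ^ 4)"
    unfolding e using VS(2)[of 3 1] VS(2)[of 2 2] VS(2)[of 1 3] iVk[of 4 i] IH(1) 
      VS(1)[of 3 1] VS(1)[of 2 2] VS(1)[of 1 3] IH(2) insert.prems(3)[of i]
    by simp
  also have "\<dots> \<le> (\<Sum>j\<in>insert i I. expectation (\<lambda>x. V j x ^ 4)) + 3 * (\<Sum>j\<in>insert i I. expectation (\<lambda>x. (V j x)\<^sup>2))\<^sup>2"
  proof -
    have "expectation (\<lambda>x. S x ^ 4) \<le> (\<Sum>i\<in>I. expectation (\<lambda>x. V i x ^ 4)) +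
      (3 * (\<Sum>i\<in>I. expectation (\<lambda>x. (V i x)\<^sup>2))\<^sup>2 + 3 * (expectation (\<lambda>x. (V i x)\<^sup>2))\<^sup>2)"
      using IH(4) zero_le_power2[of "expectation (\<lambda>x. (V i x)\<^sup>2)"] by linarith
    then show ?thesis using IH(3) insert.hyps by (simp add: power2_sum algebra_simps)
  qed
  finally show ?case using int by simp
qed simp

end

lemma sum_power2_le_card:
  fixes f :: "nat \<Rightarrow> real"
  assumes "\<And>i. i \<in> I \<Longrightarrow> 0 \<le> p i"
  shows "(\<Sum>i\<in>I. p i * f i)\<^sup>2 \<le> (\<Sum>i\<in>I. p i) * (\<Sum>i\<in>I. p i * (f i)\<^sup>2)"
proof -
  have "(\<Sum>i\<in>I. p i * f i) = (\<Sum>i\<in>I. sqrt (p i) * (sqrt (p i) * f i))"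
    using assms by (intro sum.cong refl) (simp flip: mult.assoc)
  also have "\<dots>\<^sup>2 \<le> (\<Sum>i\<in>I. (sqrt (p i))\<^sup>2) * (\<Sum>i\<in>I. (sqrt (p i) * f i)\<^sup>2)"
    by (rule Cauchy_Schwarz_ineq_sum)
  also have "\<dots> = (\<Sum>i\<in>I. p i) * (\<Sum>i\<in>I. p i * (f i)\<^sup>2)"
    using assms by (simp add: power_mult_distrib)
  finally show ?thesis .
qed

context prob_space begin

text \<open>The centre \<open>c\<close> is arbitrary because sums over a sample are compared with a
  Poisson mean, not with their own. The factor \<open>1 + 3 * card I\<close> comes from
  Cauchy-Schwarz on the sum of variances; it costs nothing in order, since for marks of order one
  the fourth moment of a sum of \<open>n\<close> terms has order \<open>n\<^sup>2\<close>
  anyway.\<close>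

lemma indep_sum_about:
  fixes V :: "nat \<Rightarrow> 'a \<Rightarrow> real"
  assumes I: "finite I" "indep_vars (\<lambda>_. borel) V I"
    and V2: "\<And>i. i \<in> I \<Longrightarrow> integrable M (\<lambda>x. (V i x)\<^sup>2)"
  shows "integrable M (\<lambda>x. ((\<Sum>i\<in>I. V i x) - c)\<^sup>2)"
    and "expectation (\<lambda>x. ((\<Sum>i\<in>I. V i x) - c)\<^sup>2) =
      (\<Sum>i\<in>I. expectation (\<lambda>x. (V i x)\<^sup>2) - (expectation (V i))\<^sup>2) + ((\<Sum>i\<in>I. expectation (V i)) - c)\<^sup>2"
    and "(\<And>i. i \<in> I \<Longrightarrow> integrable M (\<lambda>x. V i x ^ 4)) \<Longrightarrow> integrable M (\<lambda>x. ((\<Sum>i\<in>I. V i x) - c) ^ 4)"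
    and "(\<And>i. i \<in> I \<Longrightarrow> integrable M (\<lambda>x. V i x ^ 4)) \<Longrightarrow> expectation (\<lambda>x. ((\<Sum>i\<in>I. V i x) - c) ^ 4) \<le>
      8 * (\<Sum>i\<in>I. 16 * expectation (\<lambda>x. V i x ^ 4)) * (1 + 3 * card I) + 8 * ((\<Sum>i\<in>I. expectation (V i)) - c) ^ 4"
proof -
  define e where "e i = expectation (V i)" for i
  define U where "U i x = V i x - e i" for i x
  have Vm [measurable]: "V j \<in> borel_measurable M" if "j \<in> I" for j
    using I(2) that unfolding indep_vars_def by auto
  have iV: "integrable M (V i)" if "i \<in> I" for i using V2[OF that] Vm[OF that] by (rule integrable_square_imp[rotated])
  have indU: "indep_vars (\<lambda>_. borel) U I"
    unfolding U_def using indep_vars_compose2[OF I(2), of "\<lambda>i y. y - e i" "\<lambda>_. borel"] by simp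
  have U2e: "(\<lambda>x. (U i x)\<^sup>2) = (\<lambda>x. (V i x)\<^sup>2 - 2 * e i * V i x + (e i)\<^sup>2)" for i
    by (simp add: U_def power2_diff fun_eq_iff)
  have U2: "integrable M (\<lambda>x. (U i x)\<^sup>2)" if "i \<in> I" for i unfolding U2e using V2 iV that by simp
  have EU: "expectation (U i) = 0" if "i \<in> I" for i unfolding U_def e_def using iV that by (simp add: prob_space)
  have EU2: "expectation (\<lambda>x. (U i x)\<^sup>2) = expectation (\<lambda>x. (V i x)\<^sup>2) - (e i)\<^sup>2" if "i \<in> I" for i
    unfolding U2e using V2 iV that by (simp add: prob_space e_def power2_eq_square)
  define S where "S x = (\<Sum>i\<in>I. U i x)" for x
  define m where "m = (\<Sum>i\<in>I. e i) - c"
  have [measurable]: "S \<in> borel_measurable M" unfolding S_def U_def by measurable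
  have SV: "(\<Sum>i\<in>I. V i x) - c = S x + m" for x by (simp add: S_def U_def m_def sum_subtractf)
  have S: "integrable M (\<lambda>x. (S x)\<^sup>2)" "expectation S = 0" "expectation (\<lambda>x. (S x)\<^sup>2) = (\<Sum>i\<in>I. expectation (\<lambda>x. (U i x)\<^sup>2))"
    using indep_sum_second_moment[OF I(1) indU U2 EU] unfolding S_def[abs_def] by blast+
  have iS: "integrable M S" by (rule integrable_square_imp) (use S(1) in auto)
  have e2: "(\<lambda>x. (S x + m)\<^sup>2) = (\<lambda>x. (S x)\<^sup>2 + 2 * m * S x + m\<^sup>2)" by (simp add: power2_sum fun_eq_iff)
  show "integrable M (\<lambda>x. ((\<Sum>i\<in>I. V i x) - c)\<^sup>2)"
    unfolding SV e2 using S iS by simp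
  show "expectation (\<lambda>x. ((\<Sum>i\<in>I. V i x) - c)\<^sup>2) =
      (\<Sum>i\<in>I. expectation (\<lambda>x. (V i x)\<^sup>2) - (expectation (V i))\<^sup>2) + ((\<Sum>i\<in>I. expectation (V i)) - c)\<^sup>2"
    unfolding SV e2 using S iS EU2 by (simp add: prob_space m_def e_def)
  assume V4: "\<And>i. i \<in> I \<Longrightarrow> integrable M (\<lambda>x. V i x ^ 4)"
  have bound: "(y - z)^4 \<le> 8 * y ^ 4 + 8 * z ^ 4" for y z :: real
    using power4_add_le[of y "- z"] by simp
  have U4: "integrable M (\<lambda>x. U i x ^ 4)" if "i \<in> I" for i
  proof (rule Bochner_Integration.integrable_bound[where f = "\<lambda>x. 8 * V i x ^ 4 + 8 * e i ^ 4"])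
    show "AE x in M. norm (U i x ^ 4) \<le> norm (8 * V i x ^ 4 + 8 * e i ^ 4)"
    proof (rule AE_I2)
      fix x
      have "norm (U i x ^ 4) = U i x ^ 4" by simp
      also have "\<dots> \<le> 8 * V i x ^ 4 + 8 * e i ^ 4" unfolding U_def by (rule bound)
      also have "\<dots> \<le> norm \<dots>" by simp
      finally show "norm (U i x ^ 4) \<le> norm (8 * V i x ^ 4 + 8 * e i ^ 4)" .
    qed
    show "(\<lambda>x. U i x ^ 4) \<in> borel_measurable M" unfolding U_def using Vm[OF that] by measurable
  qed (use V4[OF that] in simp)
  have EU22: "(expectation (\<lambda>x. (U i x)\<^sup>2))\<^sup>2 \<le> expectation (\<lambda>x. U i x ^ 4)" if "i \<in> I" for i
  proof -
    have "variance (\<lambda>x. (U i x)\<^sup>2) = expectation (\<lambda>x. ((U i x)\<^sup>2)\<^sup>2) - (expectation (\<lambda>x. (U i x)\<^sup>2))\<^sup>2"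
      using U2[OF that] U4[OF that] by (intro variance_eq) auto
    then show ?thesis using variance_positive[of "\<lambda>x. (U i x)\<^sup>2"] by simp
  qed
  have e4: "e i ^ 4 \<le> expectation (\<lambda>x. V i x ^ 4)" if "i \<in> I" for i
  proof -
    have "e i ^ 4 = ((e i)\<^sup>2)\<^sup>2" by simp
    also have "\<dots> \<le> (expectation (\<lambda>x. (V i x)\<^sup>2))\<^sup>2"
      unfolding e_def by (intro power_mono expectation_power2_le Vm V4 that) auto
    also have "\<dots> \<le> expectation (\<lambda>x. V i x ^ 4)"
    proof -
      have "variance (\<lambda>x. (V i x)\<^sup>2) = expectation (\<lambda>x. ((V i x)\<^sup>2)\<^sup>2) - (expectation (\<lambda>x. (V i x)\<^sup>2))\<^sup>2"
        using V2[OF that] V4[OF that] by (intro variance_eq) auto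
      then show ?thesis using variance_positive[of "\<lambda>x. (V i x)\<^sup>2"] by simp
    qed
    finally show ?thesis .
  qed
  have EU4: "expectation (\<lambda>x. U i x ^ 4) \<le> 16 * expectation (\<lambda>x. V i x ^ 4)" if "i \<in> I" for i
  proof -
    have "expectation (\<lambda>x. U i x ^ 4) \<le> expectation (\<lambda>x. 8 * V i x ^ 4 + 8 * e i ^ 4)"
      using U4 V4 that bound by (intro integral_mono) (auto simp: U_def)
    then show ?thesis using e4[OF that] V4[OF that] by (simp add: prob_space)
  qed
  have S4: "integrable M (\<lambda>x. S x ^ 4)" "expectation (\<lambda>x. S x ^ 4) \<le> (\<Sum>i\<in>I. expectation (\<lambda>x. U i x ^ 4))
       + 3 * (\<Sum>i\<in>I. expectation (\<lambda>x. (U i x)\<^sup>2))\<^sup>2"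
    using indep_sum_fourth_moment[OF I(1) indU U4 EU] unfolding S_def[abs_def] by blast+
  have "(\<Sum>i\<in>I. expectation (\<lambda>x. (U i x)\<^sup>2))\<^sup>2 \<le> card I * (\<Sum>i\<in>I. (expectation (\<lambda>x. (U i x)\<^sup>2))\<^sup>2)"
    using sum_power2_le_card[of I "\<lambda>_. 1" "\<lambda>i. expectation (\<lambda>x. (U i x)\<^sup>2)"] by simp
  also have "\<dots> \<le> card I * (\<Sum>i\<in>I. expectation (\<lambda>x. U i x ^ 4))"
    using EU22 by (intro mult_left_mono sum_mono) auto
  finally have "expectation (\<lambda>x. S x ^ 4) \<le> (\<Sum>i\<in>I. expectation (\<lambda>x. U i x ^ 4)) * (1 + 3 * card I)"
    using S4(2) by (simp add: algebra_simps)
  also have "\<dots> \<le> (\<Sum>i\<in>I. 16 * expectation (\<lambda>x. V i x ^ 4)) * (1 + 3 * card I)"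
    using EU4 by (intro mult_right_mono sum_mono) auto
  finally have ES4: "expectation (\<lambda>x. S x ^ 4) \<le> (\<Sum>i\<in>I. 16 * expectation (\<lambda>x. V i x ^ 4)) * (1 + 3 * card I)" .
  show Sm4: "integrable M (\<lambda>x. ((\<Sum>i\<in>I. V i x) - c) ^ 4)"
    unfolding SV
  proof (rule Bochner_Integration.integrable_bound[where f = "\<lambda>x. 8 * S x ^ 4 + 8 * m ^ 4"])
    show "AE x in M. norm ((S x + m) ^ 4) \<le> norm (8 * S x ^ 4 + 8 * m ^ 4)"
    proof (rule AE_I2)
      fix x
      have "norm ((S x + m) ^ 4) = (S x + m) ^ 4" by simp
      also have "\<dots> \<le> 8 * S x ^ 4 + 8 * m ^ 4" by (rule power4_add_le)
      also have "\<dots> \<le> norm \<dots>" by simp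
      finally show "norm ((S x + m) ^ 4) \<le> norm (8 * S x ^ 4 + 8 * m ^ 4)" .
    qed
  qed (use S4 in auto)
  have "expectation (\<lambda>x. ((\<Sum>i\<in>I. V i x) - c) ^ 4) \<le> expectation (\<lambda>x. 8 * S x ^ 4 + 8 * m ^ 4)"
    using Sm4 S4(1) power4_add_le unfolding SV by (intro integral_mono) auto
  also have "\<dots> = 8 * expectation (\<lambda>x. S x ^ 4) + 8 * m ^ 4" using S4 by (simp add: prob_space)
  also have "\<dots> \<le> 8 * ((\<Sum>i\<in>I. 16 * expectation (\<lambda>x. V i x ^ 4)) * (1 + 3 * card I)) + 8 * m ^ 4"
    using ES4 by simp
  finally show "expectation (\<lambda>x. ((\<Sum>i\<in>I. V i x) - c) ^ 4) \<le>
      8 * (\<Sum>i\<in>I. 16 * expectation (\<lambda>x. V i x ^ 4)) * (1 + 3 * card I) + 8 * ((\<Sum>i\<in>I. expectation (V i)) - c) ^ 4"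
    by (simp add: m_def e_def mult.assoc)
qed

end

section \<open>Moments of sums of random marks over a rejective sample\<close>

context rejective begin

lemma n_ge_1: "1 \<le> real n"
proof -
  have "d \<le> (\<Sum>i\<in>A. q i)" unfolding size_var_def using q01 by (intro sum_mono mult_left_le) auto
  then show ?thesis using d1 sumq by simp
qed

lemma E_member_sum: "E (\<lambda>s. \<Sum>i\<in>s. f i) = (\<Sum>i\<in>A. \<pi> i * f i)" for f :: "nat \<Rightarrow> real"
  unfolding rej_incl_def by (rule Ew_member_sum[OF fin])

context
  fixes M :: "'w measure" and V :: "nat \<Rightarrow> 'w \<Rightarrow> real"
  assumes M: "prob_space M"
    and ind: "prob_space.indep_vars M (\<lambda>_. borel) V A"
begin

text \<open>Given \<open>s\<close>, the mean square splits into the variance of the marks and the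
  squared deviation of their means; the first is averaged with
  \<open>\<pi> i \<le> 33 * q i\<close>, the second falls under
  \<open>E_linear_moments\<close>.\<close>

lemma E_marks_second_moment:
  assumes V2: "\<And>i. i \<in> A \<Longrightarrow> integrable M (\<lambda>x. (V i x)\<^sup>2)"
  shows "E (\<lambda>s. LINT x|M. ((\<Sum>i\<in>s. V i x) - (\<Sum>i\<in>A. q i * (LINT x|M. V i x)))\<^sup>2)
    \<le> 48 * (\<Sum>i\<in>A. q i * (LINT x|M. (V i x)\<^sup>2))"
proof -
  interpret M: prob_space M by (rule M)
  let ?e = "\<lambda>i. LINT x|M. V i x" and ?e2 = "\<lambda>i. LINT x|M. (V i x)\<^sup>2"
  have Vm: "V j \<in> borel_measurable M" if "j \<in> A" for j
    using ind that unfolding M.indep_vars_def by auto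
  have v: "(?e i)\<^sup>2 \<le> ?e2 i" if "i \<in> A" for i
  proof -
    have "M.variance (V i) = ?e2 i - (?e i)\<^sup>2"
      using V2[OF that] M.integrable_square_imp[OF Vm[OF that] V2[OF that]] by (intro M.variance_eq)
    then show ?thesis using M.variance_positive[of "V i"] by linarith
  qed
  have "E (\<lambda>s. LINT x|M. ((\<Sum>i\<in>s. V i x) - (\<Sum>i\<in>A. q i * ?e i))\<^sup>2) =
    E (\<lambda>s. (\<Sum>i\<in>s. ?e2 i - (?e i)\<^sup>2) + ((\<Sum>i\<in>s. ?e i) - (\<Sum>i\<in>A. q i * ?e i))\<^sup>2)"
    by (intro Ew_cong M.indep_sum_about(2) M.indep_vars_subset[OF ind]) (use fin V2 in \<open>auto intro: finite_subset\<close>)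
  also have "\<dots> \<le> (\<Sum>i\<in>A. 33 * q i * (?e2 i - (?e i)\<^sup>2)) + 48 * (\<Sum>i\<in>A. q i * (1 - q i) * (?e i)\<^sup>2)"
    unfolding Ew_add E_member_sum using pi_le_q v
    by (intro add_mono sum_mono mult_right_mono E_linear_moments(1)) auto
  also have "\<dots> \<le> (\<Sum>i\<in>A. 48 * q i * (?e2 i - (?e i)\<^sup>2)) + (\<Sum>i\<in>A. 48 * q i * (?e i)\<^sup>2)"
    unfolding sum_distrib_left
  proof (intro add_mono sum_mono)
    fix i assume i: "i \<in> A"
    show "33 * q i * (?e2 i - (?e i)\<^sup>2) \<le> 48 * q i * (?e2 i - (?e i)\<^sup>2)"
      using v[OF i] q01[OF i] by (intro mult_right_mono) auto
    have "q i * (1 - q i) \<le> q i" using q01[OF i] by (intro mult_left_le) auto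
    then have "q i * (1 - q i) * (?e i)\<^sup>2 \<le> q i * (?e i)\<^sup>2" by (rule mult_right_mono) simp
    then show "48 * (q i * (1 - q i) * (?e i)\<^sup>2) \<le> 48 * q i * (?e i)\<^sup>2" by simp
  qed
  also have "\<dots> = 48 * (\<Sum>i\<in>A. q i * ?e2 i)"
    by (simp add: sum_distrib_left algebra_simps flip: sum.distrib)
  finally show ?thesis .
qed

text \<open>Same splitting as for the second moment. All samples have \<open>n\<close> members, so
  both parts are at most a constant times \<open>n\<close> times the weighted sum of fourth moments;
  the constants add up to \<open>16896 + 4608 + 1536 = 23040\<close>.\<close>

lemma E_marks_fourth_moment:
  assumes V4: "\<And>i. i \<in> A \<Longrightarrow> integrable M (\<lambda>x. V i x ^ 4)"
  shows "E (\<lambda>s. LINT x|M. ((\<Sum>i\<in>s. V i x) - (\<Sum>i\<in>A. q i * (LINT x|M. V i x))) ^ 4)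
    \<le> 24000 * n * (\<Sum>i\<in>A. q i * (LINT x|M. V i x ^ 4))"
proof -
  interpret M: prob_space M by (rule M)
  let ?e = "\<lambda>i. LINT x|M. V i x" and ?e4 = "\<lambda>i. LINT x|M. V i x ^ 4"
  let ?T = "\<Sum>i\<in>A. q i * ?e4 i"
  have Vm: "V j \<in> borel_measurable M" if "j \<in> A" for j
    using ind that unfolding M.indep_vars_def by auto
  have V2: "integrable M (\<lambda>x. (V i x)\<^sup>2)" if "i \<in> A" for i
    using M.integrable_power_le4[OF Vm V4, of i 2] that by simp
  have e4: "?e i ^ 4 \<le> ?e4 i" if "i \<in> A" for i
  proof -
    have "?e i ^ 4 = ((?e i)\<^sup>2)\<^sup>2" by simp
    also have "\<dots> \<le> (LINT x|M. (V i x)\<^sup>2)\<^sup>2"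
      by (intro power_mono M.expectation_power2_le Vm V4 that) auto
    also have "\<dots> \<le> ?e4 i"
    proof -
      have "M.variance (\<lambda>x. (V i x)\<^sup>2) = (LINT x|M. ((V i x)\<^sup>2)\<^sup>2) - (LINT x|M. (V i x)\<^sup>2)\<^sup>2"
        using V2[OF that] V4[OF that] by (intro M.variance_eq) auto
      then show ?thesis using M.variance_positive[of "\<lambda>x. (V i x)\<^sup>2"] by simp
    qed
    finally show ?thesis .
  qed
  have e40: "0 \<le> ?e4 i" for i by simp
  have T0: "0 \<le> ?T" using q01 by (intro sum_nonneg mult_nonneg_nonneg) auto
  have n0: "0 \<le> real n" by simp
  have "E (\<lambda>s. LINT x|M. ((\<Sum>i\<in>s. V i x) - (\<Sum>i\<in>A. q i * ?e i)) ^ 4) \<le>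
    E (\<lambda>s. (\<Sum>i\<in>s. 128 * (1 + 3 * n) * ?e4 i) + 8 * ((\<Sum>i\<in>s. ?e i) - (\<Sum>i\<in>A. q i * ?e i)) ^ 4)"
  proof (rule Ew_mono[OF prob_weight_rej_weight])
    fix s assume s: "s \<subseteq> A" "rej_weight A q n s \<noteq> 0"
    have c: "card s = n" using s by (auto simp: rej_weight_def split: if_splits)
    have "(LINT x|M. ((\<Sum>i\<in>s. V i x) - (\<Sum>i\<in>A. q i * ?e i)) ^ 4) \<le>
      8 * (\<Sum>i\<in>s. 16 * ?e4 i) * (1 + 3 * card s) + 8 * ((\<Sum>i\<in>s. ?e i) - (\<Sum>i\<in>A. q i * ?e i)) ^ 4"
      using s fin V2 V4 M.indep_vars_subset[OF ind s(1)] by (intro M.indep_sum_about(4)) (auto intro: finite_subset)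
    then show "(LINT x|M. ((\<Sum>i\<in>s. V i x) - (\<Sum>i\<in>A. q i * ?e i)) ^ 4) \<le>
      (\<Sum>i\<in>s. 128 * (1 + 3 * n) * ?e4 i) + 8 * ((\<Sum>i\<in>s. ?e i) - (\<Sum>i\<in>A. q i * ?e i)) ^ 4"
      unfolding c sum_distrib_left[symmetric] by (simp add: algebra_simps)
  qed
  also have "\<dots> = (\<Sum>i\<in>A. \<pi> i * (128 * (1 + 3 * n) * ?e4 i)) + 8 * E (\<lambda>s. ((\<Sum>i\<in>s. ?e i) - (\<Sum>i\<in>A. q i * ?e i)) ^ 4)"
    unfolding Ew_add Ew_cmult E_member_sum ..
  also have "\<dots> \<le> (\<Sum>i\<in>A. (33 * q i) * (128 * (4 * n) * ?e4 i)) + 8 * (192 * (?T + 3 * (n * ?T)))"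
  proof (intro add_mono mult_left_mono)
    show "(\<Sum>i\<in>A. \<pi> i * (128 * (1 + 3 * n) * ?e4 i)) \<le> (\<Sum>i\<in>A. (33 * q i) * (128 * (4 * n) * ?e4 i))"
      using pi_le_q pi_le q01 n_ge_1 by (intro sum_mono mult_mono) auto
    have qq: "q i * (1 - q i) \<le> q i" "0 \<le> q i * (1 - q i)" if "i \<in> A" for i
      using q01[OF that] mult_left_le[of "1 - q i" "q i"] by auto
    have "(\<Sum>i\<in>A. q i * (1 - q i) * (?e i)^4) \<le> ?T"
    proof (rule sum_mono)
      fix i assume i: "i \<in> A"
      show "q i * (1 - q i) * (?e i)^4 \<le> q i * ?e4 i"
        using qq[OF i] q01[OF i] e4[OF i] by (intro mult_mono) auto
    qed
    moreover have "(\<Sum>i\<in>A. q i * (1 - q i) * (?e i)\<^sup>2)\<^sup>2 \<le> n * ?T"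
    proof -
      have "(\<Sum>i\<in>A. q i * (1 - q i) * (?e i)\<^sup>2)\<^sup>2 \<le> (\<Sum>i\<in>A. q i * (?e i)\<^sup>2)\<^sup>2"
        using qq q01 by (intro power_mono sum_mono mult_right_mono sum_nonneg mult_nonneg_nonneg) auto
      also have "\<dots> \<le> (\<Sum>i\<in>A. q i) * (\<Sum>i\<in>A. q i * ((?e i)\<^sup>2)\<^sup>2)"
        by (rule sum_power2_le_card) (use q01 in auto)
      also have "\<dots> \<le> n * ?T" unfolding sumq using q01 e4 by (intro mult_left_mono sum_mono) auto
      finally show ?thesis .
    qed
    ultimately have "(\<Sum>i\<in>A. q i * (1 - q i) * ?e i ^ 4) + 3 * (\<Sum>i\<in>A. q i * (1 - q i) * (?e i)\<^sup>2)\<^sup>2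
       \<le> ?T + 3 * (n * ?T)" by linarith
    then show "E (\<lambda>s. ((\<Sum>i\<in>s. ?e i) - (\<Sum>i\<in>A. q i * ?e i)) ^ 4) \<le> 192 * (?T + 3 * (n * ?T))"
      by (intro order.trans[OF E_linear_moments(2)] mult_left_mono) auto
  qed auto
  also have "(\<Sum>i\<in>A. (33 * q i) * (128 * (4 * n) * ?e4 i)) = 16896 * (n * ?T)"
    by (simp add: sum_distrib_left mult_ac)
  also have "16896 * (n * ?T) + 8 * (192 * (?T + 3 * (n * ?T))) = 21504 * (n * ?T) + 1536 * ?T"
    by simp
  also have "\<dots> \<le> 21504 * (n * ?T) + 1536 * (n * ?T)"
    using T0 n_ge_1 mult_right_mono[OF n_ge_1 T0] by linarith
  also have "\<dots> \<le> 24000 * n * ?T" using mult_nonneg_nonneg[OF n0 T0] by linarith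
  finally show ?thesis .
qed

end
end

subsection \<open>Hajek's variance estimator for marked samples\<close>

text \<open>
  In the application \<open>Z i\<close> is \<open>n\<close> times the centred expanded PSU total and \<open>\<delta> i\<close> is \<open>n\<^sup>2\<close> times the
  expanded variance estimator of PSU \<open>i\<close>, so that all moments are of order one; \<open>P\<close> is the actual
  first-stage design.  The condition \<open>centred\<close> makes the sum of the marks asymptotically uncorrelated
  with the Poisson sample size, so that conditioning on the size does not affect its variance
  \<open>n * nu\<close> to first order.
\<close>

locale marked_design = rejective A q n + M: prob_space M
  for A :: "nat set" and q :: "nat \<Rightarrow> real" and n :: nat and M :: "'w measure" +
  fixes P :: "nat set \<Rightarrow> real" and Z \<delta> :: "nat \<Rightarrow> 'w \<Rightarrow> real" and K :: real
  assumes P: "prob_weight A P"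
    and ac: "\<And>s. s \<subseteq> A \<Longrightarrow> rej_weight A q n s = 0 \<Longrightarrow> P s = 0"
    and inclP: "\<And>i. i \<in> A \<Longrightarrow> Ew A P (\<lambda>s. of_bool (i \<in> s)) = \<pi> i"
    and ind: "M.indep_vars (\<lambda>_. borel \<Otimes>\<^sub>M borel) (\<lambda>i x. (Z i x, \<delta> i x)) A"
    and Z4: "\<And>i. i \<in> A \<Longrightarrow> integrable M (\<lambda>x. Z i x ^ 4)"
    and \<delta>2: "\<And>i. i \<in> A \<Longrightarrow> integrable M (\<lambda>x. (\<delta> i x)\<^sup>2)"
    and centred: "(\<Sum>i\<in>A. q i * (1 - q i) * M.expectation (Z i)) = 0"
    and E\<delta>: "\<And>i. i \<in> A \<Longrightarrow> M.expectation (\<delta> i) = \<pi> i * (M.expectation (\<lambda>x. (Z i x)\<^sup>2) - (M.expectation (Z i))\<^sup>2)"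
    and KZ: "(\<Sum>i\<in>A. q i * M.expectation (\<lambda>x. Z i x ^ 4)) \<le> K * n"
    and K\<delta>: "(\<Sum>i\<in>A. q i * M.expectation (\<lambda>x. (\<delta> i x)\<^sup>2)) \<le> K * n"
begin

abbreviation "e i \<equiv> M.expectation (Z i)"
abbreviation "e2 i \<equiv> M.expectation (\<lambda>x. (Z i x)\<^sup>2)"
abbreviation "c \<equiv> chi2 A P (rej_weight A q n)"

definition nu :: real where "nu = (\<Sum>i\<in>A. q i * e2 i - (q i)\<^sup>2 * (e i)\<^sup>2) / n"

text \<open>Centred at the mean under Poisson sampling, the centring that appears in the limit law,
  and not at the mean under \<open>P\<close>.\<close>

definition G :: "nat set \<Rightarrow> 'w \<Rightarrow> real" where "G s x = (\<Sum>i\<in>s. Z i x) - (\<Sum>i\<in>A. q i * e i)"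

definition H :: "nat set \<Rightarrow> 'w \<Rightarrow> real" where
  "H s x = (\<Sum>i\<in>s. (1 - \<pi> i) * (Z i x - (\<Sum>i\<in>s. (1 - \<pi> i) * Z i x) / (\<Sum>i\<in>s. 1 - \<pi> i))\<^sup>2) + (\<Sum>i\<in>s. \<delta> i x)"

lemma n0: "0 < real n" using n_ge_1 by linarith

lemma indf: "M.indep_vars (\<lambda>_. borel) (\<lambda>i x. f i (Z i x) (\<delta> i x)) A"
  if "\<And>i. (\<lambda>z. f i (fst z) (snd z)) \<in> borel_measurable (borel \<Otimes>\<^sub>M borel)" for f :: "nat \<Rightarrow> real \<Rightarrow> real \<Rightarrow> real"
  using M.indep_vars_compose2[OF ind, of "\<lambda>i z. f i (fst z) (snd z)" "\<lambda>_. borel"] that by simp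

lemma indZ: "M.indep_vars (\<lambda>_. borel) Z A" using indf[of "\<lambda>i z w. z"] by simp

lemma Zm [measurable]: "i \<in> A \<Longrightarrow> Z i \<in> borel_measurable M"
  using indZ unfolding M.indep_vars_def by auto

lemma \<delta>m [measurable]: "i \<in> A \<Longrightarrow> \<delta> i \<in> borel_measurable M"
  using indf[of "\<lambda>i z w. w"] unfolding M.indep_vars_def by auto

lemma Zk: "i \<in> A \<Longrightarrow> k \<le> 4 \<Longrightarrow> integrable M (\<lambda>x. Z i x ^ k)"
  by (rule M.integrable_power_le4[OF Zm Z4])

lemma Z1: "i \<in> A \<Longrightarrow> integrable M (Z i)" using Zk[of i 1] by simp
lemma Z2: "i \<in> A \<Longrightarrow> integrable M (\<lambda>x. (Z i x)\<^sup>2)" using Zk[of i 2] by simp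
lemma \<delta>1: "i \<in> A \<Longrightarrow> integrable M (\<delta> i)" by (rule M.integrable_square_imp[OF \<delta>m \<delta>2])

lemma e_le: "i \<in> A \<Longrightarrow> (e i)\<^sup>2 \<le> e2 i" by (rule M.expectation_power2_le[OF Zm Z4])

lemma e2_le: "i \<in> A \<Longrightarrow> (e2 i)\<^sup>2 \<le> M.expectation (\<lambda>x. Z i x ^ 4)"
proof -
  assume i: "i \<in> A"
  have "M.variance (\<lambda>x. (Z i x)\<^sup>2) = M.expectation (\<lambda>x. ((Z i x)\<^sup>2)\<^sup>2) - (e2 i)\<^sup>2"
    using Z2[OF i] Z4[OF i] by (intro M.variance_eq) auto
  then show ?thesis using M.variance_positive[of "\<lambda>x. (Z i x)\<^sup>2"] by simp
qed

lemma K0: "0 \<le> K"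
proof -
  have "0 \<le> (\<Sum>i\<in>A. q i * M.expectation (\<lambda>x. Z i x ^ 4))"
    using q01 by (intro sum_nonneg mult_nonneg_nonneg) auto
  then have "0 \<le> K * n" using KZ by linarith
  then show ?thesis using n0 by (simp add: zero_le_mult_iff)
qed

lemma sum_q_e2: "(\<Sum>i\<in>A. q i * e2 i) \<le> n * sqrt K"
proof -
  have "(\<Sum>i\<in>A. q i * e2 i)\<^sup>2 \<le> (\<Sum>i\<in>A. q i) * (\<Sum>i\<in>A. q i * (e2 i)\<^sup>2)"
    by (rule sum_power2_le_card) (use q01 in auto)
  also have "\<dots> \<le> n * (\<Sum>i\<in>A. q i * M.expectation (\<lambda>x. Z i x ^ 4))"
    unfolding sumq using q01 e2_le by (intro mult_left_mono sum_mono) auto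
  also have "\<dots> \<le> n * (K * n)" using KZ by (intro mult_left_mono) auto
  finally have "(\<Sum>i\<in>A. q i * e2 i) \<le> sqrt (n * (K * n))" by (rule real_le_rsqrt)
  then show ?thesis by (simp add: real_sqrt_mult mult_ac)
qed

lemma qe_le: "i \<in> A \<Longrightarrow> q i * (1 - q i) * (e i)\<^sup>2 \<le> q i * e2 i - (q i)\<^sup>2 * (e i)\<^sup>2"
proof -
  assume i: "i \<in> A"
  have "q i * (e i)\<^sup>2 \<le> q i * e2 i" using e_le[OF i] q01[OF i] by (intro mult_left_mono) auto
  then show ?thesis by (simp add: algebra_simps power2_eq_square)
qed

lemma nu_bounds: "0 \<le> nu" "nu \<le> sqrt K" "(\<Sum>i\<in>A. q i * (1 - q i) * (e i)\<^sup>2) \<le> n * nu"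
proof -
  have nn: "n * nu = (\<Sum>i\<in>A. q i * e2 i - (q i)\<^sup>2 * (e i)\<^sup>2)" using n0 by (simp add: nu_def)
  show 1: "(\<Sum>i\<in>A. q i * (1 - q i) * (e i)\<^sup>2) \<le> n * nu" unfolding nn by (intro sum_mono qe_le)
  have "0 \<le> (\<Sum>i\<in>A. q i * (1 - q i) * (e i)\<^sup>2)" using q01 by (intro sum_nonneg mult_nonneg_nonneg) auto
  then have "0 \<le> n * nu" using 1 by linarith
  then show "0 \<le> nu" using n0 by (simp add: zero_le_mult_iff)
  have "n * nu \<le> (\<Sum>i\<in>A. q i * e2 i)" unfolding nn by (intro sum_mono) auto
  also note sum_q_e2
  finally show "nu \<le> sqrt K" using n0 by simp
qed

lemma EG4: "E (\<lambda>s. M.expectation (\<lambda>x. G s x ^ 4)) \<le> 24000 * K * n\<^sup>2"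
proof -
  have "E (\<lambda>s. M.expectation (\<lambda>x. G s x ^ 4)) \<le> 24000 * n * (\<Sum>i\<in>A. q i * M.expectation (\<lambda>x. Z i x ^ 4))"
    unfolding G_def using E_marks_fourth_moment[OF M.prob_space_axioms indZ Z4] by simp
  also have "\<dots> \<le> 24000 * n * (K * n)" using KZ by (intro mult_left_mono) auto
  finally show ?thesis by (simp add: power2_eq_square mult_ac)
qed

lemma G4: "s \<subseteq> A \<Longrightarrow> integrable M (\<lambda>x. G s x ^ 4)"
  unfolding G_def using fin Z2 Z4 M.indep_vars_subset[OF indZ]
  by (intro M.indep_sum_about(3)) (auto intro: finite_subset)

lemma Gm [measurable]: "s \<subseteq> A \<Longrightarrow> G s \<in> borel_measurable M"
  unfolding G_def by (intro borel_measurable_diff borel_measurable_sum) auto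

lemma c0: "0 \<le> c" by (rule chi2_nonneg[OF prob_weight_rej_weight])

text \<open>The variance under \<open>P\<close> is at most the second moment about the Poisson mean,
  which the change of design compares with \<open>n * nu\<close>; \<open>768 = 192 * 4\<close>. Read
  backwards, this bounds \<open>nu\<close> from below by the first-stage variance.\<close>

lemma V1_bound:
  "Ew A P (\<lambda>s. ((\<Sum>i\<in>s. e i) - (\<Sum>i\<in>A. \<pi> i * e i))\<^sup>2) \<le> 48 * n * nu + sqrt c * (sqrt (768 * K) * n)"
proof -
  let ?Y = "\<lambda>s. (\<Sum>i\<in>s. e i) - (\<Sum>i\<in>A. q i * e i)"
  let ?m = "Ew A P ?Y"
  have m: "?m = (\<Sum>i\<in>A. \<pi> i * e i) - (\<Sum>i\<in>A. q i * e i)"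
    using inclP by (simp add: Ew_diff Ew_const[OF P] Ew_member_sum[OF fin])
  have "Ew A P (\<lambda>s. ((\<Sum>i\<in>s. e i) - (\<Sum>i\<in>A. \<pi> i * e i))\<^sup>2) = Ew A P (\<lambda>s. (?Y s)\<^sup>2 - 2 * ?m * ?Y s + ?m\<^sup>2)"
  proof (rule Ew_cong)
    fix s
    have "(\<Sum>i\<in>s. e i) - (\<Sum>i\<in>A. \<pi> i * e i) = ?Y s - ?m" unfolding m by simp
    then show "((\<Sum>i\<in>s. e i) - (\<Sum>i\<in>A. \<pi> i * e i))\<^sup>2 = (?Y s)\<^sup>2 - 2 * ?m * ?Y s + ?m\<^sup>2"
      by (simp only: power2_diff) (simp add: mult_ac)
  qed
  also have "\<dots> = Ew A P (\<lambda>s. (?Y s)\<^sup>2) - 2 * ?m * ?m + ?m\<^sup>2"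
    unfolding Ew_add[of A P _ "\<lambda>_. ?m\<^sup>2"] Ew_diff[of A P "\<lambda>s. (?Y s)\<^sup>2"] Ew_cmult Ew_const[OF P] ..
  also have "\<dots> \<le> Ew A P (\<lambda>s. (?Y s)\<^sup>2)" by (simp add: power2_eq_square)
  also have "\<dots> \<le> E (\<lambda>s. (?Y s)\<^sup>2) + sqrt c * sqrt (E (\<lambda>s. (norm ((?Y s)\<^sup>2))\<^sup>2))"
  proof -
    have "norm (Ew A P (\<lambda>s. (?Y s)\<^sup>2) - E (\<lambda>s. (?Y s)\<^sup>2)) \<le> sqrt c * sqrt (E (\<lambda>s. (norm ((?Y s)\<^sup>2))\<^sup>2))"
      by (rule norm_Ew_diff_le[OF prob_weight_rej_weight ac])
    then show ?thesis by (simp add: abs_le_iff)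
  qed
  also have "E (\<lambda>s. (norm ((?Y s)\<^sup>2))\<^sup>2) = E (\<lambda>s. ?Y s ^ 4)" by simp
  also have "E (\<lambda>s. (?Y s)\<^sup>2) + sqrt c * sqrt (E (\<lambda>s. ?Y s ^ 4)) \<le> 48 * (n * nu) + sqrt c * sqrt (768 * K * n\<^sup>2)"
  proof (intro add_mono mult_left_mono real_sqrt_le_mono)
    show "E (\<lambda>s. (?Y s)\<^sup>2) \<le> 48 * (n * nu)"
      by (rule order.trans[OF E_linear_moments(1)]) (use nu_bounds(3) in simp)
    have "(\<Sum>i\<in>A. q i * (1 - q i) * e i ^ 4) \<le> K * n"
    proof (rule order.trans[OF sum_mono KZ])
      fix i assume i: "i \<in> A"
      have "e i ^ 4 = ((e i)\<^sup>2)\<^sup>2" by simp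
      also have "\<dots> \<le> (e2 i)\<^sup>2" using e_le[OF i] by (intro power_mono) auto
      also note e2_le[OF i]
      finally have "e i ^ 4 \<le> M.expectation (\<lambda>x. Z i x ^ 4)" .
      then show "q i * (1 - q i) * e i ^ 4 \<le> q i * M.expectation (\<lambda>x. Z i x ^ 4)"
        using q01[OF i] by (intro mult_mono mult_left_le) auto
    qed
    also have "K * n \<le> K * n\<^sup>2" using n_ge_1 K0 by (intro mult_left_mono) (auto simp: power2_eq_square)
    finally have 4: "(\<Sum>i\<in>A. q i * (1 - q i) * e i ^ 4) \<le> K * n\<^sup>2" .
    have "(\<Sum>i\<in>A. q i * (1 - q i) * (e i)\<^sup>2)\<^sup>2 \<le> (n * sqrt K)\<^sup>2"
    proof (rule power_mono)
      have "(\<Sum>i\<in>A. q i * (1 - q i) * (e i)\<^sup>2) \<le> n * nu" by (rule nu_bounds)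
      also have "\<dots> \<le> n * sqrt K" using nu_bounds by (intro mult_left_mono) auto
      finally show "(\<Sum>i\<in>A. q i * (1 - q i) * (e i)\<^sup>2) \<le> n * sqrt K" .
    qed (use q01 in \<open>auto intro!: sum_nonneg mult_nonneg_nonneg\<close>)
    also have "\<dots> = K * n\<^sup>2" using K0 by (simp add: power_mult_distrib)
    finally have 2: "(\<Sum>i\<in>A. q i * (1 - q i) * (e i)\<^sup>2)\<^sup>2 \<le> K * n\<^sup>2" .
    show "E (\<lambda>s. ?Y s ^ 4) \<le> 768 * K * n\<^sup>2"
      by (rule order.trans[OF E_linear_moments(2)]) (use 4 2 in simp)
  qed (use c0 in auto)
  finally show ?thesis by (simp add: real_sqrt_mult mult_ac)
qed

text \<open>Jensen's inequality over the marks, after \<open>Ew_change_le\<close> over the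
  design.\<close>

lemma EE_abs_le:
  fixes Y :: "nat set \<Rightarrow> 'w \<Rightarrow> real"
  assumes "\<And>s. s \<subseteq> A \<Longrightarrow> Y s \<in> borel_measurable M" "\<And>s. s \<subseteq> A \<Longrightarrow> integrable M (\<lambda>x. (Y s x)\<^sup>2)"
    and "E (\<lambda>s. M.expectation (\<lambda>x. (Y s x)\<^sup>2)) \<le> B"
  shows "Ew A P (\<lambda>s. M.expectation (\<lambda>x. \<bar>Y s x\<bar>)) \<le> (1 + sqrt c) * sqrt B"
proof -
  have "Ew A P (\<lambda>s. M.expectation (\<lambda>x. \<bar>Y s x\<bar>)) \<le> (1 + sqrt c) * sqrt (E (\<lambda>s. (M.expectation (\<lambda>x. \<bar>Y s x\<bar>))\<^sup>2))"
    by (rule Ew_change_le[OF prob_weight_rej_weight ac])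
  also have "\<dots> \<le> (1 + sqrt c) * sqrt B"
  proof (intro mult_left_mono real_sqrt_le_mono order.trans[OF Ew_mono[OF prob_weight_rej_weight] assms(3)])
    fix s assume s: "s \<subseteq> A"
    have "M.variance (\<lambda>x. \<bar>Y s x\<bar>) = M.expectation (\<lambda>x. \<bar>Y s x\<bar>\<^sup>2) - (M.expectation (\<lambda>x. \<bar>Y s x\<bar>))\<^sup>2"
      using assms(2)[OF s] M.integrable_square_imp[OF assms(1)[OF s] assms(2)[OF s]] by (intro M.variance_eq) auto
    then show "(M.expectation (\<lambda>x. \<bar>Y s x\<bar>))\<^sup>2 \<le> M.expectation (\<lambda>x. (Y s x)\<^sup>2)"
      using M.variance_positive[of "\<lambda>x. \<bar>Y s x\<bar>"] by simp
  qed (use c0 in auto)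
  finally show ?thesis .
qed

text \<open>Expanding the square, Hajek's estimator is the sum of \<open>Q\<close> minus the squared
  sum of \<open>R\<close> over \<open>den\<close>. \<open>Q'\<close> is \<open>Q\<close> without the
  second-stage part; its sum dominates the subtracted term.\<close>

definition Q :: "nat \<Rightarrow> 'w \<Rightarrow> real" where "Q i x = (1 - \<pi> i) * (Z i x)\<^sup>2 + \<delta> i x"
definition Q' :: "nat \<Rightarrow> 'w \<Rightarrow> real" where "Q' i x = (1 - \<pi> i) * (Z i x)\<^sup>2"
definition R :: "nat \<Rightarrow> 'w \<Rightarrow> real" where "R i x = (1 - \<pi> i) * Z i x"
definition den :: "nat set \<Rightarrow> real" where "den s = (\<Sum>i\<in>s. 1 - \<pi> i)"

lemma ind_QR:
  "M.indep_vars (\<lambda>_. borel) Q A" "M.indep_vars (\<lambda>_. borel) Q' A" "M.indep_vars (\<lambda>_. borel) R A"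
  unfolding Q_def Q'_def R_def
  using indf[of "\<lambda>i z w. (1 - \<pi> i) * z\<^sup>2 + w"] indf[of "\<lambda>i z w. (1 - \<pi> i) * z\<^sup>2"] indf[of "\<lambda>i z w. (1 - \<pi> i) * z"]
  by simp_all

lemma QR_meas [measurable]:
  "i \<in> A \<Longrightarrow> Q i \<in> borel_measurable M" "i \<in> A \<Longrightarrow> Q' i \<in> borel_measurable M" "i \<in> A \<Longrightarrow> R i \<in> borel_measurable M"
  using ind_QR unfolding M.indep_vars_def by auto

lemma pi01: "i \<in> A \<Longrightarrow> 0 \<le> 1 - \<pi> i" "i \<in> A \<Longrightarrow> 1 - \<pi> i \<le> 1" using pi_le by auto

lemma Q_sq_le: "i \<in> A \<Longrightarrow> (Q i x)\<^sup>2 \<le> 2 * Z i x ^ 4 + 2 * (\<delta> i x)\<^sup>2" "i \<in> A \<Longrightarrow> (Q' i x)\<^sup>2 \<le> Z i x ^ 4"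
  "i \<in> A \<Longrightarrow> R i x ^ 4 \<le> Z i x ^ 4"
proof -
  assume i: "i \<in> A"
  have p: "(1 - \<pi> i) ^ k \<le> 1" "0 \<le> (1 - \<pi> i) ^ k" for k
    using pi01[OF i] by (auto intro: power_le_one)
  have *: "((1 - \<pi> i) * (Z i x)\<^sup>2)\<^sup>2 \<le> Z i x ^ 4"
    using mult_right_mono[OF p(1)[of 2], of "Z i x ^ 4"] by (simp add: power_mult_distrib)
  then show "(Q' i x)\<^sup>2 \<le> Z i x ^ 4" by (simp add: Q'_def)
  show "(Q i x)\<^sup>2 \<le> 2 * Z i x ^ 4 + 2 * (\<delta> i x)\<^sup>2"
    using power2_add_le[of "(1 - \<pi> i) * (Z i x)\<^sup>2" "\<delta> i x"] * by (simp add: Q_def)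
  show "R i x ^ 4 \<le> Z i x ^ 4"
    using mult_right_mono[OF p(1)[of 4], of "Z i x ^ 4"] by (simp add: R_def power_mult_distrib)
qed

lemma QR_int:
  "i \<in> A \<Longrightarrow> integrable M (\<lambda>x. (Q i x)\<^sup>2)" "i \<in> A \<Longrightarrow> integrable M (\<lambda>x. (Q' i x)\<^sup>2)" "i \<in> A \<Longrightarrow> integrable M (\<lambda>x. R i x ^ 4)"
proof -
  assume i: "i \<in> A"
  show "integrable M (\<lambda>x. (Q i x)\<^sup>2)"
    by (rule Bochner_Integration.integrable_bound[where f = "\<lambda>x. 2 * Z i x ^ 4 + 2 * (\<delta> i x)\<^sup>2"])
      (use i Z4 \<delta>2 Q_sq_le(1)[OF i] in \<open>auto intro!: AE_I2 order.trans[OF _ abs_ge_self]\<close>)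
  show "integrable M (\<lambda>x. (Q' i x)\<^sup>2)"
    by (rule Bochner_Integration.integrable_bound[OF Z4[OF i]]) (use i Q_sq_le(2)[OF i] in auto)
  show "integrable M (\<lambda>x. R i x ^ 4)"
    by (rule Bochner_Integration.integrable_bound[OF Z4[OF i]]) (use i Q_sq_le(3)[OF i] in auto)
qed

lemma sum_about_int:
  assumes s: "s \<subseteq> A"
  shows "integrable M (\<lambda>x. ((\<Sum>i\<in>s. Q i x) - a)\<^sup>2)" "integrable M (\<lambda>x. ((\<Sum>i\<in>s. Q' i x) - a)\<^sup>2)"
    "integrable M (\<lambda>x. ((\<Sum>i\<in>s. R i x) - a) ^ 4)"
proof -
  have f: "finite s" using s fin by (rule finite_subset)
  have R2: "integrable M (\<lambda>x. (R i x)\<^sup>2)" if "i \<in> A" for i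
    using M.integrable_power_le4[OF QR_meas(3) QR_int(3), of i 2] that by simp
  show "integrable M (\<lambda>x. ((\<Sum>i\<in>s. Q i x) - a)\<^sup>2)"
    using s f by (intro M.indep_sum_about(1) M.indep_vars_subset[OF ind_QR(1)] QR_int) auto
  show "integrable M (\<lambda>x. ((\<Sum>i\<in>s. Q' i x) - a)\<^sup>2)"
    using s f by (intro M.indep_sum_about(1) M.indep_vars_subset[OF ind_QR(2)] QR_int) auto
  show "integrable M (\<lambda>x. ((\<Sum>i\<in>s. R i x) - a) ^ 4)"
    using s f R2 by (intro M.indep_sum_about(3) M.indep_vars_subset[OF ind_QR(3)] QR_int) auto
qed

lemma EE_Q: "Ew A P (\<lambda>s. M.expectation (\<lambda>x. \<bar>(\<Sum>i\<in>s. Q i x) - (\<Sum>i\<in>A. q i * M.expectation (Q i))\<bar>))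
    \<le> (1 + sqrt c) * sqrt (192 * K * n)"
proof (rule EE_abs_le)
  have "E (\<lambda>s. M.expectation (\<lambda>x. ((\<Sum>i\<in>s. Q i x) - (\<Sum>i\<in>A. q i * M.expectation (Q i)))\<^sup>2))
    \<le> 48 * (\<Sum>i\<in>A. q i * M.expectation (\<lambda>x. (Q i x)\<^sup>2))"
    by (rule E_marks_second_moment[OF M.prob_space_axioms ind_QR(1) QR_int(1)])
  also have "\<dots> \<le> 48 * (\<Sum>i\<in>A. q i * (2 * M.expectation (\<lambda>x. Z i x ^ 4) + 2 * M.expectation (\<lambda>x. (\<delta> i x)\<^sup>2)))"
  proof (intro mult_left_mono sum_mono)
    fix i assume i: "i \<in> A"
    have "M.expectation (\<lambda>x. (Q i x)\<^sup>2) \<le> M.expectation (\<lambda>x. 2 * Z i x ^ 4 + 2 * (\<delta> i x)\<^sup>2)"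
      using i Z4 \<delta>2 QR_int Q_sq_le by (intro integral_mono) auto
    then show "M.expectation (\<lambda>x. (Q i x)\<^sup>2) \<le> 2 * M.expectation (\<lambda>x. Z i x ^ 4) + 2 * M.expectation (\<lambda>x. (\<delta> i x)\<^sup>2)"
      using i Z4 \<delta>2 by simp
  qed (use q01 in auto)
  also have "\<dots> = 96 * (\<Sum>i\<in>A. q i * M.expectation (\<lambda>x. Z i x ^ 4)) + 96 * (\<Sum>i\<in>A. q i * M.expectation (\<lambda>x. (\<delta> i x)\<^sup>2))"
    by (simp add: sum_distrib_left sum.distrib distrib_left mult_ac)
  also have "\<dots> \<le> 96 * (K * n) + 96 * (K * n)" using KZ K\<delta> by (intro add_mono mult_left_mono) auto
  finally show "E (\<lambda>s. M.expectation (\<lambda>x. ((\<Sum>i\<in>s. Q i x) - (\<Sum>i\<in>A. q i * M.expectation (Q i)))\<^sup>2)) \<le> 192 * K * n"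
    by simp
qed (auto intro!: sum_about_int borel_measurable_diff borel_measurable_sum)

lemma EE_Q': "Ew A P (\<lambda>s. M.expectation (\<lambda>x. \<bar>(\<Sum>i\<in>s. Q' i x) - (\<Sum>i\<in>A. q i * M.expectation (Q' i))\<bar>))
    \<le> (1 + sqrt c) * sqrt (192 * K * n)"
proof (rule EE_abs_le)
  have "E (\<lambda>s. M.expectation (\<lambda>x. ((\<Sum>i\<in>s. Q' i x) - (\<Sum>i\<in>A. q i * M.expectation (Q' i)))\<^sup>2))
    \<le> 48 * (\<Sum>i\<in>A. q i * M.expectation (\<lambda>x. (Q' i x)\<^sup>2))"
    by (rule E_marks_second_moment[OF M.prob_space_axioms ind_QR(2) QR_int(2)])
  also have "\<dots> \<le> 48 * (\<Sum>i\<in>A. q i * M.expectation (\<lambda>x. Z i x ^ 4))"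
    using q01 Z4 QR_int Q_sq_le by (intro mult_left_mono sum_mono integral_mono) auto
  also have "\<dots> \<le> 192 * K * n" using KZ mult_nonneg_nonneg[OF K0, of n] by simp
  finally show "E (\<lambda>s. M.expectation (\<lambda>x. ((\<Sum>i\<in>s. Q' i x) - (\<Sum>i\<in>A. q i * M.expectation (Q' i)))\<^sup>2)) \<le> 192 * K * n" .
qed (auto intro!: sum_about_int borel_measurable_diff borel_measurable_sum)

lemma EE_R: "Ew A P (\<lambda>s. M.expectation (\<lambda>x. ((\<Sum>i\<in>s. R i x) - (\<Sum>i\<in>A. q i * M.expectation (R i)))\<^sup>2))
    \<le> (1 + sqrt c) * (sqrt (24000 * K) * n)"
proof -
  have "Ew A P (\<lambda>s. M.expectation (\<lambda>x. \<bar>((\<Sum>i\<in>s. R i x) - (\<Sum>i\<in>A. q i * M.expectation (R i)))\<^sup>2\<bar>))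
    \<le> (1 + sqrt c) * sqrt (24000 * K * n\<^sup>2)"
  proof (rule EE_abs_le)
    have "E (\<lambda>s. M.expectation (\<lambda>x. ((\<Sum>i\<in>s. R i x) - (\<Sum>i\<in>A. q i * M.expectation (R i))) ^ 4))
      \<le> 24000 * n * (\<Sum>i\<in>A. q i * M.expectation (\<lambda>x. R i x ^ 4))"
      using E_marks_fourth_moment[OF M.prob_space_axioms ind_QR(3) QR_int(3)] by simp
    also have "\<dots> \<le> 24000 * n * (\<Sum>i\<in>A. q i * M.expectation (\<lambda>x. Z i x ^ 4))"
      using q01 Z4 QR_int Q_sq_le by (intro mult_left_mono sum_mono integral_mono) auto
    also have "\<dots> \<le> 24000 * n * (K * n)" using KZ by (intro mult_left_mono) auto
    finally show "E (\<lambda>s. M.expectation (\<lambda>x. (((\<Sum>i\<in>s. R i x) - (\<Sum>i\<in>A. q i * M.expectation (R i)))\<^sup>2)\<^sup>2)) \<le> 24000 * K * n\<^sup>2"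
      by (simp add: power2_eq_square[of "real n"] mult_ac)
  next
    fix s assume s: "s \<subseteq> A"
    show "integrable M (\<lambda>x. (((\<Sum>i\<in>s. R i x) - (\<Sum>i\<in>A. q i * M.expectation (R i)))\<^sup>2)\<^sup>2)"
      using sum_about_int(3)[OF s] by simp
    show "(\<lambda>x. ((\<Sum>i\<in>s. R i x) - (\<Sum>i\<in>A. q i * M.expectation (R i)))\<^sup>2) \<in> borel_measurable M"
      using s by (intro borel_measurable_power borel_measurable_diff borel_measurable_sum) auto
  qed
  then show ?thesis by (simp add: real_sqrt_mult)
qed

text \<open>By \<open>E\<delta>\<close> the mean of \<open>Q i\<close> is
  \<open>e2 i - \<pi> i * (e i)\<^sup>2\<close>: the second-stage term restores exactly the share of
  the mark variance that the factor \<open>1 - \<pi> i\<close> removes. Only the exchange of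
  \<open>\<pi> i\<close> and \<open>q i\<close> in the last term is left to estimate.\<close>

lemma EQ_diff: "\<bar>(\<Sum>i\<in>A. q i * M.expectation (Q i)) - n * nu\<bar> \<le> 32 / sqrt d * (n * sqrt K)"
proof -
  have "(\<Sum>i\<in>A. q i * M.expectation (Q i)) - n * nu = (\<Sum>i\<in>A. q i * (q i - \<pi> i) * (e i)\<^sup>2)"
  proof -
    have nn: "n * nu = (\<Sum>i\<in>A. q i * e2 i - (q i)\<^sup>2 * (e i)\<^sup>2)" using n0 by (simp add: nu_def)
    have EQ: "M.expectation (Q i) = (1 - \<pi> i) * e2 i + \<pi> i * (e2 i - (e i)\<^sup>2)" if "i \<in> A" for i
      unfolding Q_def using Z2[OF that] \<delta>1[OF that] E\<delta>[OF that] by simp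
    then show ?thesis unfolding nn sum_subtractf[symmetric]
      by (intro sum.cong refl) (simp add: EQ algebra_simps power2_eq_square)
  qed
  also have "\<bar>\<dots>\<bar> \<le> (\<Sum>i\<in>A. 32 / sqrt d * (q i * e2 i))"
  proof (rule order.trans[OF sum_abs sum_mono])
    fix i assume i: "i \<in> A"
    have "\<bar>q i - \<pi> i\<bar> \<le> 32 / sqrt d * (q i * (1 - q i))" using pi_minus_q[OF i] by (simp add: abs_minus_commute)
    also have "\<dots> \<le> 32 / sqrt d * 1"
      using q01[OF i] d1 by (intro mult_left_mono mult_le_one) auto
    finally have "q i * \<bar>q i - \<pi> i\<bar> * (e i)\<^sup>2 \<le> q i * (32 / sqrt d * 1) * e2 i"
      using q01[OF i] e_le[OF i] d1 by (intro mult_mono) auto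
    then show "\<bar>q i * (q i - \<pi> i) * (e i)\<^sup>2\<bar> \<le> 32 / sqrt d * (q i * e2 i)"
      using q01[OF i] by (simp add: abs_mult mult_ac)
  qed
  also have "\<dots> \<le> 32 / sqrt d * (n * sqrt K)"
    unfolding sum_distrib_left[symmetric] using sum_q_e2 d1 by (intro mult_left_mono) auto
  finally show ?thesis .
qed

text \<open>With \<open>q\<close> in place of \<open>\<pi>\<close> the sum would be 0 by
  \<open>centred\<close>; the difference is governed by \<open>32 / sqrt d\<close>, and
  \<open>1024 = 32\<^sup>2\<close>.\<close>

lemma ER_small: "(\<Sum>i\<in>A. q i * M.expectation (R i))\<^sup>2 \<le> 1024 / d * (n\<^sup>2 * sqrt K)"
proof -
  have ER: "M.expectation (R i) = (1 - \<pi> i) * e i" if "i \<in> A" for i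
    unfolding R_def using Z1[OF that] by simp
  have "(\<Sum>i\<in>A. q i * M.expectation (R i)) = (\<Sum>i\<in>A. q i * M.expectation (R i)) - (\<Sum>i\<in>A. q i * (1 - q i) * e i)"
    using centred by simp
  also have "\<dots> = (\<Sum>i\<in>A. q i * (q i - \<pi> i) * e i)"
    unfolding sum_subtractf[symmetric] by (intro sum.cong refl) (simp add: ER algebra_simps)
  finally have 1: "(\<Sum>i\<in>A. q i * M.expectation (R i)) = (\<Sum>i\<in>A. q i * ((q i - \<pi> i) * e i))" by (simp add: mult_ac)
  have "(\<Sum>i\<in>A. q i * M.expectation (R i))\<^sup>2 \<le> (\<Sum>i\<in>A. q i) * (\<Sum>i\<in>A. q i * ((q i - \<pi> i) * e i)\<^sup>2)"
    unfolding 1 by (rule sum_power2_le_card) (use q01 in auto)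
  also have "\<dots> \<le> n * (\<Sum>i\<in>A. q i * (1024 / d * e2 i))"
    unfolding sumq
  proof (intro mult_left_mono sum_mono)
    fix i assume i: "i \<in> A"
    have "\<bar>q i - \<pi> i\<bar> \<le> 32 / sqrt d * (q i * (1 - q i))" using pi_minus_q[OF i] by (simp add: abs_minus_commute)
    also have "\<dots> \<le> 32 / sqrt d * 1"
      using q01[OF i] d1 by (intro mult_left_mono mult_le_one) auto
    finally have "\<bar>q i - \<pi> i\<bar>\<^sup>2 \<le> (32 / sqrt d)\<^sup>2" by (intro power_mono) auto
    then have "(q i - \<pi> i)\<^sup>2 \<le> 1024 / d" using d1 by (simp add: power_divide)
    then have "(q i - \<pi> i)\<^sup>2 * (e i)\<^sup>2 \<le> 1024 / d * e2 i" using e_le[OF i] d1 by (intro mult_mono) auto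
    then show "((q i - \<pi> i) * e i)\<^sup>2 \<le> 1024 / d * e2 i" by (simp add: power_mult_distrib)
  qed (use q01 in auto)
  also have "\<dots> = n * (1024 / d * (\<Sum>i\<in>A. q i * e2 i))"
    by (simp add: sum_distrib_left sum_divide_distrib mult_ac)
  also have "\<dots> \<le> n * (1024 / d * (n * sqrt K))" using sum_q_e2 d1 by (intro mult_left_mono) auto
  finally show ?thesis by (simp add: power2_eq_square mult_ac)
qed

text \<open>Chebyshev's inequality for the linear statistic \<open>den\<close>, whose Poisson mean
  is at least \<open>d / 2\<close>. The threshold \<open>4096 = 64\<^sup>2\<close> makes
  \<open>32 / sqrt d \<le> 1/2\<close> in \<open>pi_minus_q\<close>;
  \<open>768 = 16 * 48\<close>.\<close>

lemma den_small:
  assumes d: "4096 \<le> d"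
  shows "Ew A P (\<lambda>s. of_bool (den s < d / 4)) \<le> (1 + sqrt c) * sqrt (768 / d)"
proof -
  let ?m = "\<Sum>i\<in>A. q i * (1 - \<pi> i)"
  have r: "32 / sqrt d \<le> 1/2"
  proof -
    have "64 = sqrt (64\<^sup>2)" by (simp only: real_sqrt_abs)
    also have "\<dots> \<le> sqrt d" using d by (intro real_sqrt_le_mono) simp
    finally have "64 \<le> sqrt d" .
    then have "32 / sqrt d \<le> 32 / 64" using d by (intro divide_left_mono) auto
    then show ?thesis by simp
  qed
  have m: "d / 2 \<le> ?m"
    unfolding size_var_def sum_divide_distrib
  proof (rule sum_mono)
    fix i assume i: "i \<in> A"
    have q: "0 \<le> q i" "q i \<le> 1" using q01[OF i] by auto
    have "32 / sqrt d * (q i * (1 - q i)) \<le> 1/2 * (q i * (1 - q i))" using r q by (intro mult_right_mono) auto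
    also have "\<dots> \<le> 1/2 * (1 - q i)" using q by (intro mult_left_mono mult_left_le_one_le) auto
    finally have "(1 - q i) / 2 \<le> 1 - \<pi> i" using pi_minus_q[OF i] by (simp add: abs_le_iff)
    then have "q i * ((1 - q i) / 2) \<le> q i * (1 - \<pi> i)" using q by (intro mult_left_mono) auto
    then show "q i * (1 - q i) / 2 \<le> q i * (1 - \<pi> i)" by simp
  qed
  have dpos: "0 < d" using d by simp
  have "Ew A P (\<lambda>s. of_bool (den s < d / 4)) \<le> (1 + sqrt c) * sqrt (E (\<lambda>s. (of_bool (den s < d / 4))\<^sup>2))"
    by (rule Ew_change_le[OF prob_weight_rej_weight ac])
  also have "\<dots> \<le> (1 + sqrt c) * sqrt (768 / d)"
  proof (intro mult_left_mono real_sqrt_le_mono)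
    have "E (\<lambda>s. (of_bool (den s < d / 4))\<^sup>2) \<le> E (\<lambda>s. 16 / d\<^sup>2 * (den s - ?m)\<^sup>2)"
    proof (rule Ew_mono[OF prob_weight_rej_weight])
      fix s
      show "(of_bool (den s < d / 4))\<^sup>2 \<le> 16 / d\<^sup>2 * (den s - ?m)\<^sup>2"
      proof (cases "den s < d / 4")
        case True
        then have "d / 4 \<le> ?m - den s" using m by simp
        then have "(d / 4)\<^sup>2 \<le> (?m - den s)\<^sup>2" using dpos by (intro power_mono) auto
        then have "16 / d\<^sup>2 * (d / 4)\<^sup>2 \<le> 16 / d\<^sup>2 * (?m - den s)\<^sup>2" by (intro mult_left_mono) auto
        moreover have "16 / d\<^sup>2 * (d / 4)\<^sup>2 = 1" using dpos by (simp add: power_divide)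
        ultimately show ?thesis using True by (simp add: power2_commute)
      qed simp
    qed
    also have "\<dots> = 16 / d\<^sup>2 * E (\<lambda>s. (den s - ?m)\<^sup>2)" by (rule Ew_cmult)
    also have "\<dots> \<le> 16 / d\<^sup>2 * (48 * d)"
    proof (rule mult_left_mono)
      have "E (\<lambda>s. (den s - ?m)\<^sup>2) \<le> 48 * (\<Sum>i\<in>A. q i * (1 - q i) * (1 - \<pi> i)\<^sup>2)"
        unfolding den_def by (rule E_linear_moments(1))
      also have "\<dots> \<le> 48 * d" unfolding size_var_def
        using q01 pi01 by (intro mult_left_mono sum_mono mult_left_le power_le_one mult_nonneg_nonneg) auto
      finally show "E (\<lambda>s. (den s - ?m)\<^sup>2) \<le> 48 * d" .
    qed simp
    also have "\<dots> = 768 / d" using dpos by (simp add: power2_eq_square)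
    finally show "E (\<lambda>s. (of_bool (den s < d / 4))\<^sup>2) \<le> 768 / d" .
  qed (use c0 in auto)
  finally show ?thesis .
qed

lemma H_eq:
  assumes "s \<subseteq> A"
  shows "H s x = (\<Sum>i\<in>s. Q i x) - (\<Sum>i\<in>s. R i x)\<^sup>2 / den s"
proof -
  have f: "finite s" using assms fin by (rule finite_subset)
  define r where "r = (\<Sum>i\<in>s. R i x) / den s"
  have "(\<Sum>i\<in>s. (1 - \<pi> i) * (Z i x - r)\<^sup>2) = (\<Sum>i\<in>s. Q' i x) - (\<Sum>i\<in>s. R i x)\<^sup>2 / den s"
  \<comment> \<open>If \<open>den s = 0\<close>, all weights \<open>1 - \<pi> i\<close> vanish and
    the quotients are 0 by division by zero.\<close>
  proof (cases "den s = 0")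
    case True
    then have "\<forall>i\<in>s. 1 - \<pi> i = 0" unfolding den_def using f pi01 assms by (subst (asm) sum_nonneg_eq_0_iff) auto
    then show ?thesis using True by (simp add: Q'_def)
  next
    case False
    have "(\<Sum>i\<in>s. (1 - \<pi> i) * (Z i x - r)\<^sup>2) = (\<Sum>i\<in>s. Q' i x - 2 * r * R i x + r\<^sup>2 * (1 - \<pi> i))"
      by (intro sum.cong refl) (simp add: Q'_def R_def power2_diff algebra_simps)
    also have "\<dots> = (\<Sum>i\<in>s. Q' i x) - 2 * r * (\<Sum>i\<in>s. R i x) + r\<^sup>2 * den s"
      unfolding den_def sum_distrib_left by (simp only: sum.distrib sum_subtractf)
    also have "\<dots> = (\<Sum>i\<in>s. Q' i x) - (\<Sum>i\<in>s. R i x)\<^sup>2 / den s"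
      using False by (simp add: r_def power2_eq_square field_simps)
    finally show ?thesis .
  qed
  then show ?thesis
    unfolding H_def r_def den_def R_def by (simp add: Q_def Q'_def sum.distrib)
qed

text \<open>Cauchy-Schwarz with weights \<open>1 - \<pi> i\<close>. The bound by the sum of
  \<open>Q'\<close> involves no lower bound on \<open>den\<close>, so it remains available on the
  event where \<open>den\<close> is small.\<close>

lemma rem_bounds:
  assumes "s \<subseteq> A"
  shows "0 \<le> (\<Sum>i\<in>s. R i x)\<^sup>2 / den s" "(\<Sum>i\<in>s. R i x)\<^sup>2 / den s \<le> (\<Sum>i\<in>s. Q' i x)" "0 \<le> den s"
proof -
  have f: "finite s" using assms fin by (rule finite_subset)
  show d0: "0 \<le> den s" unfolding den_def using assms pi01 by (intro sum_nonneg) auto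
  then show "0 \<le> (\<Sum>i\<in>s. R i x)\<^sup>2 / den s" by simp
  have "(\<Sum>i\<in>s. R i x)\<^sup>2 \<le> den s * (\<Sum>i\<in>s. Q' i x)"
    unfolding den_def R_def Q'_def using assms pi01 by (intro sum_power2_le_card) auto
  moreover have "0 \<le> (\<Sum>i\<in>s. Q' i x)" unfolding Q'_def using assms pi01 by (intro sum_nonneg) auto
  ultimately show "(\<Sum>i\<in>s. R i x)\<^sup>2 / den s \<le> (\<Sum>i\<in>s. Q' i x)"
    using d0 by (cases "den s = 0") (auto simp: divide_le_eq mult.commute)
qed

lemma sum_int:
  assumes s: "s \<subseteq> A"
  shows "integrable M (\<lambda>x. \<Sum>i\<in>s. Q i x)" "integrable M (\<lambda>x. \<Sum>i\<in>s. Q' i x)" "integrable M (\<lambda>x. (\<Sum>i\<in>s. R i x)\<^sup>2)"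
    "integrable M (\<lambda>x. ((\<Sum>i\<in>s. R i x) - a)\<^sup>2)"
proof -
  have Qi: "integrable M (Q i)" "integrable M (Q' i)" if "i \<in> A" for i
    using that by (auto intro: M.integrable_square_imp[OF QR_meas(1) QR_int(1)] M.integrable_square_imp[OF QR_meas(2) QR_int(2)])
  show "integrable M (\<lambda>x. \<Sum>i\<in>s. Q i x)" "integrable M (\<lambda>x. \<Sum>i\<in>s. Q' i x)"
    using s Qi by (auto intro!: Bochner_Integration.integrable_sum)
  have m: "(\<lambda>x. (\<Sum>i\<in>s. R i x) - a) \<in> borel_measurable M" for a
    using s by (intro borel_measurable_diff borel_measurable_sum) auto
  show 1: "integrable M (\<lambda>x. ((\<Sum>i\<in>s. R i x) - a)\<^sup>2)" for a
    by (rule M.integrable_power_le4[OF m sum_about_int(3)[OF s]]) simp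
  show "integrable M (\<lambda>x. (\<Sum>i\<in>s. R i x)\<^sup>2)" using 1[of 0] by simp
qed

lemma H_int: "s \<subseteq> A \<Longrightarrow> integrable M (H s)"
  using sum_int[of s] by (simp add: H_eq cong: Bochner_Integration.integrable_cong)

text \<open>Where \<open>den\<close> is at least \<open>d / 4\<close>, the subtracted square is
  controlled by the second moment of the sum of \<open>R\<close>; elsewhere it is bounded by the sum
  of \<open>Q'\<close>, which is close to a constant at most \<open>n * sqrt K\<close>, on an event
  of small probability.\<close>

lemma EE_H:
  assumes d: "4096 \<le> d"
  defines "C \<equiv> 1 + sqrt c"
  shows "Ew A P (\<lambda>s. M.expectation (\<lambda>x. \<bar>H s x - n * nu\<bar>)) \<le>
    2 * C * sqrt (192 * K * n) + 32 / sqrt d * (n * sqrt K) + n * sqrt K * (C * sqrt (768 / d))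
     + 4 / d * (2 * (C * (sqrt (24000 * K) * n)) + 2 * (1024 / d * (n\<^sup>2 * sqrt K)))"
proof -
  let ?mQ = "\<Sum>i\<in>A. q i * M.expectation (Q i)"
  let ?mQ' = "\<Sum>i\<in>A. q i * M.expectation (Q' i)"
  let ?mR = "\<Sum>i\<in>A. q i * M.expectation (R i)"
  have dpos: "0 < d" using d by simp
  have mQ': "0 \<le> ?mQ'" "?mQ' \<le> n * sqrt K"
  proof -
    have EQ': "M.expectation (Q' i) = (1 - \<pi> i) * e2 i" if "i \<in> A" for i
      unfolding Q'_def using Z2[OF that] by simp
    show "0 \<le> ?mQ'" using q01 pi01 by (intro sum_nonneg) (auto simp: EQ')
    have "?mQ' \<le> (\<Sum>i\<in>A. q i * e2 i)"
      using q01 pi01 by (intro sum_mono mult_left_mono) (auto simp: EQ' intro!: mult_left_le_one_le)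
    then show "?mQ' \<le> n * sqrt K" using sum_q_e2 by linarith
  qed
  have pointwise: "\<bar>H s x - n * nu\<bar> \<le> \<bar>(\<Sum>i\<in>s. Q i x) - ?mQ\<bar> + 32 / sqrt d * (n * sqrt K)
     + \<bar>(\<Sum>i\<in>s. Q' i x) - ?mQ'\<bar> + n * sqrt K * of_bool (den s < d / 4)
     + 4 / d * (2 * ((\<Sum>i\<in>s. R i x) - ?mR)\<^sup>2 + 2 * (1024 / d * (n\<^sup>2 * sqrt K)))" if s: "s \<subseteq> A" for s x
  proof -
    let ?rem = "(\<Sum>i\<in>s. R i x)\<^sup>2 / den s"
    have R2: "(\<Sum>i\<in>s. R i x)\<^sup>2 \<le> 2 * ((\<Sum>i\<in>s. R i x) - ?mR)\<^sup>2 + 2 * (1024 / d * (n\<^sup>2 * sqrt K))"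
      using power2_add_le[of "(\<Sum>i\<in>s. R i x) - ?mR" ?mR] ER_small by simp
    have "?rem \<le> \<bar>(\<Sum>i\<in>s. Q' i x) - ?mQ'\<bar> + n * sqrt K * of_bool (den s < d / 4)
     + 4 / d * (2 * ((\<Sum>i\<in>s. R i x) - ?mR)\<^sup>2 + 2 * (1024 / d * (n\<^sup>2 * sqrt K)))"
    proof (cases "den s < d / 4")
      case True
      have "0 \<le> 4 / d * (2 * ((\<Sum>i\<in>s. R i x) - ?mR)\<^sup>2 + 2 * (1024 / d * (n\<^sup>2 * sqrt K)))"
        using dpos K0 by (intro mult_nonneg_nonneg add_nonneg_nonneg) auto
      moreover have "?rem \<le> \<bar>(\<Sum>i\<in>s. Q' i x) - ?mQ'\<bar> + n * sqrt K"
        using rem_bounds(2)[OF s, of x] mQ' by linarith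
      ultimately show ?thesis using True by simp
    next
      case False
      have "?rem \<le> (\<Sum>i\<in>s. R i x)\<^sup>2 / (d / 4)"
        using False dpos by (intro divide_left_mono) auto
      also have "\<dots> = 4 / d * (\<Sum>i\<in>s. R i x)\<^sup>2" by simp
      also have "\<dots> \<le> 4 / d * (2 * ((\<Sum>i\<in>s. R i x) - ?mR)\<^sup>2 + 2 * (1024 / d * (n\<^sup>2 * sqrt K)))"
        using R2 dpos by (intro mult_left_mono) auto
      finally show ?thesis using False by simp
    qed
    moreover have "\<bar>H s x - n * nu\<bar> \<le> \<bar>(\<Sum>i\<in>s. Q i x) - ?mQ\<bar> + \<bar>?mQ - n * nu\<bar> + ?rem"
      unfolding H_eq[OF s] using rem_bounds(1)[OF s, of x] by linarith
    ultimately show ?thesis using EQ_diff by linarith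
  qed
  have int_abs: "integrable M (\<lambda>x. \<bar>(\<Sum>i\<in>s. Q i x) - ?mQ\<bar>)" "integrable M (\<lambda>x. \<bar>(\<Sum>i\<in>s. Q' i x) - ?mQ'\<bar>)"
    "integrable M (\<lambda>x. ((\<Sum>i\<in>s. R i x) - ?mR)\<^sup>2)" "integrable M (\<lambda>x. \<bar>H s x - n * nu\<bar>)" if "s \<subseteq> A" for s
    using sum_int[OF that] H_int[OF that] by auto
  have "Ew A P (\<lambda>s. M.expectation (\<lambda>x. \<bar>H s x - n * nu\<bar>)) \<le> Ew A P (\<lambda>s. 
     M.expectation (\<lambda>x. \<bar>(\<Sum>i\<in>s. Q i x) - ?mQ\<bar>) + 32 / sqrt d * (n * sqrt K)
     + M.expectation (\<lambda>x. \<bar>(\<Sum>i\<in>s. Q' i x) - ?mQ'\<bar>) + n * sqrt K * of_bool (den s < d / 4)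
     + 4 / d * (2 * M.expectation (\<lambda>x. ((\<Sum>i\<in>s. R i x) - ?mR)\<^sup>2) + 2 * (1024 / d * (n\<^sup>2 * sqrt K))))"
  proof (rule Ew_mono[OF P])
    fix s assume s: "s \<subseteq> A"
    have "M.expectation (\<lambda>x. \<bar>H s x - n * nu\<bar>) \<le> M.expectation (\<lambda>x. \<bar>(\<Sum>i\<in>s. Q i x) - ?mQ\<bar> + 32 / sqrt d * (n * sqrt K)
     + \<bar>(\<Sum>i\<in>s. Q' i x) - ?mQ'\<bar> + n * sqrt K * of_bool (den s < d / 4)
     + 4 / d * (2 * ((\<Sum>i\<in>s. R i x) - ?mR)\<^sup>2 + 2 * (1024 / d * (n\<^sup>2 * sqrt K))))"
      using int_abs[OF s] pointwise[OF s] by (intro integral_mono) auto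
    also have "\<dots> = M.expectation (\<lambda>x. \<bar>(\<Sum>i\<in>s. Q i x) - ?mQ\<bar>) + 32 / sqrt d * (n * sqrt K)
     + M.expectation (\<lambda>x. \<bar>(\<Sum>i\<in>s. Q' i x) - ?mQ'\<bar>) + n * sqrt K * of_bool (den s < d / 4)
     + 4 / d * (2 * M.expectation (\<lambda>x. ((\<Sum>i\<in>s. R i x) - ?mR)\<^sup>2) + 2 * (1024 / d * (n\<^sup>2 * sqrt K)))"
      using int_abs[OF s] by (simp add: M.prob_space)
    finally show "M.expectation (\<lambda>x. \<bar>H s x - n * nu\<bar>) \<le> M.expectation (\<lambda>x. \<bar>(\<Sum>i\<in>s. Q i x) - ?mQ\<bar>) + 32 / sqrt d * (n * sqrt K)
     + M.expectation (\<lambda>x. \<bar>(\<Sum>i\<in>s. Q' i x) - ?mQ'\<bar>) + n * sqrt K * of_bool (den s < d / 4)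
     + 4 / d * (2 * M.expectation (\<lambda>x. ((\<Sum>i\<in>s. R i x) - ?mR)\<^sup>2) + 2 * (1024 / d * (n\<^sup>2 * sqrt K)))" .
  qed
  also have "\<dots> \<le> C * sqrt (192 * K * n) + 32 / sqrt d * (n * sqrt K) + C * sqrt (192 * K * n)
     + n * sqrt K * (C * sqrt (768 / d))
     + 4 / d * (2 * (C * (sqrt (24000 * K) * n)) + 2 * (1024 / d * (n\<^sup>2 * sqrt K)))"
    unfolding Ew_add Ew_cmult Ew_const[OF P] C_def
    by (intro add_mono mult_left_mono order.refl EE_Q EE_Q' EE_R den_small d) (use dpos K0 in auto)
  finally show ?thesis by simp
qed

end

section \<open>Characteristic function and truncated second moment under the actual design\<close>

context marked_design begin

lemma char_sum:
  assumes s: "s \<subseteq> A"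
  shows "(CLINT x|M. iexp (t * (\<Sum>i\<in>s. Z i x))) = (\<Prod>i\<in>s. CLINT x|M. iexp (t * Z i x))"
proof -
  have f: "finite s" using s fin by (rule finite_subset)
  have "M.indep_vars (\<lambda>_. borel) (\<lambda>i x. iexp (t * Z i x)) s"
    using M.indep_vars_compose2[OF M.indep_vars_subset[OF indZ s], of "\<lambda>_ z. iexp (t * z)" "\<lambda>_. borel"] by simp
  then have "(CLINT x|M. (\<Prod>i\<in>s. iexp (t * Z i x))) = (\<Prod>i\<in>s. CLINT x|M. iexp (t * Z i x))"
    using f s by (intro M.indep_vars_lebesgue_integral) (auto intro!: M.integrable_iexp)
  moreover have "(\<Prod>i\<in>s. iexp (t * Z i x)) = iexp (t * (\<Sum>i\<in>s. Z i x))" for x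
    using f by (simp add: exp_sum[symmetric] sum_distrib_left)
  ultimately show ?thesis by simp
qed

text \<open>A characteristic function has modulus at most 1, so the change of design costs just
  \<open>sqrt c\<close>, uniformly in \<open>t\<close>.\<close>

lemma char_EE:
  "norm (Ew A P (\<lambda>s. CLINT x|M. iexp (t * G s x)) -
     E (\<lambda>s. \<Prod>i\<in>s. CLINT x|M. iexp (t * Z i x)) * iexp (- (t * (\<Sum>i\<in>A. q i * e i)))) \<le> sqrt c"
proof -
  let ?g = "\<lambda>s. CLINT x|M. iexp (t * G s x)"
  have g: "?g s = (\<Prod>i\<in>s. CLINT x|M. iexp (t * Z i x)) * iexp (- (t * (\<Sum>i\<in>A. q i * e i)))" if "s \<subseteq> A" for s
  proof -
    have "?g s = (CLINT x|M. iexp (t * (\<Sum>i\<in>s. Z i x)) * iexp (- (t * (\<Sum>i\<in>A. q i * e i))))"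
      unfolding G_def exp_add[symmetric]
      by (intro Bochner_Integration.integral_cong refl arg_cong[where f = exp]) (simp add: algebra_simps)
    also have "\<dots> = (CLINT x|M. iexp (t * (\<Sum>i\<in>s. Z i x))) * iexp (- (t * (\<Sum>i\<in>A. q i * e i)))"
      by (rule integral_mult_left_zero)
    finally show ?thesis unfolding char_sum[OF that] .
  qed
  have "E (\<lambda>s. \<Prod>i\<in>s. CLINT x|M. iexp (t * Z i x)) * iexp (- (t * (\<Sum>i\<in>A. q i * e i))) = E ?g"
    unfolding Ew_multc[symmetric] by (rule Ew_cong) (rule g[symmetric])
  moreover have "norm (Ew A P ?g - E ?g) \<le> sqrt c * sqrt (E (\<lambda>s. (norm (?g s))\<^sup>2))"
    by (rule norm_Ew_diff_le[OF prob_weight_rej_weight ac])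
  moreover have "sqrt c * sqrt (E (\<lambda>s. (norm (?g s))\<^sup>2)) \<le> sqrt c * 1"
  proof (intro mult_left_mono)
    have "E (\<lambda>s. (norm (?g s))\<^sup>2) \<le> E (\<lambda>s. 1)"
    proof (rule Ew_mono[OF prob_weight_rej_weight])
      fix s assume s: "s \<subseteq> A"
      have m: "(\<lambda>x. complex_of_real (t * G s x)) \<in> borel_measurable M" using Gm[OF s] by measurable
      have "norm (?g s) \<le> M.expectation (\<lambda>x. 1)"
        by (intro norm_integral_le_integral M.integrable_iexp m) auto
      then show "(norm (?g s))\<^sup>2 \<le> 1" by (simp add: M.prob_space power_le_one)
    qed
    then show "sqrt (E (\<lambda>s. (norm (?g s))\<^sup>2)) \<le> 1" by (simp add: Ew_const[OF prob_weight_rej_weight])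
  qed (simp add: c0)
  ultimately show ?thesis by simp
qed

text \<open>With \<open>y = (G s x)\<^sup>2\<close>, the positive part of \<open>y - m\<close> is at
  most \<open>y\<^sup>2 / m\<close> and at most \<open>y\<close>. The first bound makes its mean
  under the rejective design small for large \<open>m\<close>, the second bounds the root mean
  square that enters the change of design; both lead to fourth moments of \<open>G\<close>.\<close>

lemma tail_EE:
  assumes m: "0 < m"
  shows "Ew A P (\<lambda>s. M.expectation (\<lambda>x. max 0 ((G s x)\<^sup>2 - m))) \<le>
     24000 * K * n\<^sup>2 / m + sqrt c * (sqrt (24000 * K) * n)"
proof -
  let ?h = "\<lambda>s. M.expectation (\<lambda>x. max 0 ((G s x)\<^sup>2 - m))"
  have b1: "max 0 (y - m) \<le> y\<^sup>2 / m" for y :: real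
  proof (cases "y \<le> m")
    case False
    then have "y * m \<le> y * y" using m by (intro mult_left_mono) auto
    moreover have "(y - m) * m = y * m - m * m" by (simp add: algebra_simps)
    moreover have "0 \<le> m * m" by simp
    ultimately have "(y - m) * m \<le> y\<^sup>2" unfolding power2_eq_square by linarith
    then show ?thesis using m False by (simp add: pos_le_divide_eq)
  qed (use m in simp)
  have b2: "(max 0 (y - m))\<^sup>2 \<le> y\<^sup>2" if "0 \<le> y" for y :: real
    using that m by (intro power_mono) auto
  have hm: "(\<lambda>x. max 0 ((G s x)\<^sup>2 - m)) \<in> borel_measurable M" if "s \<subseteq> A" for s
    using Gm[OF that] by measurable
  have h2: "integrable M (\<lambda>x. (max 0 ((G s x)\<^sup>2 - m))\<^sup>2)" if "s \<subseteq> A" for s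
    by (rule Bochner_Integration.integrable_bound[OF G4[OF that]])
      (use hm[OF that] b2[of "(G s x)\<^sup>2" for x] in auto)
  have h1: "integrable M (\<lambda>x. max 0 ((G s x)\<^sup>2 - m))" if "s \<subseteq> A" for s
    by (rule M.integrable_square_imp[OF hm[OF that] h2[OF that]])
  have "norm (Ew A P ?h - E ?h) \<le> sqrt c * sqrt (E (\<lambda>s. (norm (?h s))\<^sup>2))"
    by (rule norm_Ew_diff_le[OF prob_weight_rej_weight ac])
  then have "Ew A P ?h \<le> E ?h + sqrt c * sqrt (E (\<lambda>s. (norm (?h s))\<^sup>2))" by (simp add: abs_le_iff)
  also have "\<dots> \<le> 24000 * K * n\<^sup>2 / m + sqrt c * sqrt (24000 * K * n\<^sup>2)"
  proof (intro add_mono mult_left_mono real_sqrt_le_mono)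
    have "E ?h \<le> E (\<lambda>s. 1 / m * M.expectation (\<lambda>x. G s x ^ 4))"
    proof (rule Ew_mono[OF prob_weight_rej_weight])
      fix s assume s: "s \<subseteq> A"
      have "?h s \<le> M.expectation (\<lambda>x. 1 / m * G s x ^ 4)"
        using h1[OF s] G4[OF s] b1[of "(G s x)\<^sup>2" for x] by (intro integral_mono) auto
      then show "?h s \<le> 1 / m * M.expectation (\<lambda>x. G s x ^ 4)" by simp
    qed
    also have "\<dots> = E (\<lambda>s. M.expectation (\<lambda>x. G s x ^ 4)) / m" unfolding Ew_cmult by simp
    also have "\<dots> \<le> 24000 * K * n\<^sup>2 / m" using EG4 m by (intro divide_right_mono) auto
    finally show "E ?h \<le> 24000 * K * n\<^sup>2 / m" .
    show "E (\<lambda>s. (norm (?h s))\<^sup>2) \<le> 24000 * K * n\<^sup>2"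
    proof (rule order.trans[OF Ew_mono[OF prob_weight_rej_weight] EG4])
      fix s assume s: "s \<subseteq> A"
      have "M.variance (\<lambda>x. max 0 ((G s x)\<^sup>2 - m)) = M.expectation (\<lambda>x. (max 0 ((G s x)\<^sup>2 - m))\<^sup>2) - (?h s)\<^sup>2"
        using h1[OF s] h2[OF s] by (intro M.variance_eq)
      then have "(?h s)\<^sup>2 \<le> M.expectation (\<lambda>x. (max 0 ((G s x)\<^sup>2 - m))\<^sup>2)"
        using M.variance_positive[of "\<lambda>x. max 0 ((G s x)\<^sup>2 - m)"] by linarith
      also have "\<dots> \<le> M.expectation (\<lambda>x. G s x ^ 4)"
        using h2[OF s] G4[OF s] b2[of "(G s x)\<^sup>2" for x] by (intro integral_mono) auto
      finally show "(norm (?h s))\<^sup>2 \<le> M.expectation (\<lambda>x. G s x ^ 4)" by simp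
    qed
  qed (simp add: c0)
  finally show ?thesis by (simp add: real_sqrt_mult)
qed

end

section \<open>Limits along a sequence of marked designs\<close>

lemma tendsto_if_diff_tendsto_0:
  fixes f g :: "nat \<Rightarrow> 'b::real_normed_vector"
  assumes "g \<longlonglongrightarrow> l" "(\<lambda>k. f k - g k) \<longlonglongrightarrow> 0"
  shows "f \<longlonglongrightarrow> l"
  using tendsto_add[OF assms(2,1)] by simp

locale marked_design_seq =
  fixes A :: "nat \<Rightarrow> nat set" and q :: "nat \<Rightarrow> nat \<Rightarrow> real" and n :: "nat \<Rightarrow> nat" and M :: "nat \<Rightarrow> 'w measure"
    and P :: "nat \<Rightarrow> nat set \<Rightarrow> real" and Z \<delta> :: "nat \<Rightarrow> nat \<Rightarrow> 'w \<Rightarrow> real" and K \<kappa> \<nu> :: real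
  assumes md: "\<And>k. marked_design (A k) (q k) (n k) (M k) (P k) (Z k) (\<delta> k) K"
    and n_inf: "filterlim (\<lambda>k. real (n k)) at_top sequentially"
    and d_ge: "\<And>k. \<kappa> * n k \<le> size_var (A k) (q k)" and \<kappa>: "0 < \<kappa>"
    and chi: "(\<lambda>k. chi2 (A k) (P k) (rej_weight (A k) (q k) (n k))) \<longlonglongrightarrow> 0"
    and nu_ge: "\<And>k. \<nu> \<le> marked_design.nu (A k) (q k) (n k) (M k) (Z k)" and \<nu>: "0 < \<nu>"
begin

sublocale md: marked_design "A k" "q k" "n k" "M k" "P k" "Z k" "\<delta> k" K for k by (rule md)

lemma d_inf: "filterlim (\<lambda>k. size_var (A k) (q k)) at_top sequentially"
  by (rule filterlim_at_top_mono[OF filterlim_tendsto_pos_mult_at_top[OF tendsto_const \<kappa> n_inf]])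
    (use d_ge in auto)

text \<open>After division of the marks by \<open>sqrt (n * nu)\<close> the Lyapunov sum is at most
  \<open>K * n / (n * nu)\<^sup>2\<close>, which tends to 0 because \<open>nu\<close> stays above
  \<open>\<nu>\<close>.\<close>

lemma char_limit:
  "(\<lambda>k. Ew (A k) (P k) (\<lambda>s. CLINT x|M k. iexp (t / sqrt (n k * md.nu k) * md.G k s x))) \<longlonglongrightarrow> complex_of_real (exp (- t\<^sup>2 / 2))"
proof -
  define r where "r k = sqrt (n k * md.nu k)" for k
  have r2: "(r k)\<^sup>2 = n k * md.nu k" and r0: "0 < r k" for k
    using md.n0[of k] nu_ge[of k] \<nu> by (auto simp: r_def zero_less_mult_iff)
  have r4: "r k ^ 4 = (n k * md.nu k)\<^sup>2" for k using r2[of k] by (metis power2_eq_square power4_eq_xxxx mult.assoc)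
  let ?Z = "\<lambda>k i x. Z k i x / r k"
  have "(\<lambda>k. Ew (A k) (rej_weight (A k) (q k) (n k)) (\<lambda>s. \<Prod>i\<in>s. CLINT x|M k. iexp (t * ?Z k i x)) *
      iexp (- (t * (\<Sum>i\<in>A k. q k i * (LINT x|M k. ?Z k i x))))) \<longlonglongrightarrow> exp (- (t\<^sup>2) / 2)"
  proof (rule rejective_char_tendsto[OF md.rejective_axioms d_inf md.M.prob_space_axioms])
    fix k i assume i: "i \<in> A k"
    show "?Z k i \<in> borel_measurable (M k)" using md.Zm[OF i] by measurable
    show "integrable (M k) (\<lambda>x. ?Z k i x ^ 4)" using md.Z4[OF i] by (simp add: power_divide)
  next
    fix k
    have "(\<Sum>i\<in>A k. q k i * (1 - q k i) * (LINT x|M k. ?Z k i x)) = (\<Sum>i\<in>A k. q k i * (1 - q k i) * md.e k i) / r k"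
      by (simp add: sum_divide_distrib)
    then show "(\<Sum>i\<in>A k. q k i * (1 - q k i) * (LINT x|M k. ?Z k i x)) = 0" by (simp add: md.centred)
    have "(\<Sum>i\<in>A k. q k i * (LINT x|M k. (?Z k i x)\<^sup>2) - (q k i)\<^sup>2 * (LINT x|M k. ?Z k i x)\<^sup>2)
      = (\<Sum>i\<in>A k. q k i * md.e2 k i - (q k i)\<^sup>2 * (md.e k i)\<^sup>2) / (r k)\<^sup>2"
      by (simp add: sum_divide_distrib power_divide diff_divide_distrib)
    also have "(\<Sum>i\<in>A k. q k i * md.e2 k i - (q k i)\<^sup>2 * (md.e k i)\<^sup>2) = (r k)\<^sup>2"
      unfolding r2 using md.n0[of k] by (simp add: md.nu_def)
    also have "(r k)\<^sup>2 / (r k)\<^sup>2 = 1" using r0[of k] by simp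
    finally show "(\<Sum>i\<in>A k. q k i * (LINT x|M k. (?Z k i x)\<^sup>2) - (q k i)\<^sup>2 * (LINT x|M k. ?Z k i x)\<^sup>2) = 1" .
  next
    show "(\<lambda>k. \<Sum>i\<in>A k. q k i * (LINT x|M k. ?Z k i x ^ 4)) \<longlonglongrightarrow> 0"
    proof (rule tendsto_sandwich[OF _ _ tendsto_const])
      show "(\<lambda>k. K / \<nu>\<^sup>2 / real (n k)) \<longlonglongrightarrow> 0"
        by (rule tendsto_divide_0[OF tendsto_const filterlim_at_top_imp_at_infinity[OF n_inf]])
      show "\<forall>\<^sub>F k in sequentially. 0 \<le> (\<Sum>i\<in>A k. q k i * (LINT x|M k. ?Z k i x ^ 4))"
        using md.q01 by (intro always_eventually allI sum_nonneg mult_nonneg_nonneg) auto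
      show "\<forall>\<^sub>F k in sequentially. (\<Sum>i\<in>A k. q k i * (LINT x|M k. ?Z k i x ^ 4)) \<le> K / \<nu>\<^sup>2 / real (n k)"
      proof (intro always_eventually allI)
        fix k
        have "(\<Sum>i\<in>A k. q k i * (LINT x|M k. ?Z k i x ^ 4)) = (\<Sum>i\<in>A k. q k i * (LINT x|M k. Z k i x ^ 4)) / r k ^ 4"
          by (simp add: sum_divide_distrib power_divide)
        also have "\<dots> \<le> K * n k / r k ^ 4" using md.KZ[of k] r0[of k] by (intro divide_right_mono) auto
        also have "\<dots> = K / (md.nu k)\<^sup>2 / real (n k)"
          unfolding r4 using md.n0[of k] by (simp add: power2_eq_square)
        also have "\<dots> \<le> K / \<nu>\<^sup>2 / real (n k)"
          using nu_ge[of k] \<nu> md.K0 by (intro divide_right_mono divide_left_mono power_mono) auto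
        finally show "(\<Sum>i\<in>A k. q k i * (LINT x|M k. ?Z k i x ^ 4)) \<le> K / \<nu>\<^sup>2 / real (n k)" .
      qed
    qed
  qed
  moreover have "(\<lambda>k. Ew (A k) (P k) (\<lambda>s. CLINT x|M k. iexp (t / r k * md.G k s x)) -
      Ew (A k) (rej_weight (A k) (q k) (n k)) (\<lambda>s. \<Prod>i\<in>s. CLINT x|M k. iexp (t * ?Z k i x)) *
      iexp (- (t * (\<Sum>i\<in>A k. q k i * (LINT x|M k. ?Z k i x))))) \<longlonglongrightarrow> 0"
  proof (rule Lim_null_comparison)
    show "(\<lambda>k. sqrt (md.c k)) \<longlonglongrightarrow> 0" using tendsto_real_sqrt[OF chi] by simp
    show "\<forall>\<^sub>F k in sequentially. norm (Ew (A k) (P k) (\<lambda>s. CLINT x|M k. iexp (t / r k * md.G k s x)) -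
      Ew (A k) (rej_weight (A k) (q k) (n k)) (\<lambda>s. \<Prod>i\<in>s. CLINT x|M k. iexp (t * ?Z k i x)) *
      iexp (- (t * (\<Sum>i\<in>A k. q k i * (LINT x|M k. ?Z k i x))))) \<le> sqrt (md.c k)"
    proof (intro always_eventually allI)
      fix k
      have 1: "t / r k * Z k i x = t * ?Z k i x" for i x by simp
      have 2: "t / r k * (\<Sum>i\<in>A k. q k i * md.e k i) = t * (\<Sum>i\<in>A k. q k i * (LINT x|M k. ?Z k i x))"
        by (simp add: sum_divide_distrib sum_distrib_left)
      show "norm (Ew (A k) (P k) (\<lambda>s. CLINT x|M k. iexp (t / r k * md.G k s x)) -
        Ew (A k) (rej_weight (A k) (q k) (n k)) (\<lambda>s. \<Prod>i\<in>s. CLINT x|M k. iexp (t * ?Z k i x)) *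
        iexp (- (t * (\<Sum>i\<in>A k. q k i * (LINT x|M k. ?Z k i x))))) \<le> sqrt (md.c k)"
        using md.char_EE[of k "t / r k"] unfolding 1 2 .
    qed
  qed
  ultimately have "(\<lambda>k. Ew (A k) (P k) (\<lambda>s. CLINT x|M k. iexp (t / r k * md.G k s x))) \<longlonglongrightarrow> exp (- (t\<^sup>2) / 2)"
    by (rule tendsto_if_diff_tendsto_0)
  then show ?thesis by (simp add: r_def)
qed

text \<open>\<open>EE_H\<close> divided by \<open>n\<close>: since \<open>d\<close> is at least
  \<open>\<kappa> * n\<close>, the ratio \<open>n / d\<close> stays bounded and every term retains a
  vanishing factor.\<close>

lemma H_limit: "(\<lambda>k. Ew (A k) (P k) (\<lambda>s. LINT x|M k. \<bar>md.H k s x / n k - md.nu k\<bar>)) \<longlonglongrightarrow> 0"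
proof -
  let ?d = "\<lambda>k. size_var (A k) (q k)"
  let ?C = "\<lambda>k. 1 + sqrt (md.c k)"
  define U where "U k = 2 * ?C k * (sqrt (192 * K) / sqrt (n k)) + 32 / sqrt (?d k) * sqrt K + sqrt K * (?C k * sqrt (768 / ?d k))
     + 4 / ?d k * (2 * (?C k * sqrt (24000 * K)) + 2 * (1024 / \<kappa> * sqrt K))" for k
  have K0: "0 \<le> K" by (rule md.K0)
  have sq: "filterlim (\<lambda>k. sqrt (f k)) at_infinity sequentially" if "filterlim f at_top sequentially" for f :: "nat \<Rightarrow> real"
    by (rule filterlim_at_top_imp_at_infinity, rule filterlim_compose[OF sqrt_at_top that])
  have C: "?C \<longlonglongrightarrow> 1 + sqrt 0" by (intro tendsto_intros chi)
  have "U \<longlonglongrightarrow> 2 * (1 + sqrt 0) * 0 + 0 * sqrt K + sqrt K * ((1 + sqrt 0) * sqrt 0)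
     + 0 * (2 * ((1 + sqrt 0) * sqrt (24000 * K)) + 2 * (1024 / \<kappa> * sqrt K))"
    unfolding U_def
    by (intro tendsto_add tendsto_mult C tendsto_const tendsto_real_sqrt tendsto_divide_0[OF tendsto_const]
        sq n_inf d_inf filterlim_at_top_imp_at_infinity)
  then have U: "U \<longlonglongrightarrow> 0" by simp
  show ?thesis
  proof (rule tendsto_sandwich[OF _ _ tendsto_const U])
    show "\<forall>\<^sub>F k in sequentially. 0 \<le> Ew (A k) (P k) (\<lambda>s. LINT x|M k. \<bar>md.H k s x / n k - md.nu k\<bar>)"
      by (intro always_eventually allI Ew_nonneg[OF md.P]) simp
    have "\<forall>\<^sub>F k in sequentially. 4096 \<le> ?d k" using d_inf by (simp add: filterlim_at_top)
    then show "\<forall>\<^sub>F k in sequentially. Ew (A k) (P k) (\<lambda>s. LINT x|M k. \<bar>md.H k s x / n k - md.nu k\<bar>) \<le> U k"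
    proof eventually_elim
      case (elim k)
      have n0: "0 < real (n k)" by (rule md.n0)
      have eq: "\<bar>md.H k s x / n k - md.nu k\<bar> = 1 / n k * \<bar>md.H k s x - n k * md.nu k\<bar>" for s x
      proof -
        have "md.H k s x / n k - md.nu k = (md.H k s x - n k * md.nu k) / n k" using n0 by (simp add: field_simps)
        then show ?thesis using n0 by simp
      qed
      have "Ew (A k) (P k) (\<lambda>s. LINT x|M k. \<bar>md.H k s x / n k - md.nu k\<bar>)
        = 1 / n k * Ew (A k) (P k) (\<lambda>s. LINT x|M k. \<bar>md.H k s x - n k * md.nu k\<bar>)"
        unfolding eq by (simp add: Ew_cmult[symmetric])
      also have "\<dots> \<le> 1 / n k * (2 * ?C k * sqrt (192 * K * n k) + 32 / sqrt (?d k) * (n k * sqrt K) +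
           n k * sqrt K * (?C k * sqrt (768 / ?d k))
         + 4 / ?d k * (2 * (?C k * (sqrt (24000 * K) * n k)) + 2 * (1024 / ?d k * ((n k)\<^sup>2 * sqrt K))))"
        using md.EE_H[OF elim] by (intro mult_left_mono) auto
      also have "\<dots> = 2 * ?C k * (sqrt (192 * K) / sqrt (n k)) + 32 / sqrt (?d k) * sqrt K + sqrt K * (?C k * sqrt (768 / ?d k))
         + 4 / ?d k * (2 * (?C k * sqrt (24000 * K)) + 2 * (1024 * (n k / ?d k) * sqrt K))"
      proof -
        define y where "y = sqrt (n k)"
        have y: "0 < y" "real (n k) = y\<^sup>2" using n0 by (auto simp: y_def)
        have "sqrt (192 * K * n k) = sqrt (192 * K) * y" by (simp add: y_def real_sqrt_mult)
        then show ?thesis unfolding y_def[symmetric] using y(1) unfolding of_nat_power y(2) 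
          by (simp add: field_simps power2_eq_square)
      qed
      also have "\<dots> \<le> U k"
      proof -
        have "n k / ?d k \<le> 1 / \<kappa>" using d_ge[of k] \<kappa> elim by (simp add: field_simps)
        then have "1024 * (n k / ?d k) * sqrt K \<le> 1024 * (1 / \<kappa>) * sqrt K"
          using K0 by (intro mult_right_mono mult_left_mono) auto
        then have "4 / ?d k * (2 * (?C k * sqrt (24000 * K)) + 2 * (1024 * (n k / ?d k) * sqrt K))
          \<le> 4 / ?d k * (2 * (?C k * sqrt (24000 * K)) + 2 * (1024 / \<kappa> * sqrt K))"
          using elim by (intro mult_left_mono add_left_mono) auto
        then show ?thesis by (simp add: U_def)
      qed
      finally show ?case .
    qed
  qed
qed

end

subsection \<open>From weak convergence to convergence of the first two moments\<close>

text \<open>Interchange of limits: the truncation level \<open>m\<close> is fixed before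
  \<open>k\<close> grows, and the error splits into a part small in \<open>m\<close> and a part
  small in \<open>k\<close>.\<close>

lemma limit_by_approximation:
  fixes x :: "nat \<Rightarrow> real"
  assumes "\<And>m. 1 \<le> m \<Longrightarrow> y m \<longlonglongrightarrow> l m" "\<And>m k. 1 \<le> m \<Longrightarrow> \<bar>x k - y m k\<bar> \<le> C / m + \<epsilon> k"
    "\<And>m. 1 \<le> m \<Longrightarrow> \<bar>l m - L\<bar> \<le> C / m" "\<epsilon> \<longlonglongrightarrow> 0"
  shows "x \<longlonglongrightarrow> L"
proof (rule LIMSEQ_I)
  fix r :: real assume r: "0 < r"
  define m :: real where "m = max 1 (4 * \<bar>C\<bar> / r)"
  have m: "1 \<le> m" by (simp add: m_def)
  have Cm: "C / m \<le> r / 4"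
  proof -
    have "4 * \<bar>C\<bar> / r \<le> m" by (simp add: m_def)
    then have "\<bar>C\<bar> \<le> r / 4 * m" using r by (simp add: field_simps)
    then have "C \<le> r / 4 * m" by linarith
    then show ?thesis using m by (simp add: pos_divide_le_eq)
  qed
  have "\<forall>\<^sub>F k in sequentially. \<bar>y m k - l m\<bar> < r / 4"
    using tendstoD[OF assms(1)[OF m], of "r / 4"] r by (simp add: dist_real_def)
  moreover have "\<forall>\<^sub>F k in sequentially. \<epsilon> k < r / 4" using order_tendstoD(2)[OF assms(4), of "r / 4"] r by simp
  ultimately have "\<forall>\<^sub>F k in sequentially. norm (x k - L) < r"
  proof eventually_elim
    case (elim k)
    then show ?case using assms(2)[OF m, of k] assms(3)[OF m] Cm unfolding real_norm_def by linarith
  qed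
  then show "\<exists>no. \<forall>k\<ge>no. norm (x k - L) < r" by (simp add: eventually_sequentially)
qed

text \<open>For \<open>1 \<le> m\<close> the clipping error of \<open>W\<close> itself is at most
  the positive part of \<open>(W x)\<^sup>2 - m\<^sup>2\<close>, so one tail bound on squares serves
  both moments.\<close>

lemma (in prob_space) truncation_errors:
  fixes W :: "'a \<Rightarrow> real"
  assumes [measurable]: "W \<in> borel_measurable M" and W2: "integrable M (\<lambda>x. (W x)\<^sup>2)"
    and tail: "\<And>m. 0 < m \<Longrightarrow> expectation (\<lambda>x. max 0 ((W x)\<^sup>2 - m)) \<le> C / m + \<epsilon>" and m: "1 \<le> m" and C: "0 \<le> C" and \<epsilon>: "0 \<le> \<epsilon>"
  shows "\<bar>expectation (\<lambda>x. (W x)\<^sup>2) - expectation (\<lambda>x. min ((W x)\<^sup>2) m)\<bar> \<le> C / m + \<epsilon>"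
    and "\<bar>expectation W - expectation (\<lambda>x. max (- m) (min (W x) m))\<bar> \<le> C / m + \<epsilon>"
proof -
  have i1: "integrable M W" by (rule integrable_square_imp[OF _ W2]) simp
  have it: "integrable M (\<lambda>x. max 0 ((W x)\<^sup>2 - m'))" if "0 < m'" for m'
    by (rule Bochner_Integration.integrable_bound[OF W2]) (use that in auto)
  have im: "integrable M (\<lambda>x. min ((W x)\<^sup>2) m)"
    by (rule Bochner_Integration.integrable_bound[OF W2]) (use m in auto)
  have ic: "integrable M (\<lambda>x. max (- m) (min (W x) m))"
    by (rule Bochner_Integration.integrable_bound[OF i1]) (use m in auto)
  have "expectation (\<lambda>x. (W x)\<^sup>2) - expectation (\<lambda>x. min ((W x)\<^sup>2) m) = expectation (\<lambda>x. max 0 ((W x)\<^sup>2 - m))"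
    unfolding Bochner_Integration.integral_diff[OF W2 im, symmetric]
    by (intro Bochner_Integration.integral_cong refl) (auto simp: max_def min_def)
  moreover have "0 \<le> expectation (\<lambda>x. max 0 ((W x)\<^sup>2 - m))" by simp
  ultimately show "\<bar>expectation (\<lambda>x. (W x)\<^sup>2) - expectation (\<lambda>x. min ((W x)\<^sup>2) m)\<bar> \<le> C / m + \<epsilon>"
    using tail[of m] m by simp
  have "\<bar>expectation W - expectation (\<lambda>x. max (- m) (min (W x) m))\<bar> = norm (expectation (\<lambda>x. W x - max (- m) (min (W x) m)))"
    using i1 ic by simp
  also have "\<dots> \<le> expectation (\<lambda>x. max 0 ((W x)\<^sup>2 - m\<^sup>2))"
  proof (rule norm_integral_le_integral)
    fix x
    have "\<bar>w - max (- m) (min w m)\<bar> \<le> max 0 (w\<^sup>2 - m\<^sup>2)" for w :: real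
    proof (cases "\<bar>w\<bar> \<le> m")
      case False
      have "(\<bar>w\<bar> - m) * 1 \<le> (\<bar>w\<bar> - m) * (\<bar>w\<bar> + m)" using False m by (intro mult_left_mono) auto
      also have "\<dots> = w\<^sup>2 - m\<^sup>2" by (simp add: algebra_simps power2_eq_square)
      finally have "\<bar>w\<bar> - m \<le> w\<^sup>2 - m\<^sup>2" by simp
      moreover have "\<bar>w - max (- m) (min w m)\<bar> = \<bar>w\<bar> - m" using False m by (auto simp: max_def min_def abs_if split: if_splits)
      ultimately show ?thesis by simp
    qed (auto simp: max_def min_def abs_le_iff)
    then show "norm (W x - max (- m) (min (W x) m)) \<le> max 0 ((W x)\<^sup>2 - m\<^sup>2)" by simp
  qed (use i1 ic it[of "m\<^sup>2"] m in auto)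
  also have "\<dots> \<le> C / m\<^sup>2 + \<epsilon>" using m by (intro tail) simp
  also have "C / m\<^sup>2 \<le> C / m" using m C by (intro divide_left_mono) (auto simp: power2_eq_square)
  finally show "\<bar>expectation W - expectation (\<lambda>x. max (- m) (min (W x) m))\<bar> \<le> C / m + \<epsilon>" by simp
qed

text \<open>Asymptotic uniform integrability of the squares: the tail is small once \<open>k\<close>
  and \<open>m\<close> are both large. The normal law meets the same bound with constant 3, its
  fourth moment, whence \<open>max C 3\<close>.\<close>

lemma moments_of_weak_limit:
  fixes \<Omega> :: "nat \<Rightarrow> 'w measure" and W :: "nat \<Rightarrow> 'w \<Rightarrow> real"
  assumes \<Omega>: "\<And>k. prob_space (\<Omega> k)" and Wm: "\<And>k. W k \<in> borel_measurable (\<Omega> k)"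
    and W2: "\<And>k. integrable (\<Omega> k) (\<lambda>x. (W k x)\<^sup>2)"
    and wc: "weak_conv_m (\<lambda>k. distr (\<Omega> k) borel (W k)) std_normal_distribution"
    and tail: "\<And>m k. 0 < m \<Longrightarrow> (LINT x|\<Omega> k. max 0 ((W k x)\<^sup>2 - m)) \<le> C / m + \<epsilon> k"
    and C: "0 \<le> C" and \<epsilon>: "\<And>k. 0 \<le> \<epsilon> k" "\<epsilon> \<longlonglongrightarrow> 0"
  shows "(\<lambda>k. LINT x|\<Omega> k. W k x) \<longlonglongrightarrow> 0" and "(\<lambda>k. LINT x|\<Omega> k. (W k x)\<^sup>2) \<longlonglongrightarrow> 1"
proof -
  interpret \<Omega>: prob_space "\<Omega> k" for k by (rule \<Omega>)
  interpret N: real_distribution std_normal_distribution by (rule real_dist_normal_dist)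
  let ?N = std_normal_distribution
  have rd: "real_distribution (distr (\<Omega> k) borel (W k))" for k
    using Wm[of k] by (intro \<Omega>.real_distribution_distr) auto
  have lim: "(\<lambda>k. LINT x|\<Omega> k. f (W k x)) \<longlonglongrightarrow> (LINT x|?N. f x)"
    if "\<And>x. isCont f x" "\<And>x. norm (f x) \<le> B" for f :: "real \<Rightarrow> real" and B
  proof -
    have fm: "f \<in> borel_measurable borel" using that(1) by (intro borel_measurable_continuous_onI continuous_at_imp_continuous_on) auto
    have "(\<lambda>k. LINT x|distr (\<Omega> k) borel (W k). f x) \<longlonglongrightarrow> (LINT x|?N. f x)"
      by (rule weak_conv_imp_integral_bdd_continuous_conv[OF rd real_dist_normal_dist wc that])
    then show ?thesis using Wm fm by (simp add: integral_distr)
  qed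
  have N2: "integrable ?N (\<lambda>x. x\<^sup>2)" "(LINT x|?N. x\<^sup>2) = 1" "integrable ?N (\<lambda>x. x^4)" "(LINT x|?N. x^4) = 3" "(LINT x|?N. x) = 0"
    using std_normal_distribution_even_moments[of 1] std_normal_distribution_even_moments[of 2]
      integral_std_normal_distribution_moment_odd[of 1] by (auto simp: fact_numeral)
  have tailN: "(LINT x|?N. max 0 (x\<^sup>2 - m)) \<le> 3 / m + 0" if m: "0 < m" for m
  proof -
    have "(LINT x|?N. max 0 (x\<^sup>2 - m)) \<le> (LINT x|?N. x^4 / m)"
    proof (rule integral_mono)
      show "integrable ?N (\<lambda>x. max 0 (x\<^sup>2 - m))"
        by (rule Bochner_Integration.integrable_bound[OF N2(1)]) (use m in auto)
      fix x :: real
      show "max 0 (x\<^sup>2 - m) \<le> x^4 / m"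
      proof (cases "x\<^sup>2 \<le> m")
        case False
        then have "x\<^sup>2 * m \<le> x\<^sup>2 * x\<^sup>2" by (intro mult_left_mono) auto
        moreover have "(x\<^sup>2 - m) * m = x\<^sup>2 * m - m * m" "x^4 = x\<^sup>2 * x\<^sup>2"
          by (simp_all add: algebra_simps power4_eq_xxxx power2_eq_square)
        moreover have "0 \<le> m * m" by simp
        ultimately have "(x\<^sup>2 - m) * m \<le> x^4" by linarith
        then show ?thesis using m False by (simp add: pos_le_divide_eq)
      qed (use m in simp)
    qed (use N2 in simp)
    then show ?thesis using N2 by simp
  qed
  let ?D = "max C 3"
  have tail': "(LINT x|\<Omega> k. max 0 ((W k x)\<^sup>2 - m)) \<le> ?D / m + \<epsilon> k" if "0 < m" for m k
    using tail[OF that, of k] divide_right_mono[of C ?D m] that by simp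
  have tailN': "(LINT x|?N. max 0 (x\<^sup>2 - m)) \<le> ?D / m + 0" if "0 < m" for m
    using tailN[OF that] divide_right_mono[of 3 ?D m] that by simp
  have err: "\<bar>(LINT x|\<Omega> k. (W k x)\<^sup>2) - (LINT x|\<Omega> k. min ((W k x)\<^sup>2) m)\<bar> \<le> ?D / m + \<epsilon> k"
    "\<bar>(LINT x|\<Omega> k. W k x) - (LINT x|\<Omega> k. max (- m) (min (W k x) m))\<bar> \<le> ?D / m + \<epsilon> k" if m: "1 \<le> m" for m k
    using \<Omega>.truncation_errors[OF Wm W2 tail' m _ \<epsilon>(1)] by auto
  have errN: "\<bar>(LINT x|?N. x\<^sup>2) - (LINT x|?N. min (x\<^sup>2) m)\<bar> \<le> ?D / m + 0"
    "\<bar>(LINT x|?N. x) - (LINT x|?N. max (- m) (min x m))\<bar> \<le> ?D / m + 0" if m: "1 \<le> m" for m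
    using N.truncation_errors[of "\<lambda>x. x" ?D 0, OF _ _ tailN' m] N2 by auto
  show "(\<lambda>k. LINT x|\<Omega> k. W k x) \<longlonglongrightarrow> 0"
  proof (rule limit_by_approximation[where y = "\<lambda>m k. LINT x|\<Omega> k. max (- m) (min (W k x) m)"])
    fix m :: real assume m: "1 \<le> m"
    show "(\<lambda>k. LINT x|\<Omega> k. max (- m) (min (W k x) m)) \<longlonglongrightarrow> (LINT x|?N. max (- m) (min x m))"
      by (rule lim[of "\<lambda>x. max (- m) (min x m)" m]) (use m in \<open>auto intro!: continuous_intros\<close>)
    show "\<bar>(LINT x|?N. max (- m) (min x m)) - 0\<bar> \<le> ?D / m" using errN(2)[OF m] N2 by simp
  qed (use err \<epsilon> in auto)
  show "(\<lambda>k. LINT x|\<Omega> k. (W k x)\<^sup>2) \<longlonglongrightarrow> 1"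
  proof (rule limit_by_approximation[where y = "\<lambda>m k. LINT x|\<Omega> k. min ((W k x)\<^sup>2) m"])
    fix m :: real assume m: "1 \<le> m"
    show "(\<lambda>k. LINT x|\<Omega> k. min ((W k x)\<^sup>2) m) \<longlonglongrightarrow> (LINT x|?N. min (x\<^sup>2) m)"
      by (rule lim[of "\<lambda>x. min (x\<^sup>2) m" m]) (use m in \<open>auto intro!: continuous_intros\<close>)
    show "\<bar>(LINT x|?N. min (x\<^sup>2) m) - 1\<bar> \<le> ?D / m" using errN(1)[OF m] N2 by simp
  qed (use err \<epsilon> in auto)
qed

text \<open>Slutsky's lemma in terms of characteristic functions;
  \<open>\<bar>W x\<bar> \<le> 1 + (W x)\<^sup>2\<close> brings in the second moment, which
  converges along the sequence.\<close>

lemma (in prob_space) char_affine_diff_le: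
  fixes W :: "'a \<Rightarrow> real"
  assumes [measurable]: "W \<in> borel_measurable M" and W2: "integrable M (\<lambda>x. (W x)\<^sup>2)"
  shows "norm ((CLINT x|M. iexp (t * (a * W x + c))) - (CLINT x|M. iexp (t * W x)))
    \<le> \<bar>t\<bar> * (\<bar>a - 1\<bar> * (1 + expectation (\<lambda>x. (W x)\<^sup>2)) + \<bar>c\<bar>)"
proof -
  have i1: "integrable M W" by (rule integrable_square_imp[OF _ W2]) simp
  have ii: "complex_integrable M (\<lambda>x. iexp (t * (a * W x + c)))" "complex_integrable M (\<lambda>x. iexp (t * W x))"
    by (rule integrable_iexp; simp)+
  have "norm ((CLINT x|M. iexp (t * (a * W x + c))) - (CLINT x|M. iexp (t * W x)))
    = norm (CLINT x|M. iexp (t * (a * W x + c)) - iexp (t * W x))" using ii by simp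
  also have "\<dots> \<le> expectation (\<lambda>x. \<bar>t\<bar> * (\<bar>a - 1\<bar> * (1 + (W x)\<^sup>2) + \<bar>c\<bar>))"
  proof (rule norm_integral_le_integral)
    fix x
    have "iexp (t * (a * W x + c)) - iexp (t * W x) = iexp (t * W x) * (iexp (t * ((a - 1) * W x + c)) - 1)"
      by (simp add: right_diff_distrib exp_add[symmetric] algebra_simps)
    then have "norm (iexp (t * (a * W x + c)) - iexp (t * W x)) = norm (iexp (t * ((a - 1) * W x + c)) - 1)"
      by (simp only: norm_mult norm_exp_i_times mult_1_left)
    also have "\<dots> \<le> \<bar>t * ((a - 1) * W x + c)\<bar>" using iexp_approx1[of "t * ((a - 1) * W x + c)" 0] by simp
    also have "\<dots> \<le> \<bar>t\<bar> * (\<bar>a - 1\<bar> * \<bar>W x\<bar> + \<bar>c\<bar>)"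
      unfolding abs_mult by (intro mult_left_mono order.trans[OF abs_triangle_ineq]) (auto simp: abs_mult)
    also have "\<dots> \<le> \<bar>t\<bar> * (\<bar>a - 1\<bar> * (1 + (W x)\<^sup>2) + \<bar>c\<bar>)"
    proof (intro mult_left_mono add_right_mono)
      have "0 \<le> (\<bar>W x\<bar> - 1)\<^sup>2 + (W x)\<^sup>2 + 1" by simp
      then show "\<bar>W x\<bar> \<le> 1 + (W x)\<^sup>2" by (simp add: power2_diff)
    qed auto
    finally show "norm (iexp (t * (a * W x + c)) - iexp (t * W x)) \<le> \<bar>t\<bar> * (\<bar>a - 1\<bar> * (1 + (W x)\<^sup>2) + \<bar>c\<bar>)" .
  qed (use ii W2 in auto)
  also have "\<dots> = \<bar>t\<bar> * (\<bar>a - 1\<bar> * (1 + expectation (\<lambda>x. (W x)\<^sup>2)) + \<bar>c\<bar>)"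
    using W2 by (simp add: prob_space)
  finally show ?thesis .
qed

text \<open>\<open>b\<close> and \<open>\<nu>\<close> need not be the mean and variance of the
  estimator. Convergence of the first two moments of \<open>W\<close> shows that \<open>V\<close> is
  \<open>\<nu> / n\<close> times a factor \<open>v\<close> tending to 1, so the affine change from
  \<open>W\<close> to the standardised estimator tends to the identity.\<close>

lemma standardised_limits:
  fixes \<Omega> :: "nat \<Rightarrow> 'w measure" and W est vest :: "nat \<Rightarrow> 'w \<Rightarrow> real" and a c b \<nu> :: "nat \<Rightarrow> real" and \<nu>0 \<nu>1 C :: real
    and n :: "nat \<Rightarrow> nat"
  assumes \<Omega>: "\<And>k. prob_space (\<Omega> k)" and Wm: "\<And>k. W k \<in> borel_measurable (\<Omega> k)"
    and W2: "\<And>k. integrable (\<Omega> k) (\<lambda>x. (W k x)\<^sup>2)"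
    and char: "\<And>t. (\<lambda>k. CLINT x|\<Omega> k. iexp (t * W k x)) \<longlonglongrightarrow> complex_of_real (exp (- t\<^sup>2 / 2))"
    and tail: "\<And>m k. 0 < m \<Longrightarrow> (LINT x|\<Omega> k. max 0 ((W k x)\<^sup>2 - m)) \<le> C / m + \<epsilon> k"
    and C: "0 \<le> C" and \<epsilon>: "\<And>k. 0 \<le> \<epsilon> k" "\<epsilon> \<longlonglongrightarrow> 0"
    and n: "\<And>k. 0 < n k"
    and \<nu>: "0 < \<nu>0" "\<And>k. \<nu>0 \<le> \<nu> k" "\<And>k. \<nu> k \<le> \<nu>1"
    and est: "\<And>k x. x \<in> space (\<Omega> k) \<Longrightarrow> est k x = b k + sqrt (\<nu> k / n k) * W k x"
    and mean: "\<And>k. (LINT x|\<Omega> k. est k x) = \<tau>"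
    and vest_int: "\<And>k. integrable (\<Omega> k) (vest k)"
    and vest: "(\<lambda>k. LINT x|\<Omega> k. \<bar>n k * vest k x - \<nu> k\<bar>) \<longlonglongrightarrow> 0"
  defines "V \<equiv> \<lambda>k. prob_space.variance (\<Omega> k) (est k)"
  shows "weak_conv_m (\<lambda>k. distr (\<Omega> k) borel (\<lambda>x. (est k x - \<tau>) / sqrt (V k))) std_normal_distribution"
    and "(\<lambda>k. LINT x|\<Omega> k. n k * \<bar>vest k x - V k\<bar>) \<longlonglongrightarrow> 0"
    and "conv_in_prob \<Omega> (\<lambda>k x. vest k x / V k) 1"
proof -
  interpret \<Omega>: prob_space "\<Omega> k" for k by (rule \<Omega>)
  have W1: "integrable (\<Omega> k) (W k)" for k by (rule \<Omega>.integrable_square_imp[OF Wm W2])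
  have rd: "real_distribution (distr (\<Omega> k) borel X)" if "X \<in> borel_measurable (\<Omega> k)" for k X
    using that by (intro \<Omega>.real_distribution_distr) auto
  have charW: "char (distr (\<Omega> k) borel X) t = (CLINT x|\<Omega> k. iexp (t * X x))" if "X \<in> borel_measurable (\<Omega> k)" for k X t
    using that by (simp add: char_def integral_distr)
  have wcW: "weak_conv_m (\<lambda>k. distr (\<Omega> k) borel (W k)) std_normal_distribution"
    by (rule levy_continuity[OF rd[OF Wm] real_dist_normal_dist])
      (use char in \<open>simp add: charW[OF Wm] char_std_normal_distribution\<close>)
  note mom = moments_of_weak_limit[OF \<Omega> Wm W2 wcW tail C \<epsilon>]
  define s where "s k = sqrt (\<nu> k / n k)" for k
  have s: "0 < s k" "n k * (s k)\<^sup>2 = \<nu> k" for k using n[of k] \<nu>(1) \<nu>(2)[of k] by (auto simp: s_def)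
  define \<mu> where "\<mu> k = (LINT x|\<Omega> k. W k x)" for k
  define v where "v k = (LINT x|\<Omega> k. (W k x)\<^sup>2) - (\<mu> k)\<^sup>2" for k
  have est_eq: "est k x - \<tau> = s k * (W k x - \<mu> k)" if "x \<in> space (\<Omega> k)" for k x
  proof -
    have "\<tau> = (LINT x|\<Omega> k. b k + s k * W k x)"
      unfolding mean[of k, symmetric] s_def by (intro Bochner_Integration.integral_cong refl est)
    also have "\<dots> = b k + s k * \<mu> k" using W1[of k] by (simp add: \<mu>_def \<Omega>.prob_space)
    finally show ?thesis using est[OF that] by (simp add: s_def algebra_simps)
  qed
  have V: "V k = (s k)\<^sup>2 * v k" for k
  proof -
    have "V k = (LINT x|\<Omega> k. (s k)\<^sup>2 * (W k x - \<mu> k)\<^sup>2)"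
      unfolding V_def mean using est_eq by (intro Bochner_Integration.integral_cong refl) (simp add: power_mult_distrib)
    also have "\<dots> = (s k)\<^sup>2 * \<Omega>.variance k (W k)" by (simp add: \<mu>_def)
    also have "\<Omega>.variance k (W k) = v k" unfolding v_def \<mu>_def by (rule \<Omega>.variance_eq[OF W1 W2])
    finally show ?thesis .
  qed
  have nV: "n k * V k = \<nu> k * v k" for k unfolding V s(2)[of k, symmetric] by simp
  have v0: "0 \<le> v k" for k using \<Omega>.variance_positive[of k "W k"] \<Omega>.variance_eq[OF W1 W2, of k] by (simp add: v_def \<mu>_def)
  have \<mu>: "\<mu> \<longlonglongrightarrow> 0" unfolding \<mu>_def by (rule mom(1))
  have v: "v \<longlonglongrightarrow> 1" unfolding v_def using tendsto_diff[OF mom(2) tendsto_power[OF \<mu>, of 2]] by simp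
  have vpos: "\<forall>\<^sub>F k in sequentially. 1/2 < v k" using order_tendstoD(1)[OF v, of "1/2"] by simp
  define a where "a k = 1 / sqrt (v k)" for k
  have a: "a \<longlonglongrightarrow> 1" unfolding a_def using tendsto_divide[OF tendsto_const tendsto_real_sqrt[OF v], of 1] by simp
  have std: "(est k x - \<tau>) / sqrt (V k) = a k * W k x + - (a k * \<mu> k)" if "x \<in> space (\<Omega> k)" for k x
    unfolding est_eq[OF that] V using s(1)[of k] by (simp add: a_def real_sqrt_mult diff_divide_distrib)
  have stdm: "(\<lambda>x. (est k x - \<tau>) / sqrt (V k)) \<in> borel_measurable (\<Omega> k)" for k
    using Wm[of k] by (subst measurable_cong[OF std]) auto
  show "weak_conv_m (\<lambda>k. distr (\<Omega> k) borel (\<lambda>x. (est k x - \<tau>) / sqrt (V k))) std_normal_distribution"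
  proof (rule levy_continuity[OF rd[OF stdm] real_dist_normal_dist])
    fix t
    have "(\<lambda>k. (CLINT x|\<Omega> k. iexp (t * (a k * W k x + - (a k * \<mu> k)))) - (CLINT x|\<Omega> k. iexp (t * W k x))) \<longlonglongrightarrow> 0"
    proof (rule Lim_null_comparison)
      show "\<forall>\<^sub>F k in sequentially. norm ((CLINT x|\<Omega> k. iexp (t * (a k * W k x + - (a k * \<mu> k)))) - (CLINT x|\<Omega> k. iexp (t * W k x)))
        \<le> \<bar>t\<bar> * (\<bar>a k - 1\<bar> * (1 + (LINT x|\<Omega> k. (W k x)\<^sup>2)) + \<bar>- (a k * \<mu> k)\<bar>)"
        by (intro always_eventually allI \<Omega>.char_affine_diff_le Wm W2)
      have "(\<lambda>k. \<bar>t\<bar> * (\<bar>a k - 1\<bar> * (1 + (LINT x|\<Omega> k. (W k x)\<^sup>2)) + \<bar>- (a k * \<mu> k)\<bar>)) \<longlonglongrightarrow>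
        \<bar>t\<bar> * (\<bar>1 - 1\<bar> * (1 + 1) + \<bar>- (1 * 0)\<bar>)"
        by (intro tendsto_intros a \<mu> mom(2))
      then show "(\<lambda>k. \<bar>t\<bar> * (\<bar>a k - 1\<bar> * (1 + (LINT x|\<Omega> k. (W k x)\<^sup>2)) + \<bar>- (a k * \<mu> k)\<bar>)) \<longlonglongrightarrow> 0" by simp
    qed
    from tendsto_add[OF this char[of t]]
    have "(\<lambda>k. CLINT x|\<Omega> k. iexp (t * (a k * W k x + - (a k * \<mu> k)))) \<longlonglongrightarrow> complex_of_real (exp (- t\<^sup>2 / 2))" by simp
    moreover have "char (distr (\<Omega> k) borel (\<lambda>x. (est k x - \<tau>) / sqrt (V k))) t = (CLINT x|\<Omega> k. iexp (t * (a k * W k x + - (a k * \<mu> k))))" for k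
      unfolding charW[OF stdm] by (intro Bochner_Integration.integral_cong refl) (simp only: std)
    ultimately show "(\<lambda>k. char (distr (\<Omega> k) borel (\<lambda>x. (est k x - \<tau>) / sqrt (V k))) t) \<longlonglongrightarrow> char std_normal_distribution t"
      by (simp add: char_std_normal_distribution)
  qed
  have int1: "integrable (\<Omega> k) (\<lambda>x. \<bar>n k * vest k x - \<nu> k\<bar>)" "integrable (\<Omega> k) (\<lambda>x. n k * \<bar>vest k x - V k\<bar>)"
    "integrable (\<Omega> k) (\<lambda>x. \<bar>vest k x - V k\<bar>)" for k
    using vest_int[of k] by auto
  have nVlim: "(\<lambda>k. \<bar>\<nu> k - n k * V k\<bar>) \<longlonglongrightarrow> 0"
  proof (rule Lim_null_comparison)
    show "\<forall>\<^sub>F k in sequentially. norm \<bar>\<nu> k - n k * V k\<bar> \<le> \<nu>1 * \<bar>1 - v k\<bar>"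
    proof (intro always_eventually allI)
      fix k
      have "\<nu> k - n k * V k = \<nu> k * (1 - v k)" unfolding nV by (simp add: algebra_simps)
      then have "norm \<bar>\<nu> k - n k * V k\<bar> = \<nu> k * \<bar>1 - v k\<bar>" using \<nu>(1) \<nu>(2)[of k] by (simp add: abs_mult)
      also have "\<dots> \<le> \<nu>1 * \<bar>1 - v k\<bar>" using \<nu>(3) by (intro mult_right_mono) auto
      finally show "norm \<bar>\<nu> k - n k * V k\<bar> \<le> \<nu>1 * \<bar>1 - v k\<bar>" .
    qed
    have "(\<lambda>k. \<nu>1 * \<bar>1 - v k\<bar>) \<longlonglongrightarrow> \<nu>1 * \<bar>1 - 1\<bar>" by (intro tendsto_intros v)
    then show "(\<lambda>k. \<nu>1 * \<bar>1 - v k\<bar>) \<longlonglongrightarrow> 0" by simp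
  qed
  show L1: "(\<lambda>k. LINT x|\<Omega> k. n k * \<bar>vest k x - V k\<bar>) \<longlonglongrightarrow> 0"
  proof (rule tendsto_sandwich[OF _ _ tendsto_const])
    show "\<forall>\<^sub>F k in sequentially. 0 \<le> (LINT x|\<Omega> k. n k * \<bar>vest k x - V k\<bar>)" by simp
    show "\<forall>\<^sub>F k in sequentially. (LINT x|\<Omega> k. n k * \<bar>vest k x - V k\<bar>) \<le>
      (LINT x|\<Omega> k. \<bar>n k * vest k x - \<nu> k\<bar>) + \<bar>\<nu> k - n k * V k\<bar>"
    proof (intro always_eventually allI)
      fix k
      have "(LINT x|\<Omega> k. n k * \<bar>vest k x - V k\<bar>) \<le> (LINT x|\<Omega> k. \<bar>n k * vest k x - \<nu> k\<bar> + \<bar>\<nu> k - n k * V k\<bar>)"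
      proof (rule integral_mono)
        fix x
        have "n k * \<bar>vest k x - V k\<bar> = \<bar>n k * vest k x - n k * V k\<bar>" by (simp add: abs_mult right_diff_distrib[symmetric])
        then show "n k * \<bar>vest k x - V k\<bar> \<le> \<bar>n k * vest k x - \<nu> k\<bar> + \<bar>\<nu> k - n k * V k\<bar>" by linarith
      qed (use int1[of k] in auto)
      then show "(LINT x|\<Omega> k. n k * \<bar>vest k x - V k\<bar>) \<le> (LINT x|\<Omega> k. \<bar>n k * vest k x - \<nu> k\<bar>) + \<bar>\<nu> k - n k * V k\<bar>"
        using int1[of k] by (simp add: \<Omega>.prob_space)
    qed
    show "(\<lambda>k. (LINT x|\<Omega> k. \<bar>n k * vest k x - \<nu> k\<bar>) + \<bar>\<nu> k - n k * V k\<bar>) \<longlonglongrightarrow> 0"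
      using tendsto_add[OF vest nVlim] by simp
  qed
  show "conv_in_prob \<Omega> (\<lambda>k x. vest k x / V k) 1"
    unfolding conv_in_prob_def
  proof (intro allI impI)
    fix r :: real assume r: "0 < r"
    show "(\<lambda>k. measure (\<Omega> k) {x \<in> space (\<Omega> k). r < \<bar>vest k x / V k - 1\<bar>}) \<longlonglongrightarrow> 0"
    proof (rule tendsto_sandwich[OF _ _ tendsto_const])
      show "\<forall>\<^sub>F k in sequentially. 0 \<le> measure (\<Omega> k) {x \<in> space (\<Omega> k). r < \<bar>vest k x / V k - 1\<bar>}" by simp
      show "(\<lambda>k. (LINT x|\<Omega> k. n k * \<bar>vest k x - V k\<bar>) / (r * (\<nu>0 / 2))) \<longlonglongrightarrow> 0"
        using tendsto_divide[OF L1 tendsto_const, of "r * (\<nu>0 / 2)"] r \<nu>(1) by simp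
      show "\<forall>\<^sub>F k in sequentially. measure (\<Omega> k) {x \<in> space (\<Omega> k). r < \<bar>vest k x / V k - 1\<bar>}
        \<le> (LINT x|\<Omega> k. n k * \<bar>vest k x - V k\<bar>) / (r * (\<nu>0 / 2))"
        using vpos
      proof eventually_elim
        case (elim k)
        \<comment> \<open>This lower bound lets Markov's inequality turn the L1 statement into one
          about the ratio.\<close>
        have nV0: "\<nu>0 / 2 \<le> n k * V k"
        proof -
          have "0 \<le> \<nu> k" using \<nu>(1) \<nu>(2)[of k] by linarith
          then have "\<nu>0 * (1 / 2) \<le> \<nu> k * v k" using \<nu>(1,2) elim by (intro mult_mono) auto
          then show ?thesis unfolding nV by simp
        qed
        then have V0: "0 < V k" using \<nu>(1) n[of k] by (simp add: zero_less_mult_iff) (smt (verit) divide_pos_pos mult_nonneg_nonpos of_nat_0_le_iff)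
        have "measure (\<Omega> k) {x \<in> space (\<Omega> k). r < \<bar>vest k x / V k - 1\<bar>}
          \<le> measure (\<Omega> k) {x \<in> space (\<Omega> k). r * (\<nu>0 / 2) \<le> n k * \<bar>vest k x - V k\<bar>}"
        proof (rule \<Omega>.finite_measure_mono)
          show "{x \<in> space (\<Omega> k). r < \<bar>vest k x / V k - 1\<bar>} \<subseteq> {x \<in> space (\<Omega> k). r * (\<nu>0 / 2) \<le> n k * \<bar>vest k x - V k\<bar>}"
          proof safe
            fix x assume "r < \<bar>vest k x / V k - 1\<bar>"
            moreover have "\<bar>vest k x / V k - 1\<bar> = \<bar>vest k x - V k\<bar> / V k"
            proof -
              have "vest k x / V k - 1 = (vest k x - V k) / V k" using V0 by (simp add: field_simps)
              then show ?thesis using V0 by simp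
            qed
            ultimately have "r * V k \<le> \<bar>vest k x - V k\<bar>" using V0 by (simp add: field_simps)
            then have "n k * (r * V k) \<le> n k * \<bar>vest k x - V k\<bar>" by (intro mult_left_mono) auto
            moreover have "r * (\<nu>0 / 2) \<le> r * (n k * V k)" using nV0 r by (intro mult_left_mono) auto
            ultimately show "r * (\<nu>0 / 2) \<le> n k * \<bar>vest k x - V k\<bar>" by (simp add: mult_ac)
          qed
          show "{x \<in> space (\<Omega> k). r * (\<nu>0 / 2) \<le> n k * \<bar>vest k x - V k\<bar>} \<in> sets (\<Omega> k)"
            using borel_measurable_integrable[OF int1(2)[of k]] by measurable
        qed
        also have "\<dots> \<le> (LINT x|\<Omega> k. n k * \<bar>vest k x - V k\<bar>) / (r * (\<nu>0 / 2))"
          by (rule integral_Markov_inequality_measure[where A = "{}"]) (use int1 r \<nu>(1) in auto)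
        finally show ?case .
      qed
    qed
  qed
qed

subsection \<open>Normalised parameters of a rejective design\<close>

lemma pmf_poisson_design:
  assumes q: "\<And>i. i < N \<Longrightarrow> 0 \<le> q i \<and> q i \<le> 1" and s: "s \<subseteq> {..<N}"
  shows "pmf (poisson_design N q) s = poisson_weight {..<N} q s"
proof -
  let ?M = "Pi_pmf {..<N} False (\<lambda>i. bernoulli_pmf (q i))"
  have "pmf (poisson_design N q) s = measure_pmf.prob ?M ((\<lambda>b. {i. i < N \<and> b i}) -` {s})"
    unfolding poisson_design_def by (simp add: pmf_map)
  also have "\<dots> = measure_pmf.prob ?M {\<lambda>i. i \<in> s}"
  proof (rule measure_pmf.finite_measure_eq_AE)
    show "AE b in measure_pmf ?M. (b \<in> (\<lambda>b. {i. i < N \<and> b i}) -` {s}) = (b \<in> {\<lambda>i. i \<in> s})"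
    proof (rule AE_pmfI)
      fix b assume "b \<in> set_pmf ?M"
      then have "\<And>i. i \<ge> N \<Longrightarrow> \<not> b i"
        using set_Pi_pmf_subset[of "{..<N}" False "\<lambda>i. bernoulli_pmf (q i)"] by (auto simp: PiE_dflt_def)
      then show "(b \<in> (\<lambda>b. {i. i < N \<and> b i}) -` {s}) = (b \<in> {\<lambda>i. i \<in> s})"
        using s by (auto simp: fun_eq_iff)
    qed
  qed auto
  also have "\<dots> = pmf ?M (\<lambda>i. i \<in> s)" by (simp add: pmf.rep_eq)
  also have "\<dots> = (\<Prod>i<N. pmf (bernoulli_pmf (q i)) (i \<in> s))"
    using s by (subst pmf_Pi) auto
  also have "\<dots> = (\<Prod>i<N. if i \<in> s then q i else 1 - q i)"
    using q by (intro prod.cong refl) auto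
  also have "\<dots> = poisson_weight {..<N} q s"
    unfolding poisson_weight_def using s by (simp add: prod.If_cases Int_absorb1 Diff_eq)
  finally show ?thesis .
qed

lemma set_poisson_design: "set_pmf (poisson_design N q) \<subseteq> Pow {..<N}"
  by (auto simp: poisson_design_def)

lemma prob_eq_Ew:
  assumes "set_pmf p \<subseteq> Pow A" "finite A"
  shows "measure_pmf.prob p B = Ew A (pmf p) (\<lambda>s. of_bool (s \<in> B))"
proof -
  have "measure_pmf.prob p B = measure_pmf.prob p (B \<inter> Pow A)"
    using assms(1) by (intro measure_pmf.finite_measure_eq_AE AE_pmfI) auto
  also have "\<dots> = (\<Sum>s\<in>B \<inter> Pow A. pmf p s)" using assms(2) by (intro measure_measure_pmf_finite) auto
  also have "\<dots> = (\<Sum>s\<in>Pow A. pmf p s * of_bool (s \<in> B))"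
    using assms(2) by (intro sum.mono_neutral_cong_left) auto
  finally show ?thesis by (simp add: Ew_def)
qed

lemma prob_weight_pmf:
  assumes "set_pmf p \<subseteq> Pow A" "finite A"
  shows "prob_weight A (pmf p)"
  using assms sum_pmf_eq_1[of "Pow A" p] by (auto simp: prob_weight_def)

text \<open>The new parameter has odds \<open>t\<close> times those of \<open>q i\<close>, written
  so that it also makes sense at \<open>q i = 1\<close>. The weights change by a factor depending on
  \<open>s\<close> only through \<open>card s\<close>, which conditioning on the size
  cancels.\<close>

lemma poisson_weight_tilt:
  assumes "finite A" "s \<subseteq> A" and t: "0 < t" and q: "\<And>i. i \<in> A \<Longrightarrow> 0 \<le> q i \<and> q i \<le> 1"
  shows "poisson_weight A (\<lambda>i. t * q i / (1 - q i + t * q i)) s = t ^ card s / (\<Prod>i\<in>A. 1 - q i + t * q i) * poisson_weight A q s"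
proof -
  have pos: "0 < 1 - q i + t * q i" if "i \<in> A" for i
    using q[OF that] t by (cases "q i = 1") (auto intro!: add_pos_nonneg)
  have "poisson_weight A (\<lambda>i. t * q i / (1 - q i + t * q i)) s =
    (\<Prod>i\<in>s. t * q i / (1 - q i + t * q i)) * (\<Prod>i\<in>A - s. (1 - q i) / (1 - q i + t * q i))"
    unfolding poisson_weight_def
  proof (intro arg_cong2[where f = "(*)"] refl prod.cong)
    fix i assume "i \<in> A - s"
    then show "1 - t * q i / (1 - q i + t * q i) = (1 - q i) / (1 - q i + t * q i)"
      using pos[of i] by (simp add: field_simps)
  qed
  also have "\<dots> = t ^ card s * poisson_weight A q s / ((\<Prod>i\<in>s. 1 - q i + t * q i) * (\<Prod>i\<in>A - s. 1 - q i + t * q i))"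
    by (simp add: poisson_weight_def prod_dividef prod.distrib)
  also have "(\<Prod>i\<in>s. 1 - q i + t * q i) * (\<Prod>i\<in>A - s. 1 - q i + t * q i) = (\<Prod>i\<in>A. 1 - q i + t * q i)"
    by (subst prod.subset_diff[OF assms(2,1)], rule mult.commute)
  finally show ?thesis by simp
qed

lemma size_prob_eq_sum: "finite A \<Longrightarrow> size_prob A q (int n) = (\<Sum>s | s \<subseteq> A \<and> card s = n. poisson_weight A q s)"
proof -
  assume "finite A"
  then have "(\<Sum>s | s \<subseteq> A \<and> card s = n. poisson_weight A q s) = (\<Sum>s\<in>Pow A. poisson_weight A q s *\<^sub>R (if int (card s) = int n then 1 else 0))"
    by (intro sum.mono_neutral_cong_left) auto
  then show ?thesis by (simp add: size_prob_def E_poisson_def)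
qed

lemma rej_weight_tilt:
  assumes "finite A" "s \<subseteq> A" and t: "0 < t" and q: "\<And>i. i \<in> A \<Longrightarrow> 0 \<le> q i \<and> q i \<le> 1"
  shows "rej_weight A (\<lambda>i. t * q i / (1 - q i + t * q i)) n s = rej_weight A q n s"
proof -
  let ?c = "t ^ n / (\<Prod>i\<in>A. 1 - q i + t * q i)"
  have "0 < (\<Prod>i\<in>A. 1 - q i + t * q i)"
  proof (rule prod_pos)
    fix i assume "i \<in> A"
    then show "0 < 1 - q i + t * q i"
      using q[of i] t by (cases "q i = 1") (auto intro!: add_pos_nonneg)
  qed
  then have c0: "0 < ?c" using t by simp
  define c where "c = ?c"
  have c: "0 < c" using c0 by (simp add: c_def)
  have pb': "size_prob A (\<lambda>i. t * q i / (1 - q i + t * q i)) (int n) = c * size_prob A q (int n)"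
    unfolding size_prob_eq_sum[OF assms(1)] sum_distrib_left c_def
    using poisson_weight_tilt[OF assms(1) _ t q] by (intro sum.cong refl) auto
  then show ?thesis
  proof (cases "card s = n")
    case True
    then have "poisson_weight A (\<lambda>i. t * q i / (1 - q i + t * q i)) s = c * poisson_weight A q s"
      using poisson_weight_tilt[OF assms(1,2) t q] by (simp add: c_def)
    then show ?thesis
      unfolding rej_weight_def pb' using True c by simp
  qed (simp add: rej_weight_def)
qed

text \<open>Intermediate value theorem: the expected size starts at the number of units with
  parameter 1 at \<open>t = 0\<close> and tends to \<open>card A\<close> as \<open>t\<close> tends
  to infinity.\<close>

lemma exists_tilt:
  assumes A: "finite A" and q: "\<And>i. i \<in> A \<Longrightarrow> 0 < q i \<and> q i \<le> 1"
    and n: "real (card {i \<in> A. q i = 1}) < n" "n < real (card A)"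
  obtains t :: real where "0 < t" "(\<Sum>i\<in>A. t * q i / (1 - q i + t * q i)) = n"
proof -
  \<comment> \<open>For \<open>q i = 1\<close> the quotient is 1 for positive \<open>t\<close> but
    \<open>0 / 0 = 0\<close> at \<open>t = 0\<close>; the case distinction restores continuity
    there.\<close>
  define h where "h t = (\<Sum>i\<in>A. if q i = 1 then 1 else t * q i / (1 - q i + t * q i))" for t
  have cont: "continuous_on {0..} h" unfolding h_def
  proof (intro continuous_on_sum)
    fix i assume i: "i \<in> A"
    show "continuous_on {0..} (\<lambda>t. if q i = 1 then 1 else t * q i / (1 - q i + t * q i))"
    proof (cases "q i = 1")
      case False
      have "1 - q i + t * q i \<noteq> 0" if "t \<ge> 0" for t
        using q[OF i] False that by (smt (verit) mult_nonneg_nonneg)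
      then show ?thesis using False by (auto intro!: continuous_intros)
    qed simp
  qed
  have h0: "h 0 < n"
  proof -
    have "h 0 = (\<Sum>i\<in>A. if q i = 1 then 1 else 0)" unfolding h_def by (intro sum.cong refl) auto
    also have "\<dots> = real (card {i \<in> A. q i = 1})" using A by (simp add: sum.If_cases Int_def)
    finally show ?thesis using n by simp
  qed
  have "(h \<longlongrightarrow> (\<Sum>i\<in>A. 1)) at_top" unfolding h_def
  proof (intro tendsto_sum)
    fix i assume i: "i \<in> A"
    show "((\<lambda>t. if q i = 1 then 1 else t * q i / (1 - q i + t * q i)) \<longlongrightarrow> 1) at_top"
    proof (cases "q i = 1")
      case False
      have qi: "0 < q i" using q[OF i] by simp
      have "((\<lambda>t. q i / ((1 - q i) / t + q i)) \<longlongrightarrow> q i / (0 + q i)) at_top"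
        using qi by (intro tendsto_intros tendsto_divide_0[OF tendsto_const] filterlim_at_top_imp_at_infinity filterlim_ident) auto
      moreover have "\<forall>\<^sub>F t in at_top. q i / ((1 - q i) / t + q i) = t * q i / (1 - q i + t * q i)"
        using eventually_gt_at_top[of 0]
      proof eventually_elim
        case (elim t)
        have "(1 - q i) / t + q i = (1 - q i + t * q i) / t" using elim by (simp add: field_simps)
        then show ?case using elim by (simp add: mult.commute)
      qed
      ultimately show ?thesis using False qi by (simp add: tendsto_cong)
    qed simp
  qed
  then have "\<forall>\<^sub>F t in at_top. n < h t" using n(2) by (intro order_tendstoD(1)) auto
  then obtain T0 where T0: "\<And>t. T0 \<le> t \<Longrightarrow> n < h t" unfolding eventually_at_top_linorder by blast
  define T where "T = max 0 T0"
  have T: "0 \<le> T" "n < h T" using T0[of T] by (auto simp: T_def)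
  obtain t where t: "0 \<le> t" "t \<le> T" "h t = n"
    using IVT'[of h 0 n T] h0 T continuous_on_subset[OF cont, of "{0..T}"] by auto
  have t0: "0 < t" using t h0 by (cases "t = 0") auto
  have "h t = (\<Sum>i\<in>A. t * q i / (1 - q i + t * q i))"
    unfolding h_def using t0 by (intro sum.cong refl) auto
  then show ?thesis using that[OF t0] t by simp
qed

text \<open>Positive inclusion probabilities force positive parameters, and units with parameter 1
  are selected with certainty. Since the inclusion probabilities sum to \<open>n < N\<close>, some
  unit has parameter below 1 and adds to that sum, so fewer than \<open>n\<close> units have
  parameter 1 and \<open>exists_tilt\<close> applies.\<close>

lemma rejective_design_normalised:
  assumes rd: "rejective_design N n p" and incl: "\<And>i. i < N \<Longrightarrow> 0 < incl p i" and n: "n < N"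
  obtains q where "rejective_normalised {..<N} q n" "\<And>s. s \<subseteq> {..<N} \<Longrightarrow> pmf p s = rej_weight {..<N} q n s"
    "\<And>i. i < N \<Longrightarrow> incl p i = rej_incl {..<N} q n i"
proof -
  let ?A = "{..<N}"
  obtain q0 where q0: "\<And>i. i < N \<Longrightarrow> 0 \<le> q0 i \<and> q0 i \<le> 1"
    and ne: "set_pmf (poisson_design N q0) \<inter> {s. card s = n} \<noteq> {}"
    and p: "p = cond_pmf (poisson_design N q0) {s. card s = n}"
    using rd unfolding rejective_design_def by blast
  let ?po = "poisson_design N q0"
  have supp: "set_pmf p \<subseteq> Pow ?A" unfolding p set_cond_pmf[OF ne] using set_poisson_design[of N q0] by auto
  have pm: "measure_pmf.prob ?po {s. card s = n} = size_prob ?A q0 (int n)"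
  proof -
    have "measure_pmf.prob ?po {s. card s = n} = Ew ?A (pmf ?po) (\<lambda>s. of_bool (s \<in> {s. card s = n}))"
      by (rule prob_eq_Ew[OF set_poisson_design]) simp
    also have "\<dots> = size_prob ?A q0 (int n)"
      unfolding Ew_def size_prob_def E_poisson_def using q0 by (intro sum.cong refl) (simp add: pmf_poisson_design)
    finally show ?thesis .
  qed
  have prw: "pmf p s = rej_weight ?A q0 n s" if "s \<subseteq> ?A" for s
    unfolding p pmf_cond[OF ne] pm rej_weight_def using q0 that by (simp add: pmf_poisson_design)
  have inclE: "incl p i = Ew ?A (rej_weight ?A q0 n) (\<lambda>s. of_bool (i \<in> s))" for i
  proof -
    have "incl p i = Ew ?A (pmf p) (\<lambda>s. of_bool (s \<in> {s. i \<in> s}))"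
      unfolding incl_def by (rule prob_eq_Ew[OF supp]) simp
    also have "\<dots> = Ew ?A (rej_weight ?A q0 n) (\<lambda>s. of_bool (i \<in> s))"
      unfolding Ew_def using prw by (intro sum.cong refl) auto
    finally show ?thesis .
  qed
  have sum_incl: "(\<Sum>i\<in>?A. incl p i) = n"
  proof -
    have "(\<Sum>i\<in>?A. incl p i) = Ew ?A (pmf p) (\<lambda>s. \<Sum>i\<in>s. 1)"
      unfolding Ew_member_sum[OF finite_lessThan] inclE
      using prw by (intro sum.cong refl) (auto simp: Ew_def intro!: sum.cong)
    also have "\<dots> = Ew ?A (pmf p) (\<lambda>s. n)"
    proof (rule Ew_cong)
      fix s assume "s \<subseteq> ?A" "pmf p s \<noteq> 0"
      then show "(\<Sum>i\<in>s. 1) = real n" using prw[of s] by (auto simp: rej_weight_def split: if_splits)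
    qed
    also have "\<dots> = n" using prob_weight_pmf[OF supp] by (simp add: Ew_const)
    finally show ?thesis .
  qed
  have q0pos: "0 < q0 i" if i: "i < N" for i
  proof (rule ccontr)
    assume "\<not> 0 < q0 i"
    then have qi: "q0 i = 0" using q0[OF i] by auto
    have "Ew ?A (rej_weight ?A q0 n) (\<lambda>s. of_bool (i \<in> s)) = Ew ?A (rej_weight ?A q0 n) (\<lambda>s. 0 :: real)"
    proof (rule Ew_cong)
      fix s assume s: "s \<subseteq> ?A" "rej_weight ?A q0 n s \<noteq> 0"
      have "i \<notin> s"
      proof
        assume "i \<in> s"
        then have "(\<Prod>i\<in>s. q0 i) = 0" using qi s by (intro prod_zero) (auto intro: finite_subset)
        then show False using s by (simp add: rej_weight_def poisson_weight_def split: if_splits)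
      qed
      then show "of_bool (i \<in> s) = (0 :: real)" by simp
    qed
    then show False using incl[OF i] inclE[of i] by (simp add: Ew_def)
  qed
  have ones: "incl p i = 1" if i: "i < N" "q0 i = 1" for i
  proof -
    have "Ew ?A (pmf p) (\<lambda>s. of_bool (i \<in> s)) = Ew ?A (pmf p) (\<lambda>s. 1 :: real)"
    proof (rule Ew_cong)
      fix s assume s: "s \<subseteq> ?A" "pmf p s \<noteq> 0"
      have "i \<in> s"
      proof (rule ccontr)
        assume "i \<notin> s"
        then have "(\<Prod>i\<in>?A - s. 1 - q0 i) = 0" using i by (intro prod_zero) auto
        then show False using s prw[of s] by (simp add: rej_weight_def poisson_weight_def split: if_splits)
      qed
      then show "of_bool (i \<in> s) = (1 :: real)" by simp
    qed
    moreover have "Ew ?A (pmf p) (\<lambda>s. of_bool (i \<in> s)) = incl p i"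
      unfolding inclE Ew_def using prw by (intro sum.cong refl) auto
    ultimately show ?thesis using prob_weight_pmf[OF supp] by (simp add: Ew_const)
  qed
  have card1: "real (card {i \<in> ?A. q0 i = 1}) < n"
  proof -
    let ?O = "{i \<in> ?A. q0 i = 1}"
    have "real (card ?O) = (\<Sum>i\<in>?O. incl p i)" using ones by simp
    also have "\<dots> < (\<Sum>i\<in>?A. incl p i)"
    proof -
      have "?O \<noteq> ?A"
      proof
        assume "?O = ?A"
        then have "(\<Sum>i\<in>?A. incl p i) = (\<Sum>i\<in>?A. 1)" using ones by (intro sum.cong) auto
        then show False using sum_incl n by simp
      qed
      then obtain j where j: "j \<in> ?A" "j \<notin> ?O" by auto
      show ?thesis
      proof (rule sum_strict_mono2[where b = j])
        fix i assume "i \<in> ?A"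
        then show "0 \<le> incl p i" using incl[of i] by simp
      qed (use j incl[of j] in auto)
    qed
    finally show ?thesis using sum_incl by simp
  qed
  obtain t where t: "0 < t" "(\<Sum>i\<in>?A. t * q0 i / (1 - q0 i + t * q0 i)) = n"
    by (rule exists_tilt[of ?A q0 "real n"]) (use q0 q0pos card1 n in auto)
  let ?q = "\<lambda>i. t * q0 i / (1 - q0 i + t * q0 i)"
  have rwq: "pmf p s = rej_weight ?A ?q n s" if "s \<subseteq> ?A" for s
    unfolding prw[OF that] by (rule rej_weight_tilt[symmetric]) (use that t q0 in auto)
  show ?thesis
  proof (rule that[of ?q])
    show "rejective_normalised ?A ?q n"
    proof
      fix i assume "i \<in> ?A"
      then have "0 \<le> q0 i" "q0 i \<le> 1" using q0 by auto
      moreover have "0 \<le> t * q0 i" using t(1) calculation by simp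
      ultimately show "0 \<le> ?q i \<and> ?q i \<le> 1"
        by (intro conjI divide_nonneg_nonneg divide_le_eq_1[THEN iffD2]) auto
    qed (use t in auto)
    show "pmf p s = rej_weight ?A ?q n s" if "s \<subseteq> ?A" for s by (rule rwq[OF that])
    show "incl p i = rej_incl ?A ?q n i" if "i < N" for i
      unfolding inclE rej_incl_def Ew_def using prw rwq by (intro sum.cong refl) auto
  qed
qed

text \<open>A set of size \<open>n\<close> with weight 0 contains a unit with \<open>q i = 0\<close>
  or misses one with \<open>q i = 1\<close>; equality of the inclusion probabilities excludes both
  under \<open>p\<close>. This is the absolute continuity that the change of design requires and
  that \<open>d2\<close>, a sum over the support of the rejective design, does not see.\<close>

lemma (in rejective_normalised) rej_weight_zero_imp:
  assumes p: "set_pmf p \<subseteq> {s. s \<subseteq> A \<and> card s = n}" and incl: "\<And>i. i \<in> A \<Longrightarrow> incl p i = \<pi> i" "\<And>i. i \<in> A \<Longrightarrow> 0 < incl p i"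
    and s: "s \<subseteq> A" "rej_weight A q n s = 0"
  shows "pmf p s = 0"
proof (rule ccontr)
  assume ps: "pmf p s \<noteq> 0"
  then have c: "card s = n" using p by (auto simp: set_pmf_iff)
  have f: "finite s" "finite (A - s)" using s fin by (auto intro: finite_subset)
  have "poisson_weight A q s = 0" using s(2) c b_pos by (simp add: rej_weight_def)
  then consider i where "i \<in> s" "q i = 0" | i where "i \<in> A - s" "q i = 1"
    unfolding poisson_weight_def using f by (auto simp: prod_zero_iff)
  then show False
  proof cases
    case 1
    then have "\<pi> i = 0" using pi_eq(1)[of i] s by auto
    then show False using 1 incl[of i] s by auto
  next
    case 2
    then have "\<pi> i = 1" using pi_eq(2)[of i] by auto
    then have "measure_pmf.prob p {s. i \<in> s} = 1" using incl(1)[of i] 2 by (simp add: incl_def)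
    then have "AE s in measure_pmf p. i \<in> s" using measure_pmf.prob_eq_1[of "{s. i \<in> s}" p] by simp
    then have "i \<in> s" using ps by (auto simp: AE_measure_pmf_iff set_pmf_iff)
    then show False using 2 by simp
  qed
qed

subsection \<open>Reduction of the two-stage sample to a product space\<close>

locale two_stage =
  fixes M :: "'w measure" and N n :: nat and p :: "nat set pmf" and nII :: "nat \<Rightarrow> nat"
    and f :: "nat \<Rightarrow> 'a::euclidean_space \<Rightarrow> real" and S :: "'w \<Rightarrow> nat set" and X :: "nat \<Rightarrow> nat \<Rightarrow> 'w \<Rightarrow> 'a"
    and u :: "nat \<Rightarrow> 'a set"
  assumes ts: "two_stage_sample M N p nII f S X"
    and fs: "fixed_size_design N n p" and n: "0 < n"
    and incl_pos: "\<And>i. i < N \<Longrightarrow> 0 < incl p i"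
    and dens: "\<And>i. i < N \<Longrightarrow> density_on (u i) (f i)"
    and nII: "\<And>i. i < N \<Longrightarrow> 2 \<le> nII i"
begin

text \<open>The point mass at indices outside the population makes every component a probability
  measure, as the locale for product spaces demands.\<close>

definition lam :: "nat \<times> nat \<Rightarrow> 'a measure" where
  "lam k = (if fst k < N then density lebesgue (\<lambda>x. ennreal (f (fst k) x)) else return lebesgue 0)"

definition Ks :: "nat set \<Rightarrow> (nat \<times> nat) set" where "Ks s = (SIGMA i:s. {..<nII i})"

text \<open>
  \<open>M0\<close> describes a second stage carried out in every PSU.  Given \<open>S = s\<close>, a function of the points in
  the PSUs of \<open>s\<close> has the same expectation under \<open>M\<close> as under \<open>M0\<close>.
\<close>

definition M0 :: "(nat \<times> nat \<Rightarrow> 'a) measure" where "M0 = PiM (Ks {..<N}) lam"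

definition XX :: "'w \<Rightarrow> nat \<times> nat \<Rightarrow> 'a" where "XX \<omega> k = X (fst k) (snd k) \<omega>"

abbreviation "sel s \<equiv> {\<omega>\<in>space M. S \<omega> = s}"

sublocale M: prob_space M using ts by (simp add: two_stage_sample_def)

lemma f_meas [measurable]: "i < N \<Longrightarrow> f i \<in> borel_measurable lebesgue"
  using dens by (simp add: density_on_def)

lemma sets_lam [simp]: "sets (lam k) = sets lebesgue" by (simp add: lam_def)
lemma prob_space_lam: "prob_space (lam k)"
proof (cases "fst k < N")
  case True
  then show ?thesis
    using dens[OF True] by (intro prob_spaceI) (simp add: lam_def density_on_def emeasure_density)
qed (simp add: lam_def prob_space_return)

sublocale lam: product_prob_space lam "Ks {..<N}"
  by (intro product_prob_spaceI prob_space_lam)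

sublocale M0: prob_space M0 unfolding M0_def by (intro prob_space_PiM prob_space_lam)

lemma Ks_fin: "s \<subseteq> {..<N} \<Longrightarrow> finite (Ks s)" unfolding Ks_def by (auto intro: finite_subset)

lemma Ks_mono: "s \<subseteq> {..<N} \<Longrightarrow> Ks s \<subseteq> Ks {..<N}" unfolding Ks_def by auto

lemma sel_sets [measurable]: "s \<subseteq> {..<N} \<Longrightarrow> sel s \<in> sets M"
proof -
  assume s: "s \<subseteq> {..<N}"
  have "S \<in> measurable M (count_space (Pow {..<N}))" using ts by (simp add: two_stage_sample_def)
  then have "S -` {s} \<inter> space M \<in> sets M" by (rule measurable_sets) (use s in auto)
  also have "S -` {s} \<inter> space M = sel s" by auto
  finally show ?thesis .
qed

lemma S_Pow: "\<omega> \<in> space M \<Longrightarrow> S \<omega> \<in> Pow {..<N}"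
  using ts measurable_space[of S M "count_space (Pow {..<N})"] by (simp add: two_stage_sample_def)

lemma measure_sel: "s \<subseteq> {..<N} \<Longrightarrow> measure M (sel s) = pmf p s"
  using ts by (simp add: two_stage_sample_def)

lemma supp: "set_pmf p \<subseteq> Pow {..<N}" "pmf p s \<noteq> 0 \<Longrightarrow> s \<subseteq> {..<N} \<and> card s = n"
  using fs by (auto simp: fixed_size_design_def set_pmf_iff)

lemma pw: "prob_weight {..<N} (pmf p)" by (rule prob_weight_pmf[OF supp(1)]) simp

text \<open>The measurability contained in \<open>distributed\<close> concerns a conditional
  measure, which has the same measurable sets as \<open>M\<close>; as unit \<open>i\<close> has
  positive inclusion probability, such a measure exists.\<close>

lemma X_meas: assumes "k \<in> Ks {..<N}" shows "(\<lambda>\<omega>. XX \<omega> k) \<in> measurable M lebesgue"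
proof -
  obtain i j where k: "k = (i, j)" "i < N" "j < nII i" using assms by (auto simp: Ks_def)
  have "measure_pmf.prob p {s. i \<in> s} \<noteq> 0" using incl_pos[OF k(2)] by (simp add: incl_def)
  then obtain s where s: "s \<in> set_pmf p" "i \<in> s"
    by (metis (mono_tags, lifting) disjoint_iff measure_pmf_zero_iff mem_Collect_eq)
  have "distributed (uniform_measure M (sel s)) lebesgue (X i j) (\<lambda>x. ennreal (f i x))"
    using ts s k by (auto simp: two_stage_sample_def)
  then have "X i j \<in> measurable (uniform_measure M (sel s)) lebesgue" by (rule distributed_measurable)
  moreover have "measurable (uniform_measure M (sel s)) (lebesgue :: 'a measure) = measurable M lebesgue"
    by (rule measurable_cong_sets) simp_all
  ultimately show ?thesis by (simp add: XX_def k)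
qed

context
  fixes s :: "nat set"
  assumes s: "s \<subseteq> {..<N}"
begin

abbreviation "L \<equiv> PiM (Ks s) (\<lambda>_. lebesgue :: 'a measure)"

lemma XR_meas: "(\<lambda>\<omega>. restrict (XX \<omega>) (Ks s)) \<in> measurable M L"
  using Ks_mono[OF s] X_meas by (intro measurable_restrict) auto

lemma sets_L: "sets (PiM (Ks s) lam) = sets L" by (intro sets_PiM_cong) auto

lemma restrict_meas: "(\<lambda>w. restrict w (Ks s)) \<in> measurable M0 L"
proof -
  have "(\<lambda>w. restrict w (Ks s)) \<in> measurable M0 (PiM (Ks s) lam)"
    unfolding M0_def by (rule measurable_restrict_subset[OF Ks_mono[OF s]])
  then show ?thesis using measurable_cong_sets[OF refl sets_L] by blast
qed

lemma distr_M0: "distr M0 L (\<lambda>w. restrict w (Ks s)) = PiM (Ks s) lam"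
proof -
  have "distr M0 (PiM (Ks s) lam) (\<lambda>w. restrict w (Ks s)) = PiM (Ks s) lam"
    unfolding M0_def by (rule lam.distr_PiM_restrict_finite[OF Ks_fin[OF s] Ks_mono[OF s]])
  moreover have "distr M0 L (\<lambda>w. restrict w (Ks s)) = distr M0 (PiM (Ks s) lam) (\<lambda>w. restrict w (Ks s))"
    by (rule distr_cong) (simp_all add: sets_L)
  ultimately show ?thesis by simp
qed

lemma distr_U:
  assumes ps: "pmf p s \<noteq> 0"
  shows "distr (uniform_measure M (sel s)) L (\<lambda>\<omega>. restrict (XX \<omega>) (Ks s)) = PiM (Ks s) lam"
proof -
  let ?U = "uniform_measure M (sel s)"
  have sp: "s \<in> set_pmf p" using ps by (simp add: set_pmf_iff)
  have "measure M (sel s) \<noteq> 0" using ps s by (simp add: measure_sel)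
  then have "emeasure M (sel s) \<noteq> 0" by (simp add: M.emeasure_eq_measure)
  then interpret U: prob_space ?U by (intro prob_space_uniform_measure) (simp_all add: M.emeasure_eq_measure)
  have ind: "U.indep_vars (\<lambda>_. lebesgue) (\<lambda>(i, j). X i j) (Ks s)"
    using ts sp by (simp add: two_stage_sample_def Ks_def)
  have XXe: "(\<lambda>(i, j). X i j) = (\<lambda>k \<omega>. XX \<omega> k)" by (auto simp: fun_eq_iff XX_def)
  have d: "distr ?U lebesgue (\<lambda>\<omega>. XX \<omega> k) = lam k" "(\<lambda>\<omega>. XX \<omega> k) \<in> measurable ?U lebesgue" if k: "k \<in> Ks s" for k
  proof -
    obtain i j where k': "k = (i, j)" "i \<in> s" "j < nII i" using k by (auto simp: Ks_def)
    have *: "distributed ?U lebesgue (X i j) (\<lambda>x. ennreal (f i x))"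
      using ts sp k' by (auto simp: two_stage_sample_def)
    show "distr ?U lebesgue (\<lambda>\<omega>. XX \<omega> k) = lam k"
      using distributed_distr_eq_density[OF *] k' s by (auto simp: XX_def lam_def)
    show "(\<lambda>\<omega>. XX \<omega> k) \<in> measurable ?U lebesgue"
      using distributed_measurable[OF *] by (simp add: XX_def k')
  qed
  \<comment> \<open>The characterisation of independence by a product law requires a nonempty index
    set; \<open>0 < n\<close> and \<open>2 \<le> nII i\<close> provide one.\<close>
  have ne: "Ks s \<noteq> {}"
  proof -
    have "card s = n" using supp(2)[OF ps] by simp
    then have "s \<noteq> {}" using n by auto
    then obtain i where "i \<in> s" by auto
    then have "(i, 0) \<in> Ks s" using nII[of i] s by (auto simp: Ks_def)
    then show ?thesis by auto
  qed
  have "distr ?U L (\<lambda>\<omega>. \<lambda>k\<in>Ks s. XX \<omega> k) = PiM (Ks s) (\<lambda>k. distr ?U lebesgue (\<lambda>\<omega>. XX \<omega> k))"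
    using ind unfolding XXe by (subst (asm) U.indep_vars_iff_distr_eq_PiM'[OF ne]) (use d in auto)
  also have "\<dots> = PiM (Ks s) lam" by (intro PiM_cong refl d(1))
  finally show ?thesis .
qed

context
  fixes \<Phi> :: "(nat \<times> nat \<Rightarrow> 'a) \<Rightarrow> 'b::{banach,second_countable_topology}"
  assumes \<Phi>m: "\<Phi> \<in> borel_measurable L" and \<Phi>r: "\<And>w. \<Phi> w = \<Phi> (restrict w (Ks s))"
begin

lemma \<Phi>_M: "(\<lambda>\<omega>. \<Phi> (XX \<omega>)) \<in> borel_measurable M"
proof -
  have "(\<lambda>\<omega>. \<Phi> (restrict (XX \<omega>) (Ks s))) \<in> borel_measurable M" by (rule measurable_compose[OF XR_meas \<Phi>m])
  then show ?thesis unfolding \<Phi>r[symmetric] .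
qed

text \<open>Given \<open>S = s\<close>, the points in \<open>s\<close> have the product law, which
  is also the law of the restriction under \<open>M0\<close>. Integrability is asked only for
  \<open>s\<close> in the support; for other \<open>s\<close> both sides are 0.\<close>

lemma expectation_transfer_event:
  assumes int: "pmf p s \<noteq> 0 \<Longrightarrow> integrable M0 \<Phi>"
  shows "integrable M (\<lambda>\<omega>. indicator (sel s) \<omega> *\<^sub>R \<Phi> (XX \<omega>))"
    and "(\<integral>\<omega>. indicator (sel s) \<omega> *\<^sub>R \<Phi> (XX \<omega>) \<partial>M) = pmf p s *\<^sub>R (\<integral>w. \<Phi> w \<partial>M0)"
proof -
  have *: "integrable M (\<lambda>\<omega>. indicator (sel s) \<omega> *\<^sub>R \<Phi> (XX \<omega>)) \<and>
    (\<integral>\<omega>. indicator (sel s) \<omega> *\<^sub>R \<Phi> (XX \<omega>) \<partial>M) = pmf p s *\<^sub>R (\<integral>w. \<Phi> w \<partial>M0)"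
  proof (cases "pmf p s = 0")
    case True
    then have "measure M (sel s) = 0" using s by (simp add: measure_sel)
    then have "sel s \<in> null_sets M" using s by (intro null_setsI) (auto simp: M.emeasure_eq_measure)
    then have ae: "AE \<omega> in M. indicator (sel s) \<omega> *\<^sub>R \<Phi> (XX \<omega>) = 0"
      by (rule AE_I') (auto simp: indicator_def)
    have m: "(\<lambda>\<omega>. indicator (sel s) \<omega> *\<^sub>R \<Phi> (XX \<omega>)) \<in> borel_measurable M"
      using \<Phi>_M sel_sets[OF s] by (intro borel_measurable_scaleR borel_measurable_indicator)
    have "integrable M (\<lambda>\<omega>. indicator (sel s) \<omega> *\<^sub>R \<Phi> (XX \<omega>)) = integrable M (\<lambda>\<omega>. 0 :: 'b)"
      by (rule integrable_cong_AE[OF m _ ae]) simp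
    moreover have "(\<integral>\<omega>. indicator (sel s) \<omega> *\<^sub>R \<Phi> (XX \<omega>) \<partial>M) = 0" using ae by (rule integral_eq_zero_AE)
    ultimately show ?thesis using True by simp
  next
    case False
    let ?U = "uniform_measure M (sel s)"
    have gm: "(\<lambda>\<omega>. indicator (sel s) \<omega> / pmf p s) \<in> borel_measurable M"
      using sel_sets[OF s] by (intro borel_measurable_divide borel_measurable_indicator) auto
    have Ud: "?U = density M (\<lambda>\<omega>. ennreal (indicator (sel s) \<omega> / pmf p s))"
      unfolding uniform_measure_def
    proof (rule density_cong)
      show "AE \<omega> in M. indicator (sel s) \<omega> / emeasure M (sel s) = ennreal (indicator (sel s) \<omega> / pmf p s)"
      proof (rule AE_I2)
        fix \<omega>
        have "0 < pmf p s" using False by (simp add: pmf_pos)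
        then have "ennreal (indicator (sel s) \<omega> / pmf p s) = ennreal (indicator (sel s) \<omega>) / ennreal (pmf p s)"
          by (intro divide_ennreal[symmetric]) auto
        then show "indicator (sel s) \<omega> / emeasure M (sel s) = ennreal (indicator (sel s) \<omega> / pmf p s)"
          using s by (simp only: M.emeasure_eq_measure measure_sel ennreal_indicator)
      qed
    qed (use sel_sets[OF s] gm in \<open>auto intro!: borel_measurable_indicator\<close>)
    have XU: "(\<lambda>\<omega>. restrict (XX \<omega>) (Ks s)) \<in> measurable ?U L" using XR_meas measurable_cong_sets[of ?U M L L] by simp
    have M0r: "integrable M0 \<Phi>" by (rule int[OF False])
    have "integrable (distr M0 L (\<lambda>w. restrict w (Ks s))) \<Phi>"
      unfolding integrable_distr_eq[OF restrict_meas \<Phi>m] \<Phi>r[symmetric] by (rule M0r)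
    then have "integrable (distr ?U L (\<lambda>\<omega>. restrict (XX \<omega>) (Ks s))) \<Phi>"
      unfolding distr_M0 distr_U[OF False] .
    then have iU: "integrable ?U (\<lambda>\<omega>. \<Phi> (XX \<omega>))"
      unfolding integrable_distr_eq[OF XU \<Phi>m] \<Phi>r[symmetric] .
    have "(\<integral>\<omega>. \<Phi> (XX \<omega>) \<partial>?U) = (\<integral>w. \<Phi> w \<partial>distr ?U L (\<lambda>\<omega>. restrict (XX \<omega>) (Ks s)))"
      unfolding integral_distr[OF XU \<Phi>m] \<Phi>r[symmetric] ..
    also have "\<dots> = (\<integral>w. \<Phi> w \<partial>distr M0 L (\<lambda>w. restrict w (Ks s)))" unfolding distr_M0 distr_U[OF False] ..
    also have "\<dots> = (\<integral>w. \<Phi> w \<partial>M0)" unfolding integral_distr[OF restrict_meas \<Phi>m] \<Phi>r[symmetric] ..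
    finally have eU: "(\<integral>\<omega>. \<Phi> (XX \<omega>) \<partial>?U) = (\<integral>w. \<Phi> w \<partial>M0)" .
    have dnn: "AE \<omega> in M. 0 \<le> indicator (sel s) \<omega> / pmf p s" by simp
    have sc: "indicator (sel s) \<omega> *\<^sub>R \<Phi> (XX \<omega>) = pmf p s *\<^sub>R ((indicator (sel s) \<omega> / pmf p s) *\<^sub>R \<Phi> (XX \<omega>))" for \<omega>
      using False by simp
    have i1: "integrable M (\<lambda>\<omega>. (indicator (sel s) \<omega> / pmf p s) *\<^sub>R \<Phi> (XX \<omega>))"
      using iU unfolding Ud by (subst (asm) integrable_density[OF \<Phi>_M gm dnn])
    have e1: "(\<integral>\<omega>. (indicator (sel s) \<omega> / pmf p s) *\<^sub>R \<Phi> (XX \<omega>) \<partial>M) = (\<integral>w. \<Phi> w \<partial>M0)"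
      using eU unfolding Ud by (subst (asm) integral_density[OF \<Phi>_M gm dnn])
    show ?thesis unfolding sc
    proof (intro conjI integrable_scaleR_right i1)
      show "(\<integral>\<omega>. pmf p s *\<^sub>R ((indicator (sel s) \<omega> / pmf p s) *\<^sub>R \<Phi> (XX \<omega>)) \<partial>M) = pmf p s *\<^sub>R (\<integral>w. \<Phi> w \<partial>M0)"
        unfolding e1[symmetric] by (rule integral_scaleR_right)
    qed
  qed
  then show "integrable M (\<lambda>\<omega>. indicator (sel s) \<omega> *\<^sub>R \<Phi> (XX \<omega>))"
    "(\<integral>\<omega>. indicator (sel s) \<omega> *\<^sub>R \<Phi> (XX \<omega>) \<partial>M) = pmf p s *\<^sub>R (\<integral>w. \<Phi> w \<partial>M0)" by auto
qed

end
end

text \<open>Decomposition over the finitely many values of \<open>S\<close>. The restriction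
  hypothesis \<open>\<Phi>r\<close> reflects that points outside the sampled PSUs have no prescribed
  law.\<close>

lemma expectation_transfer:
  fixes \<Phi> :: "nat set \<Rightarrow> (nat \<times> nat \<Rightarrow> 'a) \<Rightarrow> 'b::{banach,second_countable_topology}"
  assumes \<Phi>m: "\<And>s. s \<subseteq> {..<N} \<Longrightarrow> \<Phi> s \<in> borel_measurable (PiM (Ks s) (\<lambda>_. lebesgue))"
    and \<Phi>r: "\<And>s w. s \<subseteq> {..<N} \<Longrightarrow> \<Phi> s w = \<Phi> s (restrict w (Ks s))"
    and int: "\<And>s. s \<subseteq> {..<N} \<Longrightarrow> pmf p s \<noteq> 0 \<Longrightarrow> integrable M0 (\<Phi> s)"
  shows "integrable M (\<lambda>\<omega>. \<Phi> (S \<omega>) (XX \<omega>))"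
    and "(\<integral>\<omega>. \<Phi> (S \<omega>) (XX \<omega>) \<partial>M) = Ew {..<N} (pmf p) (\<lambda>s. \<integral>w. \<Phi> s w \<partial>M0)"
proof -
  have e: "\<Phi> (S \<omega>) (XX \<omega>) = (\<Sum>s\<in>Pow {..<N}. indicator (sel s) \<omega> *\<^sub>R \<Phi> s (XX \<omega>))" if "\<omega> \<in> space M" for \<omega>
  proof -
    have "(\<Sum>s\<in>Pow {..<N}. indicator (sel s) \<omega> *\<^sub>R \<Phi> s (XX \<omega>)) = (\<Sum>s\<in>Pow {..<N}. if s = S \<omega> then \<Phi> s (XX \<omega>) else 0)"
      using that by (intro sum.cong refl) (auto simp: indicator_def)
    then show ?thesis using S_Pow[OF that] by simp
  qed
  note be = expectation_transfer_event[OF _ \<Phi>m \<Phi>r int]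
  show "integrable M (\<lambda>\<omega>. \<Phi> (S \<omega>) (XX \<omega>))"
  proof (subst Bochner_Integration.integrable_cong[OF refl e])
    show "integrable M (\<lambda>\<omega>. \<Sum>s\<in>Pow {..<N}. indicator (sel s) \<omega> *\<^sub>R \<Phi> s (XX \<omega>))"
      by (intro Bochner_Integration.integrable_sum be) auto
  qed
  have "(\<integral>\<omega>. \<Phi> (S \<omega>) (XX \<omega>) \<partial>M) = (\<integral>\<omega>. (\<Sum>s\<in>Pow {..<N}. indicator (sel s) \<omega> *\<^sub>R \<Phi> s (XX \<omega>)) \<partial>M)"
    by (intro Bochner_Integration.integral_cong refl e)
  also have "\<dots> = (\<Sum>s\<in>Pow {..<N}. \<integral>\<omega>. indicator (sel s) \<omega> *\<^sub>R \<Phi> s (XX \<omega>) \<partial>M)"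
    by (intro Bochner_Integration.integral_sum be) auto
  also have "\<dots> = Ew {..<N} (pmf p) (\<lambda>s. \<integral>w. \<Phi> s w \<partial>M0)"
    unfolding Ew_def by (intro sum.cong refl be) auto
  finally show "(\<integral>\<omega>. \<Phi> (S \<omega>) (XX \<omega>) \<partial>M) = Ew {..<N} (pmf p) (\<lambda>s. \<integral>w. \<Phi> s w \<partial>M0)" .
qed

end

subsection \<open>Moments of the estimators within the primary sampling units\<close>

text \<open>Reindexing along \<open>Pair i\<close>, obtained from independence of disjoint blocks by
  taking one-element blocks.\<close>

lemma (in prob_space) indep_vars_pairI:
  assumes "indep_vars M' X (Pair i ` J)"
  shows "indep_vars (\<lambda>j. M' (i, j)) (\<lambda>j. X (i, j)) J"
proof -
  have "indep_vars (\<lambda>j. PiM {(i, j)} M') (\<lambda>j \<omega>. restrict (\<lambda>k. X k \<omega>) {(i, j)}) J"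
    by (rule indep_vars_restrict[OF assms]) (auto simp: disjoint_family_on_def)
  then have "indep_vars (\<lambda>j. M' (i, j)) (\<lambda>j \<omega>. (\<lambda>h. h (i, j)) (restrict (\<lambda>k. X k \<omega>) {(i, j)})) J"
    by (rule indep_vars_compose2) (rule measurable_component_singleton, simp)
  then show ?thesis by simp
qed

locale two_stage_totals = two_stage M N n p nII f S X u
  for M :: "'w measure" and N n :: nat and p :: "nat set pmf" and nII :: "nat \<Rightarrow> nat"
    and f :: "nat \<Rightarrow> 'a::euclidean_space \<Rightarrow> real" and S :: "'w \<Rightarrow> nat set" and X :: "nat \<Rightarrow> nat \<Rightarrow> 'w \<Rightarrow> 'a"
    and u :: "nat \<Rightarrow> 'a set" +
  fixes F :: "'a set" and \<rho> :: "'a \<Rightarrow> real" and c1 :: real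
  assumes F: "F \<in> sets lebesgue" and \<rho>: "set_integrable lebesgue F \<rho>" and \<rho>4: "set_integrable lebesgue F (\<lambda>x. \<rho> x ^ 4)"
    and u: "\<And>i. i < N \<Longrightarrow> u i \<in> sets lebesgue" "\<And>i. i < N \<Longrightarrow> u i \<subseteq> F" "\<And>i. i < N \<Longrightarrow> 0 < measure lebesgue (u i)"
    and c1: "0 < c1" and f_ge: "\<And>i x. i < N \<Longrightarrow> x \<in> u i \<Longrightarrow> c1 / measure lebesgue (u i) \<le> f i x"
begin

definition X0 :: "nat \<Rightarrow> nat \<Rightarrow> (nat \<times> nat \<Rightarrow> 'a) \<Rightarrow> 'a" where "X0 i j w = w (i, j)"
definition T :: "nat \<Rightarrow> (nat \<times> nat \<Rightarrow> 'a) \<Rightarrow> real" where "T = tau_hat_psu \<rho> nII f X0"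
definition D :: "nat \<Rightarrow> (nat \<times> nat \<Rightarrow> 'a) \<Rightarrow> real" where "D = V_hat_psu \<rho> nII f X0"
definition g :: "nat \<Rightarrow> 'a \<Rightarrow> real" where "g i x = \<rho> x / piII nII f i x"
definition Y :: "nat \<Rightarrow> nat \<Rightarrow> (nat \<times> nat \<Rightarrow> 'a) \<Rightarrow> real" where "Y i j w = g i (w (i, j))"
text \<open>Arises from the integral of \<open>\<rho> ^ 4 / f i ^ 3\<close> over the PSU with the
  lower bound on the density. It bounds the fourth moment of \<open>T i\<close> and the second
  moment of \<open>D i\<close>, whatever the second-stage sample size.\<close>

definition m4 :: "nat \<Rightarrow> real" where
  "m4 i = (measure lebesgue (u i) / c1) ^ 3 * (LINT x:u i|lebesgue. \<rho> x ^ 4)"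

lemma T_eq: "T i w = (\<Sum>j<nII i. Y i j w)"
  by (simp add: T_def tau_hat_psu_def Y_def g_def X0_def)

lemma D_eq: "D i w = real (nII i) / (real (nII i) - 1) * (\<Sum>j<nII i. (Y i j w - T i w / real (nII i))\<^sup>2)"
  by (simp add: D_def V_hat_psu_def T_def Y_def g_def X0_def)

lemma f_nonneg: "i < N \<Longrightarrow> 0 \<le> f i x" and f_out: "i < N \<Longrightarrow> x \<notin> u i \<Longrightarrow> f i x = 0"
  using dens by (auto simp: density_on_def)

lemma f_pos: "i < N \<Longrightarrow> x \<in> u i \<Longrightarrow> 0 < f i x"
proof -
  assume i: "i < N" "x \<in> u i"
  have "0 < c1 / measure lebesgue (u i)" using c1 u(3)[OF i(1)] by simp
  then show "0 < f i x" using f_ge[OF i] by linarith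
qed

text \<open>\<open>\<rho>\<close> is known to be measurable on \<open>F\<close> only. Off
  \<open>u i\<close> the density vanishes and the quotient is 0 by division by zero, so
  \<open>\<rho>\<close> may be cut off outside \<open>F\<close>.\<close>

lemma g_meas [measurable]: "i < N \<Longrightarrow> g i \<in> borel_measurable lebesgue"
proof -
  assume i: "i < N"
  have "(\<lambda>x. indicator F x *\<^sub>R \<rho> x) \<in> borel_measurable lebesgue"
    using \<rho> unfolding set_integrable_def by (rule borel_measurable_integrable)
  then have "(\<lambda>x. indicator F x *\<^sub>R \<rho> x / (nII i * f i x)) \<in> borel_measurable lebesgue"
    using f_meas[OF i] by measurable
  also have "(\<lambda>x. indicator F x *\<^sub>R \<rho> x / (nII i * f i x)) = g i"
  proof
    fix x
    show "indicator F x *\<^sub>R \<rho> x / (nII i * f i x) = g i x"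
      using f_out[OF i, of x] u(2)[OF i] by (cases "x \<in> u i") (auto simp: g_def piII_def indicator_def)
  qed
  finally show "g i \<in> borel_measurable lebesgue" .
qed

lemma coord_meas: "k \<in> J \<Longrightarrow> (\<lambda>w. w k) \<in> measurable (PiM J (\<lambda>_. lebesgue :: 'a measure)) lebesgue"
  by (rule measurable_component_singleton)

lemma Y_meas: "i < N \<Longrightarrow> (i, j) \<in> J \<Longrightarrow> Y i j \<in> borel_measurable (PiM J (\<lambda>_. lebesgue))"
  unfolding Y_def by (rule measurable_compose[OF coord_meas g_meas])

lemma T_meas: "i < N \<Longrightarrow> Ks {i} \<subseteq> J \<Longrightarrow> T i \<in> borel_measurable (PiM J (\<lambda>_. lebesgue))"
  unfolding T_eq[abs_def] by (intro borel_measurable_sum Y_meas) (auto simp: Ks_def)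

lemma D_meas: "i < N \<Longrightarrow> Ks {i} \<subseteq> J \<Longrightarrow> D i \<in> borel_measurable (PiM J (\<lambda>_. lebesgue))"
proof -
  assume i: "i < N" "Ks {i} \<subseteq> J"
  have Yj: "Y i j \<in> borel_measurable (PiM J (\<lambda>_. lebesgue))" if "j < nII i" for j
    using i that by (intro Y_meas) (auto simp: Ks_def)
  have "(\<lambda>w. (Y i j w - T i w / real (nII i))\<^sup>2) \<in> borel_measurable (PiM J (\<lambda>_. lebesgue))" if "j < nII i" for j
    using Yj[OF that] T_meas[OF i] by measurable
  then have "(\<lambda>w. \<Sum>j<nII i. (Y i j w - T i w / real (nII i))\<^sup>2) \<in> borel_measurable (PiM J (\<lambda>_. lebesgue))"
    by (intro borel_measurable_sum) auto
  then show "D i \<in> borel_measurable (PiM J (\<lambda>_. lebesgue))" unfolding D_eq[abs_def] by measurable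
qed

lemma TD_restrict: "Ks {i} \<subseteq> J \<Longrightarrow> T i (restrict w J) = T i w" "Ks {i} \<subseteq> J \<Longrightarrow> D i (restrict w J) = D i w"
proof -
  assume J: "Ks {i} \<subseteq> J"
  have Y: "Y i j (restrict w J) = Y i j w" if "j < nII i" for j
    using J that by (auto simp: Y_def Ks_def)
  show T: "T i (restrict w J) = T i w" unfolding T_eq using Y by (intro sum.cong) auto
  show "D i (restrict w J) = D i w" unfolding D_eq T using Y by (intro arg_cong2[where f = "(*)"] refl sum.cong) auto
qed

lemma sets_M0: "sets M0 = sets (PiM (Ks {..<N}) (\<lambda>_. lebesgue))"
  unfolding M0_def by (intro sets_PiM_cong) auto

lemma meas_M0: "measurable M0 B = measurable (PiM (Ks {..<N}) (\<lambda>_. lebesgue)) B"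
  by (rule measurable_cong_sets[OF sets_M0 refl])

lemma ind_coord: "M0.indep_vars lam (\<lambda>k w. w k) (Ks {..<N})"
proof (cases "Ks {..<N} = {}")
  case True
  then show ?thesis by (simp add: M0.indep_vars_def M0.indep_sets_def)
next
  case False
  have "distr M0 (PiM (Ks {..<N}) lam) (\<lambda>w. \<lambda>k\<in>Ks {..<N}. w k) = distr M0 M0 (\<lambda>w. w)"
    by (rule distr_cong) (auto simp: M0_def space_PiM)
  also have "\<dots> = M0" by simp
  also have "\<dots> = PiM (Ks {..<N}) (\<lambda>k. distr M0 (lam k) (\<lambda>w. w k))"
    unfolding M0_def by (intro PiM_cong refl distr_PiM_component[symmetric] prob_space_lam)
  finally show ?thesis
    by (subst M0.indep_vars_iff_distr_eq_PiM'[OF False]) (auto simp: M0_def)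
qed

lemma ind_TD: "M0.indep_vars (\<lambda>_. borel \<Otimes>\<^sub>M borel) (\<lambda>i w. (T i w, D i w)) {..<N}"
proof -
  have "M0.indep_vars (\<lambda>i. PiM (Ks {i}) lam) (\<lambda>i w. restrict (\<lambda>k. w k) (Ks {i})) {..<N}"
    by (rule M0.indep_vars_restrict[OF ind_coord]) (auto simp: Ks_def disjoint_family_on_def)
  then have "M0.indep_vars (\<lambda>_. borel \<Otimes>\<^sub>M borel) (\<lambda>i w. (T i (restrict (\<lambda>k. w k) (Ks {i})), D i (restrict (\<lambda>k. w k) (Ks {i})))) {..<N}"
  proof (rule M0.indep_vars_compose2)
    fix i assume i: "i \<in> {..<N}"
    have eq: "sets (PiM (Ks {i}) lam) = sets (PiM (Ks {i}) (\<lambda>_. lebesgue))" by (intro sets_PiM_cong) auto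
    show "(\<lambda>w. (T i w, D i w)) \<in> measurable (PiM (Ks {i}) lam) (borel \<Otimes>\<^sub>M borel)"
      unfolding measurable_cong_sets[OF eq refl] using i by (intro measurable_Pair T_meas D_meas) auto
  qed
  then show ?thesis by (simp add: TD_restrict)
qed

lemma int_coord:
  fixes h :: "'a \<Rightarrow> real"
  assumes i: "i < N" "j < nII i" and h: "h \<in> borel_measurable lebesgue" and int: "integrable lebesgue (\<lambda>x. f i x * h x)"
  shows "integrable M0 (\<lambda>w. h (w (i, j)))" "(LINT w|M0. h (w (i, j))) = (LINT x|lebesgue. f i x * h x)"
proof -
  let ?k = "(i, j)"
  have k: "?k \<in> Ks {..<N}" using i by (auto simp: Ks_def)
  have c: "(\<lambda>w. w ?k) \<in> measurable M0 (lam ?k)" unfolding M0_def by (rule measurable_component_singleton[OF k])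
  have d: "distr M0 (lam ?k) (\<lambda>w. w ?k) = lam ?k"
    unfolding M0_def by (rule distr_PiM_component[OF prob_space_lam k])
  have h': "h \<in> borel_measurable (lam ?k)" using h by (simp add: measurable_cong_sets[OF sets_lam refl])
  have lam: "lam ?k = density lebesgue (\<lambda>x. ennreal (f i x))" using i by (simp add: lam_def)
  have "integrable (lam ?k) h"
    unfolding lam using int f_nonneg[OF i(1)] f_meas[OF i(1)] h by (subst integrable_density) auto
  then have "integrable (distr M0 (lam ?k) (\<lambda>w. w ?k)) h" unfolding d .
  then show "integrable M0 (\<lambda>w. h (w (i, j)))" unfolding integrable_distr_eq[OF c h'] .
  have "(LINT w|M0. h (w (i, j))) = (LINT x|distr M0 (lam ?k) (\<lambda>w. w ?k). h x)" unfolding integral_distr[OF c h'] ..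
  also have "\<dots> = (LINT x|lebesgue. f i x * h x)"
    unfolding d unfolding lam using f_nonneg[OF i(1)] f_meas[OF i(1)] h by (subst integral_density) auto
  finally show "(LINT w|M0. h (w (i, j))) = (LINT x|lebesgue. f i x * h x)" .
qed

context
  fixes i assumes i: "i < N"
begin

abbreviation "r \<equiv> real (nII i)"

lemma r2: "2 \<le> r" using nII[OF i] by simp

lemma sub_int: "set_integrable lebesgue (u i) \<rho>" "set_integrable lebesgue (u i) (\<lambda>x. \<rho> x ^ 4)"
  using set_integrable_subset[OF \<rho> u(1)[OF i] u(2)[OF i]] set_integrable_subset[OF \<rho>4 u(1)[OF i] u(2)[OF i]] by auto

lemma Y_mean: assumes "j < nII i" shows "M0.expectation (Y i j) = tau \<rho> (u i) / r"
proof -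
  have e: "f i x * g i x = indicator (u i) x *\<^sub>R \<rho> x / r" for x
    using f_pos[OF i, of x] f_out[OF i, of x] by (cases "x \<in> u i") (auto simp: g_def piII_def)
  have "integrable lebesgue (\<lambda>x. f i x * g i x)"
    unfolding e using sub_int(1) unfolding set_integrable_def by simp
  from int_coord(2)[OF i assms g_meas[OF i] this]
  show ?thesis unfolding e Y_def tau_def set_lebesgue_integral_def by simp
qed

lemma Y4: assumes "j < nII i"
  shows "integrable M0 (\<lambda>w. Y i j w ^ 4)" "r ^ 4 * M0.expectation (\<lambda>w. Y i j w ^ 4) \<le> m4 i"
proof -
  let ?B = "(measure lebesgue (u i) / c1) ^ 3 / r ^ 4"
  have B: "f i x * g i x ^ 4 \<le> ?B * (indicator (u i) x *\<^sub>R \<rho> x ^ 4)" for x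
  proof (cases "x \<in> u i")
    case True
    have fp: "0 < f i x" using f_pos[OF i True] .
    have "f i x * g i x ^ 4 = (1 / f i x) ^ 3 / r ^ 4 * \<rho> x ^ 4"
      using fp by (simp add: g_def piII_def power_divide power_mult_distrib eval_nat_numeral)
    also have "\<dots> \<le> ?B * \<rho> x ^ 4"
    proof (intro mult_right_mono divide_right_mono power_mono)
      have "0 < c1 / measure lebesgue (u i)" using c1 u(3)[OF i] by simp
      then have "1 / f i x \<le> 1 / (c1 / measure lebesgue (u i))" using f_ge[OF i True] fp by (intro divide_left_mono mult_pos_pos) simp_all
      then show "1 / f i x \<le> measure lebesgue (u i) / c1" by simp
    qed (use fp in auto)
    finally show ?thesis using True by simp
  qed (use f_out[OF i] in simp)
  have iB: "integrable lebesgue (\<lambda>x. ?B * (indicator (u i) x *\<^sub>R \<rho> x ^ 4))"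
    using sub_int(2) unfolding set_integrable_def by (intro integrable_mult_right)
  have gm: "(\<lambda>x. g i x ^ 4) \<in> borel_measurable lebesgue" using g_meas[OF i] by measurable
  have fg: "integrable lebesgue (\<lambda>x. f i x * g i x ^ 4)"
  proof (rule Bochner_Integration.integrable_bound[OF iB])
    show "(\<lambda>x. f i x * g i x ^ 4) \<in> borel_measurable lebesgue" using f_meas[OF i] gm by measurable
    show "AE x in lebesgue. norm (f i x * g i x ^ 4) \<le> norm (?B * (indicator (u i) x *\<^sub>R \<rho> x ^ 4))"
    proof (rule AE_I2)
      fix x
      have "norm (f i x * g i x ^ 4) = f i x * g i x ^ 4" using f_nonneg[OF i] by simp
      also note B[of x]
      also have "?B * (indicator (u i) x *\<^sub>R \<rho> x ^ 4) \<le> norm (?B * (indicator (u i) x *\<^sub>R \<rho> x ^ 4))"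
          by (simp only: real_norm_def abs_ge_self)
      finally show "norm (f i x * g i x ^ 4) \<le> norm (?B * (indicator (u i) x *\<^sub>R \<rho> x ^ 4))" .
    qed
  qed
  note ic = int_coord[OF i assms gm fg]
  show "integrable M0 (\<lambda>w. Y i j w ^ 4)" unfolding Y_def by (rule ic(1))
  have "r ^ 4 * M0.expectation (\<lambda>w. Y i j w ^ 4) = r ^ 4 * (LINT x|lebesgue. f i x * g i x ^ 4)"
    unfolding Y_def ic(2) ..
  also have "\<dots> \<le> r ^ 4 * (LINT x|lebesgue. ?B * (indicator (u i) x *\<^sub>R \<rho> x ^ 4))"
    using B fg iB by (intro mult_left_mono integral_mono) auto
  also have "\<dots> = m4 i" using r2 by (simp add: m4_def set_lebesgue_integral_def)
  finally show "r ^ 4 * M0.expectation (\<lambda>w. Y i j w ^ 4) \<le> m4 i" .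
qed

lemma Ym: "j < nII i \<Longrightarrow> Y i j \<in> borel_measurable M0"
  unfolding meas_M0 using i by (intro Y_meas) (auto simp: Ks_def)

lemma Y_ident: "j < nII i \<Longrightarrow> M0.expectation (\<lambda>w. Y i j w ^ k) = M0.expectation (\<lambda>w. Y i 0 w ^ k)" if "k \<le> 4" for k
proof -
  assume j: "j < nII i"
  have 0: "0 < nII i" using j by simp
  have "M0.expectation (\<lambda>w. Y i j w ^ k) = (LINT x|lam (i, 0). g i x ^ k)" if j: "j < nII i" for j
  proof -
    let ?k = "(i, j)"
    have k: "?k \<in> Ks {..<N}" using i j by (auto simp: Ks_def)
    have c: "(\<lambda>w. w ?k) \<in> measurable M0 (lam ?k)" unfolding M0_def by (rule measurable_component_singleton[OF k])
    have d: "distr M0 (lam ?k) (\<lambda>w. w ?k) = lam ?k"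
      unfolding M0_def by (rule distr_PiM_component[OF prob_space_lam k])
    have h': "(\<lambda>x. g i x ^ k) \<in> borel_measurable (lam ?k)"
      unfolding measurable_cong_sets[OF sets_lam refl] using g_meas[OF i] by measurable
    have "M0.expectation (\<lambda>w. Y i j w ^ k) = (LINT x|distr M0 (lam ?k) (\<lambda>w. w ?k). g i x ^ k)"
      unfolding integral_distr[OF c h'] Y_def ..
    then show ?thesis unfolding d by (simp add: lam_def)
  qed
  from this[OF j] this[OF 0] show ?thesis by simp
qed

lemma ind_Y: "M0.indep_vars (\<lambda>_. borel) (\<lambda>j. Y i j) {..<nII i}"
proof -
  have "M0.indep_vars lam (\<lambda>k w. w k) (Pair i ` {..<nII i})"
    by (rule M0.indep_vars_subset[OF ind_coord]) (use i in \<open>auto simp: Ks_def\<close>)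
  then have "M0.indep_vars (\<lambda>j. lam (i, j)) (\<lambda>j w. w (i, j)) {..<nII i}" by (rule M0.indep_vars_pairI)
  then have "M0.indep_vars (\<lambda>_. borel) (\<lambda>j w. g i (w (i, j))) {..<nII i}"
    by (rule M0.indep_vars_compose2) (use g_meas[OF i] in \<open>simp add: measurable_cong_sets[OF sets_lam refl]\<close>)
  then show ?thesis unfolding Y_def .
qed

lemma Yk: "j < nII i \<Longrightarrow> k \<le> 4 \<Longrightarrow> integrable M0 (\<lambda>w. Y i j w ^ k)"
  by (rule M0.integrable_power_le4[OF Ym Y4(1)])

lemma Tm: "T i \<in> borel_measurable M0" and Dm: "D i \<in> borel_measurable M0"
  unfolding meas_M0 using i by (auto intro!: T_meas D_meas simp: Ks_def)

lemma T_mean: "M0.expectation (T i) = tau \<rho> (u i)"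
proof -
  have "M0.expectation (T i) = (\<Sum>j<nII i. M0.expectation (Y i j))"
    unfolding T_eq[abs_def] using Yk[of _ 1] by (intro Bochner_Integration.integral_sum) auto
  then show ?thesis using r2 by (simp add: Y_mean)
qed

lemma T_pow4_le: "T i w ^ 4 \<le> r ^ 3 * (\<Sum>j<nII i. Y i j w ^ 4)"
proof -
  have 1: "(T i w)\<^sup>2 \<le> r * (\<Sum>j<nII i. (Y i j w)\<^sup>2)"
    using sum_power2_le_card[of "{..<nII i}" "\<lambda>_. 1" "\<lambda>j. Y i j w"] by (simp add: T_eq)
  have "T i w ^ 4 = ((T i w)\<^sup>2)\<^sup>2" by simp
  also have "\<dots> \<le> (r * (\<Sum>j<nII i. (Y i j w)\<^sup>2))\<^sup>2" by (rule power_mono[OF 1]) simp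
  also have "\<dots> = r\<^sup>2 * (\<Sum>j<nII i. (Y i j w)\<^sup>2)\<^sup>2" by (simp add: power_mult_distrib)
  also have "\<dots> \<le> r\<^sup>2 * (r * (\<Sum>j<nII i. Y i j w ^ 4))"
    using sum_power2_le_card[of "{..<nII i}" "\<lambda>_. 1" "\<lambda>j. (Y i j w)\<^sup>2"] by (intro mult_left_mono) auto
  finally show ?thesis by (simp add: power3_eq_cube power2_eq_square mult.assoc)
qed

lemma sum_Y4: "integrable M0 (\<lambda>w. \<Sum>j<nII i. Y i j w ^ 4)"
  "r ^ 3 * M0.expectation (\<lambda>w. \<Sum>j<nII i. Y i j w ^ 4) \<le> m4 i"
proof -
  show "integrable M0 (\<lambda>w. \<Sum>j<nII i. Y i j w ^ 4)" using Y4(1) by (intro Bochner_Integration.integrable_sum) auto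
  have "M0.expectation (\<lambda>w. \<Sum>j<nII i. Y i j w ^ 4) = (\<Sum>j<nII i. M0.expectation (\<lambda>w. Y i j w ^ 4))"
    using Y4(1) by (intro Bochner_Integration.integral_sum) auto
  also have "\<dots> = (\<Sum>j<nII i. M0.expectation (\<lambda>w. Y i 0 w ^ 4))" by (intro sum.cong refl Y_ident) auto
  also have "\<dots> = r * M0.expectation (\<lambda>w. Y i 0 w ^ 4)" by simp
  finally have E4: "M0.expectation (\<lambda>w. \<Sum>j<nII i. Y i j w ^ 4) = r * M0.expectation (\<lambda>w. Y i 0 w ^ 4)" .
  show "r ^ 3 * M0.expectation (\<lambda>w. \<Sum>j<nII i. Y i j w ^ 4) \<le> m4 i"
  proof -
    have "r ^ 3 * (r * M0.expectation (\<lambda>w. Y i 0 w ^ 4)) = r ^ 4 * M0.expectation (\<lambda>w. Y i 0 w ^ 4)"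
      by (simp add: power3_eq_cube power4_eq_xxxx mult.assoc)
    also have "\<dots> \<le> m4 i" by (rule Y4(2)) (use nII[OF i] in simp)
    finally show ?thesis unfolding E4 .
  qed
qed

lemma T4: "integrable M0 (\<lambda>w. T i w ^ 4)" "M0.expectation (\<lambda>w. T i w ^ 4) \<le> m4 i"
proof -
  have ib: "integrable M0 (\<lambda>w. r ^ 3 * (\<Sum>j<nII i. Y i j w ^ 4))" using sum_Y4(1) by (rule integrable_mult_right)
  show 1: "integrable M0 (\<lambda>w. T i w ^ 4)"
  proof (rule Bochner_Integration.integrable_bound[OF ib])
    show "(\<lambda>w. T i w ^ 4) \<in> borel_measurable M0" using Tm by measurable
    show "AE w in M0. norm (T i w ^ 4) \<le> norm (r ^ 3 * (\<Sum>j<nII i. Y i j w ^ 4))"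
    proof (rule AE_I2)
      fix w
      have "norm (T i w ^ 4) = T i w ^ 4" by simp
      also note T_pow4_le[of w]
      also have "r ^ 3 * (\<Sum>j<nII i. Y i j w ^ 4) \<le> norm (r ^ 3 * (\<Sum>j<nII i. Y i j w ^ 4))" by simp
      finally show "norm (T i w ^ 4) \<le> norm (r ^ 3 * (\<Sum>j<nII i. Y i j w ^ 4))" .
    qed
  qed
  have "M0.expectation (\<lambda>w. T i w ^ 4) \<le> M0.expectation (\<lambda>w. r ^ 3 * (\<Sum>j<nII i. Y i j w ^ 4))"
    using 1 ib T_pow4_le by (intro integral_mono) auto
  then show "M0.expectation (\<lambda>w. T i w ^ 4) \<le> m4 i" using sum_Y4(2) by simp
qed

lemma D_alt: "D i w = r / (r - 1) * ((\<Sum>j<nII i. (Y i j w)\<^sup>2) - (T i w)\<^sup>2 / r)"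
proof -
  have "(\<Sum>j<nII i. (Y i j w - T i w / r)\<^sup>2) = (\<Sum>j<nII i. (Y i j w)\<^sup>2 - 2 * (T i w / r) * Y i j w + (T i w / r)\<^sup>2)"
    by (intro sum.cong refl) (simp add: power2_diff)
  also have "\<dots> = (\<Sum>j<nII i. (Y i j w)\<^sup>2) - 2 * (T i w / r) * (\<Sum>j<nII i. Y i j w) + r * (T i w / r)\<^sup>2"
    by (simp add: sum.distrib sum_subtractf sum_distrib_left)
  also have "\<dots> = (\<Sum>j<nII i. (Y i j w)\<^sup>2) - (T i w)\<^sup>2 / r"
    unfolding T_eq[symmetric] using r2 by (simp add: power2_eq_square field_simps)
  finally show ?thesis unfolding D_eq by simp
qed

lemma D_sq_le: "(D i w)\<^sup>2 \<le> 4 * r * (\<Sum>j<nII i. Y i j w ^ 4)"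
proof -
  let ?s = "\<Sum>j<nII i. (Y i j w)\<^sup>2"
  have k: "0 \<le> r / (r - 1)" "r / (r - 1) \<le> 2" using r2 by (auto simp: field_simps)
  have 0: "0 \<le> D i w" unfolding D_eq using k by (intro mult_nonneg_nonneg sum_nonneg) auto
  have "D i w \<le> r / (r - 1) * ?s" unfolding D_alt using k by (intro mult_left_mono) auto
  also have "\<dots> \<le> 2 * ?s" using k by (intro mult_right_mono sum_nonneg) auto
  finally have "(D i w)\<^sup>2 \<le> (2 * ?s)\<^sup>2" using 0 by (intro power_mono)
  also have "\<dots> = 4 * ?s\<^sup>2" by (simp add: power_mult_distrib)
  also have "\<dots> \<le> 4 * (r * (\<Sum>j<nII i. Y i j w ^ 4))"
    using sum_power2_le_card[of "{..<nII i}" "\<lambda>_. 1" "\<lambda>j. (Y i j w)\<^sup>2"] by simp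
  finally show ?thesis by simp
qed

text \<open>At least two points per PSU give \<open>r / (r - 1) \<le> 2\<close> and
  \<open>4 * r \<le> r ^ 3\<close>, so the square of \<open>D i\<close> obeys the same bound as the
  fourth power of \<open>T i\<close>.\<close>

lemma D2: "integrable M0 (\<lambda>w. (D i w)\<^sup>2)" "M0.expectation (\<lambda>w. (D i w)\<^sup>2) \<le> m4 i"
proof -
  have ib: "integrable M0 (\<lambda>w. 4 * r * (\<Sum>j<nII i. Y i j w ^ 4))" using sum_Y4(1) by (rule integrable_mult_right)
  show 1: "integrable M0 (\<lambda>w. (D i w)\<^sup>2)"
  proof (rule Bochner_Integration.integrable_bound[OF ib])
    show "(\<lambda>w. (D i w)\<^sup>2) \<in> borel_measurable M0" using Dm by measurable
    show "AE w in M0. norm ((D i w)\<^sup>2) \<le> norm (4 * r * (\<Sum>j<nII i. Y i j w ^ 4))"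
    proof (rule AE_I2)
      fix w
      have "norm ((D i w)\<^sup>2) = (D i w)\<^sup>2" by simp
      also note D_sq_le[of w]
      also have "4 * r * (\<Sum>j<nII i. Y i j w ^ 4) \<le> norm (4 * r * (\<Sum>j<nII i. Y i j w ^ 4))" by simp
      finally show "norm ((D i w)\<^sup>2) \<le> norm (4 * r * (\<Sum>j<nII i. Y i j w ^ 4))" .
    qed
  qed
  have "M0.expectation (\<lambda>w. (D i w)\<^sup>2) \<le> M0.expectation (\<lambda>w. 4 * r * (\<Sum>j<nII i. Y i j w ^ 4))"
    using 1 ib D_sq_le by (intro integral_mono) auto
  also have "\<dots> = (4 * r) * M0.expectation (\<lambda>w. \<Sum>j<nII i. Y i j w ^ 4)" by simp
  also have "\<dots> \<le> r ^ 3 * M0.expectation (\<lambda>w. \<Sum>j<nII i. Y i j w ^ 4)"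
  proof (rule mult_right_mono)
    have "2\<^sup>2 \<le> r\<^sup>2" using r2 by (intro power_mono) auto
    then have "4 * r \<le> r\<^sup>2 * r" using r2 by (intro mult_right_mono) auto
    then show "4 * r \<le> r ^ 3" by (simp add: power3_eq_cube power2_eq_square)
    show "0 \<le> M0.expectation (\<lambda>w. \<Sum>j<nII i. Y i j w ^ 4)" by (intro Bochner_Integration.integral_nonneg sum_nonneg) simp
  qed
  also note sum_Y4(2)
  finally show "M0.expectation (\<lambda>w. (D i w)\<^sup>2) \<le> m4 i" .
qed

text \<open>Unbiasedness of the sample variance: with \<open>y\<close> and \<open>y2\<close> the
  first two moments of one term, both sides equal \<open>r * (y2 - y\<^sup>2)\<close>.\<close>

lemma D_mean: "M0.expectation (D i) = M0.expectation (\<lambda>w. (T i w)\<^sup>2) - (M0.expectation (T i))\<^sup>2"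
proof -
  define y where "y = tau \<rho> (u i) / r"
  define y2 where "y2 = M0.expectation (\<lambda>w. (Y i 0 w)\<^sup>2)"
  have Y2i: "integrable M0 (\<lambda>w. (Y i j w)\<^sup>2)" if "j < nII i" for j using Yk[OF that, of 2] by simp
  have T2i: "integrable M0 (\<lambda>w. (T i w)\<^sup>2)" using M0.integrable_power_le4[OF Tm T4(1), of 2] by simp
  have EY2: "M0.expectation (\<lambda>w. (Y i j w)\<^sup>2) = y2" if "j < nII i" for j
    using Y_ident[of 2 j] that by (simp add: y2_def)
  have ET2: "M0.expectation (\<lambda>w. (T i w)\<^sup>2) = r * (y2 - y\<^sup>2) + (r * y)\<^sup>2"
  proof -
    have "M0.expectation (\<lambda>w. ((\<Sum>j<nII i. Y i j w) - 0)\<^sup>2) = (\<Sum>j<nII i. M0.expectation (\<lambda>w. (Y i j w)\<^sup>2) - (M0.expectation (Y i j))\<^sup>2)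
       + ((\<Sum>j<nII i. M0.expectation (Y i j)) - 0)\<^sup>2"
      by (rule M0.indep_sum_about(2)[OF _ ind_Y]) (use Y2i in auto)
    also have "\<dots> = r * (y2 - y\<^sup>2) + (r * y)\<^sup>2" by (simp add: EY2 Y_mean y_def)
    finally show ?thesis by (simp add: T_eq)
  qed
  have iS: "integrable M0 (\<lambda>w. \<Sum>j<nII i. (Y i j w)\<^sup>2)" by (intro Bochner_Integration.integrable_sum Y2i) auto
  have "M0.expectation (D i) = r / (r - 1) * M0.expectation (\<lambda>w. (\<Sum>j<nII i. (Y i j w)\<^sup>2) - (T i w)\<^sup>2 / r)"
    unfolding D_alt[abs_def] by (rule integral_mult_right_zero)
  also have "M0.expectation (\<lambda>w. (\<Sum>j<nII i. (Y i j w)\<^sup>2) - (T i w)\<^sup>2 / r)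
    = M0.expectation (\<lambda>w. \<Sum>j<nII i. (Y i j w)\<^sup>2) - M0.expectation (\<lambda>w. (T i w)\<^sup>2 / r)"
    by (rule Bochner_Integration.integral_diff[OF iS]) (use T2i in simp)
  also have "M0.expectation (\<lambda>w. (T i w)\<^sup>2 / r) = M0.expectation (\<lambda>w. (T i w)\<^sup>2) / r" by simp
  also have "M0.expectation (\<lambda>w. \<Sum>j<nII i. (Y i j w)\<^sup>2) = r * y2"
    using Y2i EY2 by (subst Bochner_Integration.integral_sum) auto
  also have "r / (r - 1) * (r * y2 - M0.expectation (\<lambda>w. (T i w)\<^sup>2) / r) = r * (y2 - y\<^sup>2)"
  proof -
    have "r * y2 - (r * (y2 - y\<^sup>2) + (r * y)\<^sup>2) / r = (r - 1) * (y2 - y\<^sup>2)"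
      using r2 by (simp add: field_simps power2_eq_square)
    then show ?thesis unfolding ET2 using r2 by simp
  qed
  also have "\<dots> = M0.expectation (\<lambda>w. (T i w)\<^sup>2) - (M0.expectation (T i))\<^sup>2"
    unfolding ET2 T_mean y_def using r2 by simp
  finally show ?thesis .
qed

end
end

subsection \<open>The estimators as functions on the product space\<close>

context two_stage_totals begin

abbreviation "est \<equiv> tau_hat \<rho> p nII f S X"
abbreviation "vest \<equiv> V_HAJ \<rho> p nII f S X"

text \<open>The sample becomes a parameter and the points the argument, so that for each fixed
  \<open>s\<close> the estimators are functions on the product space \<open>M0\<close>.\<close>

definition Phi :: "nat set \<Rightarrow> (nat \<times> nat \<Rightarrow> 'a) \<Rightarrow> real" where
  "Phi s w = (\<Sum>i\<in>s. T i w / incl p i)"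

definition Rh :: "nat set \<Rightarrow> (nat \<times> nat \<Rightarrow> 'a) \<Rightarrow> real" where
  "Rh s w = (\<Sum>i\<in>s. (1 - incl p i) * (T i w / incl p i)) / (\<Sum>i\<in>s. 1 - incl p i)"

definition Psi :: "nat set \<Rightarrow> (nat \<times> nat \<Rightarrow> 'a) \<Rightarrow> real" where
  "Psi s w = (\<Sum>i\<in>s. (1 - incl p i) * (T i w / incl p i - Rh s w)\<^sup>2) + (\<Sum>i\<in>s. D i w / incl p i)"

lemma T_XX: "tau_hat_psu \<rho> nII f X i \<omega> = T i (XX \<omega>)"
  by (simp add: T_def tau_hat_psu_def X0_def XX_def)

lemma D_XX: "V_hat_psu \<rho> nII f X i \<omega> = D i (XX \<omega>)"
  by (simp add: D_def V_hat_psu_def tau_hat_psu_def X0_def XX_def)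

lemma est_eq: "est \<omega> = Phi (S \<omega>) (XX \<omega>)" and vest_eq: "vest \<omega> = Psi (S \<omega>) (XX \<omega>)"
  by (simp_all add: tau_hat_def V_HAJ_def R_hat_def Phi_def Psi_def Rh_def T_XX D_XX)

lemma Ks_single: "i \<in> s \<Longrightarrow> Ks {i} \<subseteq> Ks s" by (auto simp: Ks_def)

lemma Phi_meas: "s \<subseteq> {..<N} \<Longrightarrow> Phi s \<in> borel_measurable (PiM (Ks s) (\<lambda>_. lebesgue))"
  unfolding Phi_def
  by (intro borel_measurable_sum borel_measurable_divide borel_measurable_const T_meas Ks_single) auto

lemma Rh_meas: "s \<subseteq> {..<N} \<Longrightarrow> Rh s \<in> borel_measurable (PiM (Ks s) (\<lambda>_. lebesgue))"
proof -
  assume s: "s \<subseteq> {..<N}"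
  have "(\<lambda>w. (1 - incl p i) * (T i w / incl p i)) \<in> borel_measurable (PiM (Ks s) (\<lambda>_. lebesgue))" if "i \<in> s" for i
    using T_meas[of i "Ks s"] s that Ks_single[OF that] by (intro borel_measurable_times borel_measurable_const borel_measurable_divide) auto
  then have "(\<lambda>w. \<Sum>i\<in>s. (1 - incl p i) * (T i w / incl p i)) \<in> borel_measurable (PiM (Ks s) (\<lambda>_. lebesgue))"
    by (rule borel_measurable_sum)
  then show "Rh s \<in> borel_measurable (PiM (Ks s) (\<lambda>_. lebesgue))" unfolding Rh_def[abs_def] by measurable
qed

lemma Psi_meas: "s \<subseteq> {..<N} \<Longrightarrow> Psi s \<in> borel_measurable (PiM (Ks s) (\<lambda>_. lebesgue))"
proof -
  assume s: "s \<subseteq> {..<N}"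
  have m: "T i \<in> borel_measurable (PiM (Ks s) (\<lambda>_. lebesgue))" "D i \<in> borel_measurable (PiM (Ks s) (\<lambda>_. lebesgue))" if "i \<in> s" for i
    using T_meas[of i "Ks s"] D_meas[of i "Ks s"] s that Ks_single[OF that] by auto
  have "(\<lambda>w. (1 - incl p i) * (T i w / incl p i - Rh s w)\<^sup>2) \<in> borel_measurable (PiM (Ks s) (\<lambda>_. lebesgue))" if "i \<in> s" for i
    using m(1)[OF that] Rh_meas[OF s] by measurable
  moreover have "(\<lambda>w. D i w / incl p i) \<in> borel_measurable (PiM (Ks s) (\<lambda>_. lebesgue))" if "i \<in> s" for i
    using m(2)[OF that] by measurable
  ultimately show "Psi s \<in> borel_measurable (PiM (Ks s) (\<lambda>_. lebesgue))"
    unfolding Psi_def[abs_def] by (intro borel_measurable_add borel_measurable_sum) auto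
qed

lemma Phi_restrict: "Phi s (restrict w (Ks s)) = Phi s w"
  unfolding Phi_def by (intro sum.cong refl) (simp add: TD_restrict(1)[OF Ks_single])

lemma Psi_restrict: "Psi s (restrict w (Ks s)) = Psi s w"
proof -
  have "Rh s (restrict w (Ks s)) = Rh s w"
    unfolding Rh_def by (intro arg_cong2[where f = "(/)"] sum.cong refl) (simp add: TD_restrict(1)[OF Ks_single])
  then show ?thesis
    unfolding Psi_def by (intro arg_cong2[where f = "(+)"] sum.cong refl) (simp_all add: TD_restrict[OF Ks_single])
qed

lemma expectation_transfer_est:
  fixes h :: "real \<Rightarrow> 'b::{banach,second_countable_topology}"
  assumes h: "h \<in> borel_measurable borel"
    and int: "\<And>s. s \<subseteq> {..<N} \<Longrightarrow> pmf p s \<noteq> 0 \<Longrightarrow> integrable M0 (\<lambda>w. h (Phi s w))"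
  shows "integrable M (\<lambda>\<omega>. h (est \<omega>))"
    and "(\<integral>\<omega>. h (est \<omega>) \<partial>M) = Ew {..<N} (pmf p) (\<lambda>s. \<integral>w. h (Phi s w) \<partial>M0)"
  unfolding est_eq
  by (rule expectation_transfer[where \<Phi> = "\<lambda>s w. h (Phi s w)"];
      use int in \<open>auto simp: Phi_restrict intro: measurable_compose[OF Phi_meas h]\<close>)+

lemma expectation_transfer_vest:
  fixes h :: "real \<Rightarrow> 'b::{banach,second_countable_topology}"
  assumes h: "h \<in> borel_measurable borel"
    and int: "\<And>s. s \<subseteq> {..<N} \<Longrightarrow> pmf p s \<noteq> 0 \<Longrightarrow> integrable M0 (\<lambda>w. h (Psi s w))"
  shows "integrable M (\<lambda>\<omega>. h (vest \<omega>))"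
    and "(\<integral>\<omega>. h (vest \<omega>) \<partial>M) = Ew {..<N} (pmf p) (\<lambda>s. \<integral>w. h (Psi s w) \<partial>M0)"
  unfolding vest_eq
  by (rule expectation_transfer[where \<Phi> = "\<lambda>s w. h (Psi s w)"];
      use int in \<open>auto simp: Psi_restrict intro: measurable_compose[OF Psi_meas h]\<close>)+

lemma T_ints: assumes "i < N" shows "integrable M0 (T i)" "integrable M0 (\<lambda>w. (T i w)\<^sup>2)" "integrable M0 (D i)"
  using M0.integrable_power_le4[OF Tm[OF assms] T4(1)[OF assms], of 1]
    M0.integrable_power_le4[OF Tm[OF assms] T4(1)[OF assms], of 2]
    M0.integrable_square_imp[OF Dm[OF assms] D2(1)[OF assms]] by simp_all

lemma lin_sq_int:
  assumes s: "s \<subseteq> {..<N}"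
  shows "integrable M0 (\<lambda>w. (\<Sum>i\<in>s. a i * T i w)\<^sup>2)"
proof -
  have "M0.indep_vars (\<lambda>_. borel) (\<lambda>i w. a i * fst (T i w, D i w)) {..<N}"
    using M0.indep_vars_compose2[OF ind_TD, of "\<lambda>i z. a i * fst z" "\<lambda>_. borel"] by simp
  then have ind: "M0.indep_vars (\<lambda>_. borel) (\<lambda>i w. a i * T i w) s"
    using M0.indep_vars_subset[OF _ s] by simp
  have "integrable M0 (\<lambda>w. ((\<Sum>i\<in>s. a i * T i w) - 0)\<^sup>2)"
    by (rule M0.indep_sum_about(1)[OF _ ind]) (use s T_ints in \<open>auto intro: finite_subset simp: power_mult_distrib\<close>)
  then show ?thesis by simp
qed

lemma Phi_int: assumes "s \<subseteq> {..<N}" shows "integrable M0 (Phi s)"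
  unfolding Phi_def[abs_def] using assms T_ints by (intro Bochner_Integration.integrable_sum) auto

text \<open>Each residual is a linear combination of the totals in the sample, so
  \<open>lin_sq_int\<close> applies.\<close>

lemma Psi_int: assumes s: "s \<subseteq> {..<N}" shows "integrable M0 (Psi s)"
proof -
  have f: "finite s" using s by (auto intro: finite_subset)
  have "integrable M0 (\<lambda>w. (T i w / incl p i - Rh s w)\<^sup>2)" if i: "i \<in> s" for i
  proof -
    let ?d = "\<Sum>i\<in>s. 1 - incl p i"
    have "(\<Sum>j\<in>s. (of_bool (j = i) / incl p i - (1 - incl p j) / incl p j / ?d) * T j w) = T i w / incl p i - Rh s w" for w
    proof -
      have "(\<Sum>j\<in>s. (of_bool (j = i) / incl p i - (1 - incl p j) / incl p j / ?d) * T j w)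
        = (\<Sum>j\<in>s. if j = i then T i w / incl p i else 0) - (\<Sum>j\<in>s. (1 - incl p j) * (T j w / incl p j) / ?d)"
        unfolding sum_subtractf[symmetric] by (intro sum.cong refl) (simp add: left_diff_distrib)
      then show ?thesis using i f by (simp add: Rh_def sum_divide_distrib)
    qed
    then show ?thesis using lin_sq_int[OF s, of "\<lambda>j. of_bool (j = i) / incl p i - (1 - incl p j) / incl p j / ?d"] by simp
  qed
  then show ?thesis unfolding Psi_def[abs_def] using s T_ints
    by (intro Bochner_Integration.integrable_add Bochner_Integration.integrable_sum integrable_mult_right integrable_divide) auto
qed

lemma vest_integrable: "integrable M vest"
  using expectation_transfer_vest(1)[of "\<lambda>x. x"] Psi_int by simp

lemma incl_Ew: "incl p i = Ew {..<N} (pmf p) (\<lambda>s. of_bool (i \<in> s))"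
  unfolding incl_def using prob_eq_Ew[OF supp(1), of "{s. i \<in> s}"] by simp

lemma Ew_sum_incl: "Ew {..<N} (pmf p) (\<lambda>s. \<Sum>i\<in>s. a i) = (\<Sum>i<N. incl p i * a i)" for a :: "nat \<Rightarrow> real"
  unfolding incl_Ew by (rule Ew_member_sum) simp

lemma est_mean: "M.expectation est = (\<Sum>i<N. tau \<rho> (u i))"
proof -
  have "M.expectation est = Ew {..<N} (pmf p) (\<lambda>s. M0.expectation (Phi s))"
    using expectation_transfer_est(2)[of "\<lambda>x. x"] Phi_int by simp
  also have "\<dots> = Ew {..<N} (pmf p) (\<lambda>s. \<Sum>i\<in>s. tau \<rho> (u i) / incl p i)"
  proof (rule Ew_cong)
    fix s assume s: "s \<subseteq> {..<N}"
    have "M0.expectation (Phi s) = (\<Sum>i\<in>s. M0.expectation (\<lambda>w. T i w / incl p i))"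
      unfolding Phi_def[abs_def] using s T_ints by (intro Bochner_Integration.integral_sum) auto
    also have "\<dots> = (\<Sum>i\<in>s. tau \<rho> (u i) / incl p i)"
      using s by (intro sum.cong refl) (auto simp: T_mean)
    finally show "M0.expectation (Phi s) = (\<Sum>i\<in>s. tau \<rho> (u i) / incl p i)" .
  qed
  also have "\<dots> = (\<Sum>i<N. tau \<rho> (u i))"
    unfolding Ew_sum_incl using incl_pos by (intro sum.cong refl) (metis lessThan_iff less_irrefl nonzero_mult_div_cancel_left times_divide_eq_right)
  finally show ?thesis .
qed

text \<open>\<open>incl2\<close> is the expectation of a product of membership indicators, so the
  double sum with \<open>Delta\<close> is an expanded square. In this form it can enter the
  comparison of designs.\<close>

lemma V1_eq: "V1 \<rho> N u p = Ew {..<N} (pmf p) (\<lambda>s. ((\<Sum>i\<in>s. tau \<rho> (u i) / incl p i) - (\<Sum>i<N. tau \<rho> (u i)))\<^sup>2)"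
proof -
  define x where "x i = tau \<rho> (u i) / incl p i" for i
  have incl2: "incl2 p i j = Ew {..<N} (pmf p) (\<lambda>s. of_bool (i \<in> s) * of_bool (j \<in> s))" for i j
    unfolding incl2_def using prob_eq_Ew[OF supp(1), of "{s. i \<in> s \<and> j \<in> s}"] by (simp add: of_bool_conj)
  define m where "m = (\<Sum>i<N. incl p i * x i)"
  have m: "m = (\<Sum>i<N. tau \<rho> (u i))" unfolding m_def x_def
    using incl_pos by (intro sum.cong refl) (metis lessThan_iff less_irrefl nonzero_mult_div_cancel_left times_divide_eq_right)
  have ind: "(\<Sum>i\<in>s. x i) = (\<Sum>i<N. of_bool (i \<in> s) * x i)" if "s \<subseteq> {..<N}" for s
    using that by (intro sum.mono_neutral_cong_left) auto
  have sq: "Ew {..<N} (pmf p) (\<lambda>s. (\<Sum>i\<in>s. x i)\<^sup>2) = (\<Sum>i<N. \<Sum>j<N. incl2 p i j * (x i * x j))"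
  proof -
    have "Ew {..<N} (pmf p) (\<lambda>s. (\<Sum>i\<in>s. x i)\<^sup>2) = 
      Ew {..<N} (pmf p) (\<lambda>s. \<Sum>i<N. \<Sum>j<N. (of_bool (i \<in> s) * of_bool (j \<in> s)) * (x i * x j))"
    proof (rule Ew_cong)
      fix s assume s: "s \<subseteq> {..<N}"
      show "(\<Sum>i\<in>s. x i)\<^sup>2 = (\<Sum>i<N. \<Sum>j<N. (of_bool (i \<in> s) * of_bool (j \<in> s)) * (x i * x j))"
        unfolding ind[OF s] power2_eq_square sum_product by (intro sum.cong refl) (simp only: mult_ac)
    qed
    then show ?thesis unfolding Ew_sum Ew_multc incl2 .
  qed
  have "Ew {..<N} (pmf p) (\<lambda>s. ((\<Sum>i\<in>s. x i) - m)\<^sup>2) = Ew {..<N} (pmf p) (\<lambda>s. (\<Sum>i\<in>s. x i)\<^sup>2 - (2 * m) * (\<Sum>i\<in>s. x i) + m\<^sup>2)"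
    by (rule Ew_cong) (simp add: power2_diff)
  also have "\<dots> = Ew {..<N} (pmf p) (\<lambda>s. (\<Sum>i\<in>s. x i)\<^sup>2) - m * m"
    unfolding Ew_add[of _ _ _ "\<lambda>_. m\<^sup>2"] Ew_diff[of _ _ "\<lambda>s. (\<Sum>i\<in>s. x i)\<^sup>2"] Ew_cmult Ew_sum_incl Ew_const[OF pw] m_def[symmetric]
    by (simp add: power2_eq_square)
  also have "m * m = (\<Sum>i<N. \<Sum>j<N. (incl p i * incl p j) * (x i * x j))"
    unfolding m_def sum_product by (intro sum.cong refl) simp
  also have "Ew {..<N} (pmf p) (\<lambda>s. (\<Sum>i\<in>s. x i)\<^sup>2) - \<dots> = V1 \<rho> N u p"
    unfolding sq V1_def Delta_def sum_subtractf[symmetric] x_def[symmetric]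
    by (intro sum.cong refl) (simp only: left_diff_distrib mult.assoc)
  finally show ?thesis unfolding m x_def by simp
qed

end

section \<open>Scaling of the survey to marks of order one\<close>

locale normalised_sample = two_stage_totals M N n p nII f S X u F \<rho> c1 + rej: rejective "{..<N}" q n
  for M :: "'w measure" and N n :: nat and p :: "nat set pmf" and nII :: "nat \<Rightarrow> nat"
    and f :: "nat \<Rightarrow> 'a::euclidean_space \<Rightarrow> real" and S :: "'w \<Rightarrow> nat set" and X :: "nat \<Rightarrow> nat \<Rightarrow> 'w \<Rightarrow> 'a"
    and u :: "nat \<Rightarrow> 'a set" and F :: "'a set" and \<rho> :: "'a \<Rightarrow> real" and c1 :: real and q :: "nat \<Rightarrow> real" +
  fixes \<kappa> cF B L :: real
  assumes ac: "\<And>s. s \<subseteq> {..<N} \<Longrightarrow> rej_weight {..<N} q n s = 0 \<Longrightarrow> pmf p s = 0"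
    and incl_q: "\<And>i. i < N \<Longrightarrow> incl p i = rej_incl {..<N} q n i"
    and d_big: "4096 \<le> size_var {..<N} q" and d_\<kappa>: "\<kappa> * n \<le> size_var {..<N} q" and \<kappa>: "0 < \<kappa>"
    and cF: "0 < cF" "\<And>i. i < N \<Longrightarrow> cF * n / N \<le> incl p i" and nN: "n \<le> N"
    and B: "(\<Sum>i<N. m4 i) \<le> B / N ^ 3" and L: "(\<Sum>i<N. \<bar>tau \<rho> (u i)\<bar>) \<le> L"
begin

abbreviation "\<pi> \<equiv> incl p"

text \<open>The regression coefficient of the linear statistic on the sample size under Poisson
  sampling, which is the value for which \<open>centred\<close> holds.\<close>

definition Rc :: real where "Rc = (\<Sum>i<N. q i * (1 - q i) * (tau \<rho> (u i) / \<pi> i)) / size_var {..<N} q"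
definition Z :: "nat \<Rightarrow> (nat \<times> nat \<Rightarrow> 'a) \<Rightarrow> real" where "Z i w = n * (T i w / \<pi> i - Rc)"
definition \<delta> :: "nat \<Rightarrow> (nat \<times> nat \<Rightarrow> 'a) \<Rightarrow> real" where "\<delta> i w = n\<^sup>2 * (D i w / \<pi> i)"
text \<open>Sum of the bounds in \<open>KZ\<close> and \<open>K\<delta>\<close>; it depends on fixed
  constants only, so one \<open>K\<close> serves the whole sequence.\<close>

definition K :: real where "K = 16 * B / cF ^ 3 + 8 * (2 * L / \<kappa>) ^ 4 + 2 * B / cF"

lemma q01: "i < N \<Longrightarrow> 0 \<le> q i \<and> q i \<le> 1" using rej.q01 by simp

lemma N0: "0 < real N" using n nN by simp
lemma n0: "0 < real n" using n by simp

lemma pi_q: assumes "i < N" shows "\<bar>\<pi> i - q i\<bar> \<le> q i * (1 - q i) / 2"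
proof -
  \<comment> \<open>\<open>d_big\<close> is \<open>64\<^sup>2 \<le> d\<close>, chosen so that the
    constant 32 in \<open>pi_minus_q\<close> becomes 1/2.\<close>
  have "64 = sqrt (64\<^sup>2)" by (simp only: real_sqrt_abs)
  also have "\<dots> \<le> sqrt (size_var {..<N} q)" using d_big by (intro real_sqrt_le_mono) simp
  finally have "64 \<le> sqrt (size_var {..<N} q)" .
  then have "32 / sqrt (size_var {..<N} q) \<le> 32 / 64" using d_big by (intro divide_left_mono) auto
  then have "32 / sqrt (size_var {..<N} q) * (q i * (1 - q i)) \<le> 32 / 64 * (q i * (1 - q i))"
    using q01[OF assms] by (intro mult_right_mono) auto
  then show ?thesis using rej.pi_minus_q[of i] assms incl_q[OF assms] by simp
qed

lemma q_le: assumes "i < N" shows "q i \<le> 2 * \<pi> i"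
proof -
  have "q i * (1 - q i) \<le> q i" using q01[OF assms] by (intro mult_left_le) auto
  then show ?thesis using pi_q[OF assms] by linarith
qed

lemma m4_nonneg: "i < N \<Longrightarrow> 0 \<le> m4 i"
  using T4(2)[of i] by (meson Bochner_Integration.integral_nonneg order.trans zero_le_even_power even_numeral)

lemma B0: "0 \<le> B"
proof -
  have "0 \<le> (\<Sum>i<N. m4 i)" by (intro sum_nonneg m4_nonneg) simp
  then have "0 \<le> B / N ^ 3" using B by linarith
  then show ?thesis using N0 by (simp add: zero_le_divide_iff)
qed

lemma L0: "0 \<le> L"
proof -
  have "0 \<le> (\<Sum>i<N. \<bar>tau \<rho> (u i)\<bar>)" by (intro sum_nonneg) simp
  then show ?thesis using L by linarith
qed

text \<open>\<open>q i \<le> 2 * \<pi> i\<close> cancels the expansion factor, and \<open>d\<close>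
  is at least \<open>\<kappa> * n\<close>; thus \<open>n * Rc\<close> stays bounded.\<close>

lemma Rc_le: "\<bar>Rc\<bar> \<le> 2 * L / (\<kappa> * n)"
proof -
  let ?d = "size_var {..<N} q"
  have d0: "0 < ?d" using d_big by simp
  have "\<bar>\<Sum>i<N. q i * (1 - q i) * (tau \<rho> (u i) / \<pi> i)\<bar> \<le> (\<Sum>i<N. 2 * \<bar>tau \<rho> (u i)\<bar>)"
  proof (rule order.trans[OF sum_abs sum_mono])
    fix i assume "i \<in> {..<N}"
    then have i: "i < N" by simp
    have p: "0 < \<pi> i" by (rule incl_pos[OF i])
    have "q i * (1 - q i) \<le> q i * 1" using q01[OF i] by (intro mult_left_mono) auto
    also have "\<dots> \<le> 2 * \<pi> i" using q_le[OF i] by simp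
    finally have "q i * (1 - q i) * (\<bar>tau \<rho> (u i)\<bar> / \<pi> i) \<le> 2 * \<pi> i * (\<bar>tau \<rho> (u i)\<bar> / \<pi> i)"
      using p by (intro mult_right_mono) auto
    then show "\<bar>q i * (1 - q i) * (tau \<rho> (u i) / \<pi> i)\<bar> \<le> 2 * \<bar>tau \<rho> (u i)\<bar>"
      using p q01[OF i] by (simp add: abs_mult)
  qed
  also have "\<dots> \<le> 2 * L" unfolding sum_distrib_left[symmetric] using L by simp
  finally have "\<bar>Rc\<bar> \<le> 2 * L / ?d" unfolding Rc_def using d0 by (simp add: divide_right_mono)
  also have "\<dots> \<le> 2 * L / (\<kappa> * n)" using d_\<kappa> \<kappa> n0 L0 d0 by (intro divide_left_mono mult_pos_pos) auto
  finally show ?thesis .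
qed

text \<open>Order count: \<open>n ^ 4\<close> from the scaling, \<open>(N / n) ^ 3\<close> from
  three surplus factors \<open>1 / \<pi> i\<close>, and \<open>1 / N ^ 3\<close> from the bound on
  the sum of \<open>m4\<close>, altogether \<open>n\<close>. The centring contributes the bounded
  quantity \<open>(n * Rc) ^ 4\<close> with total weight \<open>n\<close>.\<close>

lemma KZ: "(\<Sum>i<N. q i * M0.expectation (\<lambda>w. Z i w ^ 4)) \<le> (16 * B / cF ^ 3 + 8 * (2 * L / \<kappa>) ^ 4) * n"
proof -
  let ?c = "cF * n / N"
  have c0: "0 < ?c" using cF N0 n0 by simp
  have each: "q i * M0.expectation (\<lambda>w. Z i w ^ 4) \<le> 8 * n ^ 4 * (2 / ?c ^ 3 * m4 i + q i * (2 * L / (\<kappa> * n)) ^ 4)" if i: "i < N" for i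
  proof -
    have p: "0 < \<pi> i" "?c \<le> \<pi> i" using incl_pos[OF i] cF(2)[OF i] by auto
    have ptw: "Z i w ^ 4 \<le> 8 * n ^ 4 * (T i w ^ 4 / \<pi> i ^ 4 + (2 * L / (\<kappa> * n)) ^ 4)" for w
    proof -
      have "Z i w ^ 4 = n ^ 4 * (T i w / \<pi> i + - Rc) ^ 4" by (simp add: Z_def power_mult_distrib)
      also have "\<dots> \<le> n ^ 4 * (8 * (T i w / \<pi> i) ^ 4 + 8 * (- Rc) ^ 4)" by (intro mult_left_mono power4_add_le) simp
      also have "(- Rc) ^ 4 = \<bar>Rc\<bar> ^ 4" by simp
      also have "n ^ 4 * (8 * (T i w / \<pi> i) ^ 4 + 8 * \<bar>Rc\<bar> ^ 4) \<le> n ^ 4 * (8 * (T i w / \<pi> i) ^ 4 + 8 * (2 * L / (\<kappa> * n)) ^ 4)"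
        using Rc_le by (intro mult_left_mono add_left_mono power_mono) auto
      finally show ?thesis by (simp add: power_divide algebra_simps)
    qed
    have "M0.expectation (\<lambda>w. Z i w ^ 4) \<le> M0.expectation (\<lambda>w. 8 * n ^ 4 * (T i w ^ 4 / \<pi> i ^ 4 + (2 * L / (\<kappa> * n)) ^ 4))"
    proof (rule integral_mono')
      show "integrable M0 (\<lambda>w. 8 * n ^ 4 * (T i w ^ 4 / \<pi> i ^ 4 + (2 * L / (\<kappa> * n)) ^ 4))" using T4(1)[OF i] by simp
    qed (use ptw in auto)
    also have "\<dots> = 8 * n ^ 4 * (M0.expectation (\<lambda>w. T i w ^ 4) / \<pi> i ^ 4 + (2 * L / (\<kappa> * n)) ^ 4)"
      using T4(1)[OF i] by (simp add: M0.prob_space)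
    also have "\<dots> \<le> 8 * n ^ 4 * (m4 i / \<pi> i ^ 4 + (2 * L / (\<kappa> * n)) ^ 4)"
      using T4(2)[OF i] by (intro mult_left_mono add_right_mono divide_right_mono) auto
    finally have "q i * M0.expectation (\<lambda>w. Z i w ^ 4) \<le> q i * (8 * n ^ 4 * (m4 i / \<pi> i ^ 4 + (2 * L / (\<kappa> * n)) ^ 4))"
      using q01[OF i] by (intro mult_left_mono) auto
    also have "\<dots> = 8 * n ^ 4 * (q i * (m4 i / \<pi> i ^ 4) + q i * (2 * L / (\<kappa> * n)) ^ 4)" by (simp add: algebra_simps)
    also have "\<dots> \<le> 8 * n ^ 4 * (2 / ?c ^ 3 * m4 i + q i * (2 * L / (\<kappa> * n)) ^ 4)"
    proof (intro mult_left_mono add_right_mono)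
      have "q i * (m4 i / \<pi> i ^ 4) \<le> 2 * \<pi> i * (m4 i / \<pi> i ^ 4)"
        using q_le[OF i] m4_nonneg[OF i] p by (intro mult_right_mono) auto
      also have "\<dots> = 2 * m4 i / \<pi> i ^ 3" using p by (simp add: power3_eq_cube power4_eq_xxxx)
      also have "\<dots> \<le> 2 * m4 i / ?c ^ 3"
        using c0 p m4_nonneg[OF i] by (intro divide_left_mono power_mono mult_pos_pos zero_less_power) auto
      finally show "q i * (m4 i / \<pi> i ^ 4) \<le> 2 / ?c ^ 3 * m4 i" by simp
    qed simp
    finally show ?thesis .
  qed
  have "(\<Sum>i<N. q i * M0.expectation (\<lambda>w. Z i w ^ 4)) \<le> (\<Sum>i<N. 8 * n ^ 4 * (2 / ?c ^ 3 * m4 i + q i * (2 * L / (\<kappa> * n)) ^ 4))"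
    using each by (intro sum_mono) auto
  also have "\<dots> = 8 * n ^ 4 * (2 / ?c ^ 3 * (\<Sum>i<N. m4 i) + n * (2 * L / (\<kappa> * n)) ^ 4)"
  proof -
    have "(\<Sum>i<N. x * m4 i + q i * y) = x * (\<Sum>i<N. m4 i) + n * y" for x y :: real
      unfolding sum.distrib sum_distrib_left[symmetric] sum_distrib_right[symmetric] rej.sumq ..
    then show ?thesis by (simp only: sum_distrib_left[symmetric])
  qed
  also have "\<dots> \<le> 8 * n ^ 4 * (2 / ?c ^ 3 * (B / N ^ 3) + n * (2 * L / (\<kappa> * n)) ^ 4)"
    using B c0 by (intro mult_left_mono add_right_mono) auto
  also have "\<dots> = (16 * B / cF ^ 3 + 8 * (2 * L / \<kappa>) ^ 4) * n"
    using N0 n0 cF(1) \<kappa> by (simp add: power_divide power_mult_distrib field_simps power3_eq_cube power4_eq_xxxx)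
  finally show ?thesis .
qed

text \<open>Here the orders are \<open>n ^ 4 * (N / n) / N ^ 3\<close>, which
  \<open>n \<le> N\<close> reduces to \<open>n\<close>.\<close>

lemma K\<delta>: "(\<Sum>i<N. q i * M0.expectation (\<lambda>w. (\<delta> i w)\<^sup>2)) \<le> (2 * B / cF) * n"
proof -
  let ?c = "cF * n / N"
  have c0: "0 < ?c" using cF N0 n0 by simp
  have each: "q i * M0.expectation (\<lambda>w. (\<delta> i w)\<^sup>2) \<le> n ^ 4 * (2 / ?c) * m4 i" if i: "i < N" for i
  proof -
    have p: "0 < \<pi> i" "?c \<le> \<pi> i" using incl_pos[OF i] cF(2)[OF i] by auto
    have "M0.expectation (\<lambda>w. (\<delta> i w)\<^sup>2) = n ^ 4 * (M0.expectation (\<lambda>w. (D i w)\<^sup>2) / (\<pi> i)\<^sup>2)"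
      by (simp add: \<delta>_def power_mult_distrib power_divide)
    also have "\<dots> \<le> n ^ 4 * (m4 i / (\<pi> i)\<^sup>2)" using D2(2)[OF i] by (intro mult_left_mono divide_right_mono) auto
    finally have "q i * M0.expectation (\<lambda>w. (\<delta> i w)\<^sup>2) \<le> (2 * \<pi> i) * (n ^ 4 * (m4 i / (\<pi> i)\<^sup>2))"
      using q_le[OF i] q01[OF i] p by (intro mult_mono) auto
    also have "\<dots> = n ^ 4 * (2 / \<pi> i) * m4 i" using p by (simp add: power2_eq_square)
    also have "\<dots> \<le> n ^ 4 * (2 / ?c) * m4 i"
      using c0 p m4_nonneg[OF i] by (intro mult_right_mono mult_left_mono divide_left_mono mult_pos_pos) auto
    finally show ?thesis .
  qed
  have "(\<Sum>i<N. q i * M0.expectation (\<lambda>w. (\<delta> i w)\<^sup>2)) \<le> (\<Sum>i<N. n ^ 4 * (2 / ?c) * m4 i)"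
    using each by (intro sum_mono) auto
  also have "\<dots> = n ^ 4 * (2 / ?c) * (\<Sum>i<N. m4 i)" by (simp add: sum_distrib_left)
  also have "\<dots> \<le> n ^ 4 * (2 / ?c) * (B / N ^ 3)"
    using c0 by (intro mult_left_mono[OF B] mult_nonneg_nonneg divide_nonneg_pos) auto
  also have "\<dots> = (2 * B / cF) * n * (real n / N)\<^sup>2"
    using N0 n0 cF(1) by (simp add: field_simps power2_eq_square power3_eq_cube power4_eq_xxxx)
  also have "\<dots> \<le> (2 * B / cF) * n * 1"
    using B0 cF(1) nN N0 by (intro mult_left_mono power_le_one) auto
  finally show ?thesis by simp
qed

lemma Z_mean: "i < N \<Longrightarrow> M0.expectation (Z i) = n * (tau \<rho> (u i) / \<pi> i - Rc)"
  unfolding Z_def using T_ints[of i] by (simp add: T_mean M0.prob_space)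

lemma marked: "marked_design {..<N} q n M0 (pmf p) Z \<delta> K"
proof
  show "prob_weight {..<N} (pmf p)" by (rule pw)
  show "pmf p s = 0" if "s \<subseteq> {..<N}" "rej_weight {..<N} q n s = 0" for s using ac that by simp
  show "Ew {..<N} (pmf p) (\<lambda>s. of_bool (i \<in> s)) = rej_incl {..<N} q n i" if "i \<in> {..<N}" for i
    using incl_q[of i] that by (simp add: incl_Ew[symmetric])
  have "M0.indep_vars (\<lambda>_. borel \<Otimes>\<^sub>M borel) (\<lambda>i w. (\<lambda>z. (n * (fst z / \<pi> i - Rc), n\<^sup>2 * (snd z / \<pi> i))) (T i w, D i w)) {..<N}"
    by (rule M0.indep_vars_compose2[OF ind_TD]) measurable
  then show "M0.indep_vars (\<lambda>_. borel \<Otimes>\<^sub>M borel) (\<lambda>i x. (Z i x, \<delta> i x)) {..<N}"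
    by (simp add: Z_def \<delta>_def)
  show "integrable M0 (\<lambda>x. Z i x ^ 4)" if "i \<in> {..<N}" for i
  proof (rule Bochner_Integration.integrable_bound[where f = "\<lambda>w. n ^ 4 * (8 * (T i w / \<pi> i) ^ 4 + 8 * (- Rc) ^ 4)"])
    show "integrable M0 (\<lambda>w. n ^ 4 * (8 * (T i w / \<pi> i) ^ 4 + 8 * (- Rc) ^ 4))" using T4(1)[of i] that by (simp add: power_divide)
    show "(\<lambda>x. Z i x ^ 4) \<in> borel_measurable M0" unfolding Z_def using Tm[of i] that
      by (intro borel_measurable_power borel_measurable_times borel_measurable_diff borel_measurable_divide borel_measurable_const) auto
    show "AE x in M0. norm (Z i x ^ 4) \<le> norm (n ^ 4 * (8 * (T i x / \<pi> i) ^ 4 + 8 * (- Rc) ^ 4))"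
    proof (rule AE_I2)
      fix x
      have "norm (Z i x ^ 4) = n ^ 4 * (T i x / \<pi> i + - Rc) ^ 4" by (simp add: Z_def power_mult_distrib)
      also have "\<dots> \<le> n ^ 4 * (8 * (T i x / \<pi> i) ^ 4 + 8 * (- Rc) ^ 4)" by (intro mult_left_mono power4_add_le) simp
      also have "\<dots> \<le> norm (n ^ 4 * (8 * (T i x / \<pi> i) ^ 4 + 8 * (- Rc) ^ 4))" by (simp only: real_norm_def abs_ge_self)
      finally show "norm (Z i x ^ 4) \<le> norm (n ^ 4 * (8 * (T i x / \<pi> i) ^ 4 + 8 * (- Rc) ^ 4))" .
    qed
  qed
  show "integrable M0 (\<lambda>x. (\<delta> i x)\<^sup>2)" if "i \<in> {..<N}" for i
    unfolding \<delta>_def using D2(1)[of i] that by (simp add: power_mult_distrib power_divide)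
  have "(\<Sum>i<N. q i * (1 - q i) * M0.expectation (Z i)) = (\<Sum>i<N. n * (q i * (1 - q i) * (tau \<rho> (u i) / \<pi> i)) - n * Rc * (q i * (1 - q i)))"
    by (intro sum.cong refl) (simp add: Z_mean algebra_simps)
  also have "\<dots> = n * (\<Sum>i<N. q i * (1 - q i) * (tau \<rho> (u i) / \<pi> i)) - n * Rc * size_var {..<N} q"
    unfolding size_var_def sum_distrib_left sum_subtractf ..
  also have "\<dots> = 0" using d_big by (simp add: Rc_def)
  finally show "(\<Sum>i\<in>{..<N}. q i * (1 - q i) * M0.expectation (Z i)) = 0" .
  \<comment> \<open>Scaling by \<open>n / \<pi> i\<close> multiplies the variance of
    \<open>T i\<close> by \<open>(n / \<pi> i)\<^sup>2\<close>, and by \<open>D_mean\<close> this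
    variance is the mean of \<open>D i\<close>.\<close>
  show "M0.expectation (\<delta> i) = rej_incl {..<N} q n i * (M0.expectation (\<lambda>x. (Z i x)\<^sup>2) - (M0.expectation (Z i))\<^sup>2)" if "i \<in> {..<N}" for i
  proof -
    have i: "i < N" and p: "0 < \<pi> i" using that incl_pos by auto
    have Z2: "(\<lambda>x. (Z i x)\<^sup>2) = (\<lambda>x. (n / \<pi> i)\<^sup>2 * (T i x)\<^sup>2 - (2 * n\<^sup>2 * Rc / \<pi> i) * T i x + n\<^sup>2 * Rc\<^sup>2)"
      using p by (auto simp: Z_def fun_eq_iff power2_eq_square field_simps)
    have "M0.expectation (\<lambda>x. (Z i x)\<^sup>2) = (n / \<pi> i)\<^sup>2 * M0.expectation (\<lambda>x. (T i x)\<^sup>2) - (2 * n\<^sup>2 * Rc / \<pi> i) * M0.expectation (T i) + n\<^sup>2 * Rc\<^sup>2"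
      unfolding Z2 using T_ints[OF i] by (simp add: M0.prob_space)
    then have "M0.expectation (\<lambda>x. (Z i x)\<^sup>2) - (M0.expectation (Z i))\<^sup>2 = (n / \<pi> i)\<^sup>2 * (M0.expectation (\<lambda>x. (T i x)\<^sup>2) - (M0.expectation (T i))\<^sup>2)"
      unfolding Z_mean[OF i] T_mean[OF i] using p by (simp add: power2_eq_square field_simps)
    moreover have "M0.expectation (\<delta> i) = n\<^sup>2 * (M0.expectation (D i) / \<pi> i)"
      unfolding \<delta>_def by simp
    ultimately show ?thesis unfolding incl_q[OF i, symmetric] D_mean[OF i] using p by (simp add: power2_eq_square)
  qed
  have "0 \<le> 2 * B / cF" "0 \<le> 16 * B / cF ^ 3 + 8 * (2 * L / \<kappa>) ^ 4" using B0 cF(1) by auto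
  then have "(16 * B / cF ^ 3 + 8 * (2 * L / \<kappa>) ^ 4) * n \<le> K * n" "2 * B / cF * n \<le> K * n"
    unfolding K_def by (intro mult_right_mono; simp)+
  then show "(\<Sum>i\<in>{..<N}. q i * M0.expectation (\<lambda>x. Z i x ^ 4)) \<le> K * n"
    "(\<Sum>i\<in>{..<N}. q i * M0.expectation (\<lambda>x. (\<delta> i x)\<^sup>2)) \<le> K * n"
    using KZ K\<delta> by auto
qed

end

section \<open>Variance of the inclusion indicators and sums over the partition\<close>

context two_stage_totals begin

lemma sum_incl: "(\<Sum>i<N. incl p i) = n"
proof -
  have "(\<Sum>i<N. incl p i) = Ew {..<N} (pmf p) (\<lambda>s. \<Sum>i\<in>s. 1)" unfolding Ew_sum_incl by simp
  also have "\<dots> = Ew {..<N} (pmf p) (\<lambda>s. n)" using supp(2) by (intro Ew_cong) auto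
  also have "\<dots> = n" by (rule Ew_const[OF pw])
  finally show ?thesis .
qed

text \<open>The complementary probabilities sum to \<open>N - n\<close>, at least
  \<open>(1 - f0) * N\<close>, and each is multiplied by at least \<open>cF * n / N\<close>. This is
  where a sampling fraction bounded away from 1 enters.\<close>

lemma incl_variance_ge:
  fixes cF f0 :: real
  assumes cF: "0 \<le> cF" "\<And>i. i < N \<Longrightarrow> cF * n / N \<le> incl p i" and f0: "n / N \<le> f0" and N: "0 < N"
  shows "cF * (1 - f0) * n \<le> (\<Sum>i<N. incl p i * (1 - incl p i))"
proof -
  have "cF * (1 - f0) * n \<le> cF * (1 - n / N) * n"
    using cF f0 by (intro mult_right_mono mult_left_mono) auto
  also have "\<dots> = (cF * n / N) * (\<Sum>i<N. 1 - incl p i)"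
    using N by (simp add: sum_subtractf sum_incl field_simps)
  also have "\<dots> \<le> (\<Sum>i<N. incl p i * (1 - incl p i))"
    unfolding sum_distrib_left using cF by (intro sum_mono mult_right_mono) (auto simp: incl_def)
  finally show ?thesis .
qed

context
  assumes part: "psu_partition F N u"
begin

lemma set_integral_partition:
  fixes g :: "'a \<Rightarrow> real"
  assumes "set_integrable lebesgue F g"
  shows "(\<Sum>i<N. LINT x:u i|lebesgue. g x) = (LINT x:F|lebesgue. g x)"
proof -
  have UF: "(\<Union>i<N. u i) = F" and dj: "disjoint_family_on u {..<N}" using part by (auto simp: psu_partition_def)
  show ?thesis unfolding UF[symmetric]
    by (rule set_integral_finite_Union[OF _ dj, symmetric])
      (use u set_integrable_subset[OF assms] in auto)
qed

lemma sum_tau: "(\<Sum>i<N. tau \<rho> (u i)) = tau \<rho> F"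
  unfolding tau_def by (rule set_integral_partition[OF \<rho>])

lemma sum_abs_tau: "(\<Sum>i<N. \<bar>tau \<rho> (u i)\<bar>) \<le> (LINT x:F|lebesgue. \<bar>\<rho> x\<bar>)"
proof -
  have "(\<Sum>i<N. \<bar>tau \<rho> (u i)\<bar>) \<le> (\<Sum>i<N. LINT x:u i|lebesgue. \<bar>\<rho> x\<bar>)"
  proof (rule sum_mono)
    fix i assume "i \<in> {..<N}"
    then have "set_integrable lebesgue (u i) \<rho>" using u set_integrable_subset[OF \<rho>] by auto
    from set_integral_norm_bound[OF this] show "\<bar>tau \<rho> (u i)\<bar> \<le> (LINT x:u i|lebesgue. \<bar>\<rho> x\<bar>)"
      by (simp add: tau_def)
  qed
  also have "\<dots> = (LINT x:F|lebesgue. \<bar>\<rho> x\<bar>)"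
    using set_integrable_abs[OF \<rho>] by (rule set_integral_partition)
  finally show ?thesis .
qed

text \<open>Cubing the bound on the PSU measures produces \<open>1 / N ^ 3\<close>; the integrals of
  \<open>\<rho> ^ 4\<close> add up over the partition.\<close>

lemma sum_m4:
  assumes P: "\<And>i. i < N \<Longrightarrow> measure lebesgue (u i) \<le> P / N"
  shows "(\<Sum>i<N. m4 i) \<le> (P / c1) ^ 3 * (LINT x:F|lebesgue. \<rho> x ^ 4) / N ^ 3"
proof -
  have "(\<Sum>i<N. m4 i) \<le> (\<Sum>i<N. (P / N / c1) ^ 3 * (LINT x:u i|lebesgue. \<rho> x ^ 4))"
    unfolding m4_def
  proof (intro sum_mono mult_right_mono power_mono divide_right_mono)
    fix i assume "i \<in> {..<N}"
    then show "measure lebesgue (u i) \<le> P / N" by (intro P) simp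
    show "0 \<le> (LINT x:u i|lebesgue. \<rho> x ^ 4)"
      unfolding set_lebesgue_integral_def by (intro Bochner_Integration.integral_nonneg) auto
  qed (use c1 in auto)
  also have "\<dots> = (P / N / c1) ^ 3 * (LINT x:F|lebesgue. \<rho> x ^ 4)"
    unfolding sum_distrib_left[symmetric] set_integral_partition[OF \<rho>4] ..
  also have "\<dots> = (P / c1) ^ 3 * (LINT x:F|lebesgue. \<rho> x ^ 4) / N ^ 3"
    by (simp add: power_divide power_mult_distrib)
  finally show ?thesis .
qed

end
end

section \<open>Passage between the survey estimators and the marked design\<close>

context normalised_sample begin

sublocale md: marked_design "{..<N}" q n M0 "pmf p" Z \<delta> K by (rule marked)

text \<open>Mean of the expanded sum under Poisson sampling; it differs in general from the total,
  since selection follows \<open>q\<close> and expansion follows \<open>\<pi>\<close>.\<close>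

definition bc :: real where "bc = (\<Sum>i<N. q i * (tau \<rho> (u i) / \<pi> i))"

lemma sum_Z: "(\<Sum>i\<in>s. Z i w) = n * Phi s w - n * (card s * Rc)"
  unfolding Z_def Phi_def sum_distrib_left[symmetric] sum_subtractf by (simp add: right_diff_distrib)

text \<open>In samples of fixed size the subtraction of \<open>Rc\<close> from each expanded total
  amounts to a constant, which the centring of \<open>md.G\<close> removes again.\<close>

lemma Phi_G: assumes "card s = n" shows "Phi s w = bc + md.G s w / n"
proof -
  have "(\<Sum>i<N. q i * M0.expectation (Z i)) = (\<Sum>i<N. n * (q i * (tau \<rho> (u i) / \<pi> i)) - n * Rc * q i)"
    by (intro sum.cong refl) (simp add: Z_mean algebra_simps)
  also have "\<dots> = n * bc - n * Rc * n"
    unfolding sum_subtractf sum_distrib_left[symmetric] bc_def rej.sumq ..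
  finally have "md.G s w = n * Phi s w - n * bc"
    unfolding md.G_def sum_Z assms by simp
  then show ?thesis using n0 by (simp add: diff_divide_distrib)
qed

text \<open>A common shift of the expanded totals moves their weighted mean by the same amount, so
  the residuals keep their values. If all weights \<open>1 - \<pi> i\<close> vanish, the two means
  no longer correspond, but the squared terms are 0.\<close>

lemma Psi_H: assumes s: "s \<subseteq> {..<N}" shows "n\<^sup>2 * Psi s w = md.H s w"
proof -
  have f: "finite s" using s by (auto intro: finite_subset)
  let ?D = "\<Sum>i\<in>s. 1 - \<pi> i"
  have pi: "rej_incl {..<N} q n i = \<pi> i" if "i \<in> s" for i using that s incl_q by auto
  have D: "(\<Sum>i\<in>s. 1 - rej_incl {..<N} q n i) = ?D" by (intro sum.cong refl) (simp add: pi)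
  have R: "(\<Sum>i\<in>s. (1 - rej_incl {..<N} q n i) * Z i w) / ?D = n * Rh s w - n * Rc" if "?D \<noteq> 0"
  proof -
    have "(\<Sum>i\<in>s. (1 - rej_incl {..<N} q n i) * Z i w) = (\<Sum>i\<in>s. n * ((1 - \<pi> i) * (T i w / \<pi> i)) - n * Rc * (1 - \<pi> i))"
      by (intro sum.cong refl) (simp add: pi Z_def right_diff_distrib mult_ac)
    also have "\<dots> = n * (\<Sum>i\<in>s. (1 - \<pi> i) * (T i w / \<pi> i)) - n * Rc * ?D"
      unfolding sum_subtractf[of "\<lambda>i. n * ((1 - \<pi> i) * (T i w / \<pi> i))"] sum_distrib_left ..
    finally show ?thesis using that by (simp add: Rh_def diff_divide_distrib)
  qed
  have "n\<^sup>2 * (\<Sum>i\<in>s. (1 - \<pi> i) * (T i w / \<pi> i - Rh s w)\<^sup>2) =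
    (\<Sum>i\<in>s. (1 - rej_incl {..<N} q n i) * (Z i w - (\<Sum>i\<in>s. (1 - rej_incl {..<N} q n i) * Z i w) / ?D)\<^sup>2)"
    unfolding sum_distrib_left
  proof (intro sum.cong refl)
    fix i assume i: "i \<in> s"
    show "n\<^sup>2 * ((1 - \<pi> i) * (T i w / \<pi> i - Rh s w)\<^sup>2) =
      (1 - rej_incl {..<N} q n i) * (Z i w - (\<Sum>i\<in>s. (1 - rej_incl {..<N} q n i) * Z i w) / ?D)\<^sup>2"
    proof (cases "?D = 0")
      case True
      have "1 - \<pi> i = 0"
      proof (rule sum_nonneg_0[OF f _ True i])
        show "0 \<le> 1 - \<pi> j" if "j \<in> s" for j using md.pi01(1)[of j] pi[OF that] that s by auto
      qed
      then show ?thesis by (simp add: pi[OF i])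
    next
      case False
      have "Z i w - (n * Rh s w - n * Rc) = n * (T i w / \<pi> i - Rh s w)" by (simp add: Z_def right_diff_distrib)
      then show ?thesis unfolding R[OF False] pi[OF i] by (simp add: power_mult_distrib)
    qed
  qed
  then show ?thesis
    unfolding Psi_def md.H_def D distrib_left by (simp add: \<delta>_def sum_distrib_left)
qed

text \<open>Translates \<open>V1_bound\<close> to the scale of the totals; together with
  \<open>VA2\<close> it keeps \<open>md.nu\<close> away from 0.\<close>

lemma V1_le: "n * V1 \<rho> N u p \<le> 48 * md.nu + sqrt (768 * K) * sqrt md.c"
proof -
  have "(\<Sum>i<N. rej_incl {..<N} q n i * M0.expectation (Z i)) = (\<Sum>i<N. n * tau \<rho> (u i) - n * Rc * \<pi> i)"
  proof (intro sum.cong refl)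
    fix i assume "i \<in> {..<N}"
    then have i: "i < N" and "0 < \<pi> i" using incl_pos by auto
    then show "rej_incl {..<N} q n i * M0.expectation (Z i) = n * tau \<rho> (u i) - n * Rc * \<pi> i"
      by (simp add: incl_q[OF i, symmetric] Z_mean field_simps)
  qed
  also have "\<dots> = n * (\<Sum>i<N. tau \<rho> (u i)) - n * Rc * n"
    unfolding sum_subtractf sum_distrib_left[symmetric] sum_incl ..
  finally have m: "(\<Sum>i<N. rej_incl {..<N} q n i * M0.expectation (Z i)) = n * (\<Sum>i<N. tau \<rho> (u i)) - n * Rc * n" .
  have "n\<^sup>2 * V1 \<rho> N u p = Ew {..<N} (pmf p) (\<lambda>s. n\<^sup>2 * ((\<Sum>i\<in>s. tau \<rho> (u i) / \<pi> i) - (\<Sum>i<N. tau \<rho> (u i)))\<^sup>2)"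
    unfolding V1_eq Ew_cmult ..
  also have "\<dots> = Ew {..<N} (pmf p) (\<lambda>s. ((\<Sum>i\<in>s. M0.expectation (Z i)) - (\<Sum>i<N. rej_incl {..<N} q n i * M0.expectation (Z i)))\<^sup>2)"
  proof (rule Ew_cong)
    fix s assume s: "s \<subseteq> {..<N}" "pmf p s \<noteq> 0"
    have "(\<Sum>i\<in>s. M0.expectation (Z i)) = (\<Sum>i\<in>s. n * (tau \<rho> (u i) / \<pi> i - Rc))"
      using s by (intro sum.cong refl Z_mean) auto
    also have "\<dots> = n * (\<Sum>i\<in>s. tau \<rho> (u i) / \<pi> i) - n * Rc * n"
      unfolding sum_distrib_left[symmetric] sum_subtractf using supp(2)[OF s(2)] by (simp add: right_diff_distrib)
    finally have "(\<Sum>i\<in>s. M0.expectation (Z i)) - (\<Sum>i<N. rej_incl {..<N} q n i * M0.expectation (Z i))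
      = n * ((\<Sum>i\<in>s. tau \<rho> (u i) / \<pi> i) - (\<Sum>i<N. tau \<rho> (u i)))" unfolding m by (simp add: right_diff_distrib)
    then show "n\<^sup>2 * ((\<Sum>i\<in>s. tau \<rho> (u i) / \<pi> i) - (\<Sum>i<N. tau \<rho> (u i)))\<^sup>2 =
      ((\<Sum>i\<in>s. M0.expectation (Z i)) - (\<Sum>i<N. rej_incl {..<N} q n i * M0.expectation (Z i)))\<^sup>2"
      by (simp only: power_mult_distrib of_nat_power)
  qed
  also note md.V1_bound
  finally have "n * (n * V1 \<rho> N u p) \<le> n * (48 * md.nu + sqrt (768 * K) * sqrt md.c)"
    by (simp add: power2_eq_square algebra_simps)
  then show ?thesis using n0 by (simp only: mult_le_cancel_left_pos)
qed

definition W :: "'w \<Rightarrow> real" where "W \<omega> = (est \<omega> - bc) / sqrt (md.nu / n)"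

context
  assumes nu: "0 < md.nu"
begin

lemma est_W: "est \<omega> = bc + sqrt (md.nu / n) * W \<omega>"
  using nu n0 by (simp add: W_def)

text \<open>\<open>h\<close> will be the identity, the square, its excess over a level, and the
  complex exponential.\<close>

lemma W_transfer:
  fixes h :: "real \<Rightarrow> 'b::{banach,second_countable_topology}"
  assumes h: "h \<in> borel_measurable borel"
    and int: "\<And>s. s \<subseteq> {..<N} \<Longrightarrow> integrable M0 (\<lambda>w. h (md.G s w / sqrt (n * md.nu)))"
  shows "integrable M (\<lambda>\<omega>. h (W \<omega>))"
    and "(\<integral>\<omega>. h (W \<omega>) \<partial>M) = Ew {..<N} (pmf p) (\<lambda>s. \<integral>w. h (md.G s w / sqrt (n * md.nu)) \<partial>M0)"
proof -
  let ?h = "\<lambda>x. h ((x - bc) / sqrt (md.nu / n))"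
  have hm: "?h \<in> borel_measurable borel"
    by (rule measurable_compose[OF _ h]) measurable
  have sq: "x / n / sqrt (md.nu / n) = x / sqrt (n * md.nu)" for x :: real
  proof -
    have "n * sqrt (md.nu / n) = sqrt (n * md.nu)"
      using n0 nu by (simp add: real_sqrt_divide real_sqrt_mult real_div_sqrt field_simps)
    then show ?thesis by (simp only: divide_divide_eq_left)
  qed
  have e: "?h (Phi s w) = h (md.G s w / sqrt (n * md.nu))" if "pmf p s \<noteq> 0" for s w
    using Phi_G[of s w] supp(2)[OF that] by (simp only: add_diff_cancel_left' sq)
  have i: "integrable M0 (\<lambda>w. ?h (Phi s w))" if "s \<subseteq> {..<N}" "pmf p s \<noteq> 0" for s
    unfolding e[OF that(2)] by (rule int[OF that(1)])
  show "integrable M (\<lambda>\<omega>. h (W \<omega>))" unfolding W_def by (rule expectation_transfer_est(1)[OF hm i])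
  have "(\<integral>\<omega>. h (W \<omega>) \<partial>M) = Ew {..<N} (pmf p) (\<lambda>s. \<integral>w. ?h (Phi s w) \<partial>M0)"
    unfolding W_def by (rule expectation_transfer_est(2)[OF hm i])
  also have "\<dots> = Ew {..<N} (pmf p) (\<lambda>s. \<integral>w. h (md.G s w / sqrt (n * md.nu)) \<partial>M0)"
    by (rule Ew_cong) (intro Bochner_Integration.integral_cong refl e)
  finally show "(\<integral>\<omega>. h (W \<omega>) \<partial>M) = Ew {..<N} (pmf p) (\<lambda>s. \<integral>w. h (md.G s w / sqrt (n * md.nu)) \<partial>M0)" .
qed

lemma G2: "s \<subseteq> {..<N} \<Longrightarrow> integrable M0 (\<lambda>w. (md.G s w)\<^sup>2)"
  by (rule M0.integrable_power_le4[OF md.Gm md.G4]) auto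

lemma W_sq_integrable: "integrable M (\<lambda>\<omega>. (W \<omega>)\<^sup>2)"
  by (rule W_transfer(1)) (use G2 in \<open>simp_all add: power_divide\<close>)

lemma W_meas: "W \<in> borel_measurable M"
proof -
  have "integrable M (\<lambda>\<omega>. (\<lambda>x. x) (W \<omega>))"
    by (rule W_transfer(1)) (use M0.integrable_square_imp[OF md.Gm G2] in simp_all)
  then show ?thesis by simp
qed

lemma W_char: "(CLINT \<omega>|M. iexp (t * W \<omega>)) = Ew {..<N} (pmf p) (\<lambda>s. CLINT w|M0. iexp (t / sqrt (n * md.nu) * md.G s w))"
proof -
  have "(CLINT \<omega>|M. iexp (t * W \<omega>)) = Ew {..<N} (pmf p) (\<lambda>s. CLINT w|M0. iexp (t * (md.G s w / sqrt (n * md.nu))))"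
  proof (rule W_transfer(2)[where h = "\<lambda>x. iexp (t * x)"])
    show "complex_integrable M0 (\<lambda>w. iexp (t * (md.G s w / sqrt (n * md.nu))))" if "s \<subseteq> {..<N}" for s
    proof (rule M0.integrable_iexp)
      have "(\<lambda>w. t * (md.G s w / sqrt (n * md.nu))) \<in> borel_measurable M0"
        by (intro borel_measurable_times borel_measurable_divide borel_measurable_const md.Gm that)
      then show "(\<lambda>w. complex_of_real (t * (md.G s w / sqrt (n * md.nu)))) \<in> borel_measurable M0"
        by measurable
    qed (rule Im_complex_of_real)
  qed measurable
  then show ?thesis by (simp add: mult_ac)
qed

text \<open>\<open>tail_EE\<close> at level \<open>m * (n * md.nu)\<close>; dividing by
  \<open>n * md.nu\<close> leaves no power of \<open>n\<close> in either term.\<close>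

lemma W_tail:
  assumes m: "0 < m" and \<nu>0: "0 < \<nu>0" "\<nu>0 \<le> md.nu"
  shows "(LINT \<omega>|M. max 0 ((W \<omega>)\<^sup>2 - m)) \<le> 24000 * K / \<nu>0\<^sup>2 / m + sqrt md.c * (sqrt (24000 * K) / \<nu>0)"
proof -
  let ?r = "n * md.nu"
  have r: "0 < ?r" using n0 nu by simp
  have e: "max 0 ((x / sqrt ?r)\<^sup>2 - m) = max 0 (x\<^sup>2 - m * ?r) / ?r" for x
  proof -
    have "(x / sqrt ?r)\<^sup>2 = x\<^sup>2 / ?r" "m * ?r / ?r = m" using r by (simp_all only: power_divide real_sqrt_pow2[OF less_imp_le] nonzero_mult_div_cancel_right)
    then have "(x / sqrt ?r)\<^sup>2 - m = (x\<^sup>2 - m * ?r) / ?r" by (simp only: diff_divide_distrib)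
    then show ?thesis using r by (simp add: max_def zero_le_divide_iff)
  qed
  have "(LINT \<omega>|M. max 0 ((W \<omega>)\<^sup>2 - m)) = Ew {..<N} (pmf p) (\<lambda>s. LINT w|M0. max 0 ((md.G s w / sqrt ?r)\<^sup>2 - m))"
  proof (rule W_transfer(2)[where h = "\<lambda>x. max 0 (x\<^sup>2 - m)"])
    show "integrable M0 (\<lambda>w. max 0 ((md.G s w / sqrt ?r)\<^sup>2 - m))" if "s \<subseteq> {..<N}" for s
      using G2[OF that] by (intro integrable_max) (simp_all add: power_divide)
  qed measurable
  also have "\<dots> = Ew {..<N} (pmf p) (\<lambda>s. LINT w|M0. max 0 ((md.G s w)\<^sup>2 - m * ?r)) / ?r"
    unfolding e by (simp add: divide_inverse Ew_multc)
  also have "\<dots> \<le> (24000 * K * n\<^sup>2 / (m * ?r) + sqrt md.c * (sqrt (24000 * K) * n)) / ?r"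
    using m r by (intro divide_right_mono md.tail_EE) auto
  also have "\<dots> = 24000 * K / (md.nu)\<^sup>2 / m + sqrt md.c * (sqrt (24000 * K) / md.nu)"
    using n0 nu m by (simp add: field_simps power2_eq_square)
  also have "\<dots> \<le> 24000 * K / \<nu>0\<^sup>2 / m + sqrt md.c * (sqrt (24000 * K) / \<nu>0)"
    using \<nu>0 m md.K0 md.c0 by (intro add_mono divide_right_mono mult_left_mono divide_left_mono power_mono mult_pos_pos zero_less_power) auto
  finally show ?thesis .
qed

end

lemma vest_dev: "(LINT \<omega>|M. \<bar>n * vest \<omega> - md.nu\<bar>) = Ew {..<N} (pmf p) (\<lambda>s. LINT w|M0. \<bar>md.H s w / n - md.nu\<bar>)"
proof -
  have e: "\<bar>n * Psi s w - md.nu\<bar> = \<bar>md.H s w / n - md.nu\<bar>" if "s \<subseteq> {..<N}" for s w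
    using Psi_H[OF that, of w, symmetric] n0 by (simp add: power2_eq_square)
  have "(LINT \<omega>|M. \<bar>n * vest \<omega> - md.nu\<bar>) = Ew {..<N} (pmf p) (\<lambda>s. LINT w|M0. \<bar>n * Psi s w - md.nu\<bar>)"
    by (rule expectation_transfer_vest(2)) (use Psi_int in auto)
  also have "\<dots> = Ew {..<N} (pmf p) (\<lambda>s. LINT w|M0. \<bar>md.H s w / n - md.nu\<bar>)"
    by (rule Ew_cong) (simp only: e)
  finally show ?thesis .
qed

end

section \<open>Uniform constants and conclusion along the sequence of surveys\<close>

lemma chi2_eq_d2:
  assumes "\<And>s. s \<subseteq> {..<N} \<Longrightarrow> pmf pr s = w s"
  shows "chi2 {..<N} (pmf p) w = d2 N p pr"
  unfolding chi2_def d2_def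
proof (rule sum.mono_neutral_cong_right)
  show "\<forall>s\<in>Pow {..<N} - {s. s \<subseteq> {..<N} \<and> 0 < pmf pr s}. (pmf p s - w s)\<^sup>2 / w s = 0"
    using assms by (auto simp: not_less pmf_nonneg order_antisym_conv)
qed (use assms in auto)

theorem proposition7:
  fixes F :: "'a::euclidean_space set"
    and \<rho> :: "'a \<Rightarrow> real"
    and N nI :: "nat \<Rightarrow> nat"
    and u :: "nat \<Rightarrow> nat \<Rightarrow> 'a set"
    and p pr :: "nat \<Rightarrow> nat set pmf"
    and nII :: "nat \<Rightarrow> nat \<Rightarrow> nat"
    and f :: "nat \<Rightarrow> nat \<Rightarrow> 'a \<Rightarrow> real"
    and M :: "nat \<Rightarrow> 'w measure"
    and S :: "nat \<Rightarrow> 'w \<Rightarrow> nat set"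
    and X :: "nat \<Rightarrow> nat \<Rightarrow> nat \<Rightarrow> 'w \<Rightarrow> 'a"
  assumes "F \<in> sets lebesgue" "bounded F" "0 < measure lebesgue F"
    and "set_integrable lebesgue F \<rho>"
    and "\<And>k. psu_partition F (N k) (u k)"
    and "filterlim N at_top sequentially"
    and "filterlim nI at_top sequentially"
    and "\<And>e. 0 < e \<Longrightarrow> eventually (\<lambda>k. \<forall>i<N k. diameter (u k i) < e) sequentially"
    and "\<And>k. fixed_size_design (N k) (nI k) (p k)"
    and "\<And>k. rejective_design (N k) (nI k) (pr k)"
    and "\<And>k i. i < N k \<Longrightarrow> incl (pr k) i = incl (p k) i"
    and "\<And>k i. i < N k \<Longrightarrow> density_on (u k i) (f k i)"
    and "\<And>k. two_stage_sample (M k) (N k) (p k) (nII k) (f k) (S k) (X k)"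
    and "FS1 N nI p"
    and "SS1 F N u nII f"
    and "VA1 F \<rho>"
    and "VA2 F \<rho> N u nI p"
    and "(\<lambda>k. d2 (N k) (p k) (pr k)) \<longlonglongrightarrow> 0"
  shows "let est = (\<lambda>k. tau_hat \<rho> (p k) (nII k) (f k) (S k) (X k));
             vest = (\<lambda>k. V_HAJ \<rho> (p k) (nII k) (f k) (S k) (X k));
             V = (\<lambda>k. prob_space.variance (M k) (est k))
         in weak_conv_m
              (\<lambda>k. distr (M k) borel (\<lambda>\<omega>. (est k \<omega> - tau \<rho> F) / sqrt (V k)))
              std_normal_distribution \<and>
            (\<forall>k. integrable (M k) (\<lambda>\<omega>. \<bar>vest k \<omega> - V k\<bar>)) \<and>
            (\<lambda>k. prob_space.expectation (M k)
               (\<lambda>\<omega>. real (nI k) / (measure lebesgue F)\<^sup>2 * \<bar>vest k \<omega> - V k\<bar>))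
              \<longlonglongrightarrow> 0 \<and>
            conv_in_prob M (\<lambda>k \<omega>. vest k \<omega> / V k) 1"
proof -
  let ?A = "measure lebesgue F"
  have A: "0 < ?A" by (rule assms(3))
  obtain f0 c C where f0: "f0 < 1" and c: "0 < c" and FS: "\<And>k. nI k / N k \<le> f0" "\<And>k i. i < N k \<Longrightarrow> c \<le> N k / nI k * incl (p k) i"
    using assms(14) unfolding FS1_def by blast
  obtain l1 L1 phi1 Phi1 c1 C1 where phi1: "0 < phi1" and c1: "0 < c1"
    and SS: "\<And>k i. i < N k \<Longrightarrow> phi1 * ?A / N k \<le> measure lebesgue (u k i)"
      "\<And>k i. i < N k \<Longrightarrow> measure lebesgue (u k i) \<le> Phi1 * ?A / N k"
      "\<And>k i x. i < N k \<Longrightarrow> x \<in> u k i \<Longrightarrow> c1 / measure lebesgue (u k i) \<le> f k i x"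
      "\<And>k i. i < N k \<Longrightarrow> 2 \<le> nII k i"
    using assms(15) unfolding SS1_def by blast
  have \<rho>4: "set_integrable lebesgue F (\<lambda>x. \<rho> x ^ 4)" using assms(16) by (auto simp: VA1_def)
  obtain m2 where m2: "0 < m2" and VA: "\<And>k. m2 \<le> nI k / ?A\<^sup>2 * V1 \<rho> (N k) (u k) (p k)"
    using assms(17) unfolding VA2_def by blast
  have part: "(\<Union>i<N k. u k i) = F" "\<And>i. i < N k \<Longrightarrow> u k i \<in> sets lebesgue"
    "\<And>i. i < N k \<Longrightarrow> u k i \<subseteq> F" for k
    using assms(5)[of k] by (auto simp: psu_partition_def)
  have N0: "0 < N k" for k
  proof (rule ccontr)
    assume "\<not> 0 < N k"
    then have "F = {}" using part(1)[of k] by simp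
    then show False using A by simp
  qed
  \<comment> \<open>For \<open>nI k = 0\<close> the quotient in \<open>FS1\<close> is 0 by division
    by zero, against \<open>0 < c\<close>.\<close>
  have n0: "0 < nI k" for k using FS(2)[OF N0[of k]] c by (cases "nI k = 0") auto
  have cFN: "c * nI k / N k \<le> incl (p k) i" if "i < N k" for k i
    using FS(2)[OF that] n0[of k] N0[of k] by (simp add: field_simps)
  have incl_pos: "0 < incl (p k) i" if "i < N k" for k i
  proof -
    have "0 < c * nI k / N k" using c n0[of k] N0[of k] by simp
    then show ?thesis using cFN[OF that] by linarith
  qed
  have nN: "nI k < N k" for k
  proof -
    have "nI k / N k < 1" using FS(1)[of k] f0 by linarith
    then show ?thesis using N0[of k] by simp
  qed
  have ts: "two_stage_totals (M k) (N k) (nI k) (p k) (nII k) (f k) (S k) (X k) (u k) F \<rho> c1" for k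
  proof
    show "0 < measure lebesgue (u k i)" if "i < N k" for i
    proof -
      have "0 < phi1 * ?A / N k" using phi1 A N0[of k] by simp
      then show ?thesis using SS(1)[OF that] by linarith
    qed
  qed (use assms(1,4,9,12,13) \<rho>4 c1 SS n0 incl_pos part(2,3) in auto)
  interpret ts: two_stage_totals "M k" "N k" "nI k" "p k" "nII k" "f k" "S k" "X k" "u k" F \<rho> c1 for k by (rule ts)
  have "\<exists>q. rejective_normalised {..<N k} q (nI k) \<and> (\<forall>s\<subseteq>{..<N k}. pmf (pr k) s = rej_weight {..<N k} q (nI k) s) \<and>
    (\<forall>i<N k. incl (p k) i = rej_incl {..<N k} q (nI k) i)" for k
  proof -
    have "0 < incl (pr k) i" if "i < N k" for i using incl_pos[OF that] assms(11)[OF that] by simp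
    from rejective_design_normalised[OF assms(10) this nN] show ?thesis by (metis assms(11))
  qed
  then obtain q where q: "\<And>k. rejective_normalised {..<N k} (q k) (nI k)"
    "\<And>k s. s \<subseteq> {..<N k} \<Longrightarrow> pmf (pr k) s = rej_weight {..<N k} (q k) (nI k) s"
    "\<And>k i. i < N k \<Longrightarrow> incl (p k) i = rej_incl {..<N k} (q k) (nI k) i" by metis
  \<comment> \<open>\<open>incl_variance_ge\<close> bounds the sum of
    \<open>\<pi> i * (1 - \<pi> i)\<close> from below by \<open>c * (1 - f0) * n\<close>, and
    \<open>pi_variance_le\<close> passes to \<open>d\<close> at the cost of 1089.\<close>
  define \<kappa> where "\<kappa> = c * (1 - f0) / 1089"
  define B where "B = (Phi1 * ?A / c1) ^ 3 * (LINT x:F|lebesgue. \<rho> x ^ 4)"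
  define L where "L = (LINT x:F|lebesgue. \<bar>\<rho> x\<bar>)"
  define K where "K = normalised_sample.K \<kappa> c B L"
  \<comment> \<open>\<open>96 = 2 * 48\<close>: one half of the lower bound in \<open>VA2\<close>
    pays for the design error in \<open>V1_le\<close>, the other half remains for
    \<open>nu\<close>.\<close>
  define \<nu>0 where "\<nu>0 = m2 * ?A\<^sup>2 / 96"
  have \<kappa>: "0 < \<kappa>" and \<nu>0: "0 < \<nu>0" using c f0 m2 A by (auto simp: \<kappa>_def \<nu>0_def)
  have nInf: "filterlim (\<lambda>k. real (nI k)) at_top sequentially"
    using assms(7) by (rule filterlim_compose[OF filterlim_real_sequentially])
  have "eventually (\<lambda>k. 4096 / \<kappa> \<le> real (nI k)) sequentially"
    using nInf by (simp add: filterlim_at_top)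
  moreover have "(\<lambda>k. sqrt (768 * K) * sqrt (d2 (N k) (p k) (pr k))) \<longlonglongrightarrow> sqrt (768 * K) * sqrt 0"
    by (intro tendsto_intros assms(18))
  then have "eventually (\<lambda>k. sqrt (768 * K) * sqrt (d2 (N k) (p k) (pr k)) < 48 * \<nu>0) sequentially"
    by (rule order_tendstoD) (use \<nu>0 in simp)
  ultimately have "eventually (\<lambda>k. 4096 / \<kappa> \<le> real (nI k) \<and> sqrt (768 * K) * sqrt (d2 (N k) (p k) (pr k)) < 48 * \<nu>0) sequentially"
    by (rule eventually_conj)
  \<comment> \<open>From \<open>k0\<close> on, \<open>\<kappa> * nI k\<close>, and hence
    \<open>d\<close>, is at least 4096, and the design error is below
    \<open>48 * \<nu>0\<close>.\<close>
  then obtain k0 where k0: "\<And>k. k0 \<le> k \<Longrightarrow> 4096 / \<kappa> \<le> real (nI k)"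
    "\<And>k. k0 \<le> k \<Longrightarrow> sqrt (768 * K) * sqrt (d2 (N k) (p k) (pr k)) < 48 * \<nu>0"
    by (auto simp: eventually_sequentially)
  have ns: "normalised_sample (M k) (N k) (nI k) (p k) (nII k) (f k) (S k) (X k) (u k) F \<rho> c1 (q k) \<kappa> c B L" if k: "k0 \<le> k" for k
  proof -
    interpret r: rejective_normalised "{..<N k}" "q k" "nI k" by (rule q)
    have \<kappa>n: "4096 \<le> \<kappa> * nI k" using k0(1)[OF k] \<kappa> by (simp add: field_simps)
    have "1089 * (\<kappa> * nI k) \<le> (\<Sum>i<N k. incl (p k) i * (1 - incl (p k) i))"
      using ts.incl_variance_ge[OF less_imp_le[OF c] cFN FS(1) N0, of k] by (simp add: \<kappa>_def)
    also have "\<dots> = (\<Sum>i<N k. r.\<pi> i * (1 - r.\<pi> i))" by (intro sum.cong refl) (simp add: q(3))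
    finally have var: "1089 * (\<kappa> * nI k) \<le> (\<Sum>i<N k. r.\<pi> i * (1 - r.\<pi> i))" .
    \<comment> \<open>\<open>1089 * 4096\<close> is far above the threshold 144 of
      \<open>d_ge_1_if_pi_variance\<close>; once \<open>1 \<le> d\<close> is known,
      \<open>pi_variance_le\<close> becomes available.\<close>
    interpret r: rejective "{..<N k}" "q k" "nI k"
      by unfold_locales (rule r.d_ge_1_if_pi_variance, use var \<kappa>n in linarith)
    have d: "\<kappa> * nI k \<le> size_var {..<N k} (q k)" using var r.pi_variance_le by linarith
    show ?thesis
    proof
      show "pmf (p k) s = 0" if "s \<subseteq> {..<N k}" "rej_weight {..<N k} (q k) (nI k) s = 0" for s
        by (rule r.rej_weight_zero_imp[OF _ _ _ that]) (use assms(9)[of k] q(3) incl_pos in \<open>auto simp: fixed_size_design_def\<close>)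
      show "4096 \<le> size_var {..<N k} (q k)" using d \<kappa>n by linarith
      show "(\<Sum>i<N k. ts.m4 k i) \<le> B / N k ^ 3"
        unfolding B_def by (rule ts.sum_m4[OF assms(5) SS(2)])
      show "(\<Sum>i<N k. \<bar>tau \<rho> (u k i)\<bar>) \<le> L"
        unfolding L_def by (rule ts.sum_abs_tau[OF assms(5)])
    qed (use q(3) d \<kappa> c cFN nN[of k] in auto)
  qed
  \<comment> \<open>Limits are insensitive to finitely many indices, so all estimates are made along
    the shifted sequence and transferred back by \<open>unshift\<close>.\<close>
  define sh where "sh k = k + k0" for k
  interpret ns: normalised_sample "M (sh k)" "N (sh k)" "nI (sh k)" "p (sh k)" "nII (sh k)" "f (sh k)" "S (sh k)" "X (sh k)" "u (sh k)" F \<rho> c1 "q (sh k)" \<kappa> c B L for k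
    by (rule ns) (simp add: sh_def)
  have shift: "(\<lambda>k. g (sh k)) \<longlonglongrightarrow> l" if "g \<longlonglongrightarrow> l" for g and l :: real
    unfolding sh_def by (rule LIMSEQ_ignore_initial_segment[OF that])
  have chi: "chi2 {..<N (sh k)} (pmf (p (sh k))) (rej_weight {..<N (sh k)} (q (sh k)) (nI (sh k))) = d2 (N (sh k)) (p (sh k)) (pr (sh k))" for k
    by (rule chi2_eq_d2[OF q(2)])
  have chi0: "(\<lambda>k. chi2 {..<N (sh k)} (pmf (p (sh k))) (rej_weight {..<N (sh k)} (q (sh k)) (nI (sh k)))) \<longlonglongrightarrow> 0"
    unfolding chi by (rule shift[OF assms(18)])
  have nu_ge: "\<nu>0 \<le> ns.md.nu k" for k
  proof -
    have "96 * \<nu>0 \<le> nI (sh k) * V1 \<rho> (N (sh k)) (u (sh k)) (p (sh k))"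
      using VA[of "sh k"] A by (simp add: \<nu>0_def field_simps)
    also note ns.V1_le
    finally have "96 * \<nu>0 \<le> 48 * ns.md.nu k + 48 * \<nu>0"
      using k0(2)[of "sh k"] unfolding chi K_def by (simp add: sh_def)
    then show ?thesis by simp
  qed
  have nu_pos: "0 < ns.md.nu k" for k using nu_ge[of k] \<nu>0 by linarith
  interpret sq: marked_design_seq "\<lambda>k. {..<N (sh k)}" "\<lambda>k. q (sh k)" "\<lambda>k. nI (sh k)" "\<lambda>k. ts.M0 (sh k)"
    "\<lambda>k. pmf (p (sh k))" "\<lambda>k. ns.Z k" "\<lambda>k. ns.\<delta> k" K \<kappa> \<nu>0
  proof (rule marked_design_seq.intro)
    show "marked_design {..<N (sh k)} (q (sh k)) (nI (sh k)) (ts.M0 (sh k)) (pmf (p (sh k))) (ns.Z k) (ns.\<delta> k) K" for k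
      unfolding K_def by (rule ns.marked)
    show "filterlim (\<lambda>k. real (nI (sh k))) at_top sequentially"
      unfolding sh_def using nInf by (rule filterlim_compose) (rule filterlim_add_const_nat_at_top)
  qed (use ns.d_\<kappa> \<kappa> chi0 nu_ge \<nu>0 in simp_all)
  define est where "est k = tau_hat \<rho> (p k) (nII k) (f k) (S k) (X k)" for k
  define vest where "vest k = V_HAJ \<rho> (p k) (nII k) (f k) (S k) (X k)" for k
  define V where "V k = prob_space.variance (M k) (est k)" for k
  have limits: "weak_conv_m (\<lambda>k. distr (M (sh k)) borel (\<lambda>x. (est (sh k) x - tau \<rho> F) / sqrt (V (sh k)))) std_normal_distribution"
    "(\<lambda>k. LINT x|M (sh k). nI (sh k) * \<bar>vest (sh k) x - V (sh k)\<bar>) \<longlonglongrightarrow> 0"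
    "conv_in_prob (\<lambda>k. M (sh k)) (\<lambda>k x. vest (sh k) x / V (sh k)) 1"
  proof -
    have W2: "integrable (M (sh k)) (\<lambda>x. (ns.W k x)\<^sup>2)" for k by (rule ns.W_sq_integrable[OF nu_pos])
    have ch: "(\<lambda>k. CLINT x|M (sh k). iexp (t * ns.W k x)) \<longlonglongrightarrow> complex_of_real (exp (- t\<^sup>2 / 2))" for t
      unfolding ns.W_char[OF nu_pos] by (rule sq.char_limit)
    let ?\<epsilon> = "\<lambda>k. sqrt (chi2 {..<N (sh k)} (pmf (p (sh k))) (rej_weight {..<N (sh k)} (q (sh k)) (nI (sh k)))) * (sqrt (24000 * K) / \<nu>0)"
    have tail: "(LINT x|M (sh k). max 0 ((ns.W k x)\<^sup>2 - m)) \<le> 24000 * K / \<nu>0\<^sup>2 / m + ?\<epsilon> k" if "0 < m" for m k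
      unfolding K_def by (rule ns.W_tail[OF nu_pos that \<nu>0 nu_ge])
    have K0: "0 \<le> K" unfolding K_def by (rule ns.md.K0)
    have \<epsilon>: "0 \<le> ?\<epsilon> k" for k using ns.md.c0[of k] K0 \<nu>0 by simp
    have "?\<epsilon> \<longlonglongrightarrow> sqrt 0 * (sqrt (24000 * K) / \<nu>0)" by (intro tendsto_intros chi0)
    then have \<epsilon>0: "?\<epsilon> \<longlonglongrightarrow> 0" by simp
    have mean: "(LINT x|M (sh k). est (sh k) x) = tau \<rho> F" for k
      unfolding est_def ts.est_mean by (rule ts.sum_tau[OF assms(5)])
    have vl: "(\<lambda>k. LINT x|M (sh k). \<bar>nI (sh k) * vest (sh k) x - ns.md.nu k\<bar>) \<longlonglongrightarrow> 0"
      unfolding vest_def ns.vest_dev by (rule sq.H_limit)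
    have est: "est (sh k) x = ns.bc k + sqrt (ns.md.nu k / nI (sh k)) * ns.W k x" for k x
      unfolding est_def by (rule ns.est_W[OF nu_pos])
    have vi: "integrable (M (sh k)) (vest (sh k))" for k unfolding vest_def by (rule ts.vest_integrable)
    have C: "0 \<le> 24000 * K / \<nu>0\<^sup>2" using K0 by simp
    have nu_le: "ns.md.nu k \<le> sqrt K" for k unfolding K_def by (rule ns.md.nu_bounds)
    note sl = standardised_limits[where n = "\<lambda>k. nI (sh k)", OF ts.M.prob_space_axioms ns.W_meas[OF nu_pos] W2 ch tail C \<epsilon> \<epsilon>0 n0 \<nu>0 nu_ge nu_le est mean vi vl]
    show "weak_conv_m (\<lambda>k. distr (M (sh k)) borel (\<lambda>x. (est (sh k) x - tau \<rho> F) / sqrt (V (sh k)))) std_normal_distribution"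
      unfolding V_def by (rule sl(1))
    show "(\<lambda>k. LINT x|M (sh k). nI (sh k) * \<bar>vest (sh k) x - V (sh k)\<bar>) \<longlonglongrightarrow> 0"
      unfolding V_def by (rule sl(2))
    show "conv_in_prob (\<lambda>k. M (sh k)) (\<lambda>k x. vest (sh k) x / V (sh k)) 1"
      unfolding V_def by (rule sl(3))
  qed
  have unshift: "g \<longlonglongrightarrow> l" if "(\<lambda>k. g (sh k)) \<longlonglongrightarrow> l" for g and l :: real
    using that unfolding sh_def by (rule LIMSEQ_offset)
  \<comment> \<open>Weak convergence unfolds to convergence of the distribution functions at each
    continuity point, to which \<open>unshift\<close> applies.\<close>
  have "weak_conv_m (\<lambda>k. distr (M k) borel (\<lambda>\<omega>. (est k \<omega> - tau \<rho> F) / sqrt (V k))) std_normal_distribution"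
    using limits(1) unfolding weak_conv_m_def weak_conv_def by (blast intro: unshift)
  \<comment> \<open>This claim concerns every \<open>k\<close>, including those below
    \<open>k0\<close>, and therefore rests on \<open>two_stage_totals\<close> alone.\<close>
  moreover have "integrable (M k) (\<lambda>\<omega>. \<bar>vest k \<omega> - V k\<bar>)" for k
    unfolding vest_def using ts.vest_integrable[of k] by simp
  moreover have "(\<lambda>k. LINT \<omega>|M k. nI k / ?A\<^sup>2 * \<bar>vest k \<omega> - V k\<bar>) \<longlonglongrightarrow> 0"
  proof -
    have "(\<lambda>k. (LINT \<omega>|M k. nI k * \<bar>vest k \<omega> - V k\<bar>) / ?A\<^sup>2) \<longlonglongrightarrow> 0 / ?A\<^sup>2"
      by (intro tendsto_divide unshift[OF limits(2)] tendsto_const) (use A in simp)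
    then show ?thesis by simp
  qed
  moreover have "conv_in_prob M (\<lambda>k \<omega>. vest k \<omega> / V k) 1"
    using limits(3) unfolding conv_in_prob_def by (blast intro: unshift)
  ultimately show ?thesis
    unfolding Let_def V_def est_def[abs_def] vest_def[abs_def] by blast
qed

end
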